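(* There exist a constant $C>0$ and an integer $N_0\in\mathbb{N}^{+}$ such that for every integer $N\geq N_0$ there exist a function $u_{0}\in\mathcal{C}^{\infty}(\mathbb{R})$ and a time $T$ with $0<T\leq \frac{2}{N^{1/2}}$ such that the following hold: (1) $\|u_{0}\|_{B^{1}_{\infty,1}(\mathbb{R})}\leq C N^{-\frac{1}{10}}$; (2) there is a unique solution $u\in \mathcal{C}_{T}\big(\mathcal{C}^{\infty}(\mathbb{R})\big)$ to the Cauchy problem $$u_t+uu_x=-\partial_{x}(1-\partial_{xx})^{-1}\Big(\tfrac{1}{2}u_x^2+c_1u^2+c_2u^3+c_3u^4\Big),\qquad u(0,x)=u_0(x),$$ for $t\in[0,T]$, $x\in\mathbb{R}$; (3) there exists a time $t_{0}\in[0,T]$ such that $\|u(t_{0})\|_{B^{1}_{\infty,1}(\mathbb{R})}\geq \ln N$. The constant $C$ does not depend on $N$.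
   Context: **Equation (rotation Camassa-Holm equation).** The unknown is a real-valued function $u=u(t,x)$, $t\ge 0$, $x\in\mathbb{R}$. The real constants $c_1,c_2,c_3$ are fixed and are given in terms of a real constant $\Omega$ (the rotational speed of the Earth) as follows. Put $$c=\sqrt{1+\Omega^2}-\Omega,\quad \alpha=\frac{c^2}{1+c^2},\quad \beta_0=\frac{c(c^4+6c^2-1)}{6(c^2+1)^2},\quad \beta=\frac{3c^4+8c^2-1}{6(c^2+1)^2},$$ $$\omega_1=-\frac{3c(c^2-1)(c^2-2)}{2(c^2+1)^3},\quad \omega_2=\frac{(c^2-1)^2(c^2-2)(8c^2-1)}{2(c^2+1)^5},$$ where $\Omega$ is such that $\beta\neq 0$, and let $\gamma$ be a real root of $$c-\frac{\beta_0}{\beta}-2\gamma+\frac{\omega_1}{\alpha^2}\gamma^2-\frac{\omega_2}{\alpha^3}\gamma^3=0.$$ Then $$c_1=1+\frac{3\gamma^2\omega_2}{2\alpha^3}-\frac{\omega_1\gamma}{\alpha^2},\qquad c_2=\frac{\omega_1}{3\alpha^2}-\frac{\omega_2\gamma}{\alpha^3},\qquad c_3=\frac{\omega_2}{4\alpha^3}.$$ The constants $C$ and $N_0$ in the claim may depend on $c_1,c_2,c_3$ (and on the choice of the Littlewood-Paley functions below). The operator $(1-\partial_{xx})^{-1}$ is the Fourier multiplier with symbol $(1+\xi^2)^{-1}$, i.e. convolution with $\frac12 e^{-|x|}$. **Besov norm.** Let $\chi,\varphi:\mathbb{R}\to[0,1]$ be smooth even functions with $\chi$ supported in $\{|\xi|\leq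 \frac43\}$, $\varphi$ supported in $\{\frac34\leq|\xi|\leq\frac83\}$, and $\chi(\xi)+\sum_{j\geq 0}\varphi(2^{-j}\xi)=1$ for all $\xi\in\mathbb{R}$. With $\mathcal{F}u(\xi)=\int_{\mathbb{R}}e^{-ix\xi}u(x)\,dx$, set for $u\in\mathcal{S}'(\mathbb{R})$: $\Delta_j u=0$ for $j\leq -2$, $\Delta_{-1}u=\mathcal{F}^{-1}(\chi\mathcal{F}u)$, and $\Delta_j u=\mathcal{F}^{-1}(\varphi(2^{-j}\cdot)\mathcal{F}u)$ for $j\geq0$. The nonhomogeneous Besov space $B^{1}_{\infty,1}(\mathbb{R})$ consists of all $u\in\mathcal{S}'(\mathbb{R})$ with $$\|u\|_{B^1_{\infty,1}}=\sum_{j\geq -1}2^{j}\|\Delta_j u\|_{L^\infty(\mathbb{R})}<\infty.$$ **Solution class.** $\mathcal{C}_T(X)$ denotes $\mathcal{C}([0,T];X)$, and $\mathcal{C}^\infty(\mathbb{R})$ carries its usual topology (locally uniform convergence of all derivatives). Solutions are understood to belong also to $L^\infty([0,T];\mathcal{C}^{0,1}(\mathbb{R}))$, where $\mathcal{C}^{0,1}(\mathbb{R})$ is the space of bounded Lipschitz functions with norm $\|u\|_{L^\infty}+\|u_x\|_{L^\infty}$, so that the nonlocal right-hand side of the equation is well defined; uniqueness is meant in this class. *)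

theory Defs
  imports "HOL-Analysis.Analysis" "HOL-Probability.Essential_Supremum"
begin

section \<open>Smooth functions on the real line\<close>

definition ddx :: "(real \<Rightarrow> 'a::real_normed_vector) \<Rightarrow> real \<Rightarrow> 'a" where
  "ddx f x = vector_derivative f (at x)"

definition smooth :: "(real \<Rightarrow> 'a::real_normed_vector) \<Rightarrow> bool" where
  "smooth f \<longleftrightarrow> (\<forall>n x. (ddx ^^ n) f differentiable at x)"

section \<open>Tempered distributions\<close>

definition schwartz :: "(real \<Rightarrow> complex) set" where
  "schwartz = {\<psi>. smooth \<psi> \<and> (\<forall>m n. bounded (range (\<lambda>x. \<bar>x\<bar> ^ m * norm ((ddx ^^ n) \<psi> x))))}"

definition schwartz_seminorm :: "nat \<Rightarrow> nat \<Rightarrow> (real \<Rightarrow> complex) \<Rightarrow> real" where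
  "schwartz_seminorm m n \<psi> = (SUP x. \<bar>x\<bar> ^ m * norm ((ddx ^^ n) \<psi> x))"

text \<open>A distribution is a total function on \<^typ>\<open>real \<Rightarrow> complex\<close>; only its values on
  \<^const>\<open>schwartz\<close> are meaningful.\<close>

type_synonym distr = "(real \<Rightarrow> complex) \<Rightarrow> complex"

definition tempered :: "distr \<Rightarrow> bool" where
  "tempered v \<longleftrightarrow>
     (\<forall>\<psi>\<in>schwartz. \<forall>\<eta>\<in>schwartz. v (\<lambda>x. \<psi> x + \<eta> x) = v \<psi> + v \<eta>) \<and>
     (\<forall>\<psi>\<in>schwartz. \<forall>a. v (\<lambda>x. a * \<psi> x) = a * v \<psi>) \<and>
     (\<exists>K C. \<forall>\<psi>\<in>schwartz. norm (v \<psi>) \<le> C * (\<Sum>m\<le>K. \<Sum>n\<le>K. schwartz_seminorm m n \<psi>))"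

definition distr_of_fun :: "(real \<Rightarrow> complex) \<Rightarrow> distr" where
  "distr_of_fun f \<psi> = (\<integral>x. f x * \<psi> x \<partial>lborel)"

definition tempered_fun :: "(real \<Rightarrow> complex) \<Rightarrow> bool" where
  "tempered_fun f \<longleftrightarrow> f \<in> borel_measurable lborel \<and>
     (\<forall>\<psi>\<in>schwartz. integrable lborel (\<lambda>x. f x * \<psi> x)) \<and> tempered (distr_of_fun f)"

definition fourier :: "(real \<Rightarrow> complex) \<Rightarrow> real \<Rightarrow> complex" where
  "fourier \<psi> \<xi> = (\<integral>x. exp (- \<i> * of_real (x * \<xi>)) * \<psi> x \<partial>lborel)"

definition fourier_inv :: "(real \<Rightarrow> complex) \<Rightarrow> real \<Rightarrow> complex" where
  "fourier_inv \<psi> x = 1 / (2 * of_real pi) * (\<integral>\<xi>. exp (\<i> * of_real (x * \<xi>)) * \<psi> \<xi> \<partial>lborel)"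

definition fourier_distr :: "distr \<Rightarrow> distr" where
  "fourier_distr v \<psi> = v (fourier \<psi>)"

definition fourier_inv_distr :: "distr \<Rightarrow> distr" where
  "fourier_inv_distr v \<psi> = v (fourier_inv \<psi>)"

definition mult_distr :: "(real \<Rightarrow> real) \<Rightarrow> distr \<Rightarrow> distr" where
  "mult_distr m v \<psi> = v (\<lambda>\<xi>. of_real (m \<xi>) * \<psi> \<xi>)"

definition Linf_norm :: "(real \<Rightarrow> 'a::real_normed_vector) \<Rightarrow> ennreal" where
  "Linf_norm f = esssup lborel (\<lambda>x. ennreal (norm (f x)))"

text \<open>The representing bounded function is unique up to null sets if it exists; if there is
  none, the infimum is over the empty set and the norm is infinite.\<close>

definition Linf_norm_distr :: "distr \<Rightarrow> ennreal" where
  "Linf_norm_distr v =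
     (INF f \<in> {f \<in> borel_measurable lborel. Linf_norm f < \<infinity> \<and>
                 (\<forall>\<psi>\<in>schwartz. v \<psi> = distr_of_fun f \<psi>)}. Linf_norm f)"

section \<open>Littlewood-Paley decomposition and the Besov norm\<close>

definition littlewood_paley :: "(real \<Rightarrow> real) \<Rightarrow> (real \<Rightarrow> real) \<Rightarrow> bool" where
  "littlewood_paley chi phi \<longleftrightarrow>
     smooth chi \<and> smooth phi \<and>
     (\<forall>\<xi>. chi (- \<xi>) = chi \<xi> \<and> phi (- \<xi>) = phi \<xi>) \<and>
     (\<forall>\<xi>. chi \<xi> \<in> {0..1} \<and> phi \<xi> \<in> {0..1}) \<and>
     (\<forall>\<xi>. chi \<xi> \<noteq> 0 \<longrightarrow> \<bar>\<xi>\<bar> \<le> 4/3) \<and>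
     (\<forall>\<xi>. phi \<xi> \<noteq> 0 \<longrightarrow> 3/4 \<le> \<bar>\<xi>\<bar> \<and> \<bar>\<xi>\<bar> \<le> 8/3) \<and>
     (\<forall>\<xi>. (\<lambda>j. phi (\<xi> / 2 ^ j)) sums (1 - chi \<xi>))"

definition LP_block :: "(real \<Rightarrow> real) \<Rightarrow> (real \<Rightarrow> real) \<Rightarrow> int \<Rightarrow> distr \<Rightarrow> distr" where
  "LP_block chi phi j v =
     (if j \<le> -2 then (\<lambda>\<psi>. 0)
      else if j = -1 then fourier_inv_distr (mult_distr chi (fourier_distr v))
      else fourier_inv_distr (mult_distr (\<lambda>\<xi>. phi (2 powi (- j) * \<xi>)) (fourier_distr v)))"

text \<open>The norm of $B^1_{\infty,1}$, with values in $[0,\infty]$; the summation index is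
  $j = n - 1 \ge -1$.\<close>

definition besov_norm :: "(real \<Rightarrow> real) \<Rightarrow> (real \<Rightarrow> real) \<Rightarrow> distr \<Rightarrow> ennreal" where
  "besov_norm chi phi v =
     (\<Sum>n. ennreal (2 powi (int n - 1)) * Linf_norm_distr (LP_block chi phi (int n - 1) v))"

definition complexify :: "(real \<Rightarrow> real) \<Rightarrow> real \<Rightarrow> complex" where
  "complexify f x = of_real (f x)"

section \<open>The constants of the rotation Camassa-Holm equation\<close>

definition rch_c :: "real \<Rightarrow> real" where
  "rch_c \<Omega> = sqrt (1 + \<Omega>\<^sup>2) - \<Omega>"

definition rch_alpha :: "real \<Rightarrow> real" where
  "rch_alpha \<Omega> = (let c = rch_c \<Omega> in c^2 / (1 + c^2))"

definition rch_beta0 :: "real \<Rightarrow> real" where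
  "rch_beta0 \<Omega> = (let c = rch_c \<Omega> in c * (c^4 + 6 * c^2 - 1) / (6 * (c^2 + 1)^2))"

definition rch_beta :: "real \<Rightarrow> real" where
  "rch_beta \<Omega> = (let c = rch_c \<Omega> in (3 * c^4 + 8 * c^2 - 1) / (6 * (c^2 + 1)^2))"

definition rch_omega1 :: "real \<Rightarrow> real" where
  "rch_omega1 \<Omega> = (let c = rch_c \<Omega> in - (3 * c * (c^2 - 1) * (c^2 - 2)) / (2 * (c^2 + 1)^3))"

definition rch_omega2 :: "real \<Rightarrow> real" where
  "rch_omega2 \<Omega> =
     (let c = rch_c \<Omega> in ((c^2 - 1)^2 * (c^2 - 2) * (8 * c^2 - 1)) / (2 * (c^2 + 1)^5))"

definition rch_gamma_root :: "real \<Rightarrow> real \<Rightarrow> bool" where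
  "rch_gamma_root \<Omega> \<gamma> \<longleftrightarrow>
     rch_c \<Omega> - rch_beta0 \<Omega> / rch_beta \<Omega> - 2 * \<gamma>
       + rch_omega1 \<Omega> / (rch_alpha \<Omega>)^2 * \<gamma>^2 - rch_omega2 \<Omega> / (rch_alpha \<Omega>)^3 * \<gamma>^3 = 0"

definition rch_c1 :: "real \<Rightarrow> real \<Rightarrow> real" where
  "rch_c1 \<Omega> \<gamma> = 1 + 3 * \<gamma>^2 * rch_omega2 \<Omega> / (2 * (rch_alpha \<Omega>)^3)
                 - rch_omega1 \<Omega> * \<gamma> / (rch_alpha \<Omega>)^2"

definition rch_c2 :: "real \<Rightarrow> real \<Rightarrow> real" where
  "rch_c2 \<Omega> \<gamma> = rch_omega1 \<Omega> / (3 * (rch_alpha \<Omega>)^2) - rch_omega2 \<Omega> * \<gamma> / (rch_alpha \<Omega>)^3"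

definition rch_c3 :: "real \<Rightarrow> real" where
  "rch_c3 \<Omega> = rch_omega2 \<Omega> / (4 * (rch_alpha \<Omega>)^3)"

section \<open>Solutions\<close>

text \<open>The operator $(1-\partial_{xx})^{-1}$, as convolution with $\frac12 e^{-|x|}$.\<close>

definition helmholtz_inv :: "(real \<Rightarrow> real) \<Rightarrow> real \<Rightarrow> real" where
  "helmholtz_inv f x = (\<integral>y. (1/2) * exp (- \<bar>x - y\<bar>) * f y \<partial>lborel)"

definition rch_rhs :: "real \<Rightarrow> real \<Rightarrow> real \<Rightarrow> (real \<Rightarrow> real) \<Rightarrow> real \<Rightarrow> real" where
  "rch_rhs c1 c2 c3 f x =
     - ddx (helmholtz_inv (\<lambda>y. (1/2) * (ddx f y)^2 + c1 * (f y)^2 + c2 * (f y)^3 + c3 * (f y)^4)) x"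

definition CT_smooth :: "real \<Rightarrow> (real \<Rightarrow> real \<Rightarrow> real) set" where
  "CT_smooth T = {u. (\<forall>t\<in>{0..T}. smooth (u t)) \<and>
     (\<forall>t\<in>{0..T}. \<forall>n K. compact K \<longrightarrow>
        uniform_limit K (\<lambda>s. (ddx ^^ n) (u s)) ((ddx ^^ n) (u t)) (at t within {0..T}))}"

definition bounded_lipschitz :: "(real \<Rightarrow> real) set" where
  "bounded_lipschitz = {f. bounded (range f) \<and> (\<exists>L. L-lipschitz_on UNIV f)}"

definition Linf_T_lipschitz :: "real \<Rightarrow> (real \<Rightarrow> real \<Rightarrow> real) set" where
  "Linf_T_lipschitz T = {u. \<exists>M::real. AE t in lborel. t \<in> {0..T} \<longrightarrow>
     u t \<in> bounded_lipschitz \<and> Linf_norm (u t) + Linf_norm (ddx (u t)) \<le> ennreal M}"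

definition rch_solution ::
    "real \<Rightarrow> real \<Rightarrow> real \<Rightarrow> real \<Rightarrow> (real \<Rightarrow> real) \<Rightarrow> (real \<Rightarrow> real \<Rightarrow> real) \<Rightarrow> bool" where
  "rch_solution c1 c2 c3 T u0 u \<longleftrightarrow>
     u \<in> CT_smooth T \<and> u \<in> Linf_T_lipschitz T \<and>
     (\<forall>x. u 0 x = u0 x) \<and>
     (\<forall>t\<in>{0..T}. \<forall>x. ((\<lambda>s. u s x) has_real_derivative
        (rch_rhs c1 c2 c3 (u t) x - u t x * ddx (u t) x)) (at t within {0..T}))"

end

theory Submission
  imports Defs "HOL-Probability.Probability" "HOL-Real_Asymp.Real_Asymp"
begin

text \<open>
  The initial datum is \<open>u\<^sub>0(x) = A/\<lambda> * S(\<lambda> x)\<close> with \<open>A = N powr (-1/10)\<close>, a large dyadic \<open>\<lambda>\<close> and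
  \<open>S(y) = sin (ln (1 + e^y))\<close>. Since \<open>u\<^sub>0\<close> is of size \<open>A/\<lambda>\<close> and \<open>u\<^sub>0''\<close> of size \<open>A \<lambda>\<close>, the Besov norm of
  \<open>u\<^sub>0\<close> is of size \<open>A\<close>. On average, however, \<open>(u\<^sub>0')\<^sup>2\<close> is \<open>A\<^sup>2/2\<close> on the right half line and \<open>0\<close> on the
  left one. The operator \<open>\<partial>\<^sub>x\<^sub>x (1 - \<partial>\<^sub>x\<^sub>x)^{-1}\<close> is minus the identity up to a smoothing term, so
  the nonlocal term lets the slope of \<open>u\<close> jump across the characteristic starting at \<open>0\<close>, by
  about \<open>T A\<^sup>2/4\<close> at time \<open>T\<close>, up to errors of order \<open>T\<^sup>2\<close> and \<open>1/\<lambda>\<close>. A kink contributes a fixed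
  amount to each block \<open>2^j \<Delta>\<^sub>j u\<close>, so if it is visible on \<open>M\<close> dyadic scales the norm is at least
  of order \<open>M T A\<^sup>2\<close>. The time \<open>T\<close> is chosen first, small in terms of \<open>N\<close>, \<open>A\<^sup>2\<close> and the coefficients only;
  then \<open>M\<close> is taken so large that this exceeds \<open>ln N\<close>, and finally \<open>\<lambda> \<ge> 2^M\<close>.

  Along characteristics the equation is an ordinary differential equation in a space of bounded
  continuous functions, whose lifespan depends only on the Lipschitz norm of the datum and hence
  not on \<open>\<lambda>\<close>. Smoothness is obtained by bootstrapping and uniqueness from a maximum principle.
\<close>

section \<open>Smooth functions\<close>

text \<open>The inflation rests on the summability index 1: for a function that is merely Lipschitz
  the numbers \<open>2^j * \<parallel>\<Delta>\<^sub>j u\<parallel>\<close> are bounded but need not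
  be summable. The gain is therefore made by counting scales, while all Lipschitz quantities stay
  under control. A smooth datum never develops a true kink, only one rounded at the scale
  \<open>1 / \<lambda>\<close>; the rounding error in block \<open>j\<close> has size
  \<open>2^j / \<lambda>\<close>, and \<open>2^M \<le> \<lambda>\<close> keeps the sum of these
  errors bounded. The more dangerous error is linear in the distance from the kink, because it is as
  scale invariant as the kink itself and cannot be beaten by a large \<open>M\<close> or
  \<open>\<lambda>\<close>. Its coefficient is of order \<open>t * (t + 1 / \<lambda>)\<close>, that
  of the kink of order \<open>t * A\<^sup>2\<close>, so only a short time defeats it. Affine parts
  of the solution cost nothing, as the test kernels annihilate them. A contraction argument for
  \<open>u\<close> itself would lose a derivative in \<open>u * u\<^sub>x\<close>. In labels that
  move with the flow this term disappears, at the price that the link between the unknowns (slope,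
  Jacobian) has to be recovered afterwards.\<close>

lemma smooth_coinduct:
  assumes "f \<in> S"
    and step: "\<And>g. g \<in> S \<Longrightarrow> \<exists>g'\<in>S. \<forall>x. (g has_vector_derivative g' x) (at x)"
  shows "smooth f"
proof -
  have "(ddx ^^ n) f \<in> S" for n
  proof (induction n)
    case 0
    show ?case using assms(1) by simp
  next
    case (Suc n)
    then obtain g' where g': "g' \<in> S" "\<forall>x. ((ddx ^^ n) f has_vector_derivative g' x) (at x)"
      using step by blast
    then have "ddx ((ddx ^^ n) f) = g'"
      unfolding ddx_def by (intro ext vector_derivative_at) auto
    then show ?case using g' by simp
  qed
  then show ?thesis unfolding smooth_def using step by (meson differentiableI_vector)
qed

lemma smooth_ddx: "smooth f \<Longrightarrow> smooth (ddx f)"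
  unfolding smooth_def by (metis comp_apply funpow_Suc_right)

lemma smooth_has_vector_derivative: "smooth f \<Longrightarrow> (f has_vector_derivative ddx f x) (at x)"
  unfolding smooth_def ddx_def by (metis funpow_0 vector_derivative_works)

lemma smooth_has_real_derivative:
  fixes f :: "real \<Rightarrow> real"
  shows "smooth f \<Longrightarrow> (f has_real_derivative ddx f x) (at x)"
  by (simp add: has_real_derivative_iff_has_vector_derivative smooth_has_vector_derivative)

lemma smooth_continuous_on: "smooth f \<Longrightarrow> continuous_on S f"
  by (meson continuous_at_imp_continuous_on has_vector_derivative_continuous smooth_has_vector_derivative)

lemma ddx_eqI: "(\<And>x. (f has_vector_derivative f' x) (at x)) \<Longrightarrow> ddx f = f'"
  unfolding ddx_def by (intro ext vector_derivative_at) auto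

text \<open>Iterated derivatives of composite functions have no handy closed form. If the
  derivatives of the generators lie in the algebra they generate, sums and products keep the whole
  algebra closed under differentiation, and this is the invariant that
  \<open>smooth_coinduct\<close> asks for.\<close>

inductive_set generated_algebra :: "(real \<Rightarrow> 'a::real_normed_field) set \<Rightarrow> (real \<Rightarrow> 'a) set" for G where
  base: "g \<in> G \<Longrightarrow> g \<in> generated_algebra G"
| const: "(\<lambda>x. c) \<in> generated_algebra G"
| add: "f \<in> generated_algebra G \<Longrightarrow> g \<in> generated_algebra G \<Longrightarrow> (\<lambda>x. f x + g x) \<in> generated_algebra G"
| mult: "f \<in> generated_algebra G \<Longrightarrow> g \<in> generated_algebra G \<Longrightarrow> (\<lambda>x. f x * g x) \<in> generated_algebra G"

lemma generated_algebra_derivative: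
  assumes "f \<in> generated_algebra G"
    and G: "\<And>g. g \<in> G \<Longrightarrow> \<exists>g'\<in>generated_algebra G. \<forall>x. (g has_vector_derivative g' x) (at x)"
  shows "\<exists>f'\<in>generated_algebra G. \<forall>x. (f has_vector_derivative f' x) (at x)"
  using assms(1)
proof induction
  case (base g)
  then show ?case by (rule G)
next
  case (const c)
  show ?case by (rule bexI[of _ "\<lambda>x. 0"]) (auto intro: generated_algebra.const)
next
  case (add f g)
  then obtain f' g' where "f' \<in> generated_algebra G" "g' \<in> generated_algebra G"
    and "\<forall>x. (f has_vector_derivative f' x) (at x)" "\<forall>x. (g has_vector_derivative g' x) (at x)"
    by blast
  then show ?case
    by (intro bexI[of _ "\<lambda>x. f' x + g' x"]) (auto intro!: generated_algebra.add has_vector_derivative_add)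
next
  case (mult f g)
  then obtain f' g' where "f' \<in> generated_algebra G" "g' \<in> generated_algebra G"
    and "\<forall>x. (f has_vector_derivative f' x) (at x)" "\<forall>x. (g has_vector_derivative g' x) (at x)"
    by blast
  then show ?case using mult.hyps
    by (intro bexI[of _ "\<lambda>x. f x * g' x + f' x * g x"])
      (auto intro!: generated_algebra.add generated_algebra.mult has_vector_derivative_mult)
qed

lemma smooth_generated_algebra:
  assumes "f \<in> generated_algebra G"
    and "\<And>g. g \<in> G \<Longrightarrow> \<exists>g'\<in>generated_algebra G. \<forall>x. (g has_vector_derivative g' x) (at x)"
  shows "smooth f"
  by (rule smooth_coinduct[of f "generated_algebra G"]) (use assms generated_algebra_derivative in blast)+

lemma smooth_mult:
  fixes f g :: "real \<Rightarrow> 'a::real_normed_field"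
  assumes "smooth f" "smooth g"
  shows "smooth (\<lambda>x. f x * g x)"
proof (rule smooth_generated_algebra[where G = "Collect smooth"])
  show "\<exists>g'\<in>generated_algebra (Collect smooth). \<forall>x. (g has_vector_derivative g' x) (at x)"
    if "g \<in> Collect smooth" for g :: "real \<Rightarrow> 'a"
    using that smooth_ddx[of g] smooth_has_vector_derivative[of g] by (auto intro: generated_algebra.base)
  show "(\<lambda>x. f x * g x) \<in> generated_algebra (Collect smooth)"
    using assms by (intro generated_algebra.mult generated_algebra.base) auto
qed

lemma smooth_of_real: "smooth (\<lambda>x. of_real x :: 'a::real_normed_field)"
proof (rule smooth_generated_algebra[where G = "{\<lambda>x. of_real x}"])
  show "\<exists>g'\<in>generated_algebra {\<lambda>x. of_real x}. \<forall>x. (g has_vector_derivative g' x) (at x)"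
    if "g \<in> {\<lambda>x. of_real x}" for g :: "real \<Rightarrow> 'a"
    using that
    using has_vector_derivative_of_real[OF DERIV_ident]
    by (intro bexI[of _ "\<lambda>x. 1"]) (auto intro!: generated_algebra.const)
qed (auto intro: generated_algebra.base)

lemma smooth_const: "smooth (\<lambda>x. c)"
  by (rule smooth_coinduct[of _ "{\<lambda>x. c, \<lambda>x. 0}"]) auto

lemma smooth_complexify:
  assumes "smooth f"
  shows "smooth (complexify f)"
proof (rule smooth_coinduct[of _ "complexify ` Collect smooth"])
  show "\<exists>g'\<in>complexify ` Collect smooth. \<forall>x. (g has_vector_derivative g' x) (at x)"
    if g: "g \<in> complexify ` Collect smooth" for g
  proof -
    obtain h where "smooth h" "g = complexify h" using g by auto
    then show ?thesis using smooth_ddx[of h] smooth_has_real_derivative[of h]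
      by (intro bexI[of _ "complexify (ddx h)"])
        (auto simp: complexify_def[abs_def] intro!: has_vector_derivative_of_real)
  qed
qed (use assms in auto)

lemma smooth_affine:
  fixes f :: "real \<Rightarrow> 'a::real_normed_vector"
  assumes "smooth f"
  shows "smooth (\<lambda>x. a *\<^sub>R f (c * x + d))"
proof (rule smooth_coinduct[of _ "{\<lambda>x. a *\<^sub>R f (c * x + d) | a f. smooth f}"])
  show "\<exists>g'\<in>{\<lambda>x. a *\<^sub>R f (c * x + d) |a f. smooth f}. \<forall>x. (g has_vector_derivative g' x) (at x)"
    if g0: "g \<in> {\<lambda>x. a *\<^sub>R f (c * x + d) |a f. smooth f}" for g :: "real \<Rightarrow> 'a"
  proof -
    obtain a f where f: "smooth f" and g: "g = (\<lambda>x. a *\<^sub>R f (c * x + d))" using g0 by auto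
    have "(g has_vector_derivative (a * c) *\<^sub>R ddx f (c * x + d)) (at x)" for x
    proof -
      have "((\<lambda>x. c * x + d) has_vector_derivative c) (at x)"
        by (auto intro!: derivative_eq_intros simp: has_real_derivative_iff_has_vector_derivative[symmetric])
      then have "((\<lambda>x. f (c * x + d)) has_vector_derivative c *\<^sub>R ddx f (c * x + d)) (at x)"
        using vector_diff_chain_at[of "\<lambda>x. c * x + d" c x f "ddx f (c * x + d)"]
          smooth_has_vector_derivative[OF f] by (simp add: o_def)
      then show ?thesis unfolding g
        using bounded_linear.has_vector_derivative[OF bounded_linear_scaleR_right, of _ _ _ a] by fastforce
    qed
    then show ?thesis using smooth_ddx[OF f]
      by (intro bexI[of _ "\<lambda>x. (a * c) *\<^sub>R ddx f (c * x + d)"]) auto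
  qed
qed (use assms in auto)

section \<open>Integrals over the line\<close>

lemma integrable_inverse_square: "integrable lborel (\<lambda>x::real. inverse (1 + x\<^sup>2))"
  using integrable_inverse_1_plus_square by (simp add: set_integrable_def)

lemma integrable_decay:
  fixes f :: "real \<Rightarrow> 'a::{banach,second_countable_topology}"
  assumes "f \<in> borel_measurable borel" "\<And>x. (1 + x\<^sup>2) * norm (f x) \<le> C"
  shows "integrable lborel f"
proof (rule Bochner_Integration.integrable_bound[of lborel "\<lambda>x. C * inverse (1 + x\<^sup>2)"])
  show "integrable lborel (\<lambda>x. C * inverse (1 + x\<^sup>2))"
    using integrable_inverse_square by simp
  have "norm (f x) \<le> norm (C * inverse (1 + x\<^sup>2))" for x
  proof -
    have "1 + x\<^sup>2 > 0" by (simp add: add_pos_nonneg)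
    then have "norm (f x) \<le> C / (1 + x\<^sup>2)" using assms(2)[of x] by (simp add: field_simps)
    then have "norm (f x) \<le> C * inverse (1 + x\<^sup>2)" by (simp add: divide_inverse)
    then show ?thesis by simp
  qed
  then show "AE x in lborel. norm (f x) \<le> norm (C * inverse (1 + x\<^sup>2))" by simp
qed (use assms in simp)

lemma integral_derivative_line:
  fixes F f :: "real \<Rightarrow> 'a::euclidean_space"
  assumes "\<And>x. (F has_vector_derivative f x) (at x)" "continuous_on UNIV f" "integrable lborel f"
    and "(F \<longlongrightarrow> A) at_bot" "(F \<longlongrightarrow> B) at_top"
  shows "(\<integral>x. f x \<partial>lborel) = B - A"
proof -
  have "(LBINT x=-\<infinity>..\<infinity>. f x) = B - A"
    by (rule interval_integral_FTC_integrable[of _ _ F])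
      (use assms in \<open>auto simp: ereal_tendsto_simps set_integrable_def continuous_on_eq_continuous_at\<close>)
  then show ?thesis by (simp add: interval_lebesgue_integral_def set_lebesgue_integral_def)
qed

lemma integral_derivative_half_line:
  fixes F f :: "real \<Rightarrow> 'a::euclidean_space"
  assumes d: "\<And>x. (F has_vector_derivative f x) (at x)" and "continuous_on UNIV f" "integrable lborel f"
    and "(F \<longlongrightarrow> B) at_top"
  shows "(\<integral>x. indicator {0<..} x *\<^sub>R f x \<partial>lborel) = B - F 0"
proof -
  have c: "isCont F 0" using d has_vector_derivative_continuous by blast
  have s: "set_integrable lborel A f" if "A \<in> sets lborel" for A
    unfolding set_integrable_def using integrable_mult_indicator[OF that assms(3)] .
  have "(LBINT x=0..\<infinity>. f x) = B - F 0"
    by (rule interval_integral_FTC_integrable[of _ _ F])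
      (use assms c s in \<open>auto simp: zero_ereal_def ereal_tendsto_simps continuous_on_eq_continuous_at
          isCont_def intro: tendsto_mono[OF at_le, OF subset_UNIV]\<close>)
  moreover have "einterval 0 \<infinity> = {0<..}" by (auto simp: einterval_def)
  ultimately show ?thesis by (simp add: interval_lebesgue_integral_def set_lebesgue_integral_def)
qed

section \<open>Fourier transforms of bump functions\<close>

text \<open>Compact support turns Fourier integrals into integrals over a fixed interval, where the
  Leibniz rule applies, and removes the boundary terms of integration by parts. The radius is not
  meant to be sharp, so that all symbols in use can share one.\<close>

definition bump :: "real \<Rightarrow> (real \<Rightarrow> complex) \<Rightarrow> bool" where
  "bump R m \<longleftrightarrow> smooth m \<and> (\<forall>\<xi>. \<bar>\<xi>\<bar> > R \<longrightarrow> m \<xi> = 0)"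

lemma bump_ddx:
  assumes "bump R m"
  shows "bump R (ddx m)"
proof -
  have "ddx m \<xi> = 0" if "\<bar>\<xi>\<bar> > R" for \<xi>
  proof -
    have "open {\<xi>::real. \<bar>\<xi>\<bar> > R}" by (intro open_Collect_less continuous_intros)
    then have "((\<lambda>x. 0) has_vector_derivative ddx m \<xi>) (at \<xi>)"
      using assms that unfolding bump_def
      by (intro has_vector_derivative_transform_within_open[OF smooth_has_vector_derivative,
            where S = "{\<xi>. \<bar>\<xi>\<bar> > R}"]) auto
    then show ?thesis using vector_derivative_at has_vector_derivative_const by metis
  qed
  then show ?thesis using assms smooth_ddx unfolding bump_def by blast
qed

lemma bump_mult: "bump R m \<Longrightarrow> smooth f \<Longrightarrow> bump R (\<lambda>x. f x * m x)"
  unfolding bump_def using smooth_mult by auto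

lemma bump_integrable_exp:
  assumes "bump R m"
  shows "integrable lborel (\<lambda>\<xi>. exp (- \<i> * of_real (\<xi> * x)) * m \<xi>)" (is ?a)
    and "fourier m x = integral {-R..R} (\<lambda>\<xi>. exp (- \<i> * of_real (\<xi> * x)) * m \<xi>)" (is ?b)
proof -
  let ?f = "\<lambda>\<xi>. exp (- \<i> * of_real (\<xi> * x)) * m \<xi>"
  have c: "continuous_on {-R..R} ?f"
    using assms unfolding bump_def by (intro continuous_intros smooth_continuous_on) auto
  have i: "set_integrable lborel {-R..R} ?f"
    using borel_integrable_atLeastAtMost'[OF c] .
  have eq: "(\<lambda>\<xi>. indicator {-R..R} \<xi> *\<^sub>R ?f \<xi>) = ?f"
    using assms unfolding bump_def by (auto simp: fun_eq_iff indicator_def)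
  then show ?a using i unfolding set_integrable_def by simp
  have "integral {-R..R} ?f = (LINT \<xi>:{-R..R}|lborel. ?f \<xi>)"
    using set_borel_integral_eq_integral(2)[OF i] by simp
  then show ?b unfolding fourier_def set_lebesgue_integral_def eq by simp
qed

lemma bump_integrable:
  assumes "bump R m"
  shows "integrable lborel m"
  using bump_integrable_exp(1)[OF assms, of 0] by simp

lemma fourier_bump_bounded:
  assumes "bump R m"
  shows "norm (fourier m x) \<le> (\<integral>\<xi>. norm (m \<xi>) \<partial>lborel)"
proof -
  have "norm (fourier m x) \<le> (\<integral>\<xi>. norm (exp (- \<i> * of_real (\<xi> * x)) * m \<xi>) \<partial>lborel)"
    unfolding fourier_def by (rule integral_norm_bound)
  then show ?thesis by (simp add: norm_mult)
qed

lemma has_vector_derivative_exp_i: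
  "((\<lambda>\<xi>. exp (- \<i> * of_real (\<xi> * x))) has_vector_derivative (- \<i> * of_real x) * exp (- \<i> * of_real (\<xi> * x))) (at \<xi> within S)"
proof -
  have "((\<lambda>\<xi>. exp (- \<i> * of_real x * \<xi>)) has_field_derivative (- \<i> * of_real x) * exp (- \<i> * of_real x * of_real \<xi>)) (at (of_real \<xi>))"
    by (auto intro!: derivative_eq_intros)
  from has_vector_derivative_real_field[OF this] show ?thesis by (simp add: mult_ac)
qed

lemma fourier_ddx:
  assumes "bump R m"
  shows "fourier (ddx m) x = \<i> * of_real x * fourier m x"
proof -
  let ?e = "\<lambda>\<xi>. exp (- \<i> * of_real (\<xi> * x))"
  have sm: "smooth m" using assms unfolding bump_def by simp
  have 0: "m \<xi> = 0" if "\<bar>\<xi>\<bar> > R" for \<xi> using assms that unfolding bump_def by simp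
  have i1: "integrable lborel (\<lambda>\<xi>. ?e \<xi> * m \<xi>)" "integrable lborel (\<lambda>\<xi>. ?e \<xi> * ddx m \<xi>)"
    using bump_integrable_exp(1)[OF assms] bump_integrable_exp(1)[OF bump_ddx[OF assms]] by auto
  have "(\<integral>\<xi>. ?e \<xi> * ddx m \<xi> + (- \<i> * of_real x) * (?e \<xi> * m \<xi>) \<partial>lborel) = 0 - 0"
  proof (rule integral_derivative_line[of "\<lambda>\<xi>. ?e \<xi> * m \<xi>"])
    show "((\<lambda>\<xi>. ?e \<xi> * m \<xi>) has_vector_derivative ?e \<xi> * ddx m \<xi> + (- \<i> * of_real x) * (?e \<xi> * m \<xi>)) (at \<xi>)" for \<xi>
      using has_vector_derivative_mult[OF has_vector_derivative_exp_i[where x = x and \<xi> = \<xi> and S = UNIV] smooth_has_vector_derivative[OF sm, of \<xi>]]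
      by (simp add: mult.assoc)
    show "continuous_on UNIV (\<lambda>\<xi>. ?e \<xi> * ddx m \<xi> + (- \<i> * of_real x) * (?e \<xi> * m \<xi>))"
      by (intro continuous_intros smooth_continuous_on smooth_ddx sm)
    show "integrable lborel (\<lambda>\<xi>. ?e \<xi> * ddx m \<xi> + (- \<i> * of_real x) * (?e \<xi> * m \<xi>))"
      by (intro Bochner_Integration.integrable_add integrable_mult_right i1)
    show "((\<lambda>\<xi>. ?e \<xi> * m \<xi>) \<longlongrightarrow> 0) at_bot"
      by (rule tendsto_eventually, rule eventually_mono[OF eventually_gt_at_bot[of "-\<bar>R\<bar>-1"]]) (use 0 in auto)
    show "((\<lambda>\<xi>. ?e \<xi> * m \<xi>) \<longlongrightarrow> 0) at_top"
      by (rule tendsto_eventually, rule eventually_mono[OF eventually_gt_at_top[of "\<bar>R\<bar>+1"]]) (use 0 in auto)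
  qed
  then have "fourier (ddx m) x + (- \<i> * of_real x) * fourier m x = 0"
    unfolding fourier_def
    by (subst (asm) Bochner_Integration.integral_add) (use i1 in \<open>auto\<close>)
  then show ?thesis by (simp add: algebra_simps)
qed

lemma fourier_has_vector_derivative:
  assumes "bump R m"
  shows "(fourier m has_vector_derivative fourier (\<lambda>\<xi>. - \<i> * of_real \<xi> * m \<xi>) x) (at x)"
proof -
  let ?m' = "\<lambda>\<xi>. - \<i> * of_real \<xi> * m \<xi>"
  have sm: "smooth m" using assms unfolding bump_def by simp
  have b: "bump R ?m'"
    using bump_mult[OF assms smooth_mult[OF smooth_const smooth_of_real], of "-\<i>"] by simp
  have "((\<lambda>x. integral (cbox (-R) R) (\<lambda>\<xi>. exp (- \<i> * of_real (\<xi> * x)) * m \<xi>)) has_vector_derivative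
     integral (cbox (-R) R) (\<lambda>\<xi>. exp (- \<i> * of_real (\<xi> * x)) * ?m' \<xi>)) (at x within UNIV)"
  proof (rule leibniz_rule_vector_derivative[where fx = "\<lambda>x \<xi>. exp (- \<i> * of_real (\<xi> * x)) * ?m' \<xi>"])
    show "((\<lambda>x. exp (- \<i> * of_real (\<xi> * x)) * m \<xi>) has_vector_derivative exp (- \<i> * of_real (\<xi> * x)) * ?m' \<xi>) (at x within UNIV)" for x \<xi>
      using has_vector_derivative_mult_left[OF has_vector_derivative_exp_i[where x = \<xi> and \<xi> = x and S = UNIV], of "m \<xi>"]
      by (simp add: mult_ac)
    show "(\<lambda>\<xi>. exp (- \<i> * of_real (\<xi> * x)) * m \<xi>) integrable_on cbox (-R) R" for x
      by (intro integrable_continuous continuous_intros smooth_continuous_on sm)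
    have "continuous_on (UNIV \<times> cbox (-R) R) (\<lambda>p. m (snd p))"
      by (rule continuous_on_compose2[OF smooth_continuous_on[OF sm, of UNIV]]) (auto intro: continuous_intros)
    then show "continuous_on (UNIV \<times> cbox (-R) R) (\<lambda>(x, \<xi>). exp (- \<i> * of_real (\<xi> * x)) * ?m' \<xi>)"
      unfolding split_beta by (intro continuous_intros) auto
  qed auto
  then show ?thesis
    unfolding bump_integrable_exp(2)[OF b]
    by (subst bump_integrable_exp(2)[OF assms, abs_def]) simp
qed

lemma bump_mult_id: "bump R m \<Longrightarrow> bump R (\<lambda>\<xi>. - \<i> * of_real \<xi> * m \<xi>)"
  using bump_mult[OF _ smooth_mult[OF smooth_const smooth_of_real], of R m "-\<i>"] by simp

lemma fourier_bump_continuous: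
  assumes "bump R m"
  shows "continuous_on S (fourier m)"
  using fourier_has_vector_derivative[OF assms]
  by (meson continuous_at_imp_continuous_on has_vector_derivative_continuous)

text \<open>Multiplying the transform by \<open>x\<close> amounts to differentiating the symbol, and
  \<open>ddx m\<close> is again a bump of the same radius; hence an induction over all bumps at
  once.\<close>

lemma fourier_bump_decay_power:
  assumes "bump R m"
  shows "\<exists>C. \<forall>x. \<bar>x\<bar> ^ n * norm (fourier m x) \<le> C"
  using assms
proof (induction n arbitrary: m)
  case 0
  then show ?case using fourier_bump_bounded by fastforce
next
  case (Suc n)
  obtain C where "\<And>x. \<bar>x\<bar> ^ n * norm (fourier (ddx m) x) \<le> C"
    using Suc.IH[OF bump_ddx[OF Suc.prems]] by blast
  then show ?case unfolding fourier_ddx[OF Suc.prems]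
    by (intro exI[of _ C]) (simp add: norm_mult mult_ac)
qed

lemma fourier_bump_decay:
  assumes "bump R m"
  obtains C where "C > 0" "\<And>x. (1 + x\<^sup>2)\<^sup>2 * norm (fourier m x) \<le> C"
proof -
  obtain C0 where C0: "\<And>x. norm (fourier m x) \<le> C0"
    using fourier_bump_decay_power[OF assms, of 0] by auto
  obtain C2 where C2: "\<And>x. x^2 * norm (fourier m x) \<le> C2"
    using fourier_bump_decay_power[OF assms, of 2] by auto
  obtain C4 where C4: "\<And>x. x^4 * norm (fourier m x) \<le> C4"
    using fourier_bump_decay_power[OF assms, of 4] by (auto simp: power_even_abs)
  have "(1 + x\<^sup>2)\<^sup>2 * norm (fourier m x) \<le> \<bar>C0\<bar> + 2 * \<bar>C2\<bar> + \<bar>C4\<bar> + 1" for x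
  proof -
    have "(1 + x\<^sup>2)\<^sup>2 * norm (fourier m x) = norm (fourier m x) + 2 * (x^2 * norm (fourier m x)) + x^4 * norm (fourier m x)"
      by (simp add: power2_eq_square algebra_simps power4_eq_xxxx)
    then show ?thesis using C0[of x] C2[of x] C4[of x] by linarith
  qed
  then show ?thesis by (intro that[of "\<bar>C0\<bar> + 2 * \<bar>C2\<bar> + \<bar>C4\<bar> + 1"]) auto
qed

text \<open>The orders up to 2 are those of the error terms in the expansion of the solution near
  its kink. Of the available weight \<open>(1 + x\<^sup>2)\<^sup>2\<close> one factor absorbs the
  power and the other gives integrability.\<close>

lemma fourier_bump_moment_integrable:
  assumes "bump R m" "k \<le> 2"
  shows "integrable lborel (\<lambda>x. \<bar>x\<bar> ^ k * norm (fourier m x))"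
proof -
  obtain C where C: "C > 0" "\<And>x. (1 + x\<^sup>2)\<^sup>2 * norm (fourier m x) \<le> C"
    using fourier_bump_decay[OF assms(1)] by blast
  have [measurable]: "fourier m \<in> borel_measurable borel"
    using fourier_bump_continuous[OF assms(1)] borel_measurable_continuous_onI by blast
  show ?thesis
  proof (rule integrable_decay)
    show "(1 + x\<^sup>2) * norm (\<bar>x\<bar> ^ k * norm (fourier m x)) \<le> C" for x
    proof -
      have "\<bar>x\<bar> ^ k \<le> 1 + x\<^sup>2"
      proof (cases "\<bar>x\<bar> \<le> 1")
        case True
        then show ?thesis using power_le_one[of "\<bar>x\<bar>" k] by (simp add: add_increasing2)
      next
        case False
        then show ?thesis using power_increasing[OF assms(2), of "\<bar>x\<bar>"] by auto
      qed
      then have "(1 + x\<^sup>2) * (\<bar>x\<bar> ^ k * norm (fourier m x)) \<le> (1 + x\<^sup>2) * ((1 + x\<^sup>2) * norm (fourier m x))"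
        by (intro mult_left_mono mult_right_mono) auto
      then show ?thesis using C(2)[of x] by (simp add: power2_eq_square mult.assoc abs_mult power_abs)
    qed
  qed measurable
qed

lemma fourier_bump_integrable: "bump R m \<Longrightarrow> integrable lborel (fourier m)"
  using fourier_bump_moment_integrable[of R m 0] fourier_bump_continuous[of R m UNIV]
  by (auto simp: borel_measurable_continuous_onI intro: integrable_norm_cancel)

lemma fourier_bump_tendsto:
  assumes "bump R m" "k \<le> 2" "F \<le> at_infinity"
  shows "((\<lambda>x. of_real (x ^ k) * fourier m x) \<longlongrightarrow> 0) F"
proof (rule tendsto_mono[OF assms(3)])
  obtain C where C: "\<And>x. \<bar>x\<bar> ^ Suc k * norm (fourier m x) \<le> C"
    using fourier_bump_decay_power[OF assms(1)] by blast
  have "((\<lambda>x::real. C / norm x) \<longlongrightarrow> 0) at_infinity"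
    by (intro real_tendsto_divide_at_top[OF tendsto_const] filterlim_norm_at_top)
  moreover have "eventually (\<lambda>x. norm (of_real (x ^ k) * fourier m x) \<le> C / norm x) at_infinity"
  proof (rule eventually_mono[OF eventually_at_infinity[THEN iffD2]])
    show "\<exists>b. \<forall>x. b \<le> norm x \<longrightarrow> x \<noteq> (0::real)" by (intro exI[of _ 1]) auto
    show "norm (of_real (x ^ k) * fourier m x) \<le> C / norm x" if "x \<noteq> 0" for x
      using C[of x] that by (simp add: norm_mult norm_power field_simps power_abs)
  qed
  ultimately show "((\<lambda>x. of_real (x ^ k) * fourier m x) \<longlongrightarrow> 0) at_infinity"
    by (rule Lim_null_comparison[rotated])
qed

text \<open>A violation at one point persists on a nondegenerate interval, which is not a null set.
  Endpoints are included because the statement is also applied to the time variable on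
  \<open>{0..T}\<close>.\<close>

lemma continuous_AE_le_interval:
  fixes g :: "real \<Rightarrow> real"
  assumes ae: "AE x in lborel. x \<in> {a..b} \<longrightarrow> g x \<le> M" and c: "continuous_on {a..b} g" and "a < b"
    and x: "x \<in> {a..b}"
  shows "g x \<le> M"
proof (rule ccontr)
  assume "\<not> g x \<le> M"
  then have "g x - M > 0" by simp
  then obtain d where d: "d > 0" "\<And>y. y \<in> {a..b} \<Longrightarrow> dist y x < d \<Longrightarrow> dist (g y) (g x) < g x - M"
    using c x unfolding continuous_on_iff by blast
  define l where "l = max a (x - d/2)"
  define r where "r = min b (x + d/2)"
  have lr: "l < r" using x d \<open>a < b\<close> unfolding l_def r_def by auto
  have big: "g y > M" if "y \<in> {l..r}" for y
  proof -
    have "y \<in> {a..b}" "dist y x < d"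
      using that d(1) x unfolding l_def r_def by (auto simp: dist_real_def)
    then show ?thesis using d(2)[of y] by (auto simp: dist_real_def)
  qed
  have "AE y in lborel. y \<notin> {l..r}"
    using ae
  proof eventually_elim
    case (elim y)
    then show ?case using big[of y] unfolding l_def r_def by force
  qed
  then have "emeasure lborel {l..r} = 0"
    by (rule AE_iff_measurable[THEN iffD1, rotated 2]) auto
  then show False using lr by simp
qed

lemma continuous_AE_le:
  fixes g :: "real \<Rightarrow> real"
  assumes "AE x in lborel. g x \<le> M" "continuous_on UNIV g"
  shows "g x \<le> M"
  by (rule continuous_AE_le_interval[of "x - 1" "x + 1"])
    (use assms in \<open>auto intro: continuous_on_subset\<close>)

section \<open>Schwartz functions\<close>

lemma schwartz_decay:
  assumes "\<psi> \<in> schwartz"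
  shows "\<bar>x\<bar> ^ m * norm (\<psi> x) \<le> schwartz_seminorm m 0 \<psi>"
  unfolding schwartz_seminorm_def
proof (rule cSUP_upper2[where x = x])
  show "bdd_above (range (\<lambda>x. \<bar>x\<bar> ^ m * cmod ((ddx ^^ 0) \<psi> x)))"
    using assms unfolding schwartz_def by (intro bounded_imp_bdd_above) blast
qed auto

lemma schwartz_measurable: "\<psi> \<in> schwartz \<Longrightarrow> \<psi> \<in> borel_measurable borel"
  unfolding schwartz_def by (auto intro: borel_measurable_continuous_onI smooth_continuous_on)

lemma schwartz_square_decay:
  assumes "\<psi> \<in> schwartz"
  shows "(1 + x\<^sup>2) * norm (\<psi> x) \<le> schwartz_seminorm 0 0 \<psi> + schwartz_seminorm 2 0 \<psi>"
  using schwartz_decay[OF assms, of x 0] schwartz_decay[OF assms, of x 2]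
  by (simp add: algebra_simps)

lemma schwartz_integrable: "\<psi> \<in> schwartz \<Longrightarrow> integrable lborel \<psi>"
  by (rule integrable_decay[OF schwartz_measurable schwartz_square_decay])

lemma schwartz_seminorm_nonneg:
  assumes "\<psi> \<in> schwartz"
  shows "schwartz_seminorm m n \<psi> \<ge> 0"
  unfolding schwartz_seminorm_def
proof (rule cSUP_upper2[where x = 0])
  show "bdd_above (range (\<lambda>x. \<bar>x\<bar> ^ m * cmod ((ddx ^^ n) \<psi> x)))"
    using assms unfolding schwartz_def by (auto intro: bounded_imp_bdd_above)
qed auto

lemma tempered_fun_bounded:
  assumes u: "continuous_on UNIV u" "\<And>x. \<bar>u x\<bar> \<le> B"
  shows "tempered_fun (complexify u)"
proof -
  have [measurable]: "u \<in> borel_measurable borel" using u(1) borel_measurable_continuous_onI by blast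
  have i: "integrable lborel (\<lambda>x. complexify u x * \<psi> x)" if "\<psi> \<in> schwartz" for \<psi>
  proof (rule Bochner_Integration.integrable_bound[of lborel "\<lambda>x. B * norm (\<psi> x)"])
    have [measurable]: "\<psi> \<in> borel_measurable borel" using schwartz_measurable[OF that] .
    show "integrable lborel (\<lambda>x. B * norm (\<psi> x))" using schwartz_integrable[OF that] by simp
    show "(\<lambda>x. complexify u x * \<psi> x) \<in> borel_measurable lborel" unfolding complexify_def by measurable
    have "norm (complexify u x * \<psi> x) \<le> norm (B * norm (\<psi> x))" for x
    proof -
      have "\<bar>u x\<bar> * norm (\<psi> x) \<le> \<bar>B\<bar> * norm (\<psi> x)"
        using u(2)[of x] by (intro mult_right_mono) auto
      then show ?thesis by (simp add: complexify_def norm_mult abs_mult)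
    qed
    then show "AE x in lborel. norm (complexify u x * \<psi> x) \<le> norm (B * norm (\<psi> x))" by simp
  qed
  have B0: "B \<ge> 0" using u(2)[of 0] by linarith
  have bound: "norm (distr_of_fun (complexify u) \<psi>) \<le> B * (\<integral>x. inverse (1 + x\<^sup>2) \<partial>lborel) *
      (\<Sum>m\<le>2. \<Sum>n\<le>2. schwartz_seminorm m n \<psi>)" if psi: "\<psi> \<in> schwartz" for \<psi>
  proof -
    define S where "S = schwartz_seminorm 0 0 \<psi> + schwartz_seminorm 2 0 \<psi>"
    have "norm (distr_of_fun (complexify u) \<psi>) \<le> (\<integral>x. norm (complexify u x * \<psi> x) \<partial>lborel)"
      unfolding distr_of_fun_def by (rule integral_norm_bound)
    also have "\<dots> \<le> (\<integral>x. B * S * inverse (1 + x\<^sup>2) \<partial>lborel)"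
    proof (rule integral_mono)
      show "integrable lborel (\<lambda>x. norm (complexify u x * \<psi> x))" using i[OF psi] by simp
      show "integrable lborel (\<lambda>x. B * S * inverse (1 + x\<^sup>2))" using integrable_inverse_square by simp
      show "norm (complexify u x * \<psi> x) \<le> B * S * inverse (1 + x\<^sup>2)" for x
      proof -
        have p: "1 + x\<^sup>2 > 0" by (simp add: add_pos_nonneg)
        have "norm (\<psi> x) \<le> S * inverse (1 + x\<^sup>2)"
          using schwartz_square_decay[OF psi, of x] p unfolding S_def by (simp add: field_simps)
        then have "\<bar>u x\<bar> * norm (\<psi> x) \<le> B * (S * inverse (1 + x\<^sup>2))"
          using u(2)[of x] B0 by (intro mult_mono) auto
        then show ?thesis by (simp add: norm_mult complexify_def mult.assoc)
      qed
    qed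
    also have "\<dots> = B * (\<integral>x. inverse (1 + x\<^sup>2) \<partial>lborel) * S" by simp
    also have "\<dots> \<le> B * (\<integral>x. inverse (1 + x\<^sup>2) \<partial>lborel) * (\<Sum>m\<le>2. \<Sum>n\<le>2. schwartz_seminorm m n \<psi>)"
    proof (intro mult_left_mono mult_nonneg_nonneg)
      show "S \<le> (\<Sum>m\<le>2. \<Sum>n\<le>2. schwartz_seminorm m n \<psi>)"
        unfolding S_def using schwartz_seminorm_nonneg[OF psi] by (simp add: numeral_2_eq_2 add_increasing2 add_increasing add_mono)
    qed (use B0 in \<open>auto intro!: integral_nonneg_AE\<close>)
    finally show ?thesis .
  qed
  have "tempered (distr_of_fun (complexify u))"
    unfolding tempered_def
  proof (intro conjI ballI allI exI)
    show "distr_of_fun (complexify u) (\<lambda>x. \<psi> x + \<eta> x) = distr_of_fun (complexify u) \<psi> + distr_of_fun (complexify u) \<eta>"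
      if "\<psi> \<in> schwartz" "\<eta> \<in> schwartz" for \<psi> \<eta>
      unfolding distr_of_fun_def ring_distribs using i that by (intro Bochner_Integration.integral_add)
    show "distr_of_fun (complexify u) (\<lambda>x. a * \<psi> x) = a * distr_of_fun (complexify u) \<psi>" for a \<psi>
      unfolding distr_of_fun_def by (simp add: mult.left_commute)
  qed (rule bound)
  then show ?thesis unfolding tempered_fun_def using i by (auto simp: complexify_def[abs_def])
qed

section \<open>Gaussians as test functions\<close>

lemma generated_algebra_polynomial_growth:
  fixes p :: "real \<Rightarrow> complex"
  assumes "p \<in> generated_algebra {of_real}"
  shows "\<exists>C k. \<forall>x. norm (p x) \<le> C * (1 + \<bar>x\<bar>) ^ k"
  using assms
proof induction
  case (base g)
  then show ?case by (intro exI[of _ 1]) auto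
next
  case (const c)
  then show ?case by (intro exI[of _ "norm c"] exI[of _ 0]) auto
next
  case (add f g)
  then obtain C k D l where C: "\<And>x. norm (f x) \<le> C * (1 + \<bar>x\<bar>) ^ k" and D: "\<And>x. norm (g x) \<le> D * (1 + \<bar>x\<bar>) ^ l"
    by blast
  have "norm (f x + g x) \<le> (\<bar>C\<bar> + \<bar>D\<bar>) * (1 + \<bar>x\<bar>) ^ (k + l)" for x
  proof -
    have "norm (f x) \<le> \<bar>C\<bar> * (1 + \<bar>x\<bar>) ^ (k + l)"
      by (rule order_trans[OF C]) (intro mult_mono power_increasing, auto)
    moreover have "norm (g x) \<le> \<bar>D\<bar> * (1 + \<bar>x\<bar>) ^ (k + l)"
      by (rule order_trans[OF D]) (intro mult_mono power_increasing, auto)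
    ultimately show ?thesis using norm_triangle_ineq[of "f x" "g x"] by (simp add: algebra_simps)
  qed
  then show ?case by blast
next
  case (mult f g)
  then obtain C k D l where C: "\<And>x. norm (f x) \<le> C * (1 + \<bar>x\<bar>) ^ k" and D: "\<And>x. norm (g x) \<le> D * (1 + \<bar>x\<bar>) ^ l"
    by blast
  have "norm (f x * g x) \<le> (C * D) * (1 + \<bar>x\<bar>) ^ (k + l)" for x
    using mult_mono[OF C[of x] D[of x]] order_trans[OF norm_ge_zero C[of x]]
    by (simp add: norm_mult power_add mult_ac)
  then show ?case by blast
qed

text \<open>With \<open>y\<close> the negative exponent of the Gaussian,
  \<open>1 + \<bar>x\<bar>\<close> is at most a multiple of \<open>1 + y / k\<close>, whose
  \<open>k\<close>-th power is at most \<open>exp y\<close>. The case \<open>k = 0\<close> is apart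
  only because of the division by \<open>k\<close>.\<close>

lemma gaussian_times_power_bounded:
  fixes q b :: real
  assumes "b > 0"
  shows "\<exists>C. \<forall>x. (1 + \<bar>x\<bar>) ^ k * exp (- (b * (x - q))\<^sup>2 / 2) \<le> C"
proof (cases "k = 0")
  case False
  define c where "c = 1 + \<bar>q\<bar> + 1 / b"
  have c1: "c \<ge> 1" unfolding c_def using assms by simp
  have "(1 + \<bar>x\<bar>) ^ k * exp (- (b * (x - q))\<^sup>2 / 2) \<le> (c * (1 + 2 * real k)) ^ k" for x
  proof -
    define y where "y = (b * (x - q))\<^sup>2 / 2"
    have y0: "y \<ge> 0" unfolding y_def by simp
    have "\<bar>x\<bar> \<le> \<bar>q\<bar> + \<bar>b * (x - q)\<bar> / b" using assms by (simp add: abs_mult)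
    also have "\<bar>b * (x - q)\<bar> \<le> 1 + 2 * y"
    proof -
      have "0 \<le> (\<bar>b * (x - q)\<bar> - 1)\<^sup>2" by simp
      then show ?thesis unfolding y_def power2_diff power2_abs
        using zero_le_power2[of "b * (x - q)"] by (simp del: zero_le_power2)
    qed
    finally have "1 + \<bar>x\<bar> \<le> 1 + \<bar>q\<bar> + (1 + 2 * y) / b" using assms by (simp add: divide_right_mono)
    also have "\<dots> \<le> c * (1 + 2 * y)" unfolding c_def using y0 assms by (simp add: field_simps)
    also have "\<dots> \<le> c * ((1 + 2 * real k) * (1 + y / real k))"
    proof (rule mult_left_mono)
      show "1 + 2 * y \<le> (1 + 2 * real k) * (1 + y / real k)" using False y0 by (simp add: field_simps)
    qed (use c1 in auto)
    finally have "(1 + \<bar>x\<bar>) ^ k \<le> (c * (1 + 2 * real k) * (1 + y / real k)) ^ k"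
      by (intro power_mono) (auto simp: mult_ac)
    also have "\<dots> = (c * (1 + 2 * real k)) ^ k * (1 + y / real k) ^ k" by (simp add: power_mult_distrib)
    also have "\<dots> \<le> (c * (1 + 2 * real k)) ^ k * exp y"
    proof (rule mult_left_mono)
      have "- real k \<le> y" using y0 by (smt (verit) of_nat_0_le_iff)
      then show "(1 + y / real k) ^ k \<le> exp y" using exp_ge_one_plus_x_over_n_power_n[of k y] False by simp
    qed (use c1 in auto)
    finally have "(1 + \<bar>x\<bar>) ^ k * exp (- y) \<le> (c * (1 + 2 * real k)) ^ k * exp y * exp (- y)"
      by (intro mult_right_mono) auto
    then show ?thesis unfolding y_def by (simp add: mult.assoc exp_add[symmetric])
  qed
  then show ?thesis by blast
next
  case True
  then have "(1 + \<bar>x\<bar>) ^ k * exp (- (b * (x - q))\<^sup>2 / 2) \<le> 1" for x by simp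
  then show ?thesis by blast
qed

text \<open>\<open>generated_algebra {of_real}\<close> is the ring of complex polynomials, so the
  family \<open>S\<close> of polynomials times the Gaussian is closed under differentiation, and
  each of its members decays faster than any power.\<close>

lemma gaussian_schwartz:
  assumes b: "b > 0"
  shows "(\<lambda>x. of_real (exp (- (b * (x - q))\<^sup>2 / 2))) \<in> schwartz"
proof -
  let ?G = "\<lambda>x. complex_of_real (exp (- (b * (x - q))\<^sup>2 / 2))"
  define S where "S = {\<lambda>x. p x * ?G x | p. p \<in> generated_algebra {of_real}}"
  have pd: "\<exists>p'\<in>generated_algebra {of_real}. \<forall>x. (p has_vector_derivative p' x) (at x)" if "p \<in> generated_algebra {of_real}" for p :: "real \<Rightarrow> complex"
  proof (rule generated_algebra_derivative[OF that])
    show "\<exists>g'\<in>generated_algebra {complex_of_real}. \<forall>x. (g has_vector_derivative g' x) (at x)" if "g \<in> {of_real}" for g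
      using that has_vector_derivative_of_real[OF DERIV_ident]
      by (intro bexI[of _ "\<lambda>x. 1"]) (auto intro!: generated_algebra.const)
  qed
  have dS: "\<exists>g'\<in>S. \<forall>x. (g has_vector_derivative g' x) (at x)" if gS: "g \<in> S" for g
  proof -
    obtain p where p: "p \<in> generated_algebra {of_real}" "g = (\<lambda>x. p x * ?G x)" using gS unfolding S_def by auto
    obtain p' where p': "p' \<in> generated_algebra {of_real}" "\<And>x. (p has_vector_derivative p' x) (at x)"
      using pd[OF p(1)] by auto
    define L where "L = (\<lambda>x. complex_of_real (- (b\<^sup>2)) * complex_of_real x + complex_of_real (b\<^sup>2 * q))"
    have dG: "(?G has_vector_derivative L x * ?G x) (at x)" for x
    proof -
      have "((\<lambda>x. exp (- (b * (x - q))\<^sup>2 / 2)) has_real_derivative (- (b^2) * x + b^2 * q) * exp (- (b * (x - q))\<^sup>2 / 2)) (at x)"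
        by (rule derivative_eq_intros refl | simp)+ (simp add: power2_eq_square algebra_simps)
      from has_vector_derivative_of_real[OF this, where 'a = complex]
      show ?thesis by (simp only: L_def of_real_mult of_real_add)
    qed
    let ?g' = "\<lambda>x. (p x * L x + p' x) * ?G x"
    have "(g has_vector_derivative ?g' x) (at x)" for x
      unfolding p(2) using has_vector_derivative_mult[OF p'(2) dG, of x]
      by (simp only: distrib_right mult.assoc)
    moreover have "?g' \<in> S"
    proof -
      have "(\<lambda>x. p x * L x + p' x) \<in> generated_algebra {of_real}"
      proof -
        have l: "(\<lambda>x. complex_of_real (- (b\<^sup>2)) * complex_of_real x) \<in> generated_algebra {of_real}"
          using generated_algebra.mult[OF generated_algebra.const generated_algebra.base, of complex_of_real "{of_real}" "of_real (- (b\<^sup>2))"] by simp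
        show ?thesis
          unfolding L_def
          using generated_algebra.add[OF generated_algebra.mult[OF p(1) generated_algebra.add[OF l generated_algebra.const]] p'(1), of "of_real (b\<^sup>2 * q)"] .
      qed
      then show ?thesis unfolding S_def by auto
    qed
    ultimately show ?thesis by (intro bexI[of _ ?g'] allI)
  qed
  have GS: "?G \<in> S" unfolding S_def using generated_algebra.const[of 1 "{of_real}"] by force
  have "(ddx ^^ n) ?G \<in> S" for n
  proof (induction n)
    case (Suc n)
    then obtain g' where "g' \<in> S" "\<And>x. ((ddx ^^ n) ?G has_vector_derivative g' x) (at x)" using dS by blast
    then show ?case using ddx_eqI by (metis comp_apply funpow.simps(2))
  qed (use GS in simp)
  moreover have "bounded (range (\<lambda>x. \<bar>x\<bar> ^ m * norm (g x)))" if gS: "g \<in> S" for g m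
  proof -
    obtain p where p: "p \<in> generated_algebra {of_real}" "g = (\<lambda>x. p x * ?G x)" using gS unfolding S_def by auto
    obtain C k where C: "\<And>x. norm (p x) \<le> C * (1 + \<bar>x\<bar>) ^ k" using generated_algebra_polynomial_growth[OF p(1)] by auto
    obtain D where D: "\<And>x. (1 + \<bar>x\<bar>) ^ (m + k) * exp (- (b * (x - q))\<^sup>2 / 2) \<le> D"
      using gaussian_times_power_bounded[OF b] by meson
    have C0: "C \<ge> 0" using order_trans[OF norm_ge_zero C[of 0]] by simp
    have "norm (\<bar>x\<bar> ^ m * norm (g x)) \<le> C * D" for x
    proof -
      let ?e = "exp (- (b * (x - q))\<^sup>2 / 2)"
      have "norm (\<bar>x\<bar> ^ m * norm (g x)) = \<bar>x\<bar> ^ m * (norm (p x) * ?e)"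
        unfolding p(2) norm_mult by (simp add: abs_mult power_abs)
      also have "\<dots> \<le> (1 + \<bar>x\<bar>) ^ m * ((C * (1 + \<bar>x\<bar>) ^ k) * ?e)"
        by (intro mult_mono power_mono C mult_nonneg_nonneg) (auto simp: C0)
      also have "\<dots> = C * ((1 + \<bar>x\<bar>) ^ (m + k) * ?e)" by (simp add: power_add mult_ac)
      also have "\<dots> \<le> C * D" by (rule mult_left_mono[OF D C0])
      finally show ?thesis .
    qed
    then show ?thesis unfolding bounded_iff by auto
  qed
  ultimately show ?thesis unfolding schwartz_def using smooth_coinduct[OF GS dS] by auto
qed

text \<open>No singularity arises because \<open>f\<close> vanishes near 0. The exponent has to vary
  within the coinductive family: each derivative raises it by one and turns the numerator into
  \<open>\<xi> * f' - n * f\<close>, which again vanishes near 0.\<close>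

lemma smooth_divide_power:
  fixes f :: "real \<Rightarrow> complex"
  assumes "smooth f" "r > 0" "\<And>\<xi>. \<bar>\<xi>\<bar> < r \<Longrightarrow> f \<xi> = 0"
  shows "smooth (\<lambda>\<xi>. f \<xi> / of_real \<xi> ^ n)"
proof (rule smooth_coinduct)
  let ?S = "{\<lambda>\<xi>. f \<xi> / of_real \<xi> ^ n | f n. smooth f \<and> (\<forall>\<xi>. \<bar>\<xi>\<bar> < r \<longrightarrow> f \<xi> = (0::complex))}"
  show "(\<lambda>\<xi>. f \<xi> / of_real \<xi> ^ n) \<in> ?S" using assms by blast
  show "\<exists>g'\<in>?S. \<forall>x. (g has_vector_derivative g' x) (at x)" if gS: "g \<in> ?S" for g
  proof -
    obtain f n where f: "smooth f" "\<And>\<xi>. \<bar>\<xi>\<bar> < r \<Longrightarrow> f \<xi> = 0" and g: "g = (\<lambda>\<xi>. f \<xi> / of_real \<xi> ^ n)"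
      using gS by auto
    let ?h = "\<lambda>\<xi>. of_real \<xi> * ddx f \<xi> + (- of_nat n) * f \<xi>"
    have hs: "smooth ?h"
    proof (rule smooth_generated_algebra[where G = "Collect smooth"])
      show "\<exists>g'\<in>generated_algebra (Collect smooth). \<forall>x. (g has_vector_derivative g' x) (at x)"
        if "g \<in> Collect smooth" for g :: "real \<Rightarrow> complex"
        using that smooth_ddx[of g] smooth_has_vector_derivative[of g] by (auto intro: generated_algebra.base)
      show "?h \<in> generated_algebra (Collect smooth)"
        by (intro generated_algebra.add generated_algebra.mult generated_algebra.const generated_algebra.base) (auto intro: smooth_of_real smooth_ddx f)
    qed
    have d0: "(f has_vector_derivative 0) (at \<xi>)" "ddx f \<xi> = 0" if "\<bar>\<xi>\<bar> < r" for \<xi>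
    proof -
      have op: "open {\<xi>::real. \<bar>\<xi>\<bar> < r}" by (intro open_Collect_less continuous_intros)
      show "(f has_vector_derivative 0) (at \<xi>)"
        by (rule has_vector_derivative_transform_within_open[OF has_vector_derivative_const op]) (use that f in auto)
      then show "ddx f \<xi> = 0" unfolding ddx_def by (rule vector_derivative_at)
    qed
    have "(g has_vector_derivative ?h \<xi> / of_real \<xi> ^ Suc n) (at \<xi>)" for \<xi>
    proof (cases "\<bar>\<xi>\<bar> < r")
      case True
      have op: "open {\<xi>::real. \<bar>\<xi>\<bar> < r}" by (intro open_Collect_less continuous_intros)
      have "(g has_vector_derivative 0) (at \<xi>)" unfolding g
        by (rule has_vector_derivative_transform_within_open[OF has_vector_derivative_const op]) (use True f in auto)
      then show ?thesis using d0[OF True] f True by simp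
    next
      case False
      then have nz: "\<xi> \<noteq> 0" using assms(2) by auto
      have "((\<lambda>\<xi>. inverse (\<xi> ^ n)) has_field_derivative - of_nat n / of_real \<xi> ^ Suc n) (at (complex_of_real \<xi>))"
      proof (cases n)
        case (Suc m)
        have pw: "((\<lambda>\<xi>. \<xi> ^ n) has_field_derivative of_nat n * (1 * complex_of_real \<xi> ^ (n - Suc 0))) (at (complex_of_real \<xi>))"
          by (rule DERIV_power[OF DERIV_ident])
        have nz': "complex_of_real \<xi> ^ n \<noteq> 0" using nz by simp
        have e: "- (inverse (y ^ Suc m) * (a * (1 * y ^ m)) * inverse (y ^ Suc m)) = - a / y ^ Suc (Suc m)" if "y \<noteq> 0" for a y :: complex
          using that by (simp add: divide_simps)
        show ?thesis
          using DERIV_inverse'[OF pw nz'] e[of "complex_of_real \<xi>" "of_nat n"] nz Suc by simp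
      qed simp
      from has_vector_derivative_real_field[OF this]
      have "((\<lambda>\<xi>. inverse (of_real \<xi> ^ n)) has_vector_derivative - of_nat n / complex_of_real \<xi> ^ Suc n) (at \<xi>)" .
      from has_vector_derivative_mult[OF smooth_has_vector_derivative[OF f(1), of \<xi>] this]
      have "(g has_vector_derivative f \<xi> * (- of_nat n / of_real \<xi> ^ Suc n) + ddx f \<xi> * inverse (of_real \<xi> ^ n)) (at \<xi>)"
        unfolding g by (simp only: divide_inverse)
      moreover have "f \<xi> * (- of_nat n / of_real \<xi> ^ Suc n) + ddx f \<xi> * inverse (of_real \<xi> ^ n) = ?h \<xi> / of_real \<xi> ^ Suc n"
        using nz by (simp add: divide_simps)
      ultimately show ?thesis by simp
    qed
    moreover have "\<forall>\<xi>. \<bar>\<xi>\<bar> < r \<longrightarrow> ?h \<xi> = 0" using d0 f by auto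
    moreover have "(\<lambda>\<xi>. ?h \<xi> / of_real \<xi> ^ Suc n) \<in> ?S"
      by (rule CollectI, rule exI[of _ ?h], rule exI[of _ "Suc n"]) (use hs calculation(2) in simp)
    ultimately show ?thesis by (intro bexI[of _ "\<lambda>\<xi>. ?h \<xi> / of_real \<xi> ^ Suc n"] allI)
  qed
qed

section \<open>Littlewood-Paley blocks\<close>

text \<open>The third symbol expresses that \<open>phi\<close> contains two derivatives. They are
  moved onto \<open>u\<close> to estimate high frequencies, and they explain why the test kernels
  annihilate affine functions.\<close>

lemma littlewood_paley_bump:
  assumes "littlewood_paley chi phi"
  shows "bump (8/3) (complexify phi)" "bump (8/3) (complexify chi)"
    "bump (8/3) (\<lambda>\<xi>. complexify phi \<xi> / of_real \<xi> ^ 2)"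
proof -
  have s: "smooth chi" "smooth phi" "\<And>\<xi>. chi \<xi> \<noteq> 0 \<Longrightarrow> \<bar>\<xi>\<bar> \<le> 4/3"
      "\<And>\<xi>. phi \<xi> \<noteq> 0 \<Longrightarrow> 3/4 \<le> \<bar>\<xi>\<bar> \<and> \<bar>\<xi>\<bar> \<le> 8/3"
    using assms unfolding littlewood_paley_def by auto
  show 1: "bump (8/3) (complexify phi)"
    unfolding bump_def using s smooth_complexify unfolding complexify_def[abs_def] by fastforce
  show "bump (8/3) (complexify chi)"
    unfolding bump_def using s smooth_complexify unfolding complexify_def[abs_def] by fastforce
  have "smooth (\<lambda>\<xi>. complexify phi \<xi> / of_real \<xi> ^ 2)"
  proof (rule smooth_divide_power[of _ "3/4"])
    show "complexify phi \<xi> = 0" if "\<bar>\<xi>\<bar> < 3 / 4" for \<xi>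
      using s(4)[of \<xi>] that by (auto simp: complexify_def)
  qed (use s smooth_complexify in auto)
  then show "bump (8/3) (\<lambda>\<xi>. complexify phi \<xi> / of_real \<xi> ^ 2)"
    using 1 unfolding bump_def by auto
qed

text \<open>The frequency 2 lies outside the support of \<open>chi\<close>, so the rescaled copies
  of \<open>phi\<close> sum to 1 there.\<close>

lemma phi_not_zero:
  assumes "littlewood_paley chi phi"
  obtains \<xi> where "phi \<xi> > 0"
proof -
  have "\<exists>\<xi>. phi \<xi> \<noteq> 0"
  proof (rule ccontr)
    assume "\<nexists>\<xi>. phi \<xi> \<noteq> 0"
    then have "(\<lambda>j::nat. 0::real) sums (1 - chi 2)"
      using assms unfolding littlewood_paley_def by (auto dest: spec[where x = 2])
    then have "chi 2 = 1" using sums_unique2[OF sums_zero] by fastforce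
    then show False using assms unfolding littlewood_paley_def by (auto dest!: spec[where x = 2])
  qed
  then obtain \<xi> where "phi \<xi> \<noteq> 0" by blast
  moreover have "phi \<xi> \<ge> 0" using assms unfolding littlewood_paley_def by auto
  ultimately show ?thesis using that[of \<xi>] by simp
qed

section \<open>Besov norms: upper bounds\<close>

lemma integrable_pair_product:
  fixes a b :: "real \<Rightarrow> complex"
  assumes "integrable lborel a" "integrable lborel b"
  shows "integrable (lborel \<Otimes>\<^sub>M lborel) (\<lambda>(x, y). a x * b y)"
proof -
  have [measurable]: "a \<in> borel_measurable lborel" "b \<in> borel_measurable lborel" using assms by auto
  show ?thesis
  proof (rule lborel_pair.Fubini_integrable)
    show "(\<lambda>(x, y). a x * b y) \<in> borel_measurable (lborel \<Otimes>\<^sub>M lborel)" by measurable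
    show "integrable lborel (\<lambda>x. \<integral>y. norm (case (x, y) of (x, y) \<Rightarrow> a x * b y) \<partial>lborel)"
      using assms by (simp add: norm_mult)
    show "AE x in lborel. integrable lborel (\<lambda>y. case (x, y) of (x, y) \<Rightarrow> a x * b y)"
      using assms by simp
  qed
qed

lemma fubini_unimodular:
  fixes a b :: "real \<Rightarrow> complex"
  assumes "integrable lborel a" "integrable lborel b"
    and k: "(\<lambda>(x, y). k x y) \<in> borel_measurable (lborel \<Otimes>\<^sub>M lborel)" "\<And>x y. norm (k x y) \<le> 1"
  shows "(\<integral>x. \<integral>y. k x y * (a x * b y) \<partial>lborel \<partial>lborel) = (\<integral>y. \<integral>x. k x y * (a x * b y) \<partial>lborel \<partial>lborel)"
proof (rule lborel_pair.Fubini_integral[symmetric])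
  have [measurable]: "a \<in> borel_measurable lborel" "b \<in> borel_measurable lborel" using assms by auto
  note k(1)[measurable]
  show "integrable (lborel \<Otimes>\<^sub>M lborel) (\<lambda>(x, y). k x y * (a x * b y))"
  proof (rule Bochner_Integration.integrable_bound[OF integrable_pair_product[OF assms(1,2)]])
    show "(\<lambda>(x, y). k x y * (a x * b y)) \<in> borel_measurable (lborel \<Otimes>\<^sub>M lborel)"
      using borel_measurable_times[OF k(1), of "\<lambda>(x, y). a x * b y"] by (simp add: split_beta')
    show "AE p in lborel \<Otimes>\<^sub>M lborel. norm (case p of (x, y) \<Rightarrow> k x y * (a x * b y)) \<le> norm (case p of (x, y) \<Rightarrow> a x * b y)"
    proof (rule AE_I2)
      fix p :: "real \<times> real"
      obtain x y where "p = (x, y)" by force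
      then show "norm (case p of (x, y) \<Rightarrow> k x y * (a x * b y)) \<le> norm (case p of (x, y) \<Rightarrow> a x * b y)"
        using mult_right_mono[OF k(2)[of x y], of "norm (a x * b y)"] by (simp add: norm_mult)
    qed
  qed
qed

text \<open>Unfolding the definitions, a multiplier applied to a distribution evaluates that
  distribution at this very test function. The kernel is thus found on the test side, where
  everything is integrable and Fubini applies.\<close>

lemma fourier_multiplier_kernel:
  assumes "bump R (complexify \<mu>)" "integrable lborel \<psi>"
  shows "fourier (\<lambda>\<xi>. of_real (\<mu> \<xi>) * fourier_inv \<psi> \<xi>) x =
    1 / (2 * of_real pi) * (\<integral>y. \<psi> y * fourier (complexify \<mu>) (x - y) \<partial>lborel)"
proof -
  let ?k = "\<lambda>\<xi> y. exp (- \<i> * of_real (\<xi> * (x - y)))"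
  have "fourier (\<lambda>\<xi>. of_real (\<mu> \<xi>) * fourier_inv \<psi> \<xi>) x
      = (\<integral>\<xi>. 1 / (2 * of_real pi) * (\<integral>y. ?k \<xi> y * (complexify \<mu> \<xi> * \<psi> y) \<partial>lborel) \<partial>lborel)"
    unfolding fourier_def fourier_inv_def
  proof (rule Bochner_Integration.integral_cong[OF refl])
    fix \<xi> :: real
    have "(\<integral>y. ?k \<xi> y * (complexify \<mu> \<xi> * \<psi> y) \<partial>lborel) = (\<integral>y. (exp (- \<i> * of_real (\<xi> * x)) * of_real (\<mu> \<xi>)) * (exp (\<i> * of_real (\<xi> * y)) * \<psi> y) \<partial>lborel)"
      by (rule Bochner_Integration.integral_cong[OF refl])
        (simp add: complexify_def right_diff_distrib exp_diff exp_add exp_minus field_simps)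
    then show "exp (- \<i> * complex_of_real (\<xi> * x)) * (complex_of_real (\<mu> \<xi>) * (1 / (2 * complex_of_real pi) * (CLBINT \<xi>'. exp (\<i> * complex_of_real (\<xi> * \<xi>')) * \<psi> \<xi>')))
      = 1 / (2 * complex_of_real pi) * (CLBINT y. ?k \<xi> y * (complexify \<mu> \<xi> * \<psi> y))"
      by simp
  qed
  also have "\<dots> = 1 / (2 * of_real pi) * (\<integral>\<xi>. (\<integral>y. ?k \<xi> y * (complexify \<mu> \<xi> * \<psi> y) \<partial>lborel) \<partial>lborel)"
    by simp
  also have "(\<integral>\<xi>. (\<integral>y. ?k \<xi> y * (complexify \<mu> \<xi> * \<psi> y) \<partial>lborel) \<partial>lborel)
      = (\<integral>y. (\<integral>\<xi>. ?k \<xi> y * (complexify \<mu> \<xi> * \<psi> y) \<partial>lborel) \<partial>lborel)"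
  proof (rule fubini_unimodular[OF bump_integrable[OF assms(1)] assms(2)])
    have "continuous_on UNIV (\<lambda>(\<xi>, y). ?k \<xi> y)" unfolding split_beta by (intro continuous_intros)
    then show "(\<lambda>(\<xi>, y). ?k \<xi> y) \<in> borel_measurable (lborel \<Otimes>\<^sub>M lborel)"
      using borel_measurable_continuous_onI by (simp add: lborel_prod)
  qed simp
  also have "\<dots> = (\<integral>y. \<psi> y * fourier (complexify \<mu>) (x - y) \<partial>lborel)"
    unfolding fourier_def
    by (intro Bochner_Integration.integral_cong[OF refl])
       (simp add: mult_ac flip: integral_mult_right_zero integral_mult_left_zero)
  finally show ?thesis .
qed

lemma lborel_integral_shift:
  fixes f :: "real \<Rightarrow> 'a::{banach,second_countable_topology}"
  shows "(\<integral>x. f (t + x) \<partial>lborel) = (\<integral>x. f x \<partial>lborel)"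
  using lborel_integral_real_affine[of 1 f t] by simp

text \<open>A second use of Fubini carries the kernel from the test function to \<open>u\<close>.
  Since \<open>u\<close> is only bounded, absolute integrability of the double integral comes from
  \<open>\<psi>\<close> and the kernel.\<close>

lemma fourier_multiplier_rep:
  assumes u: "continuous_on UNIV u" "\<And>x. \<bar>u x\<bar> \<le> B"
    and \<mu>: "bump R (complexify \<mu>)" and \<psi>: "\<psi> \<in> schwartz"
  shows "fourier_inv_distr (mult_distr \<mu> (fourier_distr (distr_of_fun (complexify u)))) \<psi> =
    distr_of_fun (\<lambda>y. 1 / (2 * of_real pi) * (\<integral>x. complexify u (y + x) * fourier (complexify \<mu>) x \<partial>lborel)) \<psi>"
proof -
  let ?F = "fourier (complexify \<mu>)"
  have iF: "integrable lborel ?F" using fourier_bump_integrable[OF \<mu>] .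
  have [measurable]: "u \<in> borel_measurable borel" "\<psi> \<in> borel_measurable borel" "?F \<in> borel_measurable borel"
    using u(1) borel_measurable_continuous_onI schwartz_measurable[OF \<psi>] fourier_bump_continuous[OF \<mu>] by blast+
  have i\<psi>: "integrable lborel \<psi>" using schwartz_integrable[OF \<psi>] .
  have F0: "integrable (lborel \<Otimes>\<^sub>M lborel) (\<lambda>(y, x). \<psi> y * ?F (x - y))"
  proof (rule lborel_pair.Fubini_integrable)
    show "(\<lambda>(y, x). \<psi> y * ?F (x - y)) \<in> borel_measurable (lborel \<Otimes>\<^sub>M lborel)" by measurable
    have "(\<integral>x. norm (\<psi> y * ?F (x - y)) \<partial>lborel) = norm (\<psi> y) * (\<integral>x. norm (?F x) \<partial>lborel)" for y
      using lborel_integral_shift[of "\<lambda>x. norm (?F x)" "-y"] by (simp add: norm_mult)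
    then show "integrable lborel (\<lambda>y. \<integral>x. norm (case (y, x) of (y, x) \<Rightarrow> \<psi> y * ?F (x - y)) \<partial>lborel)"
      using i\<psi> by simp
    have "integrable lborel (\<lambda>x. ?F (x - y))" for y
      using lborel_integrable_real_affine[OF iF, of 1 "-y"] by simp
    then show "AE y in lborel. integrable lborel (\<lambda>x. case (y, x) of (y, x) \<Rightarrow> \<psi> y * ?F (x - y))" by simp
  qed
  have F1: "integrable (lborel \<Otimes>\<^sub>M lborel) (\<lambda>(y, x). complexify u x * (\<psi> y * ?F (x - y)))"
  proof (rule Bochner_Integration.integrable_bound[OF integrable_mult_right[OF F0, of "of_real B"]])
    have [measurable]: "complexify u \<in> borel_measurable borel" unfolding complexify_def[abs_def] by measurable
    show "(\<lambda>(y, x). complexify u x * (\<psi> y * ?F (x - y))) \<in> borel_measurable (lborel \<Otimes>\<^sub>M lborel)"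
      by measurable
    have "\<bar>u x\<bar> \<le> \<bar>B\<bar>" for x using u(2)[of x] by linarith
    then have "norm (complexify u x * (\<psi> y * ?F (x - y))) \<le> norm (of_real B * (\<psi> y * ?F (x - y)))" for x y
      by (auto simp: complexify_def norm_mult intro!: mult_right_mono)
    then show "AE p in lborel \<Otimes>\<^sub>M lborel. norm (case p of (y, x) \<Rightarrow> complexify u x * (\<psi> y * ?F (x - y)))
        \<le> norm (of_real B * (case p of (y, x) \<Rightarrow> \<psi> y * ?F (x - y)))"
      by (intro AE_I2) (simp only: split_beta)
  qed
  have "fourier_inv_distr (mult_distr \<mu> (fourier_distr (distr_of_fun (complexify u)))) \<psi>
     = (\<integral>x. complexify u x * (1 / (2 * of_real pi) * (\<integral>y. \<psi> y * ?F (x - y) \<partial>lborel)) \<partial>lborel)"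
    unfolding fourier_inv_distr_def mult_distr_def fourier_distr_def distr_of_fun_def
    by (subst fourier_multiplier_kernel[OF \<mu> i\<psi>]) simp
  also have "\<dots> = (\<integral>x. 1 / (2 * of_real pi) * (\<integral>y. complexify u x * (\<psi> y * ?F (x - y)) \<partial>lborel) \<partial>lborel)"
    by (intro Bochner_Integration.integral_cong[OF refl]) simp
  also have "\<dots> = 1 / (2 * of_real pi) * (\<integral>x. \<integral>y. complexify u x * (\<psi> y * ?F (x - y)) \<partial>lborel \<partial>lborel)"
    by simp
  also have "(\<integral>x. \<integral>y. complexify u x * (\<psi> y * ?F (x - y)) \<partial>lborel \<partial>lborel)
     = (\<integral>y. \<integral>x. complexify u x * (\<psi> y * ?F (x - y)) \<partial>lborel \<partial>lborel)"
    by (rule lborel_pair.Fubini_integral[OF F1])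
  also have "\<dots> = (\<integral>y. \<psi> y * (\<integral>x. complexify u (y + x) * ?F x \<partial>lborel) \<partial>lborel)"
  proof (rule Bochner_Integration.integral_cong[OF refl])
    fix y
    have "(\<integral>x. complexify u x * (\<psi> y * ?F (x - y)) \<partial>lborel) = (\<integral>x. \<psi> y * (complexify u x * ?F (x - y)) \<partial>lborel)"
      by (simp add: mult_ac)
    also have "\<dots> = \<psi> y * (\<integral>x. complexify u x * ?F (x - y) \<partial>lborel)" by simp
    also have "(\<integral>x. complexify u x * ?F (x - y) \<partial>lborel) = (\<integral>x. complexify u (y + x) * ?F x \<partial>lborel)"
      using lborel_integral_shift[of "\<lambda>x. complexify u x * ?F (x - y)" y] by simp
    finally show "(\<integral>x. complexify u x * (\<psi> y * ?F (x - y)) \<partial>lborel) = \<psi> y * (\<integral>x. complexify u (y + x) * ?F x \<partial>lborel)" .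
  qed
  finally show ?thesis
    unfolding distr_of_fun_def
    by (simp add: mult_ac flip: integral_mult_right_zero)
qed

lemma Linf_norm_le:
  fixes f :: "real \<Rightarrow> 'a::{real_normed_vector,second_countable_topology}"
  assumes "f \<in> borel_measurable borel" "\<And>x. norm (f x) \<le> B"
  shows "Linf_norm f \<le> ennreal B"
  unfolding Linf_norm_def using assms by (intro esssup_I) (auto intro!: AE_I2 ennreal_leI)

lemma Linf_norm_distr_le:
  assumes "f \<in> borel_measurable borel" "\<And>x. norm (f x) \<le> B" "\<And>\<psi>. \<psi> \<in> schwartz \<Longrightarrow> v \<psi> = distr_of_fun f \<psi>"
  shows "Linf_norm_distr v \<le> ennreal B"
  unfolding Linf_norm_distr_def
proof (rule INF_lower2[of f])
  show "Linf_norm f \<le> ennreal B" using Linf_norm_le assms by blast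
  then have "Linf_norm f < \<infinity>" using ennreal_less_top le_less_trans by fastforce
  then show "f \<in> {f \<in> borel_measurable lborel. Linf_norm f < \<infinity> \<and> (\<forall>\<psi>\<in>schwartz. v \<psi> = distr_of_fun f \<psi>)}"
    using assms by simp
qed

lemma fourier_scale:
  assumes "b > 0"
  shows "fourier (\<lambda>\<xi>. m (\<xi> / b)) x = of_real b * fourier m (b * x)"
proof -
  have "fourier (\<lambda>\<xi>. m (\<xi> / b)) x = \<bar>b\<bar> *\<^sub>R (\<integral>\<xi>. exp (- \<i> * of_real ((0 + b * \<xi>) * x)) * m ((0 + b * \<xi>) / b) \<partial>lborel)"
    unfolding fourier_def by (rule lborel_integral_real_affine) (use assms in simp)
  also have "(\<integral>\<xi>. exp (- \<i> * of_real ((0 + b * \<xi>) * x)) * m ((0 + b * \<xi>) / b) \<partial>lborel) = fourier m (b * x)"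
    unfolding fourier_def
  proof (rule Bochner_Integration.integral_cong[OF refl])
    fix \<xi>
    have "(0 + b * \<xi>) * x = \<xi> * (b * x)" "(0 + b * \<xi>) / b = \<xi>" using assms by auto
    then show "exp (- \<i> * of_real ((0 + b * \<xi>) * x)) * m ((0 + b * \<xi>) / b) = exp (- \<i> * of_real (\<xi> * (b * x))) * m \<xi>"
      by (simp only:)
  qed
  finally show ?thesis using assms by (simp add: scaleR_conv_of_real)
qed

lemma bump_scale:
  assumes "bump R m" "b > 0"
  shows "bump (R * b) (\<lambda>\<xi>. m (\<xi> / b))"
proof -
  have "smooth (\<lambda>\<xi>. m (\<xi> / b))"
    using smooth_affine[of m 1 "1 / b" 0] assms unfolding bump_def by simp
  moreover have "\<bar>\<xi> / b\<bar> > R" if "\<bar>\<xi>\<bar> > R * b" for \<xi> using that assms(2) by (simp add: abs_divide pos_less_divide_eq)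
  ultimately show ?thesis using assms unfolding bump_def by auto
qed

text \<open>The dilation is put on \<open>u\<close>, so that the kernel
  \<open>fourier (complexify m)\<close> is the same on all scales. Bounds for all blocks then reduce
  to the integrals of finitely many fixed kernels.\<close>

lemma multiplier_norm_le:
  assumes u: "continuous_on UNIV u" "\<And>x. \<bar>u x\<bar> \<le> B"
    and m: "bump R (complexify m)" and b: "b > 0"
    and bd: "\<And>y. norm (\<integral>x. complexify u (y + x / b) * fourier (complexify m) x \<partial>lborel) \<le> D"
  shows "Linf_norm_distr (fourier_inv_distr (mult_distr (\<lambda>\<xi>. m (\<xi> / b)) (fourier_distr (distr_of_fun (complexify u))))) \<le> ennreal D"
proof -
  let ?\<mu> = "\<lambda>\<xi>. m (\<xi> / b)"
  have \<mu>: "bump (R * b) (complexify ?\<mu>)"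
    using bump_scale[OF m b] unfolding complexify_def[abs_def] by simp
  have [measurable]: "u \<in> borel_measurable borel" "fourier (complexify ?\<mu>) \<in> borel_measurable borel"
    using u(1) borel_measurable_continuous_onI fourier_bump_continuous[OF \<mu>] by blast+
  have [measurable]: "complexify u \<in> borel_measurable borel" unfolding complexify_def[abs_def] by measurable
  let ?f = "\<lambda>y. 1 / (2 * of_real pi) * (\<integral>x. complexify u (y + x) * fourier (complexify ?\<mu>) x \<partial>lborel)"
  have eq: "(\<integral>x. complexify u (y + x) * fourier (complexify ?\<mu>) x \<partial>lborel)
      = (\<integral>x. complexify u (y + x / b) * fourier (complexify m) x \<partial>lborel)" for y
  proof -
    have "fourier (complexify ?\<mu>) x = of_real b * fourier (complexify m) (b * x)" for x
      using fourier_scale[OF b, of "complexify m"] by (simp add: complexify_def[abs_def])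
    then show ?thesis
      using b by (subst lborel_integral_real_affine[of "1 / b" _ 0])
        (auto simp: scaleR_conv_of_real mult_ac divide_simps simp flip: integral_mult_right_zero)
  qed
  show ?thesis
  proof (rule Linf_norm_distr_le[of ?f])
    show "?f \<in> borel_measurable borel"
      by (intro borel_measurable_times borel_measurable_const) measurable
    show "norm (?f y) \<le> D" for y
    proof -
      \<comment> \<open>The factor \<open>1 / (2 * pi)\<close> is at most 1 and is
        discarded.\<close>
      have "norm (?f y) \<le> 1 * norm (\<integral>x. complexify u (y + x / b) * fourier (complexify m) x \<partial>lborel)"
        unfolding norm_mult eq using pi_ge_two by (intro mult_right_mono) (auto simp: norm_divide field_simps)
      then show ?thesis using bd[of y] by simp
    qed
    show "fourier_inv_distr (mult_distr ?\<mu> (fourier_distr (distr_of_fun (complexify u)))) \<psi> = distr_of_fun ?f \<psi>"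
      if "\<psi> \<in> schwartz" for \<psi>
      by (rule fourier_multiplier_rep[OF u \<mu> that])
  qed
qed

lemma pairing_bound:
  fixes k :: "real \<Rightarrow> complex"
  assumes k: "integrable lborel k" and v: "v \<in> borel_measurable borel" "\<And>x. \<bar>v x\<bar> \<le> B"
  shows "integrable lborel (\<lambda>x. complexify v x * k x)"
    and "norm (\<integral>x. complexify v x * k x \<partial>lborel) \<le> B * (\<integral>x. norm (k x) \<partial>lborel)"
proof -
  have B: "B \<ge> 0" using v(2)[of 0] by linarith
  have le: "norm (complexify v x * k x) \<le> B * norm (k x)" for x
    unfolding complexify_def norm_mult by (rule mult_right_mono) (use v in auto)
  note v(1)[measurable]
  have [measurable]: "k \<in> borel_measurable borel" using k by auto
  show i: "integrable lborel (\<lambda>x. complexify v x * k x)"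
  proof (rule Bochner_Integration.integrable_bound[of lborel "\<lambda>x. B * norm (k x)"])
    show "(\<lambda>x. complexify v x * k x) \<in> borel_measurable lborel" unfolding complexify_def by measurable
    show "AE x in lborel. norm (complexify v x * k x) \<le> norm (B * norm (k x))"
      using le B by (simp add: abs_mult)
  qed (use k in simp)
  have "norm (\<integral>x. complexify v x * k x \<partial>lborel) \<le> (\<integral>x. norm (complexify v x * k x) \<partial>lborel)"
    by (rule integral_norm_bound)
  also have "\<dots> \<le> (\<integral>x. B * norm (k x) \<partial>lborel)"
    by (rule integral_mono) (use i k le in auto)
  finally show "norm (\<integral>x. complexify v x * k x \<partial>lborel) \<le> B * (\<integral>x. norm (k x) \<partial>lborel)" by simp
qed

text \<open>Both integrations by parts happen at once: with \<open>G = fourier g\<close> the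
  function \<open>v * G' - v' * G\<close> has derivative \<open>v * G'' - v'' * G\<close> and tends
  to 0 at both ends, as \<open>v\<close> and \<open>v'\<close> are bounded while \<open>G\<close>
  and \<open>G'\<close> decay. The sign comes from
  \<open>G'' = - fourier (\<xi>\<^sup>2 * g)\<close>.\<close>

lemma pairing_second_derivative:
  assumes g: "bump R g" and d: "\<And>x. (v has_real_derivative v' x) (at x)" "\<And>x. (v' has_real_derivative v'' x) (at x)"
    and c: "continuous_on UNIV v''" and bd: "\<And>x. \<bar>v x\<bar> \<le> B" "\<And>x. \<bar>v' x\<bar> \<le> B1" "\<And>x. \<bar>v'' x\<bar> \<le> B2"
  shows "(\<integral>x. complexify v x * fourier (\<lambda>\<xi>. of_real \<xi> ^ 2 * g \<xi>) x \<partial>lborel) = - (\<integral>x. complexify v'' x * fourier g x \<partial>lborel)"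
proof -
  let ?g1 = "\<lambda>\<xi>. - \<i> * of_real \<xi> * g \<xi>" and ?g2 = "\<lambda>\<xi>. - \<i> * of_real \<xi> * (- \<i> * of_real \<xi> * g \<xi>)"
  have b1: "bump R ?g1" by (rule bump_mult_id[OF g])
  have b2: "bump R ?g2" by (rule bump_mult_id[OF b1])
  have c0: "continuous_on UNIV v" "continuous_on UNIV v'"
    using d by (meson DERIV_isCont continuous_at_imp_continuous_on)+
  have cv: "continuous_on UNIV (complexify w)" if "continuous_on UNIV w" for w
    using that unfolding complexify_def[abs_def] by (intro continuous_intros)
  have vm: "v \<in> borel_measurable borel" "v' \<in> borel_measurable borel" "v'' \<in> borel_measurable borel"
    using c0 c borel_measurable_continuous_onI by blast+
  have i1: "integrable lborel (\<lambda>x. complexify v x * fourier ?g2 x)"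
    by (rule pairing_bound(1)[OF fourier_bump_integrable[OF b2] vm(1) bd(1)])
  have i2: "integrable lborel (\<lambda>x. complexify v'' x * fourier g x)"
    by (rule pairing_bound(1)[OF fourier_bump_integrable[OF g] vm(3) bd(3)])
  have z: "((\<lambda>x. complexify w x * fourier h x) \<longlongrightarrow> 0) F" if "bump R h" "\<And>x. \<bar>w x\<bar> \<le> D" "F \<le> at_infinity" for w h D and F :: "real filter"
  proof -
    have "((\<lambda>x. fourier h x) \<longlongrightarrow> 0) F"
      using fourier_bump_tendsto[OF that(1), of 0 F] that(3) by simp
    then have "((\<lambda>x. D * norm (fourier h x)) \<longlongrightarrow> 0) F"
      by (auto intro!: tendsto_eq_intros)
    moreover have "eventually (\<lambda>x. norm (complexify w x * fourier h x) \<le> D * norm (fourier h x)) F"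
      by (rule always_eventually) (use that(2) in \<open>auto simp: complexify_def norm_mult intro!: mult_right_mono\<close>)
    ultimately show ?thesis by (rule Lim_null_comparison[rotated])
  qed
  have "(\<integral>x. complexify v x * fourier ?g2 x - complexify v'' x * fourier g x \<partial>lborel) = 0 - 0"
  proof (rule integral_derivative_line[of "\<lambda>x. complexify v x * fourier ?g1 x - complexify v' x * fourier g x"])
    show "((\<lambda>x. complexify v x * fourier ?g1 x - complexify v' x * fourier g x) has_vector_derivative
        complexify v x * fourier ?g2 x - complexify v'' x * fourier g x) (at x)" for x
    proof -
      have dv: "(complexify v has_vector_derivative complexify v' x) (at x)" "(complexify v' has_vector_derivative complexify v'' x) (at x)"
        unfolding complexify_def[abs_def] using d by (auto intro!: has_vector_derivative_of_real)
      show ?thesis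
        using has_vector_derivative_diff[OF has_vector_derivative_mult[OF dv(1) fourier_has_vector_derivative[OF b1]]
            has_vector_derivative_mult[OF dv(2) fourier_has_vector_derivative[OF g]]]
        by simp
    qed
    show "continuous_on UNIV (\<lambda>x. complexify v x * fourier ?g2 x - complexify v'' x * fourier g x)"
      by (intro continuous_intros cv c0 c fourier_bump_continuous[OF b2] fourier_bump_continuous[OF g])
    show "integrable lborel (\<lambda>x. complexify v x * fourier ?g2 x - complexify v'' x * fourier g x)"
      using i1 i2 by simp
    show "((\<lambda>x. complexify v x * fourier ?g1 x - complexify v' x * fourier g x) \<longlongrightarrow> 0) at_bot"
      using tendsto_diff[OF z[OF b1 bd(1) at_bot_le_at_infinity] z[OF g bd(2) at_bot_le_at_infinity]] by simp
    show "((\<lambda>x. complexify v x * fourier ?g1 x - complexify v' x * fourier g x) \<longlongrightarrow> 0) at_top"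
      using tendsto_diff[OF z[OF b1 bd(1) at_top_le_at_infinity] z[OF g bd(2) at_top_le_at_infinity]] by simp
  qed
  then have e: "(\<integral>x. complexify v x * fourier ?g2 x \<partial>lborel) = (\<integral>x. complexify v'' x * fourier g x \<partial>lborel)"
    using i1 i2 by simp
  have "fourier ?g2 x = - fourier (\<lambda>\<xi>. of_real \<xi> ^ 2 * g \<xi>) x" for x
  proof -
    have "?g2 = (\<lambda>\<xi>. - (of_real \<xi> ^ 2 * g \<xi>))" by (auto simp: fun_eq_iff power2_eq_square complex_eq_iff algebra_simps)
    then have "fourier ?g2 x = fourier (\<lambda>\<xi>. - (of_real \<xi> ^ 2 * g \<xi>)) x" by (simp only:)
    also have "\<dots> = - fourier (\<lambda>\<xi>. of_real \<xi> ^ 2 * g \<xi>) x" unfolding fourier_def by simp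
    finally show ?thesis .
  qed
  then have "- (\<integral>x. complexify v x * fourier (\<lambda>\<xi>. of_real \<xi> ^ 2 * g \<xi>) x \<partial>lborel) = (\<integral>x. complexify v'' x * fourier g x \<partial>lborel)"
    using e by simp
  then show ?thesis by (rule minus_equation_iff[THEN iffD1, symmetric])
qed

text \<open>The exponent is the distance of \<open>n\<close> and \<open>k\<close> within the natural
  numbers. The indices below \<open>k\<close> contribute at most 1, the others at most 2; keeping
  the remainder terms makes both inductions close.\<close>

lemma two_sided_geometric_sum: "(\<Sum>n<m. (1/2::real) ^ (if n \<le> k then k - n else n - k)) \<le> 3"
proof -
  have 1: "(\<Sum>n<m. (1/2::real) ^ (if n \<le> k then k - n else n - k)) \<le> (1/2) ^ (k - m)" if "m \<le> k" for m
    using that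
  proof (induction m)
    case (Suc m)
    then have "k - m = Suc (k - Suc m)" by simp
    then have "(1/2::real) ^ (k - m) + (1/2) ^ (k - m) = (1/2) ^ (k - Suc m)" by simp
    then show ?case using Suc by simp
  qed simp
  have 2: "(\<Sum>n<k + i. (1/2::real) ^ (if n \<le> k then k - n else n - k)) \<le> 3 - 2 * (1/2) ^ i" for i
  proof (induction i)
    case 0
    show ?case using 1[of k] by simp
  next
    case (Suc i)
    have "(1/2::real) ^ (if k + i \<le> k then k - (k + i) else k + i - k) = (1/2) ^ i" by simp
    then have "(\<Sum>n<k + Suc i. (1/2::real) ^ (if n \<le> k then k - n else n - k))
        = (\<Sum>n<k + i. (1/2::real) ^ (if n \<le> k then k - n else n - k)) + (1/2) ^ i"
      by (simp only: add_Suc_right sum.lessThan_Suc)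
    moreover have "(1/2::real) ^ Suc i = (1/2) ^ i / 2" by simp
    ultimately show ?case using Suc by linarith
  qed
  show ?thesis
  proof (cases "m \<le> k")
    case True
    then show ?thesis using 1[OF True] power_le_one[of "1/2::real" "k - m"] by simp
  next
    case False
    then show ?thesis using 2[of "m - k"] by (smt (verit) le_add_diff_inverse linorder_le_cases zero_le_power divide_nonneg_nonneg)
  qed
qed

text \<open>Weighted by \<open>2^j\<close>, a block is at most of order \<open>A * 2^j / 2^L\<close>
  by the bound on \<open>u\<close> and \<open>A * 2^L / 2^j\<close> by the bound on
  \<open>u''\<close>. The two balance at \<open>j = L\<close> and decay geometrically on either
  side, so the sum is of order \<open>A\<close> whatever \<open>L\<close> is. The bound
  \<open>B1\<close> on the slope serves the boundary terms only and does not enter the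
  result.\<close>

lemma besov_norm_interpolation:
  assumes LP: "littlewood_paley chi phi"
  obtains C where "C > 0"
    "\<And>u u' u'' A L B1. (\<And>x. (u has_real_derivative u' x) (at x)) \<Longrightarrow> (\<And>x. (u' has_real_derivative u'' x) (at x)) \<Longrightarrow>
       continuous_on UNIV u'' \<Longrightarrow> (\<And>x. \<bar>u x\<bar> \<le> A / 2 ^ L) \<Longrightarrow> (\<And>x. \<bar>u' x\<bar> \<le> B1) \<Longrightarrow> (\<And>x. \<bar>u'' x\<bar> \<le> A * 2 ^ L) \<Longrightarrow>
       besov_norm chi phi (distr_of_fun (complexify u)) \<le> ennreal (C * A)"
proof -
  let ?g = "\<lambda>\<xi>. complexify phi \<xi> / of_real \<xi> ^ 2"
  note b = littlewood_paley_bump[OF LP]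
  define K where "K = (\<integral>x. norm (fourier (complexify phi) x) \<partial>lborel) + (\<integral>x. norm (fourier (complexify chi) x) \<partial>lborel)
      + (\<integral>x. norm (fourier ?g x) \<partial>lborel) + 1"
  have nn: "(\<integral>x. norm (fourier h x) \<partial>lborel) \<ge> 0" for h by (rule integral_nonneg_AE) simp
  have K: "(\<integral>x. norm (fourier (complexify phi) x) \<partial>lborel) \<le> K" "(\<integral>x. norm (fourier (complexify chi) x) \<partial>lborel) \<le> K"
    "(\<integral>x. norm (fourier ?g x) \<partial>lborel) \<le> K" "K > 0"
    unfolding K_def using nn[of "complexify phi"] nn[of "complexify chi"] nn[of ?g] by linarith+
  have phi_g: "complexify phi = (\<lambda>\<xi>. of_real \<xi> ^ 2 * ?g \<xi>)"
  proof
    fix \<xi>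
    have "\<xi> = 0 \<Longrightarrow> phi \<xi> = 0" using LP unfolding littlewood_paley_def by force
    then show "complexify phi \<xi> = of_real \<xi> ^ 2 * ?g \<xi>" by (auto simp: complexify_def)
  qed
  have main: "besov_norm chi phi (distr_of_fun (complexify u)) \<le> ennreal (3 * K * A)"
    if d: "\<And>x. (u has_real_derivative u' x) (at x)" "\<And>x. (u' has_real_derivative u'' x) (at x)"
      and c: "continuous_on UNIV u''" and bd: "\<And>x. \<bar>u x\<bar> \<le> A / 2 ^ L" "\<And>x. \<bar>u' x\<bar> \<le> B1" "\<And>x. \<bar>u'' x\<bar> \<le> A * 2 ^ L"
    for u u' u'' A L B1
  proof -
    have A: "A \<ge> 0" using bd(3)[of 0] zero_less_power[of "2::real" L] by (smt (verit) mult_less_0_iff)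
    have cu: "continuous_on UNIV u" "continuous_on UNIV u'"
      using d by (meson DERIV_isCont continuous_at_imp_continuous_on)+
    have [measurable]: "u \<in> borel_measurable borel" "u'' \<in> borel_measurable borel"
      using cu c borel_measurable_continuous_onI by blast+
    have low: "Linf_norm_distr (fourier_inv_distr (mult_distr (\<lambda>\<xi>. m (\<xi> / b)) (fourier_distr (distr_of_fun (complexify u))))) \<le> ennreal (K * (A / 2 ^ L))"
      if m: "bump (8/3) (complexify m)" "(\<integral>x. norm (fourier (complexify m) x) \<partial>lborel) \<le> K" and b: "b > 0" for m b
    proof (rule multiplier_norm_le[OF cu(1) bd(1) m(1) b])
      fix y
      have "norm (\<integral>x. complexify (\<lambda>x. u (y + x / b)) x * fourier (complexify m) x \<partial>lborel) \<le> A / 2 ^ L * (\<integral>x. norm (fourier (complexify m) x) \<partial>lborel)"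
        by (rule pairing_bound(2)[OF fourier_bump_integrable[OF m(1)]]) (use bd(1) in \<open>simp_all\<close>)
      also have "\<dots> \<le> A / 2 ^ L * K" using m(2) A by (intro mult_left_mono) auto
      finally show "norm (\<integral>x. complexify u (y + x / b) * fourier (complexify m) x \<partial>lborel) \<le> K * (A / 2 ^ L)"
        by (simp add: complexify_def mult.commute)
    qed
    have high: "Linf_norm_distr (fourier_inv_distr (mult_distr (\<lambda>\<xi>. phi (\<xi> / b)) (fourier_distr (distr_of_fun (complexify u))))) \<le> ennreal (K * (A * 2 ^ L / b^2))"
      if b0: "b > 0" for b
    proof (rule multiplier_norm_le[OF cu(1) bd(1) b(1) b0])
      fix y
      let ?v = "\<lambda>x. u (y + x / b)" and ?v' = "\<lambda>x. u' (y + x / b) / b" and ?v'' = "\<lambda>x. u'' (y + x / b) / b^2"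
      have ch: "((\<lambda>x. w (y + x / b)) has_real_derivative w' (y + x / b) / b) (at x)" if "\<And>x. (w has_real_derivative w' x) (at x)" for w w' x
      proof -
        have "((\<lambda>x. y + x / b) has_real_derivative 1 / b) (at x)"
          using DERIV_add[OF DERIV_const DERIV_cdivide[OF DERIV_ident]] by simp
        from DERIV_chain2[OF that this] show ?thesis by simp
      qed
      have bv: "\<bar>?v x\<bar> \<le> A / 2 ^ L" "\<bar>?v' x\<bar> \<le> B1 / b" "\<bar>?v'' x\<bar> \<le> A * 2 ^ L / b^2" for x
        using bd(1)[of "y + x / b"] divide_right_mono[OF bd(2)[of "y + x / b"], of b]
          divide_right_mono[OF bd(3)[of "y + x / b"], of "b\<^sup>2"] b0 by (simp_all add: abs_divide)
      have "(\<integral>x. complexify ?v x * fourier (complexify phi) x \<partial>lborel) = - (\<integral>x. complexify ?v'' x * fourier ?g x \<partial>lborel)"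
        apply (subst phi_g)
        apply (rule pairing_second_derivative[OF b(3), of ?v ?v' ?v'' "A / 2 ^ L" "B1 / b" "A * 2 ^ L / b^2"])
        subgoal by (rule ch[OF d(1)])
        subgoal for x using DERIV_cdivide[OF ch[OF d(2)], of b x] by (simp add: power2_eq_square)
        subgoal by (rule continuous_on_divide[OF continuous_on_compose2[OF c] continuous_on_const]) (use b0 in \<open>auto intro!: continuous_intros\<close>)
        subgoal by (rule bv)
        subgoal by (rule bv)
        subgoal by (rule bv)
        done
      moreover have "norm (\<integral>x. complexify ?v'' x * fourier ?g x \<partial>lborel) \<le> A * 2 ^ L / b^2 * (\<integral>x. norm (fourier ?g x) \<partial>lborel)"
        by (rule pairing_bound(2)[OF fourier_bump_integrable[OF b(3)]]) (use bv(3) in simp_all)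
      moreover have "A * 2 ^ L / b^2 * (\<integral>x. norm (fourier ?g x) \<partial>lborel) \<le> A * 2 ^ L / b^2 * K"
        using K A by (intro mult_left_mono) auto
      ultimately show "norm (\<integral>x. complexify u (y + x / b) * fourier (complexify phi) x \<partial>lborel) \<le> K * (A * 2 ^ L / b^2)"
        by (simp add: complexify_def mult.commute)
    qed
    \<comment> \<open>The summation index is the block index plus one, so the peak at frequency
      \<open>2^L\<close> sits at \<open>n = Suc L\<close>.\<close>
    have blk_le: "ennreal (2 powi (int n - 1)) * Linf_norm_distr (LP_block chi phi (int n - 1) (distr_of_fun (complexify u)))
        \<le> ennreal (K * A * (1/2) ^ (if n \<le> Suc L then Suc L - n else n - Suc L))" for n
    proof (cases n)
      case 0
      have "Linf_norm_distr (LP_block chi phi (-1) (distr_of_fun (complexify u))) \<le> ennreal (K * (A / 2 ^ L))"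
        using low[OF b(2) K(2), of 1] unfolding LP_block_def by simp
      then have "ennreal (1/2) * Linf_norm_distr (LP_block chi phi (-1) (distr_of_fun (complexify u))) \<le> ennreal (1/2) * ennreal (K * (A / 2 ^ L))"
        by (intro mult_left_mono) auto
      also have "\<dots> = ennreal (1/2 * (K * (A / 2 ^ L)))"
        by (rule ennreal_mult[symmetric]) (use A K in auto)
      also have "1/2 * (K * (A / 2 ^ L)) = K * A * (1/2) ^ (if n \<le> Suc L then Suc L - n else n - Suc L)"
        using 0 by (simp add: power_divide)
      finally show ?thesis unfolding 0 by (simp add: power_int_minus inverse_eq_divide)
    next
      case (Suc j)
      have blk: "LP_block chi phi (int j) (distr_of_fun (complexify u)) = fourier_inv_distr (mult_distr (\<lambda>\<xi>. phi (\<xi> / 2 ^ j)) (fourier_distr (distr_of_fun (complexify u))))"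
        unfolding LP_block_def by (simp add: power_int_minus field_simps)
      have "ennreal (2 ^ j) * Linf_norm_distr (LP_block chi phi (int j) (distr_of_fun (complexify u))) \<le>
         ennreal (K * A * (1/2) ^ (if j \<le> L then L - j else j - L))"
      proof (cases "j \<le> L")
        case True
        have "ennreal (2 ^ j) * Linf_norm_distr (LP_block chi phi (int j) (distr_of_fun (complexify u))) \<le> ennreal (2 ^ j) * ennreal (K * (A / 2 ^ L))"
          unfolding blk by (intro mult_left_mono low[OF b(1) K(1)]) auto
        also have "\<dots> = ennreal (K * A * (1/2) ^ (L - j))"
        proof -
          have "(2::real) ^ L = 2 ^ j * 2 ^ (L - j)" using True by (simp add: power_add[symmetric])
          then show ?thesis using A K by (simp add: ennreal_mult[symmetric] power_divide)
        qed
        finally show ?thesis using True by simp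
      next
        case False
        have "ennreal (2 ^ j) * Linf_norm_distr (LP_block chi phi (int j) (distr_of_fun (complexify u))) \<le> ennreal (2 ^ j) * ennreal (K * (A * 2 ^ L / (2 ^ j)^2))"
          unfolding blk by (intro mult_left_mono high) auto
        also have "\<dots> = ennreal (K * A * (1/2) ^ (j - L))"
        proof -
          have "(2::real) ^ j = 2 ^ L * 2 ^ (j - L)" using False by (simp add: power_add[symmetric])
          then show ?thesis using A K by (simp add: ennreal_mult[symmetric] power_divide power2_eq_square)
        qed
        finally show ?thesis using False by simp
      qed
      then show ?thesis using Suc by (cases "j \<le> L") simp_all
    qed
    have "besov_norm chi phi (distr_of_fun (complexify u)) \<le> (\<Sum>n. ennreal (K * A * (1/2) ^ (if n \<le> Suc L then Suc L - n else n - Suc L)))"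
      unfolding besov_norm_def by (intro suminf_le blk_le) auto
    also have "\<dots> \<le> ennreal (3 * K * A)"
    proof (rule suminf_le_const[OF summableI])
      fix m
      have "(\<Sum>n<m. ennreal (K * A * (1/2) ^ (if n \<le> Suc L then Suc L - n else n - Suc L)))
          = ennreal (K * A * (\<Sum>n<m. (1/2) ^ (if n \<le> Suc L then Suc L - n else n - Suc L)))"
        using A K by (subst sum_ennreal) (auto simp: sum_distrib_left)
      also have "\<dots> \<le> ennreal (K * A * 3)"
        using A K by (intro ennreal_leI mult_left_mono two_sided_geometric_sum) auto
      finally show "(\<Sum>n<m. ennreal (K * A * (1/2) ^ (if n \<le> Suc L then Suc L - n else n - Suc L))) \<le> ennreal (3 * K * A)"
        by (simp add: mult_ac)
    qed
    finally show ?thesis .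
  qed
  show ?thesis by (rule that[OF _ main]) (use K in simp)
qed

section \<open>Besov norms: lower bounds\<close>

text \<open>Each bounded representative dominates the pairing with \<open>\<psi>\<close>, hence so
  does the infimum over them. If there is none, the infimum is infinite and the claim is
  trivial.\<close>

lemma Linf_norm_distr_dual:
  assumes \<psi>: "\<psi> \<in> schwartz" and I: "(\<integral>x. norm (\<psi> x) \<partial>lborel) = I" "I > 0"
  shows "ennreal (norm (v \<psi>) / I) \<le> Linf_norm_distr v"
  unfolding Linf_norm_distr_def
proof (rule INF_greatest)
  fix f assume "f \<in> {f \<in> borel_measurable lborel. Linf_norm f < \<infinity> \<and> (\<forall>\<psi>\<in>schwartz. v \<psi> = distr_of_fun f \<psi>)}"
  then have f: "f \<in> borel_measurable lborel" "Linf_norm f < \<infinity>" "v \<psi> = distr_of_fun f \<psi>" using \<psi> by auto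
  obtain r where r: "r \<ge> 0" "Linf_norm f = ennreal r"
    using f(2) by (cases "Linf_norm f") auto
  have ae: "AE x in lborel. norm (f x) \<le> r"
    using esssup_AE[of "\<lambda>x. ennreal (norm (f x))" lborel] r unfolding Linf_norm_def by simp
  have "norm (v \<psi>) \<le> r * I"
  proof (cases "integrable lborel (\<lambda>x. f x * \<psi> x)")
    case True
    have "norm (v \<psi>) \<le> (\<integral>x. norm (f x * \<psi> x) \<partial>lborel)"
      unfolding f(3) distr_of_fun_def by (rule integral_norm_bound)
    also have "\<dots> \<le> (\<integral>x. r * norm (\<psi> x) \<partial>lborel)"
    proof (rule integral_mono_AE)
      show "AE x in lborel. norm (f x * \<psi> x) \<le> r * norm (\<psi> x)"
        using ae by eventually_elim (auto simp: norm_mult intro!: mult_right_mono)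
    qed (use True schwartz_integrable[OF \<psi>] in auto)
    finally show ?thesis using I by simp
  next
    case False
    \<comment> \<open>The integral of a function that is not integrable is 0 by convention.\<close>
    then have "v \<psi> = 0" unfolding f(3) distr_of_fun_def by (rule not_integrable_integral_eq)
    then show ?thesis using r I by simp
  qed
  then have "norm (v \<psi>) / I \<le> r" using I by (simp add: field_simps)
  then show "ennreal (norm (v \<psi>) / I) \<le> Linf_norm f" unfolding r(2) by (rule ennreal_leI)
qed

text \<open>This is the characteristic function of the standard normal distribution, cleared of the
  normalising factor.\<close>

lemma gaussian_fourier_integral:
  "(\<integral>s. exp (\<i> * of_real (t * s)) * of_real (exp (- s\<^sup>2 / 2)) \<partial>lborel) = of_real (sqrt (2 * pi) * exp (- t\<^sup>2 / 2))"
proof -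
  have "(\<integral>s. std_normal_density s *\<^sub>R exp (\<i> * of_real (t * s)) \<partial>lborel) = of_real (exp (- t\<^sup>2 / 2))"
    using char_std_normal_distribution unfolding char_def
    by (subst (asm) integral_density) (auto dest: fun_cong[of _ _ t])
  moreover have "std_normal_density s *\<^sub>R exp (\<i> * of_real (t * s)) =
      of_real (1 / sqrt (2 * pi)) * (exp (\<i> * of_real (t * s)) * of_real (exp (- s\<^sup>2 / 2)))" for s
    unfolding std_normal_density_def by (simp add: scaleR_conv_of_real)
  ultimately have "of_real (1 / sqrt (2 * pi)) * (\<integral>s. exp (\<i> * of_real (t * s)) * of_real (exp (- s\<^sup>2 / 2)) \<partial>lborel)
      = complex_of_real (exp (- t\<^sup>2 / 2))"
    by simp
  then show ?thesis by (simp add: field_simps)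
qed

lemma fourier_inv_gaussian:
  assumes b: "b > 0"
  shows "fourier_inv (\<lambda>x. of_real (exp (- (b * (x - q))\<^sup>2 / 2))) \<xi> =
    exp (\<i> * of_real (\<xi> * q)) * of_real (exp (- (\<xi> / b)\<^sup>2 / 2) / sqrt (2 * pi) / b)"
proof -
  have "(\<integral>y. exp (\<i> * of_real (\<xi> * y)) * of_real (exp (- (b * (y - q))\<^sup>2 / 2)) \<partial>lborel)
      = \<bar>1 / b\<bar> *\<^sub>R (\<integral>s. exp (\<i> * of_real (\<xi> * (q + 1 / b * s))) * of_real (exp (- (b * ((q + 1 / b * s) - q))\<^sup>2 / 2)) \<partial>lborel)"
    by (rule lborel_integral_real_affine) (use b in simp)
  also have "(\<integral>s. exp (\<i> * of_real (\<xi> * (q + 1 / b * s))) * of_real (exp (- (b * ((q + 1 / b * s) - q))\<^sup>2 / 2)) \<partial>lborel)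
      = (\<integral>s. exp (\<i> * of_real (\<xi> * q)) * (exp (\<i> * of_real (\<xi> / b * s)) * of_real (exp (- s\<^sup>2 / 2))) \<partial>lborel)"
  proof (rule Bochner_Integration.integral_cong[OF refl])
    fix s
    have "b * ((q + 1 / b * s) - q) = s" using b by simp
    moreover have "\<i> * of_real (\<xi> * (q + 1 / b * s)) = \<i> * of_real (\<xi> * q) + \<i> * of_real (\<xi> / b * s)"
      by (simp add: field_simps)
    ultimately show "exp (\<i> * of_real (\<xi> * (q + 1 / b * s))) * of_real (exp (- (b * ((q + 1 / b * s) - q))\<^sup>2 / 2))
      = exp (\<i> * of_real (\<xi> * q)) * (exp (\<i> * of_real (\<xi> / b * s)) * of_real (exp (- s\<^sup>2 / 2)))"
      by (simp only: exp_add mult.assoc)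
  qed
  also have "\<dots> = exp (\<i> * of_real (\<xi> * q)) * of_real (sqrt (2 * pi) * exp (- (\<xi> / b)\<^sup>2 / 2))"
    by (subst gaussian_fourier_integral[symmetric]) simp
  finally have e: "(\<integral>y. exp (\<i> * of_real (\<xi> * y)) * of_real (exp (- (b * (y - q))\<^sup>2 / 2)) \<partial>lborel)
      = \<bar>1 / b\<bar> *\<^sub>R (exp (\<i> * of_real (\<xi> * q)) * of_real (sqrt (2 * pi) * exp (- (\<xi> / b)\<^sup>2 / 2)))" .
  have "1 / (2 * pi) * (1 / b) * (sqrt (2 * pi) * E) = E / sqrt (2 * pi) / b" for E
  proof -
    define s where "s = sqrt (2 * pi)"
    have s: "s > 0" "2 * pi = s * s" unfolding s_def by simp_all
    have "1 / (s * s) * (1 / b) * (s * E) = E / s / b" using s(1) by simp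
    then show ?thesis unfolding s(2)[symmetric] by (simp only: s_def)
  qed
  note c = this
  let ?E = "exp (- (\<xi> / b)\<^sup>2 / 2)"
  have "fourier_inv (\<lambda>x. of_real (exp (- (b * (x - q))\<^sup>2 / 2))) \<xi>
      = of_real (1 / (2 * pi) * (1 / b) * (sqrt (2 * pi) * ?E)) * exp (\<i> * of_real (\<xi> * q))"
    unfolding fourier_inv_def e using b by (simp add: scaleR_conv_of_real)
  also have "\<dots> = exp (\<i> * of_real (\<xi> * q)) * of_real (?E / sqrt (2 * pi) / b)"
    unfolding c by (rule mult.commute)
  finally show ?thesis .
qed

text \<open>A block \<open>\<Delta>\<^sub>j u\<close> is tested against a Gaussian of width \<open>2^{-j}\<close>; this amounts to pairing \<open>u\<close>
  with a rescaled Fourier transform of \<open>gauss_phi phi\<close>, which annihilates affine functions but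
  not a kink.\<close>

definition gauss_phi :: "(real \<Rightarrow> real) \<Rightarrow> real \<Rightarrow> complex" where
  "gauss_phi phi \<eta> = of_real (phi \<eta> * exp (- \<eta>\<^sup>2 / 2) / sqrt (2 * pi))"

lemma smooth_gaussian: "smooth (\<lambda>\<eta>. complex_of_real (exp (- \<eta>\<^sup>2 / 2)))"
  using gaussian_schwartz[of 1 0] unfolding schwartz_def by simp

lemma bump_gauss_phi:
  assumes "littlewood_paley chi phi"
  shows "bump (8/3) (gauss_phi phi)"
proof -
  have "bump (8/3) (\<lambda>\<eta>. (of_real (1 / sqrt (2 * pi)) * complex_of_real (exp (- \<eta>\<^sup>2 / 2))) * complexify phi \<eta>)"
    by (rule bump_mult[OF littlewood_paley_bump(1)[OF assms] smooth_mult[OF smooth_const smooth_gaussian]])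
  moreover have "(\<lambda>\<eta>. (of_real (1 / sqrt (2 * pi)) * complex_of_real (exp (- \<eta>\<^sup>2 / 2))) * complexify phi \<eta>) = gauss_phi phi"
    by (auto simp: gauss_phi_def complexify_def fun_eq_iff)
  ultimately show ?thesis by simp
qed

text \<open>The inverse transform of the Gaussian of width \<open>1 / b\<close> is again a Gaussian
  in \<open>\<xi> / b\<close>, so together with \<open>phi (\<xi> / b)\<close> it forms a dilate of
  the single symbol \<open>gauss_phi phi\<close>. All blocks therefore see the same kernel, and only
  the dilation on \<open>u\<close> changes with \<open>j\<close>.\<close>

lemma LP_block_gaussian:
  assumes b: "b = 2 ^ j"
  shows "LP_block chi phi (int j) (distr_of_fun (complexify u)) (\<lambda>x. of_real (exp (- (b * (x - q))\<^sup>2 / 2)))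
    = (\<integral>y. complexify u (q + y / b) * fourier (gauss_phi phi) y \<partial>lborel) / of_real b"
proof -
  have b0: "b > 0" using b by simp
  have "fourier (\<lambda>\<xi>. of_real (phi (\<xi> / b)) * fourier_inv (\<lambda>x. of_real (exp (- (b * (x - q))\<^sup>2 / 2))) \<xi>) x
     = fourier (gauss_phi phi) (b * (x - q))" for x
  proof -
    have "fourier (\<lambda>\<xi>. of_real (phi (\<xi> / b)) * fourier_inv (\<lambda>x. of_real (exp (- (b * (x - q))\<^sup>2 / 2))) \<xi>) x
      = (\<integral>\<xi>. of_real (1 / b) * (exp (- \<i> * of_real (\<xi> * (x - q))) * gauss_phi phi (\<xi> / b)) \<partial>lborel)"
      unfolding fourier_def
    proof (rule Bochner_Integration.integral_cong[OF refl])
      fix \<xi>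
      have "exp (- \<i> * of_real (\<xi> * (x - q))) = exp (- \<i> * of_real (\<xi> * x)) * exp (\<i> * of_real (\<xi> * q))"
        unfolding exp_add[symmetric] by (simp add: algebra_simps)
      then show "exp (- \<i> * of_real (\<xi> * x)) * (of_real (phi (\<xi> / b)) * fourier_inv (\<lambda>x. of_real (exp (- (b * (x - q))\<^sup>2 / 2))) \<xi>)
         = of_real (1 / b) * (exp (- \<i> * of_real (\<xi> * (x - q))) * gauss_phi phi (\<xi> / b))"
        unfolding fourier_inv_gaussian[OF b0] gauss_phi_def by (simp add: mult_ac)
    qed
    also have "\<dots> = of_real (1 / b) * fourier (\<lambda>\<xi>. gauss_phi phi (\<xi> / b)) (x - q)"
      unfolding fourier_def by simp
    also have "\<dots> = fourier (gauss_phi phi) (b * (x - q))"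
      using fourier_scale[OF b0, of "gauss_phi phi" "x - q"] b0 by simp
    finally show ?thesis .
  qed
  moreover have "LP_block chi phi (int j) v = fourier_inv_distr (mult_distr (\<lambda>\<xi>. phi (\<xi> / b)) (fourier_distr v))" for v
    unfolding LP_block_def b by (simp add: power_int_minus field_simps)
  ultimately have "LP_block chi phi (int j) (distr_of_fun (complexify u)) (\<lambda>x. of_real (exp (- (b * (x - q))\<^sup>2 / 2)))
    = (\<integral>x. complexify u x * fourier (gauss_phi phi) (b * (x - q)) \<partial>lborel)"
    unfolding fourier_inv_distr_def mult_distr_def fourier_distr_def distr_of_fun_def by simp
  also have "\<dots> = \<bar>1 / b\<bar> *\<^sub>R (\<integral>y. complexify u (q + 1 / b * y) * fourier (gauss_phi phi) (b * ((q + 1 / b * y) - q)) \<partial>lborel)"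
    by (rule lborel_integral_real_affine) (use b0 in simp)
  also have "\<dots> = (\<integral>y. complexify u (q + y / b) * fourier (gauss_phi phi) y \<partial>lborel) / of_real b"
    using b0 by (simp add: scaleR_conv_of_real)
  finally show ?thesis .
qed

lemma besov_norm_lower_bound:
  shows "ennreal (\<Sum>j<M. 2 ^ j / sqrt (2 * pi) * norm (\<integral>y. complexify u (q + y / 2 ^ j) * fourier (gauss_phi phi) y \<partial>lborel))
     \<le> besov_norm chi phi (distr_of_fun (complexify u))"
proof -
  let ?I = "\<lambda>j. norm (\<integral>y. complexify u (q + y / 2 ^ j) * fourier (gauss_phi phi) y \<partial>lborel)"
  let ?a = "\<lambda>n. ennreal (2 powi (int n - 1)) * Linf_norm_distr (LP_block chi phi (int n - 1) (distr_of_fun (complexify u)))"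
  \<comment> \<open>Block \<open>j\<close> has summation index \<open>Suc j\<close>; the
    low-frequency block at index 0 is dropped. The factor \<open>sqrt (2 * pi) / 2 ^ j\<close>
    removed here is the \<open>L\<^sup>1\<close> norm of the Gaussian.\<close>
  have t: "ennreal (2 ^ j / sqrt (2 * pi) * ?I j) \<le> ?a (Suc j)" for j
  proof -
    let ?b = "2 ^ j :: real"
    let ?\<psi> = "\<lambda>x. complex_of_real (exp (- (?b * (x - q))\<^sup>2 / 2))"
    have "(\<integral>x. exp (- (?b * (x - q))\<^sup>2 / 2) \<partial>lborel) = \<bar>1 / ?b\<bar> *\<^sub>R (\<integral>x. exp (- (?b * ((q + 1 / ?b * x) - q))\<^sup>2 / 2) \<partial>lborel)"
      by (rule lborel_integral_real_affine) simp
    also have "\<dots> = (\<integral>s. exp (- s\<^sup>2 / 2) \<partial>lborel) / ?b" by simp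
    also have "(\<integral>s. exp (- s\<^sup>2 / 2) \<partial>lborel) = sqrt (2 * pi)"
    proof -
      have "(\<integral>s. complex_of_real (exp (- s\<^sup>2 / 2)) \<partial>lborel) = of_real (sqrt (2 * pi))"
        using gaussian_fourier_integral[of 0] by simp
      then show ?thesis unfolding integral_complex_of_real of_real_eq_iff .
    qed
    finally have I: "(\<integral>x. norm (?\<psi> x) \<partial>lborel) = sqrt (2 * pi) / ?b" by simp
    have "ennreal (norm (LP_block chi phi (int j) (distr_of_fun (complexify u)) ?\<psi>) / (sqrt (2 * pi) / ?b))
        \<le> Linf_norm_distr (LP_block chi phi (int j) (distr_of_fun (complexify u)))"
      by (rule Linf_norm_distr_dual[OF gaussian_schwartz I]) auto
    also have "norm (LP_block chi phi (int j) (distr_of_fun (complexify u)) ?\<psi>) / (sqrt (2 * pi) / ?b) = ?I j / sqrt (2 * pi)"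
      unfolding LP_block_gaussian[OF refl] by (simp add: norm_divide norm_power)
    finally have "ennreal ?b * ennreal (?I j / sqrt (2 * pi)) \<le> ennreal ?b * Linf_norm_distr (LP_block chi phi (int j) (distr_of_fun (complexify u)))"
      by (rule mult_left_mono) simp
    then show ?thesis by (simp add: ennreal_mult[symmetric])
  qed
  have "ennreal (\<Sum>j<M. 2 ^ j / sqrt (2 * pi) * ?I j) = (\<Sum>j<M. ennreal (2 ^ j / sqrt (2 * pi) * ?I j))"
    by (subst sum_ennreal) auto
  also have "\<dots> \<le> (\<Sum>j<M. ?a (Suc j))" by (rule sum_mono[OF t])
  also have "\<dots> = sum ?a (Suc ` {..<M})" by (subst sum.reindex) (auto simp: o_def)
  also have "\<dots> \<le> (\<Sum>n. ?a n)" by (rule sum_le_suminf) auto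
  finally show ?thesis unfolding besov_norm_def .
qed

text \<open>As \<open>phi\<close> vanishes near 0, \<open>gauss_phi phi\<close> is
  \<open>\<xi>\<^sup>2 * h\<close> with a bump \<open>h\<close>, so \<open>\<theta>\<close> is minus
  the second derivative of \<open>fourier h\<close>. The first two moments are then integrals of
  exact derivatives. The half-line moment leaves the boundary value \<open>- fourier h 0\<close>,
  that is minus the integral of \<open>h\<close>, which is nonzero since \<open>h\<close> is
  nonnegative and not identically 0.\<close>

lemma gauss_phi_moments:
  assumes LP: "littlewood_paley chi phi"
  defines "\<theta> \<equiv> fourier (gauss_phi phi)"
  shows "(\<integral>y. \<theta> y \<partial>lborel) = 0" "(\<integral>y. of_real y * \<theta> y \<partial>lborel) = 0"
    "(\<integral>y. of_real (max y 0) * \<theta> y \<partial>lborel) \<noteq> 0"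
proof -
  let ?g = "\<lambda>\<xi>. complexify phi \<xi> / of_real \<xi> ^ 2"
  define h where "h = (\<lambda>\<eta>. (of_real (1 / sqrt (2 * pi)) * complex_of_real (exp (- \<eta>\<^sup>2 / 2))) * ?g \<eta>)"
  have b0: "bump (8/3) h"
    unfolding h_def by (rule bump_mult[OF littlewood_paley_bump(3)[OF LP] smooth_mult[OF smooth_const smooth_gaussian]])
  let ?h1 = "\<lambda>\<xi>. - \<i> * of_real \<xi> * h \<xi>" and ?h2 = "\<lambda>\<xi>. - \<i> * of_real \<xi> * (- \<i> * of_real \<xi> * h \<xi>)"
  have b1: "bump (8/3) ?h1" by (rule bump_mult_id[OF b0])
  have bt: "bump (8/3) (gauss_phi phi)" by (rule bump_gauss_phi[OF LP])
  have phi0: "phi 0 = 0" using LP unfolding littlewood_paley_def by force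
  have h2: "?h2 = (\<lambda>\<xi>. - gauss_phi phi \<xi>)"
  proof
    fix \<xi>
    have "?h2 \<xi> = - (of_real \<xi> ^ 2 * h \<xi>)" by (simp add: power2_eq_square complex_eq_iff algebra_simps)
    also have "of_real \<xi> ^ 2 * h \<xi> = gauss_phi phi \<xi>"
      using phi0 by (cases "\<xi> = 0") (auto simp: h_def gauss_phi_def complexify_def)
    finally show "?h2 \<xi> = - gauss_phi phi \<xi>" .
  qed
  have F2: "fourier ?h2 x = - \<theta> x" for x unfolding h2 \<theta>_def fourier_def by simp
  have d1: "(fourier h has_vector_derivative fourier ?h1 x) (at x)" for x by (rule fourier_has_vector_derivative[OF b0])
  have d2: "(fourier ?h1 has_vector_derivative - \<theta> x) (at x)" for x
    using fourier_has_vector_derivative[OF b1, of x] F2[of x] by simp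
  have c\<theta>: "continuous_on UNIV \<theta>" unfolding \<theta>_def by (rule fourier_bump_continuous[OF bt])
  have i\<theta>: "integrable lborel \<theta>" unfolding \<theta>_def by (rule fourier_bump_integrable[OF bt])
  have t1: "(fourier ?h1 \<longlongrightarrow> 0) F" "((\<lambda>x. of_real x * fourier ?h1 x) \<longlongrightarrow> 0) F" "(fourier h \<longlongrightarrow> 0) F"
    if "F \<le> at_infinity" for F :: "real filter"
    using fourier_bump_tendsto[OF b1, of 0 F] fourier_bump_tendsto[OF b1, of 1 F] fourier_bump_tendsto[OF b0, of 0 F] that by auto
  have "(\<integral>y. - \<theta> y \<partial>lborel) = 0 - 0"
    by (rule integral_derivative_line[of "fourier ?h1"])
      (use d2 c\<theta> i\<theta> t1 in \<open>auto intro!: continuous_intros at_bot_le_at_infinity at_top_le_at_infinity\<close>)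
  then show "(\<integral>y. \<theta> y \<partial>lborel) = 0" by simp
  \<comment> \<open>An antiderivative of \<open>y * \<theta> y\<close>: the two first-order terms
    cancel in its derivative.\<close>
  let ?G = "\<lambda>y. fourier h y - of_real y * fourier ?h1 y"
  have dG: "(?G has_vector_derivative of_real y * \<theta> y) (at y)" for y
    using has_vector_derivative_diff[OF d1 has_vector_derivative_mult[OF has_vector_derivative_of_real[OF DERIV_ident] d2], of y]
    by simp
  have cy: "continuous_on UNIV (\<lambda>y. of_real y * \<theta> y)" using c\<theta> by (auto intro!: continuous_intros)
  have iy: "integrable lborel (\<lambda>y. of_real y * \<theta> y)"
  proof (rule integrable_norm_cancel)
    show "integrable lborel (\<lambda>y. norm (of_real y * \<theta> y))"
      using fourier_bump_moment_integrable[OF bt, of 1] by (simp add: norm_mult \<theta>_def)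
    show "(\<lambda>y. of_real y * \<theta> y) \<in> borel_measurable lborel"
      using borel_measurable_continuous_onI[OF cy] by simp
  qed
  have tG: "(?G \<longlongrightarrow> 0) F" if "F \<le> at_infinity" for F :: "real filter"
    using tendsto_diff[OF t1(3)[OF that] t1(2)[OF that]] by simp
  show "(\<integral>y. of_real y * \<theta> y \<partial>lborel) = 0"
    using integral_derivative_line[OF dG cy iy tG[OF at_bot_le_at_infinity] tG[OF at_top_le_at_infinity]] by simp
  have "(\<integral>y. indicator {0<..} y *\<^sub>R (of_real y * \<theta> y) \<partial>lborel) = 0 - ?G 0"
    by (rule integral_derivative_half_line[OF dG cy iy tG[OF at_top_le_at_infinity]])
  moreover have "indicator {0<..} y *\<^sub>R (of_real y * \<theta> y) = of_real (max y 0) * \<theta> y" for y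
    by (simp add: indicator_def max_def)
  ultimately have e: "(\<integral>y. of_real (max y 0) * \<theta> y \<partial>lborel) = - fourier h 0" by simp
  define r where "r = (\<lambda>\<xi>. exp (- \<xi>\<^sup>2 / 2) / sqrt (2 * pi) * (phi \<xi> / \<xi>\<^sup>2))"
  have hr: "h \<xi> = of_real (r \<xi>)" for \<xi> unfolding h_def r_def complexify_def by simp
  have "fourier h 0 = of_real (\<integral>\<xi>. r \<xi> \<partial>lborel)"
    unfolding fourier_def by (simp add: hr)
  moreover have "(\<integral>\<xi>. r \<xi> \<partial>lborel) \<noteq> 0"
  proof
    assume z: "(\<integral>\<xi>. r \<xi> \<partial>lborel) = 0"
    have ir: "integrable lborel r"
      using bump_integrable[OF b0] unfolding hr[abs_def] complex_of_real_integrable_eq by simp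
    have "0 \<le> r \<xi>" for \<xi> using LP unfolding r_def littlewood_paley_def by (auto intro!: divide_nonneg_nonneg mult_nonneg_nonneg)
    then have "AE \<xi> in lborel. r \<xi> = 0"
      using integral_nonneg_eq_0_iff_AE[OF ir] z by simp
    then have "AE \<xi> in lborel. r \<xi> \<le> 0" by eventually_elim simp
    moreover have "continuous_on UNIV r"
    proof -
      have "r = (\<lambda>\<xi>. Re (h \<xi>))" by (simp add: hr)
      moreover have "continuous_on UNIV h" using b0 smooth_continuous_on unfolding bump_def by blast
      ultimately show ?thesis by (auto intro!: continuous_intros)
    qed
    ultimately have r0: "r \<xi> \<le> 0" for \<xi> by (rule continuous_AE_le)
    obtain \<xi> where xi: "phi \<xi> > 0" using phi_not_zero[OF LP] .
    then have "\<xi> \<noteq> 0" using phi0 by auto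
    then have "r \<xi> > 0" unfolding r_def using xi by simp
    then show False using r0[of \<xi>] by simp
  qed
  ultimately show "(\<integral>y. of_real (max y 0) * \<theta> y \<partial>lborel) \<noteq> 0" unfolding e by simp
qed

section \<open>Bounded solutions of linear equations on the line\<close>

lemma antiderivative_exists:
  fixes z :: "real \<Rightarrow> real"
  assumes "continuous_on UNIV z"
  obtains Z where "\<And>s. (Z has_real_derivative z s) (at s)" "Z 0 = 0"
proof
  show "((\<lambda>u. LBINT y=0..u. z y) has_real_derivative z s) (at s)" for s
  proof -
    have "((\<lambda>u. LBINT y=0..u. z y) has_vector_derivative z s) (at s within {- \<bar>s\<bar> - 1..\<bar>s\<bar> + 1})"
      using interval_integral_FTC2[of "- \<bar>s\<bar> - 1" 0 "\<bar>s\<bar> + 1" z s] continuous_on_subset[OF assms]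
      by (auto simp: zero_ereal_def)
    then have "((\<lambda>u. LBINT y=0..u. z y) has_real_derivative z s) (at s within {- \<bar>s\<bar> - 1..\<bar>s\<bar> + 1})"
      by (simp add: has_real_derivative_iff_has_vector_derivative)
    moreover have "at s within {- \<bar>s\<bar> - 1..\<bar>s\<bar> + 1} = at s"
      by (rule at_within_interior) (auto simp: interior_atLeastAtMost_real)
    ultimately show ?thesis by simp
  qed
qed (simp add: zero_ereal_def)

lemma growth_half:
  fixes Z z :: "real \<Rightarrow> real"
  assumes Z: "\<And>s. (Z has_real_derivative z s) (at s)" and z: "\<And>s. z s \<ge> 1/2" and "r \<le> s"
  shows "(s - r) / 2 \<le> Z s - Z r"
proof -
  have "Z r - r / 2 \<le> Z s - s / 2"
  proof (rule DERIV_nonneg_imp_nondecreasing[OF assms(3)])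
    fix x assume "r \<le> x" "x \<le> s"
    show "\<exists>y. ((\<lambda>x. Z x - x / 2) has_real_derivative y) (at x) \<and> 0 \<le> y"
      using z[of x] by (intro exI[of _ "z x - 1/2"]) (auto intro!: derivative_eq_intros Z)
  qed
  then show ?thesis by (simp add: field_simps)
qed

text \<open>The function \<open>exp (Z s) * (2 * B - E s)\<close> is nondecreasing, and it tends to
  0 at minus infinity because \<open>E\<close> is bounded while \<open>exp Z\<close> decays there.
  Boundedness thus plays the part of an initial condition, and the final bound is free of
  \<open>K\<close>.\<close>

lemma bounded_solution_le:
  fixes z p E :: "real \<Rightarrow> real"
  assumes cz: "continuous_on UNIV z" and z: "\<And>s. z s \<ge> 1/2" and p: "\<And>s. p s \<le> B" "B \<ge> 0"
    and E: "\<And>s. (E has_real_derivative p s - z s * E s) (at s)" and K: "\<And>s. \<bar>E s\<bar> \<le> K"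
  shows "E s \<le> 2 * B"
proof -
  obtain Z where Z: "\<And>s. (Z has_real_derivative z s) (at s)" using antiderivative_exists[OF cz] by blast
  let ?G = "\<lambda>s. exp (Z s) * (2 * B - E s)"
  have lower: "?G s \<ge> - (exp (Z s) * (2 * B + K)) * exp (- d / 2)" if d: "d \<ge> 0" for d
  proof -
    have "?G (s - d) \<le> ?G s"
    proof (rule DERIV_nonneg_imp_nondecreasing[where f = ?G])
      fix x
      have "B * 1 \<le> 2 * B * z x" using mult_left_mono[OF z[of x], of "2 * B"] p by simp
      then have "0 \<le> exp (Z x) * (2 * B * z x - p x)" using p(1)[of x] by (intro mult_nonneg_nonneg) auto
      moreover have "(?G has_real_derivative exp (Z x) * (2 * B * z x - p x)) (at x)"
        by (auto intro!: derivative_eq_intros Z E simp: algebra_simps)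
      ultimately show "\<exists>y. (?G has_real_derivative y) (at x) \<and> 0 \<le> y" by blast
    qed (use d in simp)
    moreover have "?G (s - d) \<ge> - (exp (Z s) * (2 * B + K)) * exp (- d / 2)"
    proof -
      have "Z (s - d) \<le> Z s - d / 2" using growth_half[OF Z z, of "s - d" s] d by simp
      then have e: "exp (Z (s - d)) \<le> exp (Z s) * exp (- d / 2)" unfolding exp_add[symmetric] by simp
      have "\<bar>2 * B - E (s - d)\<bar> \<le> 2 * B + K" using K[of "s - d"] p(2) by linarith
      then have "\<bar>?G (s - d)\<bar> \<le> exp (Z s) * exp (- d / 2) * (2 * B + K)"
        unfolding abs_mult using e by (intro mult_mono) auto
      then show ?thesis by (simp add: mult_ac abs_le_iff)
    qed
    ultimately show ?thesis by linarith
  qed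
  have "((\<lambda>d. - (exp (Z s) * (2 * B + K)) * exp (- d / 2)) \<longlongrightarrow> - (exp (Z s) * (2 * B + K)) * 0) at_top"
    by (intro tendsto_intros) real_asymp
  then have "- (exp (Z s) * (2 * B + K)) * 0 \<le> ?G s"
    by (rule tendsto_upperbound) (use lower in \<open>auto intro: eventually_mono[OF eventually_ge_at_top[of 0]]\<close>)
  then show ?thesis by (simp add: zero_le_mult_iff)
qed

lemma bounded_solution_bound:
  fixes z p E :: "real \<Rightarrow> real"
  assumes cz: "continuous_on UNIV z" and z: "\<And>s. z s \<ge> 1/2" and p: "\<And>s. \<bar>p s\<bar> \<le> B"
    and E: "\<And>s. (E has_real_derivative p s - z s * E s) (at s)" and K: "\<And>s. \<bar>E s\<bar> \<le> K"
  shows "\<bar>E s\<bar> \<le> 2 * B"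
proof -
  have B: "B \<ge> 0" using p[of 0] by linarith
  have "E s \<le> 2 * B"
    by (rule bounded_solution_le[OF cz z _ B E K]) (use p in \<open>auto simp: abs_le_iff\<close>)
  moreover have "- E s \<le> 2 * B"
  proof (rule bounded_solution_le[OF cz z _ B, of "\<lambda>s. - p s" "\<lambda>s. - E s"])
    show "((\<lambda>s. - E s) has_real_derivative - p s - z s * - E s) (at s)" for s
      by (auto intro!: derivative_eq_intros E)
    show "- p s \<le> B" for s using p[of s] by linarith
    show "\<bar>- E s\<bar> \<le> K" for s using K[of s] by simp
  qed
  ultimately show ?thesis by linarith
qed

lemma integrable_exp_abs: "integrable lborel (\<lambda>y::real. exp (- \<bar>y\<bar> / 2))"
proof (rule integrable_decay)
  show "(1 + x\<^sup>2) * norm (exp (- \<bar>x\<bar> / 2)) \<le> 8" for x :: real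
  proof -
    have "1 + \<bar>x\<bar> / 2 + (\<bar>x\<bar> / 2)\<^sup>2 / 2 \<le> exp (\<bar>x\<bar> / 2)"
      by (rule exp_lower_Taylor_quadratic) simp
    then have "1 + x\<^sup>2 \<le> 8 * exp (\<bar>x\<bar> / 2)" by (simp add: power_divide)
    then have "(1 + x\<^sup>2) * exp (- \<bar>x\<bar> / 2) \<le> 8 * exp (\<bar>x\<bar> / 2) * exp (- \<bar>x\<bar> / 2)"
      by (intro mult_right_mono) auto
    then show ?thesis by (simp add: mult.assoc exp_add[symmetric])
  qed
qed simp

lemma half_line_integral_derivative:
  fixes g :: "real \<Rightarrow> real"
  assumes g: "continuous_on UNIV g" and i: "\<And>s. integrable lborel (\<lambda>r. indicator {..s} r * g r)"
  shows "((\<lambda>s. \<integral>r. indicator {..s} r * g r \<partial>lborel) has_real_derivative g s) (at s)"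
proof -
  let ?I = "\<lambda>s. \<integral>r. indicator {..s} r * g r \<partial>lborel"
  \<comment> \<open>Any point to the left of \<open>s\<close> would do: beyond it only an integral
    over a compact interval varies.\<close>
  define a where "a = s - 1"
  have eq: "?I u = ?I a + integral {a..u} g" if "u \<in> {a..s+1}" for u
  proof -
    have si: "set_integrable lborel {a..u} g"
      by (rule borel_integrable_atLeastAtMost') (rule continuous_on_subset[OF g], simp)
    have "?I u = (\<integral>r. indicator {..a} r * g r + indicator {a..u} r *\<^sub>R g r \<partial>lborel)"
    proof (rule integral_cong_AE)
      have "AE r in lborel. r \<noteq> a" by (rule AE_lborel_singleton)
      then show "AE r in lborel. indicator {..u} r * g r = indicator {..a} r * g r + indicator {a..u} r *\<^sub>R g r"
        by eventually_elim (use that in \<open>auto simp: indicator_def\<close>)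
    qed (use i[of u] i[of a] si in \<open>auto simp: set_integrable_def\<close>)
    also have "\<dots> = ?I a + (\<integral>r. indicator {a..u} r *\<^sub>R g r \<partial>lborel)"
      by (rule Bochner_Integration.integral_add) (use i[of a] si in \<open>auto simp: set_integrable_def\<close>)
    also have "(\<integral>r. indicator {a..u} r *\<^sub>R g r \<partial>lborel) = integral {a..u} g"
      using set_borel_integral_eq_integral(2)[OF si] by (simp add: set_lebesgue_integral_def)
    finally show ?thesis .
  qed
  have s: "s \<in> {a..s+1}" unfolding a_def by simp
  have "((\<lambda>u. integral {a..u} g) has_real_derivative g s) (at s within {a..s+1})"
    by (rule integral_has_real_derivative[OF continuous_on_subset[OF g] s]) simp
  then have "((\<lambda>u. ?I a + integral {a..u} g) has_real_derivative g s) (at s within {a..s+1})"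
    by (auto intro!: derivative_eq_intros)
  then have "(?I has_real_derivative g s) (at s within {a..s+1})"
    by (rule has_field_derivative_transform_within[OF _ zero_less_one s]) (rule eq[symmetric])
  moreover have "at s within {a..s+1} = at s"
    unfolding a_def by (rule at_within_interior) (auto simp: interior_atLeastAtMost_real)
  ultimately show ?thesis by simp
qed

lemma half_line_solution:
  fixes Z z p :: "real \<Rightarrow> real"
  assumes Z: "\<And>s. (Z has_real_derivative z s) (at s)" and cz: "continuous_on UNIV z" and z: "\<And>s. z s \<ge> 1/2"
    and p: "continuous_on UNIV p" "\<And>s. \<bar>p s\<bar> \<le> B"
  defines "E \<equiv> \<lambda>s. \<integral>r. indicator {..s} r * (exp (Z r - Z s) * p r) \<partial>lborel"
  shows "(E has_real_derivative p s - z s * E s) (at s)" "\<bar>E s\<bar> \<le> 2 * B"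
proof -
  have cZ: "continuous_on UNIV Z" using Z DERIV_isCont continuous_at_imp_continuous_on by blast
  have [measurable]: "Z \<in> borel_measurable borel" "p \<in> borel_measurable borel"
    using cZ p(1) borel_measurable_continuous_onI by blast+
  have B: "B \<ge> 0" using p(2)[of 0] by linarith
  have ii: "integrable lborel (\<lambda>r. B * exp (- \<bar>r - s\<bar> / 2))" for s
    using lborel_integrable_real_affine[OF integrable_exp_abs, of 1 "-s"] by (simp add: add.commute)
  have le: "\<bar>indicator {..s} r * (exp (Z r - Z s) * p r)\<bar> \<le> B * exp (- \<bar>r - s\<bar> / 2)" for r s
  proof (cases "r \<le> s")
    case True
    then have "exp (Z r - Z s) \<le> exp (- \<bar>r - s\<bar> / 2)" using growth_half[OF Z z True] by simp
    then have "\<bar>exp (Z r - Z s) * p r\<bar> \<le> exp (- \<bar>r - s\<bar> / 2) * B"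
      unfolding abs_mult using p(2) by (intro mult_mono) auto
    then show ?thesis using True by (simp add: mult.commute)
  qed (use B in simp)
  have i1: "integrable lborel (\<lambda>r. indicator {..s} r * (exp (Z r - Z s) * p r))" for s
    by (rule Bochner_Integration.integrable_bound[OF ii[of s]]) (use le B in \<open>auto simp: abs_mult\<close>)
  have i2: "integrable lborel (\<lambda>r. indicator {..s} r * (exp (Z r) * p r))" for s
    using integrable_mult_right[OF i1[of s], of "exp (Z s)"] by (simp add: exp_diff mult_ac)
  have Eeq: "E = (\<lambda>s. exp (- Z s) * (\<integral>r. indicator {..s} r * (exp (Z r) * p r) \<partial>lborel))"
    unfolding E_def by (simp add: exp_diff exp_minus divide_inverse mult_ac flip: integral_mult_right_zero)
  have d: "(E has_real_derivative p s - z s * E s) (at s)" for s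
  proof -
    have c: "continuous_on UNIV (\<lambda>r. exp (Z r) * p r)" by (intro continuous_intros cZ p)
    have "((\<lambda>s. exp (- Z s) * (\<integral>r. indicator {..s} r * (exp (Z r) * p r) \<partial>lborel)) has_real_derivative
        (exp (- Z s) * (- z s)) * (\<integral>r. indicator {..s} r * (exp (Z r) * p r) \<partial>lborel) + (exp (Z s) * p s) * exp (- Z s)) (at s)"
      by (intro DERIV_mult half_line_integral_derivative[OF c i2])
        (auto intro!: derivative_eq_intros Z)
    moreover have "(exp (- Z s) * (- z s)) * (\<integral>r. indicator {..s} r * (exp (Z r) * p r) \<partial>lborel) + (exp (Z s) * p s) * exp (- Z s) = p s - z s * E s"
      unfolding Eeq by (simp add: exp_minus field_simps)
    ultimately show ?thesis by (subst Eeq) (rule DERIV_cong)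
  qed
  then show "(E has_real_derivative p s - z s * E s) (at s)" .
  \<comment> \<open>Any finite bound is good enough here, since
    \<open>bounded_solution_bound\<close> improves it to \<open>2 * B\<close>.\<close>
  have crude: "\<bar>E s\<bar> \<le> (\<integral>r. B * exp (- \<bar>r\<bar> / 2) \<partial>lborel)" for s
  proof -
    have "\<bar>E s\<bar> \<le> (\<integral>r. \<bar>indicator {..s} r * (exp (Z r - Z s) * p r)\<bar> \<partial>lborel)"
      unfolding E_def using integral_norm_bound[of lborel "\<lambda>r. indicator {..s} r * (exp (Z r - Z s) * p r)"] by simp
    also have "\<dots> \<le> (\<integral>r. B * exp (- \<bar>r - s\<bar> / 2) \<partial>lborel)"
      by (rule integral_mono) (use i1 ii le in auto)
    also have "\<dots> = (\<integral>r. B * exp (- \<bar>r\<bar> / 2) \<partial>lborel)"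
      using lborel_integral_shift[of "\<lambda>r. B * exp (- \<bar>r\<bar> / 2)" "-s"] by simp
    finally show ?thesis .
  qed
  show "\<bar>E s\<bar> \<le> 2 * B" by (rule bounded_solution_bound[OF cz z p(2) d crude])
qed

text \<open>For \<open>z = 1\<close> these are the convolutions of \<open>p\<close> with the two halves of \<open>e^{-|x|}\<close>; for
  \<open>z = \<partial>\<^sub>s q\<close> they are the same convolutions pulled back along the characteristics \<open>q\<close>. If
  \<open>z \<ge> 1/2\<close> and \<open>p\<close> is bounded, the bounded solution exists and is unique.\<close>

definition left_sol :: "(real \<Rightarrow> real) \<Rightarrow> (real \<Rightarrow> real) \<Rightarrow> real \<Rightarrow> real" where
  "left_sol z p = (SOME E. bounded (range E) \<and> (\<forall>s. (E has_real_derivative p s - z s * E s) (at s)))"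

definition right_sol :: "(real \<Rightarrow> real) \<Rightarrow> (real \<Rightarrow> real) \<Rightarrow> real \<Rightarrow> real" where
  "right_sol z p s = left_sol (\<lambda>r. z (- r)) (\<lambda>r. p (- r)) (- s)"

lemma left_sol:
  assumes cz: "continuous_on UNIV z" and z: "\<And>s. z s \<ge> 1/2"
    and p: "continuous_on UNIV p" "\<And>s. \<bar>p s\<bar> \<le> B"
  shows "(left_sol z p has_real_derivative p s - z s * left_sol z p s) (at s)" "\<bar>left_sol z p s\<bar> \<le> 2 * B"
proof -
  obtain Z where Z: "\<And>s. (Z has_real_derivative z s) (at s)" using antiderivative_exists[OF cz] by blast
  have "\<exists>E. bounded (range E) \<and> (\<forall>s. (E has_real_derivative p s - z s * E s) (at s))"
  proof (intro exI conjI allI)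
    let ?E = "\<lambda>s. \<integral>r. indicator {..s} r * (exp (Z r - Z s) * p r) \<partial>lborel"
    show "bounded (range ?E)"
      using half_line_solution(2)[OF Z cz z p] by (auto simp: bounded_iff)
    show "(?E has_real_derivative p s - z s * ?E s) (at s)" for s
      by (rule half_line_solution(1)[OF Z cz z p])
  qed
  from someI_ex[OF this] have L: "bounded (range (left_sol z p))"
      "\<And>s. (left_sol z p has_real_derivative p s - z s * left_sol z p s) (at s)"
    unfolding left_sol_def[symmetric] by auto
  then obtain K where K: "\<And>s. \<bar>left_sol z p s\<bar> \<le> K" by (auto simp: bounded_iff)
  show "(left_sol z p has_real_derivative p s - z s * left_sol z p s) (at s)" by (rule L)
  show "\<bar>left_sol z p s\<bar> \<le> 2 * B" by (rule bounded_solution_bound[OF cz z p(2) L(2) K])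
qed

lemma left_sol_unique:
  assumes cz: "continuous_on UNIV z" and z: "\<And>s. z s \<ge> 1/2"
    and p: "continuous_on UNIV p" "\<And>s. \<bar>p s\<bar> \<le> B"
    and E: "\<And>s. (E has_real_derivative p s - z s * E s) (at s)" "\<And>s. \<bar>E s\<bar> \<le> K"
  shows "E = left_sol z p"
proof
  fix s
  have "\<bar>E s - left_sol z p s\<bar> \<le> 2 * 0"
  proof (rule bounded_solution_bound[OF cz z, of "\<lambda>s. 0" 0 "\<lambda>s. E s - left_sol z p s"])
    show "((\<lambda>s. E s - left_sol z p s) has_real_derivative 0 - z s * (E s - left_sol z p s)) (at s)" for s
      by (auto intro!: derivative_eq_intros E left_sol(1)[OF cz z p] simp: algebra_simps)
    show "\<bar>E s - left_sol z p s\<bar> \<le> K + 2 * B" for s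
      using E(2)[of s] left_sol(2)[OF cz z p, of s] by linarith
  qed simp
  then show "E s = left_sol z p s" by simp
qed

text \<open>The difference of the two solutions is itself the bounded solution of an equation with
  coefficient \<open>z1\<close> and source \<open>(p1 - p2) - (z1 - z2) * left_sol z2 p2\<close>;
  its size is read off from the source.\<close>

lemma left_sol_lipschitz:
  assumes z1: "continuous_on UNIV z1" "\<And>s. z1 s \<ge> 1/2" and p1: "continuous_on UNIV p1" "\<And>s. \<bar>p1 s\<bar> \<le> B"
    and z2: "continuous_on UNIV z2" "\<And>s. z2 s \<ge> 1/2" and p2: "continuous_on UNIV p2" "\<And>s. \<bar>p2 s\<bar> \<le> B"
    and dz: "\<And>s. \<bar>z1 s - z2 s\<bar> \<le> a" and dp: "\<And>s. \<bar>p1 s - p2 s\<bar> \<le> b"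
  shows "\<bar>left_sol z1 p1 s - left_sol z2 p2 s\<bar> \<le> 2 * (b + a * (2 * B))"
proof (rule bounded_solution_bound[OF z1, of "\<lambda>s. (p1 s - p2 s) - (z1 s - z2 s) * left_sol z2 p2 s" _ "\<lambda>s. left_sol z1 p1 s - left_sol z2 p2 s" "2 * B + 2 * B"])
  show "((\<lambda>s. left_sol z1 p1 s - left_sol z2 p2 s) has_real_derivative
      p1 s - p2 s - (z1 s - z2 s) * left_sol z2 p2 s - z1 s * (left_sol z1 p1 s - left_sol z2 p2 s)) (at s)" for s
    by (auto intro!: derivative_eq_intros left_sol(1)[OF z1 p1] left_sol(1)[OF z2 p2] simp: algebra_simps)
  show "\<bar>left_sol z1 p1 s - left_sol z2 p2 s\<bar> \<le> 2 * B + 2 * B" for s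
    using left_sol(2)[OF z1 p1, of s] left_sol(2)[OF z2 p2, of s] by linarith
  show "\<bar>p1 s - p2 s - (z1 s - z2 s) * left_sol z2 p2 s\<bar> \<le> b + a * (2 * B)" for s
  proof -
    have "\<bar>(z1 s - z2 s) * left_sol z2 p2 s\<bar> \<le> a * (2 * B)"
      unfolding abs_mult by (intro mult_mono dz left_sol(2)[OF z2 p2]) (use dz[of s] in auto)
    then show ?thesis using dp[of s] by linarith
  qed
qed

lemma reflect_continuous: "continuous_on UNIV f \<Longrightarrow> continuous_on UNIV (\<lambda>r. f (- r))" for f :: "real \<Rightarrow> real"
  by (rule continuous_on_compose2[of UNIV f]) (auto intro!: continuous_intros)

lemma right_sol:
  assumes cz: "continuous_on UNIV z" and z: "\<And>s. z s \<ge> 1/2"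
    and p: "continuous_on UNIV p" "\<And>s. \<bar>p s\<bar> \<le> B"
  shows "(right_sol z p has_real_derivative z s * right_sol z p s - p s) (at s)" "\<bar>right_sol z p s\<bar> \<le> 2 * B"
proof -
  note L = left_sol[of "\<lambda>r. z (- r)" "\<lambda>r. p (- r)", OF reflect_continuous[OF cz] z reflect_continuous[OF p(1)] p(2)]
  have "((\<lambda>s. left_sol (\<lambda>r. z (- r)) (\<lambda>r. p (- r)) (- s)) has_real_derivative
     (p (- (- s)) - z (- (- s)) * left_sol (\<lambda>r. z (- r)) (\<lambda>r. p (- r)) (- s)) * (- 1)) (at s)"
    by (rule DERIV_chain2[OF L(1)]) (auto intro!: derivative_eq_intros)
  then show "(right_sol z p has_real_derivative z s * right_sol z p s - p s) (at s)"
    unfolding right_sol_def[abs_def] by simp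
  show "\<bar>right_sol z p s\<bar> \<le> 2 * B" unfolding right_sol_def by (rule L(2))
qed

lemma right_sol_unique:
  assumes cz: "continuous_on UNIV z" and z: "\<And>s. z s \<ge> 1/2"
    and p: "continuous_on UNIV p" "\<And>s. \<bar>p s\<bar> \<le> B"
    and E: "\<And>s. (E has_real_derivative z s * E s - p s) (at s)" "\<And>s. \<bar>E s\<bar> \<le> K"
  shows "E = right_sol z p"
proof -
  have "(\<lambda>s. E (- s)) = left_sol (\<lambda>r. z (- r)) (\<lambda>r. p (- r))"
  proof (rule left_sol_unique[OF reflect_continuous[OF cz] z reflect_continuous[OF p(1)] p(2) _ E(2)])
    show "((\<lambda>s. E (- s)) has_real_derivative p (- s) - z (- s) * E (- s)) (at s)" for s
      using DERIV_chain2[OF E(1) DERIV_minus[OF DERIV_ident], of s] by simp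
  qed
  then have "E (- s) = left_sol (\<lambda>r. z (- r)) (\<lambda>r. p (- r)) s" for s by metis
  then show ?thesis unfolding right_sol_def[abs_def] by (metis minus_minus)
qed

lemma right_sol_lipschitz:
  assumes z1: "continuous_on UNIV z1" "\<And>s. z1 s \<ge> 1/2" and p1: "continuous_on UNIV p1" "\<And>s. \<bar>p1 s\<bar> \<le> B"
    and z2: "continuous_on UNIV z2" "\<And>s. z2 s \<ge> 1/2" and p2: "continuous_on UNIV p2" "\<And>s. \<bar>p2 s\<bar> \<le> B"
    and dz: "\<And>s. \<bar>z1 s - z2 s\<bar> \<le> a" and dp: "\<And>s. \<bar>p1 s - p2 s\<bar> \<le> b"
  shows "\<bar>right_sol z1 p1 s - right_sol z2 p2 s\<bar> \<le> 2 * (b + a * (2 * B))"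
  unfolding right_sol_def
  by (rule left_sol_lipschitz[OF reflect_continuous[OF z1(1)] z1(2) reflect_continuous[OF p1(1)] p1(2)
        reflect_continuous[OF z2(1)] z2(2) reflect_continuous[OF p2(1)] p2(2) dz dp])

section \<open>The inverse Helmholtz operator\<close>

text \<open>For \<open>z = 1\<close> the chosen solution becomes an integral against a fixed kernel.
  This form links it to \<open>helmholtz_inv\<close> and makes dominated convergence available for
  its dependence on a parameter.\<close>

lemma left_sol_one:
  assumes p: "continuous_on UNIV p" "\<And>s. \<bar>p s\<bar> \<le> B"
  shows "integrable lborel (\<lambda>y. indicator {..0} y * exp y * p (x + y))"
    and "left_sol (\<lambda>s. 1) p x = (\<integral>y. indicator {..0} y * exp y * p (x + y) \<partial>lborel)"
proof -
  have [measurable]: "p \<in> borel_measurable borel" using p(1) borel_measurable_continuous_onI by blast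
  have B: "B \<ge> 0" using p(2)[of 0] by linarith
  show "integrable lborel (\<lambda>y. indicator {..0} y * exp y * p (x + y))"
  proof (rule Bochner_Integration.integrable_bound[of lborel "\<lambda>y. B * exp (- \<bar>y\<bar> / 2)"])
    have "norm (indicator {..0} y * exp y * p (x + y)) \<le> norm (B * exp (- \<bar>y\<bar> / 2))" for y
    proof (cases "y \<le> 0")
      case True
      then have "\<bar>exp y * p (x + y)\<bar> \<le> exp (- \<bar>y\<bar> / 2) * B"
        unfolding abs_mult using p(2) by (intro mult_mono) auto
      then show ?thesis using True B by (simp add: abs_mult mult.commute)
    qed simp
    then show "AE y in lborel. norm (indicator {..0} y * exp y * p (x + y)) \<le> norm (B * exp (- \<bar>y\<bar> / 2))" by simp
  qed (use integrable_exp_abs in auto)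
  let ?E = "\<lambda>s. \<integral>r. indicator {..s} r * (exp (r - s) * p r) \<partial>lborel"
  have "?E = left_sol (\<lambda>s. 1) p"
  proof (rule left_sol_unique[OF _ _ p])
    show "(?E has_real_derivative p s - 1 * ?E s) (at s)" for s
      by (rule half_line_solution(1)[of "\<lambda>s. s" "\<lambda>s. 1", OF _ _ _ p]) (auto intro!: continuous_intros)
    show "\<bar>?E s\<bar> \<le> 2 * B" for s
      by (rule half_line_solution(2)[of "\<lambda>s. s" "\<lambda>s. 1", OF _ _ _ p]) (auto intro!: continuous_intros)
  qed auto
  from fun_cong[OF this, of x] have "left_sol (\<lambda>s. 1) p x = ?E x" by (rule sym)
  also have "\<dots> = (\<integral>y. indicator {..x} (x + y) * (exp (x + y - x) * p (x + y)) \<partial>lborel)"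
    by (rule lborel_integral_shift[symmetric])
  also have "\<dots> = (\<integral>y. indicator {..0} y * exp y * p (x + y) \<partial>lborel)"
    by (intro Bochner_Integration.integral_cong[OF refl]) (simp add: indicator_def)
  finally show "left_sol (\<lambda>s. 1) p x = (\<integral>y. indicator {..0} y * exp y * p (x + y) \<partial>lborel)" .
qed

lemma right_sol_one:
  assumes p: "continuous_on UNIV p" "\<And>s. \<bar>p s\<bar> \<le> B"
  shows "integrable lborel (\<lambda>y. indicator {0..} y * exp (- y) * p (x + y))"
    and "right_sol (\<lambda>s. 1) p x = (\<integral>y. indicator {0..} y * exp (- y) * p (x + y) \<partial>lborel)"
proof -
  note L = left_sol_one[OF reflect_continuous[OF p(1)] p(2), of "- x"]
  have e: "indicator {..0} (0 + (-1) * y) * exp (0 + (-1) * y) * p (- (- x + (0 + (-1) * y))) = indicator {0..} y * exp (- y) * p (x + y)" for y :: real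
    by (simp add: indicator_def add.commute)
  show "integrable lborel (\<lambda>y. indicator {0..} y * exp (- y) * p (x + y))"
    using lborel_integrable_real_affine[OF L(1), of "-1" 0] unfolding e by simp
  have "right_sol (\<lambda>s. 1) p x = (\<integral>y. indicator {..0} y * exp y * p (- (- x + y)) \<partial>lborel)"
    unfolding right_sol_def using L(2) by simp
  also have "\<dots> = \<bar>-1\<bar> *\<^sub>R (\<integral>y. indicator {..0} (0 + (-1) * y) * exp (0 + (-1) * y) * p (- (- x + (0 + (-1) * y))) \<partial>lborel)"
    by (rule lborel_integral_real_affine) simp
  finally show "right_sol (\<lambda>s. 1) p x = (\<integral>y. indicator {0..} y * exp (- y) * p (x + y) \<partial>lborel)"
    unfolding e by simp
qed

lemma helmholtz_inv_eq:
  assumes p: "continuous_on UNIV p" "\<And>s. \<bar>p s\<bar> \<le> B"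
  shows "helmholtz_inv p x = (left_sol (\<lambda>s. 1) p x + right_sol (\<lambda>s. 1) p x) / 2"
proof -
  note L = left_sol_one[OF p, of x] and R = right_sol_one[OF p, of x]
  have "helmholtz_inv p x = (\<integral>y. (1/2) * exp (- \<bar>x - (x + y)\<bar>) * p (x + y) \<partial>lborel)"
    unfolding helmholtz_inv_def by (rule lborel_integral_shift[symmetric])
  also have "\<dots> = (\<integral>y. (1/2) * (indicator {..0} y * exp y * p (x + y) + indicator {0..} y * exp (- y) * p (x + y)) \<partial>lborel)"
  proof (rule integral_cong_AE)
    have [measurable]: "p \<in> borel_measurable borel" using p(1) borel_measurable_continuous_onI by blast
    show "(\<lambda>y. (1/2) * exp (- \<bar>x - (x + y)\<bar>) * p (x + y)) \<in> borel_measurable lborel" by measurable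
    show "(\<lambda>y. (1/2) * (indicator {..0} y * exp y * p (x + y) + indicator {0..} y * exp (- y) * p (x + y))) \<in> borel_measurable lborel"
      by measurable
    have "AE y in lborel. y \<noteq> (0::real)" by (rule AE_lborel_singleton)
    then show "AE y in lborel. (1/2) * exp (- \<bar>x - (x + y)\<bar>) * p (x + y) =
        (1/2) * (indicator {..0} y * exp y * p (x + y) + indicator {0..} y * exp (- y) * p (x + y))"
      by eventually_elim (auto simp: indicator_def)
  qed
  also have "\<dots> = (1/2) * (left_sol (\<lambda>s. 1) p x + right_sol (\<lambda>s. 1) p x)"
    unfolding L(2) R(2) by (simp add: Bochner_Integration.integral_add[OF L(1) R(1)] del: Bochner_Integration.integral_add)
  finally show ?thesis by simp
qed

lemma ddx_real_eqI: "(\<And>x. (f has_real_derivative f' x) (at x)) \<Longrightarrow> ddx f = f'"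
  by (rule ddx_eqI) (simp add: has_real_derivative_iff_has_vector_derivative)

text \<open>The two halves have derivatives \<open>p - left_sol\<close> and
  \<open>right_sol - p\<close>, so the local terms cancel. This spares differentiating the kernel
  across its corner, or differentiating \<open>p\<close>.\<close>

lemma ddx_helmholtz_inv:
  assumes p: "continuous_on UNIV p" "\<And>s. \<bar>p s\<bar> \<le> B"
  shows "ddx (helmholtz_inv p) = (\<lambda>x. (right_sol (\<lambda>s. 1) p x - left_sol (\<lambda>s. 1) p x) / 2)"
proof (rule ddx_real_eqI)
  fix x
  have e: "helmholtz_inv p = (\<lambda>x. (left_sol (\<lambda>s. 1) p x + right_sol (\<lambda>s. 1) p x) / 2)"
    using helmholtz_inv_eq[OF p] by auto
  show "(helmholtz_inv p has_real_derivative (right_sol (\<lambda>s. 1) p x - left_sol (\<lambda>s. 1) p x) / 2) (at x)"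
    unfolding e using left_sol(1)[of "\<lambda>s. 1" p B x] right_sol(1)[of "\<lambda>s. 1" p B x] p
    by (auto intro!: derivative_eq_intros simp: continuous_on_const)
qed

lemma convolution_jointly_continuous:
  fixes k :: "real \<Rightarrow> real" and P :: "real \<Rightarrow> real \<Rightarrow> real"
  assumes k: "integrable lborel k" and P: "continuous_on (S \<times> UNIV) (\<lambda>(t, x). P t x)"
    and B: "\<And>t x. t \<in> S \<Longrightarrow> \<bar>P t x\<bar> \<le> B"
  shows "continuous_on (S \<times> UNIV) (\<lambda>(t, x). \<integral>y. k y * P t (x + y) \<partial>lborel)"
  unfolding continuous_on_sequentially
proof (intro allI ballI impI)
  fix s :: "nat \<Rightarrow> real \<times> real" and a
  assume a: "a \<in> S \<times> UNIV" and s: "(\<forall>n. s n \<in> S \<times> UNIV) \<and> s \<longlonglongrightarrow> a"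
  have [measurable]: "k \<in> borel_measurable borel" using k by auto
  have m: "(\<lambda>y. P t (x + y)) \<in> borel_measurable borel" if "t \<in> S" for t x
  proof (rule borel_measurable_continuous_onI)
    show "continuous_on UNIV (\<lambda>y. P t (x + y))"
    proof -
      have "continuous_on UNIV (\<lambda>y. (t, x + y))" by (intro continuous_intros)
      from continuous_on_compose2[OF P this] show ?thesis using that by auto
    qed
  qed
  show "((\<lambda>(t, x). \<integral>y. k y * P t (x + y) \<partial>lborel) \<circ> s) \<longlonglongrightarrow> (case a of (t, x) \<Rightarrow> \<integral>y. k y * P t (x + y) \<partial>lborel)"
    unfolding o_def split_beta
  proof (rule integral_dominated_convergence)
    show "(\<lambda>y. k y * P (fst a) (snd a + y)) \<in> borel_measurable lborel"
      using m[of "fst a" "snd a"] a by (intro borel_measurable_times) auto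
    show "(\<lambda>y. k y * P (fst (s n)) (snd (s n) + y)) \<in> borel_measurable lborel" for n
      using m[of "fst (s n)" "snd (s n)"] s by (intro borel_measurable_times) (auto simp: mem_Times_iff)
    show "integrable lborel (\<lambda>y. \<bar>k y\<bar> * \<bar>B\<bar>)" using k by (intro integrable_mult_left) auto
    show "AE y in lborel. (\<lambda>n. k y * P (fst (s n)) (snd (s n) + y)) \<longlonglongrightarrow> k y * P (fst a) (snd a + y)"
    proof (rule AE_I2)
      fix y
      have "(\<lambda>n. (fst (s n), snd (s n) + y)) \<longlonglongrightarrow> (fst a, snd a + y)"
        using s by (intro tendsto_intros) (auto intro: tendsto_fst tendsto_snd)
      then have "(\<lambda>n. (\<lambda>(t, x). P t x) (fst (s n), snd (s n) + y)) \<longlonglongrightarrow> (\<lambda>(t, x). P t x) (fst a, snd a + y)"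
        by (rule continuous_on_tendsto_compose[OF P]) (use a s in \<open>auto simp: mem_Times_iff\<close>)
      then show "(\<lambda>n. k y * P (fst (s n)) (snd (s n) + y)) \<longlonglongrightarrow> k y * P (fst a) (snd a + y)"
        by (intro tendsto_intros) simp
    qed
    show "AE y in lborel. norm (k y * P (fst (s n)) (snd (s n) + y)) \<le> \<bar>k y\<bar> * \<bar>B\<bar>" for n
    proof (rule AE_I2)
      fix y
      have "\<bar>P (fst (s n)) (snd (s n) + y)\<bar> \<le> \<bar>B\<bar>"
        using B[of "fst (s n)" "snd (s n) + y"] s by (force simp: mem_Times_iff)
      then show "norm (k y * P (fst (s n)) (snd (s n) + y)) \<le> \<bar>k y\<bar> * \<bar>B\<bar>"
        by (simp add: abs_mult mult_left_mono)
    qed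
  qed
qed

lemma sol_one_jointly_continuous:
  fixes P :: "real \<Rightarrow> real \<Rightarrow> real"
  assumes P: "continuous_on (S \<times> UNIV) (\<lambda>(t, x). P t x)" and B: "\<And>t x. t \<in> S \<Longrightarrow> \<bar>P t x\<bar> \<le> B"
  shows "continuous_on (S \<times> UNIV) (\<lambda>(t, x). left_sol (\<lambda>s. 1) (P t) x)"
    and "continuous_on (S \<times> UNIV) (\<lambda>(t, x). right_sol (\<lambda>s. 1) (P t) x)"
proof -
  have c: "continuous_on UNIV (P t)" if "t \<in> S" for t
  proof -
    have "continuous_on UNIV (\<lambda>x. (t, x))" by (intro continuous_intros)
    from continuous_on_compose2[OF P this] show ?thesis using that by auto
  qed
  have k: "integrable lborel (\<lambda>y::real. indicator {..0} y * exp y)" "integrable lborel (\<lambda>y::real. indicator {0..} y * exp (- y))"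
    using left_sol_one(1)[of "\<lambda>s. 1" 1 0] right_sol_one(1)[of "\<lambda>s. 1" 1 0] by (auto simp: continuous_on_const)
  show "continuous_on (S \<times> UNIV) (\<lambda>(t, x). left_sol (\<lambda>s. 1) (P t) x)"
  proof (subst continuous_on_cong[OF refl])
    show "continuous_on (S \<times> UNIV) (\<lambda>(t, x). \<integral>y. indicator {..0} y * exp y * P t (x + y) \<partial>lborel)"
      by (rule convolution_jointly_continuous[OF k(1) P]) (rule B)
    show "(case q of (t, x) \<Rightarrow> left_sol (\<lambda>s. 1) (P t) x) = (case q of (t, x) \<Rightarrow> \<integral>y. indicator {..0} y * exp y * P t (x + y) \<partial>lborel)"
      if "q \<in> S \<times> UNIV" for q
      using that left_sol_one(2)[OF c[of "fst q"] B[of "fst q"], of "snd q"] by (auto simp: split_beta)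
  qed
  show "continuous_on (S \<times> UNIV) (\<lambda>(t, x). right_sol (\<lambda>s. 1) (P t) x)"
  proof (subst continuous_on_cong[OF refl])
    show "continuous_on (S \<times> UNIV) (\<lambda>(t, x). \<integral>y. indicator {0..} y * exp (- y) * P t (x + y) \<partial>lborel)"
      by (rule convolution_jointly_continuous[OF k(2) P]) (rule B)
    show "(case q of (t, x) \<Rightarrow> right_sol (\<lambda>s. 1) (P t) x) = (case q of (t, x) \<Rightarrow> \<integral>y. indicator {0..} y * exp (- y) * P t (x + y) \<partial>lborel)"
      if "q \<in> S \<times> UNIV" for q
      using that right_sol_one(2)[OF c[of "fst q"] B[of "fst q"], of "snd q"] by (auto simp: split_beta)
  qed
qed

section \<open>Ordinary differential equations in Banach spaces\<close>

text \<open>Picard iteration. Time is clamped to \<open>{0..T}\<close> by \<open>cl\<close>, so that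
  candidates are bounded continuous functions on the whole line and the completeness of that space
  can be used; \<open>T * L \<le> 1/2\<close> makes the iteration a contraction and
  \<open>T * M \<le> r\<close> keeps it in the ball.\<close>

lemma banach_ode:
  fixes f :: "'a::banach \<Rightarrow> 'a"
  assumes T: "T > 0" and lip: "\<And>x y. x \<in> cball x0 r \<Longrightarrow> y \<in> cball x0 r \<Longrightarrow> norm (f x - f y) \<le> L * norm (x - y)"
    and bd: "\<And>x. x \<in> cball x0 r \<Longrightarrow> norm (f x) \<le> M" and TM: "T * M \<le> r" and TL: "T * L \<le> 1/2" and L: "L \<ge> 0" and r: "r \<ge> 0"
  obtains X where "X 0 = x0" "\<And>t. t \<in> {0..T} \<Longrightarrow> X t \<in> cball x0 r"
    "\<And>t. t \<in> {0..T} \<Longrightarrow> (X has_vector_derivative f (X t)) (at t within {0..T})"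
proof -
  define cl where "cl = (\<lambda>t::real. max 0 (min T t))"
  have cl: "cl t \<in> {0..T}" "continuous_on A cl" for t A
    unfolding cl_def using T by (auto intro!: continuous_intros)
  define S where "S = {g :: real \<Rightarrow>\<^sub>C 'a. \<forall>t. g t \<in> cball x0 r}"
  have cf: "continuous_on (cball x0 r) f"
  proof (rule lipschitz_on_continuous_on)
    show "L-lipschitz_on (cball x0 r) f" using lip L by (auto simp: lipschitz_on_def dist_norm)
  qed
  have ch: "continuous_on A (\<lambda>\<tau>. f (g \<tau>))" if "g \<in> S" for g A
    by (rule continuous_on_compose2[OF cf continuous_on_apply_bcontfun]) (use that in \<open>auto simp: S_def\<close>)
  define \<Phi> where "\<Phi> = (\<lambda>g :: real \<Rightarrow>\<^sub>C 'a. \<lambda>t. x0 + integral {0..cl t} (\<lambda>\<tau>. f (g \<tau>)))"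
  have M: "M \<ge> 0" using bd[of x0] r order_trans[OF norm_ge_zero[of "f x0"]] by simp
  have in_ball: "\<Phi> g t \<in> cball x0 r" if "g \<in> S" for g t
  proof -
    have "norm (integral {0..cl t} (\<lambda>\<tau>. f (g \<tau>))) \<le> M * (cl t - 0)"
      by (rule integral_bound) (use cl(1)[of t] ch[OF that] bd that in \<open>auto simp: S_def\<close>)
    also have "\<dots> \<le> M * T" using cl(1)[of t] M by (intro mult_left_mono) auto
    finally show ?thesis using TM unfolding \<Phi>_def by (simp add: dist_norm mult.commute)
  qed
  have bc: "\<Phi> g \<in> bcontfun" if "g \<in> S" for g
  proof (rule bcontfun_normI)
    have "continuous_on {0..T} (\<lambda>t. integral {0..t} (\<lambda>\<tau>. f (g \<tau>)))"
      by (rule indefinite_integral_continuous_1) (rule integrable_continuous_interval, rule ch[OF that])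
    then show "continuous_on UNIV (\<Phi> g)"
      unfolding \<Phi>_def by (intro continuous_intros continuous_on_compose2[OF _ cl(2)]) (use cl(1) in auto)
    show "norm (\<Phi> g t) \<le> norm x0 + r" for t
      using in_ball[OF that, of t] norm_triangle_ineq2[of "\<Phi> g t" x0] by (simp add: dist_norm norm_minus_commute)
  qed
  have cS: "closed S"
  proof -
    have "S = PiC UNIV (\<lambda>_. cball x0 r)" unfolding S_def by (auto simp: mem_PiC_iff Pi_iff)
    then show ?thesis using closed_PiC[of UNIV "\<lambda>_. cball x0 r"] by simp
  qed
  have "\<exists>!g\<in>S. Bcontfun (\<Phi> g) = g"
  proof (rule Banach_fix[OF cS[folded complete_eq_closed]])
    show "S \<noteq> {}" unfolding S_def using r by (auto intro!: exI[of _ "const_bcontfun x0"] simp: const_bcontfun.rep_eq)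
    show "(0::real) \<le> 1/2" "(1/2::real) < 1" by auto
    show "(\<lambda>g. Bcontfun (\<Phi> g)) ` S \<subseteq> S"
      using in_ball bc by (auto simp: S_def Bcontfun_inverse)
    show "dist (Bcontfun (\<Phi> g)) (Bcontfun (\<Phi> k)) \<le> 1/2 * dist g k" if "g \<in> S" "k \<in> S" for g k
    proof (rule dist_bound)
      fix t
      have "\<Phi> g t - \<Phi> k t = integral {0..cl t} (\<lambda>\<tau>. f (g \<tau>) - f (k \<tau>))"
        unfolding \<Phi>_def using ch that by (subst integral_diff) (auto intro!: integrable_continuous_interval)
      also have "norm \<dots> \<le> (L * dist g k) * (cl t - 0)"
      proof (rule integral_bound)
        show "norm (f (g \<tau>) - f (k \<tau>)) \<le> L * dist g k" for \<tau>
        proof -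
          have "norm (f (g \<tau>) - f (k \<tau>)) \<le> L * norm (g \<tau> - k \<tau>)" by (rule lip) (use that in \<open>auto simp: S_def\<close>)
          also have "\<dots> \<le> L * dist g k" using dist_bounded[of g \<tau> k] L by (intro mult_left_mono) (auto simp: dist_norm)
          finally show ?thesis .
        qed
      qed (use cl(1)[of t] ch that in \<open>auto intro!: continuous_intros\<close>)
      also have "\<dots> \<le> (L * dist g k) * T" using cl(1)[of t] L by (intro mult_left_mono) auto
      also have "\<dots> \<le> 1/2 * dist g k" using mult_right_mono[OF TL, of "dist g k"] by (simp add: mult_ac)
      finally show "dist (apply_bcontfun (Bcontfun (\<Phi> g)) t) (apply_bcontfun (Bcontfun (\<Phi> k)) t) \<le> 1/2 * dist g k"
        using bc that by (simp add: Bcontfun_inverse dist_norm)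
    qed
  qed
  then obtain g where g: "g \<in> S" "Bcontfun (\<Phi> g) = g" by blast
  have gt: "g t = \<Phi> g t" for t using g bc[OF g(1)] by (metis Bcontfun_inverse)
  show ?thesis
  proof (rule that[of "apply_bcontfun g"])
    show "g 0 = x0" unfolding gt[of 0] \<Phi>_def cl_def using T by simp
    show "g t \<in> cball x0 r" for t using g(1) unfolding S_def by blast
    show "(apply_bcontfun g has_vector_derivative f (g t)) (at t within {0..T})" if t: "t \<in> {0..T}" for t
    proof (rule has_vector_derivative_transform[OF t])
      show "((\<lambda>t. x0 + integral {0..t} (\<lambda>\<tau>. f (g \<tau>))) has_vector_derivative f (g t)) (at t within {0..T})"
        using integral_has_vector_derivative[OF ch[OF g(1)] t] has_vector_derivative_add[OF has_vector_derivative_const] by fastforce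
      show "g s = x0 + integral {0..s} (\<lambda>\<tau>. f (g \<tau>))" if "s \<in> {0..T}" for s
        using gt[of s] that unfolding \<Phi>_def cl_def by simp
    qed
  qed
qed

instance bcontfun :: (metric_space, banach) banach ..

lemma bounded_linear_apply_bcontfun: "bounded_linear (\<lambda>f :: 'a::topological_space \<Rightarrow>\<^sub>C 'b::real_normed_vector. f s)"
  by (rule bounded_linear_intro[of _ 1]) (auto simp: plus_bcontfun.rep_eq scaleR_bcontfun.rep_eq norm_bounded)

text \<open>Convergence of \<open>X\<close> in the supremum norm is uniform in the second argument,
  so only the continuity of one slice has to be added.\<close>

lemma path_jointly_continuous:
  fixes X :: "real \<Rightarrow> (real \<Rightarrow>\<^sub>C real)"
  assumes "continuous_on S X"
  shows "continuous_on (S \<times> UNIV) (\<lambda>(t, s). X t s)"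
  unfolding continuous_on_sequentially
proof (intro allI ballI impI)
  fix p :: "nat \<Rightarrow> real \<times> real" and a
  assume a: "a \<in> S \<times> UNIV" and p: "(\<forall>n. p n \<in> S \<times> UNIV) \<and> p \<longlonglongrightarrow> a"
  have t: "(\<lambda>n. fst (p n)) \<longlonglongrightarrow> fst a" "(\<lambda>n. snd (p n)) \<longlonglongrightarrow> snd a" using p by (auto intro: tendsto_fst tendsto_snd)
  have "(\<lambda>n. X (fst (p n))) \<longlonglongrightarrow> X (fst a)"
    by (rule continuous_on_tendsto_compose[OF assms t(1)]) (use a p in \<open>auto simp: mem_Times_iff\<close>)
  then have d: "(\<lambda>n. dist (X (fst (p n))) (X (fst a))) \<longlonglongrightarrow> 0" by (rule tendsto_dist_iff[THEN iffD1])
  have "isCont (apply_bcontfun (X (fst a))) (snd a)"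
    by (metis UNIV_I continuous_on_apply_bcontfun continuous_on_eq_continuous_at open_UNIV)
  then have "(\<lambda>n. X (fst a) (snd (p n))) \<longlonglongrightarrow> X (fst a) (snd a)" by (rule isCont_tendsto_compose[OF _ t(2)])
  then have e: "(\<lambda>n. dist (X (fst a) (snd (p n))) (X (fst a) (snd a))) \<longlonglongrightarrow> 0" by (rule tendsto_dist_iff[THEN iffD1])
  have "(\<lambda>n. X (fst (p n)) (snd (p n))) \<longlonglongrightarrow> X (fst a) (snd a)"
  proof (rule tendsto_dist_iff[THEN iffD2], rule tendsto_sandwich[OF _ _ tendsto_const])
    show "(\<lambda>n. dist (X (fst (p n))) (X (fst a)) + dist (X (fst a) (snd (p n))) (X (fst a) (snd a))) \<longlonglongrightarrow> 0"
      using tendsto_add[OF d e] by simp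
    show "\<forall>\<^sub>F n in sequentially. dist (X (fst (p n)) (snd (p n))) (X (fst a) (snd a)) \<le>
        dist (X (fst (p n))) (X (fst a)) + dist (X (fst a) (snd (p n))) (X (fst a) (snd a))"
    proof (rule always_eventually, rule allI)
      fix n
      show "dist (X (fst (p n)) (snd (p n))) (X (fst a) (snd a)) \<le>
        dist (X (fst (p n))) (X (fst a)) + dist (X (fst a) (snd (p n))) (X (fst a) (snd a))"
        using dist_triangle[of "X (fst (p n)) (snd (p n))" "X (fst a) (snd a)" "X (fst a) (snd (p n))"]
          dist_bounded[of "X (fst (p n))" "snd (p n)" "X (fst a)"] by linarith
    qed
  qed auto
  then show "((\<lambda>(t, s). X t s) \<circ> p) \<longlonglongrightarrow> (case a of (t, s) \<Rightarrow> X t s)" by (simp add: o_def split_beta)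
qed

section \<open>The Lagrangian system\<close>

text \<open>With \<open>q t s\<close> the position at time \<open>t\<close> of the characteristic starting at \<open>s\<close>, the unknowns are
  \<open>U = u \<circ> q\<close>, \<open>w = u\<^sub>x \<circ> q\<close> and \<open>z = \<partial>\<^sub>s q\<close>. All estimates take place in the region \<open>good\<close>, where
  \<open>D\<close> dominates the terms of the system.\<close>

locale rch =
  fixes c1 c2 c3 :: real
begin

definition nonlin :: "real \<Rightarrow> real" where "nonlin y = c1 * y^2 + c2 * y^3 + c3 * y^4"
definition nonlin' :: "real \<Rightarrow> real" where "nonlin' y = 2 * c1 * y + 3 * c2 * y^2 + 4 * c3 * y^3"
text \<open>A bound for \<open>nonlin'\<close> on \<open>[-2, 2]\<close>: the monomials contribute
  \<open>2 * 2\<close>, \<open>3 * 4\<close> and \<open>4 * 8\<close>.\<close>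

definition Ch :: real where "Ch = 4 * \<bar>c1\<bar> + 12 * \<bar>c2\<bar> + 32 * \<bar>c3\<bar>"
text \<open>Chosen so that the flux in labels, at most \<open>(2 + 2 * Ch) * (3/2)\<close>, stays
  below \<open>D / 2\<close>; by the bound \<open>2 * B\<close> for bounded solutions both nonlocal
  halves are then at most \<open>D\<close>.\<close>

definition D :: real where "D = 8 * (1 + Ch)"

lemma Ch_nonneg: "Ch \<ge> 0" unfolding Ch_def by simp
lemma D_ge: "D \<ge> 8" unfolding D_def using Ch_nonneg by simp

lemma nonlin_deriv: "(nonlin has_real_derivative nonlin' y) (at y within A)"
  unfolding nonlin_def[abs_def] nonlin'_def by (auto intro!: derivative_eq_intros)

lemma nonlin'_bound: "\<bar>y\<bar> \<le> 2 \<Longrightarrow> \<bar>nonlin' y\<bar> \<le> Ch"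
proof -
  assume y: "\<bar>y\<bar> \<le> 2"
  have p: "\<bar>y\<bar>^2 \<le> 2^2" "\<bar>y\<bar>^3 \<le> 2^3" using y by (intro power_mono; simp)+
  have "\<bar>nonlin' y\<bar> \<le> \<bar>2 * c1 * y\<bar> + \<bar>3 * c2 * y^2\<bar> + \<bar>4 * c3 * y^3\<bar>"
    unfolding nonlin'_def by linarith
  also have "\<dots> = \<bar>c1\<bar> * (2 * \<bar>y\<bar>) + \<bar>c2\<bar> * (3 * \<bar>y\<bar>^2) + \<bar>c3\<bar> * (4 * \<bar>y\<bar>^3)"
    by (simp add: abs_mult power_abs)
  also have "\<dots> \<le> \<bar>c1\<bar> * 4 + \<bar>c2\<bar> * 12 + \<bar>c3\<bar> * 32"
    using y p by (intro add_mono mult_left_mono) auto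
  finally show ?thesis unfolding Ch_def by simp
qed

lemma nonlin_lipschitz: "\<bar>a\<bar> \<le> 2 \<Longrightarrow> \<bar>b\<bar> \<le> 2 \<Longrightarrow> \<bar>nonlin a - nonlin b\<bar> \<le> Ch * \<bar>a - b\<bar>"
  using field_differentiable_bound[of "{-2..2}" nonlin nonlin' Ch a b] nonlin_deriv nonlin'_bound by (auto simp: abs_le_iff)

lemma nonlin_bound: "\<bar>a\<bar> \<le> 2 \<Longrightarrow> \<bar>nonlin a\<bar> \<le> Ch * \<bar>a\<bar>"
  using nonlin_lipschitz[of a 0] by (simp add: nonlin_def)

lemma nonlin_bound2: "\<bar>a\<bar> \<le> 2 \<Longrightarrow> \<bar>nonlin a\<bar> \<le> 2 * Ch"
  using nonlin_bound[of a] mult_left_mono[of "\<bar>a\<bar>" 2 Ch] Ch_nonneg by simp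

section \<open>Pointwise bounds for the flux in the region \<open>good\<close>\<close>

definition flux :: "real \<Rightarrow> real \<Rightarrow> real" where "flux u w = w^2 / 2 + nonlin u"

text \<open>The factor \<open>z\<close> is the Jacobian of the passage from positions to labels;
  with it the two halves of the nonlocal term solve equations with coefficient
  \<open>z\<close>.\<close>

definition label_flux :: "(real \<Rightarrow> real) \<Rightarrow> (real \<Rightarrow> real) \<Rightarrow> (real \<Rightarrow> real) \<Rightarrow> real \<Rightarrow> real" where
  "label_flux U w z s = flux (U s) (w s) * z s"

lemma flux_bound: "\<bar>u\<bar> \<le> 2 \<Longrightarrow> \<bar>w\<bar> \<le> 2 \<Longrightarrow> \<bar>flux u w\<bar> \<le> 2 + 2 * Ch"
proof -
  assume a: "\<bar>u\<bar> \<le> 2" "\<bar>w\<bar> \<le> 2"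
  have "w^2 \<le> 4" using a(2) abs_le_square_iff[of w 2] by simp
  moreover have "0 \<le> w^2" by simp
  ultimately show ?thesis using nonlin_bound2[OF a(1)] unfolding flux_def by linarith
qed

lemma flux_lipschitz:
  assumes "\<bar>u\<bar> \<le> 2" "\<bar>w\<bar> \<le> 2" "\<bar>u'\<bar> \<le> 2" "\<bar>w'\<bar> \<le> 2"
  shows "\<bar>flux u w - flux u' w'\<bar> \<le> 2 * \<bar>w - w'\<bar> + Ch * \<bar>u - u'\<bar>"
proof -
  have "w^2 / 2 - w'^2 / 2 = (w + w') / 2 * (w - w')" by (simp add: power2_eq_square field_simps)
  then have "\<bar>w^2 / 2 - w'^2 / 2\<bar> = \<bar>(w + w') / 2\<bar> * \<bar>w - w'\<bar>" by (simp only: abs_mult)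
  also have "\<dots> \<le> 2 * \<bar>w - w'\<bar>" using assms by (intro mult_right_mono) auto
  finally show ?thesis using nonlin_lipschitz[OF assms(1,3)] unfolding flux_def by linarith
qed

text \<open>The data are bounded by 1, so there is room for the unknowns to move. The lower bound on
  \<open>z\<close> is what the theory of bounded solutions demands, and later it makes the flow
  invertible.\<close>

definition good :: "(real \<Rightarrow> real) \<Rightarrow> (real \<Rightarrow> real) \<Rightarrow> (real \<Rightarrow> real) \<Rightarrow> bool" where
  "good U w z \<longleftrightarrow> continuous_on UNIV U \<and> continuous_on UNIV w \<and> continuous_on UNIV z \<and>
     (\<forall>s. \<bar>U s\<bar> \<le> 2 \<and> \<bar>w s\<bar> \<le> 2 \<and> 1/2 \<le> z s \<and> z s \<le> 3/2)"

lemma goodD: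
  assumes "good U w z"
  shows "continuous_on UNIV U" "continuous_on UNIV w" "continuous_on UNIV z"
    "\<bar>U s\<bar> \<le> 2" "\<bar>w s\<bar> \<le> 2" "1/2 \<le> z s" "z s \<le> 3/2"
    "continuous_on UNIV (label_flux U w z)" "\<bar>label_flux U w z s\<bar> \<le> D / 2"
proof -
  show g: "continuous_on UNIV U" "continuous_on UNIV w" "continuous_on UNIV z"
    "\<bar>U s\<bar> \<le> 2" "\<bar>w s\<bar> \<le> 2" "1/2 \<le> z s" "z s \<le> 3/2" using assms unfolding good_def by auto
  show "continuous_on UNIV (label_flux U w z)"
    unfolding label_flux_def[abs_def] flux_def nonlin_def by (intro continuous_intros g) auto
  have "\<bar>label_flux U w z s\<bar> \<le> (2 + 2 * Ch) * (3/2)"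
    unfolding label_flux_def abs_mult using flux_bound[OF g(4,5)] g(6,7) Ch_nonneg by (intro mult_mono) auto
  then show "\<bar>label_flux U w z s\<bar> \<le> D / 2" unfolding D_def using Ch_nonneg by simp
qed

lemma good_left:
  assumes "good U w z"
  shows "(left_sol z (label_flux U w z) has_real_derivative label_flux U w z s - z s * left_sol z (label_flux U w z) s) (at s)"
    "\<bar>left_sol z (label_flux U w z) s\<bar> \<le> D"
  using left_sol[OF goodD(3,6,8,9)[OF assms]] by (auto simp: algebra_simps)

lemma good_right:
  assumes "good U w z"
  shows "(right_sol z (label_flux U w z) has_real_derivative z s * right_sol z (label_flux U w z) s - label_flux U w z s) (at s)"
    "\<bar>right_sol z (label_flux U w z) s\<bar> \<le> D"
  using right_sol[OF goodD(3,6,8,9)[OF assms]] by (auto simp: algebra_simps)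

lemma label_flux_lipschitz:
  assumes g: "good U w z" "good U' w' z'" and d: "\<And>s. \<bar>U s - U' s\<bar> \<le> d" "\<And>s. \<bar>w s - w' s\<bar> \<le> d" "\<And>s. \<bar>z s - z' s\<bar> \<le> d"
  shows "\<bar>label_flux U w z s - label_flux U' w' z' s\<bar> \<le> D * d"
proof -
  have d0: "d \<ge> 0" using d(1)[of 0] by linarith
  let ?P = "flux (U s) (w s)" and ?P' = "flux (U' s) (w' s)"
  have "label_flux U w z s - label_flux U' w' z' s = (?P - ?P') * z s + ?P' * (z s - z' s)"
    unfolding label_flux_def by (simp add: algebra_simps)
  then have "\<bar>label_flux U w z s - label_flux U' w' z' s\<bar> \<le> \<bar>?P - ?P'\<bar> * \<bar>z s\<bar> + \<bar>?P'\<bar> * \<bar>z s - z' s\<bar>"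
    by (metis abs_mult abs_triangle_ineq)
  also have "\<dots> \<le> ((2 + Ch) * d) * (3/2) + (2 + 2 * Ch) * d"
  proof (intro add_mono mult_mono)
    have "\<bar>?P - ?P'\<bar> \<le> 2 * \<bar>w s - w' s\<bar> + Ch * \<bar>U s - U' s\<bar>"
      by (rule flux_lipschitz) (use g[THEN goodD(4)] g[THEN goodD(5)] in auto)
    also have "\<dots> \<le> 2 * d + Ch * d" using d Ch_nonneg by (intro add_mono mult_left_mono) auto
    finally show "\<bar>?P - ?P'\<bar> \<le> (2 + Ch) * d" by (simp add: algebra_simps)
    show "\<bar>z s\<bar> \<le> 3/2" using goodD(6,7)[OF g(1), of s] by simp
    show "\<bar>?P'\<bar> \<le> 2 + 2 * Ch" by (rule flux_bound) (use goodD(4,5)[OF g(2)] in auto)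
  qed (use d d0 Ch_nonneg in auto)
  also have "\<dots> = (5 + 7/2 * Ch) * d" by (simp add: algebra_simps)
  also have "\<dots> \<le> D * d" unfolding D_def using d0 Ch_nonneg by (intro mult_right_mono) auto
  finally show ?thesis .
qed

lemma good_lipschitz:
  assumes g: "good U w z" "good U' w' z'" and d: "\<And>s. \<bar>U s - U' s\<bar> \<le> d" "\<And>s. \<bar>w s - w' s\<bar> \<le> d" "\<And>s. \<bar>z s - z' s\<bar> \<le> d"
  shows "\<bar>left_sol z (label_flux U w z) s - left_sol z' (label_flux U' w' z') s\<bar> \<le> 4 * D * d"
    "\<bar>right_sol z (label_flux U w z) s - right_sol z' (label_flux U' w' z') s\<bar> \<le> 4 * D * d"
proof -
  have e: "2 * (D * d + d * (2 * (D / 2))) = 4 * D * d" by simp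
  show "\<bar>left_sol z (label_flux U w z) s - left_sol z' (label_flux U' w' z') s\<bar> \<le> 4 * D * d"
    using left_sol_lipschitz[OF goodD(3,6,8,9)[OF g(1)] goodD(3,6,8,9)[OF g(2)] d(3) label_flux_lipschitz[OF g d], of s] unfolding e .
  show "\<bar>right_sol z (label_flux U w z) s - right_sol z' (label_flux U' w' z') s\<bar> \<le> 4 * D * d"
    using right_sol_lipschitz[OF goodD(3,6,8,9)[OF g(1)] goodD(3,6,8,9)[OF g(2)] d(3) label_flux_lipschitz[OF g d], of s] unfolding e .
qed

section \<open>The system as a vector field on triples of bounded continuous functions\<close>

definition Lb :: "(real \<Rightarrow>\<^sub>C real) \<Rightarrow> (real \<Rightarrow>\<^sub>C real) \<Rightarrow> (real \<Rightarrow>\<^sub>C real) \<Rightarrow> real \<Rightarrow>\<^sub>C real" where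
  "Lb U w z = Bcontfun (left_sol z (label_flux U w z))"

definition Rb :: "(real \<Rightarrow>\<^sub>C real) \<Rightarrow> (real \<Rightarrow>\<^sub>C real) \<Rightarrow> (real \<Rightarrow>\<^sub>C real) \<Rightarrow> real \<Rightarrow>\<^sub>C real" where
  "Rb U w z = Bcontfun (right_sol z (label_flux U w z))"

definition Fw :: "(real \<Rightarrow>\<^sub>C real) \<Rightarrow> (real \<Rightarrow>\<^sub>C real) \<Rightarrow> real \<Rightarrow>\<^sub>C real" where
  "Fw U w = Bcontfun (\<lambda>s. nonlin (U s) - (w s)^2 / 2)"

definition Fz :: "(real \<Rightarrow>\<^sub>C real) \<Rightarrow> (real \<Rightarrow>\<^sub>C real) \<Rightarrow> real \<Rightarrow>\<^sub>C real" where
  "Fz w z = Bcontfun (\<lambda>s. w s * z s)"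

text \<open>Differentiating the equation in space gives \<open>w\<^sub>t + w\<^sup>2 = P - (1 -
  \<partial>\<^sub>x\<^sub>x)^{-1} P\<close> along characteristics, with
  \<open>P = w\<^sup>2 / 2 + nonlin U\<close>; this is the middle component. No component contains a
  derivative of an unknown, so the field is Lipschitz in the supremum norm.\<close>

definition Fb :: "(real \<Rightarrow>\<^sub>C real) \<times> (real \<Rightarrow>\<^sub>C real) \<times> (real \<Rightarrow>\<^sub>C real) \<Rightarrow> (real \<Rightarrow>\<^sub>C real) \<times> (real \<Rightarrow>\<^sub>C real) \<times> (real \<Rightarrow>\<^sub>C real)" where
  "Fb X = (case X of (U, w, z) \<Rightarrow> ((1/2) *\<^sub>R (Lb U w z - Rb U w z),
      Fw U w - (1/2) *\<^sub>R (Lb U w z + Rb U w z), Fz w z))"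

lemma bcontfun_apply_good:
  fixes U w z :: "real \<Rightarrow>\<^sub>C real"
  assumes "good U w z"
  shows "Lb U w z s = left_sol z (label_flux U w z) s" "Rb U w z s = right_sol z (label_flux U w z) s"
    "Fw U w s = nonlin (U s) - (w s)^2 / 2" "Fz w z s = w s * z s"
    "\<bar>Fw U w s\<bar> \<le> D" "\<bar>Fz w z s\<bar> \<le> D"
proof -
  note g = goodD[OF assms]
  have cl: "continuous_on UNIV (left_sol z (label_flux U w z))" "continuous_on UNIV (right_sol z (label_flux U w z))"
    by (rule continuous_at_imp_continuous_on, rule ballI, rule DERIV_isCont, rule good_left(1)[OF assms])
      (rule continuous_at_imp_continuous_on, rule ballI, rule DERIV_isCont, rule good_right(1)[OF assms])
  have "left_sol z (label_flux U w z) \<in> bcontfun"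
    by (rule bcontfun_normI[OF cl(1), of D]) (use good_left(2)[OF assms] in simp)
  then show "Lb U w z s = left_sol z (label_flux U w z) s" unfolding Lb_def by (simp add: Bcontfun_inverse)
  have "right_sol z (label_flux U w z) \<in> bcontfun"
    by (rule bcontfun_normI[OF cl(2), of D]) (use good_right(2)[OF assms] in simp)
  then show "Rb U w z s = right_sol z (label_flux U w z) s" unfolding Rb_def by (simp add: Bcontfun_inverse)
  have b1: "\<bar>nonlin (U s) - (w s)^2 / 2\<bar> \<le> D" for s
  proof -
    have "(w s)^2 \<le> 4" using g(5)[of s] abs_le_square_iff[of "w s" 2] by simp
    moreover have "0 \<le> (w s)^2" by simp
    moreover have "nonlin (U s) \<le> 2 * Ch" "- nonlin (U s) \<le> 2 * Ch" using nonlin_bound2[OF g(4)[of s]] by auto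
    ultimately show ?thesis using Ch_nonneg unfolding D_def distrib_left by (intro abs_leI) linarith+
  qed
  have b2: "\<bar>w s * z s\<bar> \<le> D" for s
  proof -
    have "\<bar>w s * z s\<bar> \<le> 2 * (3/2)" unfolding abs_mult using g(5,6,7)[of s] by (intro mult_mono) auto
    then show ?thesis using D_ge by simp
  qed
  have "(\<lambda>s. nonlin (U s) - (w s)^2 / 2) \<in> bcontfun"
  proof (rule bcontfun_normI)
    show "continuous_on UNIV (\<lambda>s. nonlin (U s) - (w s)^2 / 2)" unfolding nonlin_def by (intro continuous_intros g) auto
    show "norm (nonlin (U s) - (w s)^2 / 2) \<le> D" for s using b1[of s] by simp
  qed
  then show e1: "Fw U w s = nonlin (U s) - (w s)^2 / 2" unfolding Fw_def by (simp add: Bcontfun_inverse)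
  have "(\<lambda>s. w s * z s) \<in> bcontfun"
    by (rule bcontfun_normI[of _ D]) (use g b2 in \<open>auto intro!: continuous_intros\<close>)
  then show e2: "Fz w z s = w s * z s" unfolding Fz_def by (simp add: Bcontfun_inverse)
  show "\<bar>Fw U w s\<bar> \<le> D" "\<bar>Fz w z s\<bar> \<le> D" unfolding e1 e2 by (rule b1 b2)+
qed

lemma norm_triple_le: "norm (a, b, c) \<le> norm a + norm b + norm c"
  using norm_Pair_le[of a "(b, c)"] norm_Pair_le[of b c] by simp

lemma norm_triple_ge:
  fixes a :: "'a::real_normed_vector" and b :: "'b::real_normed_vector" and c :: "'c::real_normed_vector"
  shows "norm a \<le> norm (a, b, c)" "norm b \<le> norm (a, b, c)" "norm c \<le> norm (a, b, c)"
  using norm_fst_le[of a "(b, c)"] norm_snd_le[of "(b, c)" a] norm_fst_le[of b c] norm_snd_le[of c b]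
  by linarith+

lemma Lb_Rb_lipschitz:
  fixes U w z U' w' z' :: "real \<Rightarrow>\<^sub>C real"
  assumes g: "good U w z" "good U' w' z'"
  shows "norm (Lb U w z - Lb U' w' z') \<le> 4 * D * norm ((U, w, z) - (U', w', z'))"
    "norm (Rb U w z - Rb U' w' z') \<le> 4 * D * norm ((U, w, z) - (U', w', z'))"
proof -
  let ?d = "norm ((U, w, z) - (U', w', z'))"
  have d: "\<bar>U s - U' s\<bar> \<le> ?d" "\<bar>w s - w' s\<bar> \<le> ?d" "\<bar>z s - z' s\<bar> \<le> ?d" for s
    using norm_triple_ge[where a = "U - U'" and b = "w - w'" and c = "z - z'"]
      norm_bounded[of "U - U'" s] norm_bounded[of "w - w'" s] norm_bounded[of "z - z'" s]
    by (auto simp: minus_bcontfun.rep_eq)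
  show "norm (Lb U w z - Lb U' w' z') \<le> 4 * D * ?d"
    by (rule norm_bound) (use good_lipschitz(1)[OF g d] in \<open>simp add: minus_bcontfun.rep_eq bcontfun_apply_good(1)[OF g(1)] bcontfun_apply_good(1)[OF g(2)]\<close>)
  show "norm (Rb U w z - Rb U' w' z') \<le> 4 * D * ?d"
    by (rule norm_bound) (use good_lipschitz(2)[OF g d] in \<open>simp add: minus_bcontfun.rep_eq bcontfun_apply_good(2)[OF g(1)] bcontfun_apply_good(2)[OF g(2)]\<close>)
qed

lemma Fw_Fz_lipschitz:
  fixes U w z U' w' z' :: "real \<Rightarrow>\<^sub>C real"
  assumes g: "good U w z" "good U' w' z'"
  shows "norm (Fw U w - Fw U' w') \<le> D * norm ((U, w, z) - (U', w', z'))"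
    "norm (Fz w z - Fz w' z') \<le> D * norm ((U, w, z) - (U', w', z'))"
proof -
  let ?d = "norm ((U, w, z) - (U', w', z'))"
  have d: "\<bar>U s - U' s\<bar> \<le> ?d" "\<bar>w s - w' s\<bar> \<le> ?d" "\<bar>z s - z' s\<bar> \<le> ?d" for s
    using norm_triple_ge[where a = "U - U'" and b = "w - w'" and c = "z - z'"]
      norm_bounded[of "U - U'" s] norm_bounded[of "w - w'" s] norm_bounded[of "z - z'" s]
    by (auto simp: minus_bcontfun.rep_eq)
  show "norm (Fw U w - Fw U' w') \<le> D * ?d"
  proof (rule norm_bound)
    fix s
    have "(w s)^2 / 2 - (w' s)^2 / 2 = (w s + w' s) / 2 * (w s - w' s)" by (simp add: power2_eq_square field_simps)
    then have "\<bar>(w s)^2 / 2 - (w' s)^2 / 2\<bar> = \<bar>(w s + w' s) / 2\<bar> * \<bar>w s - w' s\<bar>" by (simp only: abs_mult)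
    also have "\<dots> \<le> 2 * ?d" using goodD(5)[OF g(1), of s] goodD(5)[OF g(2), of s] d(2) by (intro mult_mono) auto
    finally have 1: "\<bar>(w s)^2 / 2 - (w' s)^2 / 2\<bar> \<le> 2 * ?d" .
    have "\<bar>nonlin (U s) - nonlin (U' s)\<bar> \<le> Ch * \<bar>U s - U' s\<bar>"
      by (rule nonlin_lipschitz) (use goodD(4)[OF g(1)] goodD(4)[OF g(2)] in auto)
    also have "\<dots> \<le> Ch * ?d" using d(1) Ch_nonneg by (intro mult_left_mono)
    finally have 2: "\<bar>nonlin (U s) - nonlin (U' s)\<bar> \<le> Ch * ?d" .
    have "(2 + Ch) * ?d \<le> D * ?d" unfolding D_def using Ch_nonneg by (intro mult_right_mono) auto
    then show "norm ((Fw U w - Fw U' w') s) \<le> D * ?d"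
      using 1 2 by (simp add: minus_bcontfun.rep_eq bcontfun_apply_good(3)[OF g(1)] bcontfun_apply_good(3)[OF g(2)] algebra_simps abs_le_iff)
  qed
  show "norm (Fz w z - Fz w' z') \<le> D * ?d"
  proof (rule norm_bound)
    fix s
    have "w s * z s - w' s * z' s = (w s - w' s) * z s + w' s * (z s - z' s)" by (simp add: algebra_simps)
    then have "\<bar>w s * z s - w' s * z' s\<bar> \<le> \<bar>w s - w' s\<bar> * \<bar>z s\<bar> + \<bar>w' s\<bar> * \<bar>z s - z' s\<bar>"
      by (metis abs_mult abs_triangle_ineq)
    also have "\<dots> \<le> ?d * (3/2) + 2 * ?d"
      using d goodD(6,7)[OF g(1), of s] goodD(5)[OF g(2), of s] by (intro add_mono mult_mono) auto
    also have "\<dots> \<le> 8 * ?d" by simp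
    also have "\<dots> \<le> D * ?d" using D_ge by (intro mult_right_mono) auto
    finally show "norm ((Fz w z - Fz w' z') s) \<le> D * ?d"
      by (simp add: minus_bcontfun.rep_eq bcontfun_apply_good(4)[OF g(1)] bcontfun_apply_good(4)[OF g(2)])
  qed
qed

lemma Fb_bound:
  fixes U w z :: "real \<Rightarrow>\<^sub>C real"
  assumes g: "good U w z"
  shows "norm (Fb (U, w, z)) \<le> 4 * D"
proof -
  have l: "norm (Lb U w z) \<le> D" "norm (Rb U w z) \<le> D"
    by (rule norm_bound, use good_left(2)[OF g] good_right(2)[OF g] bcontfun_apply_good[OF g] in simp)+
  have f: "norm (Fw U w) \<le> D" "norm (Fz w z) \<le> D"
    by (rule norm_bound, use bcontfun_apply_good(5,6)[OF g] in simp)+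
  have "norm ((1/2) *\<^sub>R (Lb U w z - Rb U w z)) \<le> D"
    using norm_triangle_ineq4[of "Lb U w z" "Rb U w z"] l by simp
  moreover have "norm (Fw U w - (1/2) *\<^sub>R (Lb U w z + Rb U w z)) \<le> 2 * D"
  proof -
    have "norm ((1/2) *\<^sub>R (Lb U w z + Rb U w z)) \<le> D"
      using norm_triangle_ineq[of "Lb U w z" "Rb U w z"] l by simp
    then show ?thesis using norm_triangle_ineq4[of "Fw U w" "(1/2) *\<^sub>R (Lb U w z + Rb U w z)"] f by linarith
  qed
  ultimately show ?thesis unfolding Fb_def
    using norm_triple_le[of "(1/2) *\<^sub>R (Lb U w z - Rb U w z)" "Fw U w - (1/2) *\<^sub>R (Lb U w z + Rb U w z)" "Fz w z"] f
    by simp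
qed

lemma Fb_lipschitz:
  fixes U w z U' w' z' :: "real \<Rightarrow>\<^sub>C real"
  assumes g: "good U w z" "good U' w' z'"
  shows "norm (Fb (U, w, z) - Fb (U', w', z')) \<le> 10 * D * norm ((U, w, z) - (U', w', z'))"
proof -
  let ?d = "norm ((U, w, z) - (U', w', z'))"
  let ?L = "Lb U w z - Lb U' w' z'" and ?R = "Rb U w z - Rb U' w' z'"
  note l = Lb_Rb_lipschitz[OF g] and f = Fw_Fz_lipschitz[OF g]
  have eq: "Fb (U, w, z) - Fb (U', w', z') = ((1/2) *\<^sub>R (?L - ?R), (Fw U w - Fw U' w') - (1/2) *\<^sub>R (?L + ?R), Fz w z - Fz w' z')"
    unfolding Fb_def by (simp add: algebra_simps)
  have "norm ((1/2) *\<^sub>R (?L - ?R)) \<le> 4 * D * ?d"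
    using norm_triangle_ineq4[of ?L ?R] l by simp
  moreover have "norm ((Fw U w - Fw U' w') - (1/2) *\<^sub>R (?L + ?R)) \<le> 5 * D * ?d"
  proof -
    have "norm ((1/2) *\<^sub>R (?L + ?R)) \<le> 4 * D * ?d"
      using norm_triangle_ineq[of ?L ?R] l by simp
    then show ?thesis using norm_triangle_ineq4[of "Fw U w - Fw U' w'" "(1/2) *\<^sub>R (?L + ?R)"] f by linarith
  qed
  ultimately show ?thesis unfolding eq
    using norm_triple_le[of "(1/2) *\<^sub>R (?L - ?R)" "(Fw U w - Fw U' w') - (1/2) *\<^sub>R (?L + ?R)" "Fz w z - Fz w' z'"] f
    by linarith
qed

lemma lagrangian_solution:
  assumes u0: "continuous_on UNIV u0" "\<And>s. \<bar>u0 s\<bar> \<le> 1" and w0: "continuous_on UNIV w0" "\<And>s. \<bar>w0 s\<bar> \<le> 1"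
    and T: "T > 0" "T \<le> 1 / (20 * D)"
  obtains U w z where
    "\<And>t. t \<in> {0..T} \<Longrightarrow> good (U t) (w t) (z t)"
    "continuous_on ({0..T} \<times> UNIV) (\<lambda>(t, s). U t s)"
    "continuous_on ({0..T} \<times> UNIV) (\<lambda>(t, s). w t s)"
    "continuous_on ({0..T} \<times> UNIV) (\<lambda>(t, s). z t s)"
    "continuous_on ({0..T} \<times> UNIV) (\<lambda>(t, s). left_sol (z t) (label_flux (U t) (w t) (z t)) s)"
    "continuous_on ({0..T} \<times> UNIV) (\<lambda>(t, s). right_sol (z t) (label_flux (U t) (w t) (z t)) s)"
    "\<And>t s. t \<in> {0..T} \<Longrightarrow> ((\<lambda>t. U t s) has_real_derivative
        (left_sol (z t) (label_flux (U t) (w t) (z t)) s - right_sol (z t) (label_flux (U t) (w t) (z t)) s) / 2) (at t within {0..T})"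
    "\<And>t s. t \<in> {0..T} \<Longrightarrow> ((\<lambda>t. w t s) has_real_derivative nonlin (U t s) - (w t s)^2 / 2 -
        (left_sol (z t) (label_flux (U t) (w t) (z t)) s + right_sol (z t) (label_flux (U t) (w t) (z t)) s) / 2) (at t within {0..T})"
    "\<And>t s. t \<in> {0..T} \<Longrightarrow> ((\<lambda>t. z t s) has_real_derivative w t s * z t s) (at t within {0..T})"
    "U 0 = u0" "w 0 = w0" "z 0 = (\<lambda>s. 1)"
proof -
  define ub wb zb where "ub = Bcontfun u0" and "wb = Bcontfun w0" and "zb = (const_bcontfun 1 :: real \<Rightarrow>\<^sub>C real)"
  have b: "ub s = u0 s" "wb s = w0 s" "zb s = 1" for s
    unfolding ub_def wb_def zb_def using bcontfun_normI[OF u0(1), of 1] bcontfun_normI[OF w0(1), of 1] u0(2) w0(2)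
    by (auto simp: Bcontfun_inverse const_bcontfun.rep_eq)
  have ball: "good (fst X) (fst (snd X)) (snd (snd X))" if X: "X \<in> cball (ub, wb, zb) (1/2)" for X
  proof -
    obtain U w z where UX: "X = (U, w, z)" by (metis prod.collapse)
    have "dist X (ub, wb, zb) \<le> 1/2" using X by (simp add: dist_commute)
    then have n: "norm ((U - ub, w - wb, z - zb)) \<le> 1/2" unfolding UX dist_norm by simp
    have "\<bar>U s - u0 s\<bar> \<le> 1/2" "\<bar>w s - w0 s\<bar> \<le> 1/2" "\<bar>z s - 1\<bar> \<le> 1/2" for s
      using norm_triple_ge[where a = "U - ub" and b = "w - wb" and c = "z - zb"] n
        norm_bounded[of "U - ub" s] norm_bounded[of "w - wb" s] norm_bounded[of "z - zb" s]
      by (auto simp: minus_bcontfun.rep_eq b)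
    note a = this
    have "\<bar>U s\<bar> \<le> 2 \<and> \<bar>w s\<bar> \<le> 2 \<and> 1/2 \<le> z s \<and> z s \<le> 3/2" for s
      using a[of s] u0(2)[of s] w0(2)[of s] by linarith
    then show ?thesis unfolding good_def UX by simp
  qed
  have D0: "D > 0" using D_ge by simp
  \<comment> \<open>The constant 20 is dictated by the contraction: the field has Lipschitz constant
    \<open>10 * D\<close>, and \<open>T * (10 * D) \<le> 1/2\<close> is required. The bound
    \<open>4 * D\<close> then keeps the path in the ball of radius \<open>1/2\<close>.\<close>
  have TD: "T * D \<le> 1/20" using T D0 by (simp add: field_simps)
  obtain X where X: "X 0 = (ub, wb, zb)" "\<And>t. t \<in> {0..T} \<Longrightarrow> X t \<in> cball (ub, wb, zb) (1/2)"
    "\<And>t. t \<in> {0..T} \<Longrightarrow> (X has_vector_derivative Fb (X t)) (at t within {0..T})"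
  proof (rule banach_ode[OF T(1), of "(ub, wb, zb)" "1/2" Fb "10 * D" "4 * D"])
    show "norm (Fb X - Fb Y) \<le> 10 * D * norm (X - Y)" if "X \<in> cball (ub, wb, zb) (1/2)" "Y \<in> cball (ub, wb, zb) (1/2)" for X Y
      using Fb_lipschitz[OF ball[OF that(1)] ball[OF that(2)]] by simp
    show "norm (Fb X) \<le> 4 * D" if "X \<in> cball (ub, wb, zb) (1/2)" for X
      using Fb_bound[OF ball[OF that]] by simp
  qed (use TD D0 in auto)
  define U w z where "U = (\<lambda>t. fst (X t))" and "w = (\<lambda>t. fst (snd (X t)))" and "z = (\<lambda>t. snd (snd (X t)))"
  have good: "good (U t) (w t) (z t)" if "t \<in> {0..T}" for t
    using ball[OF X(2)[OF that]] unfolding U_def w_def z_def .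
  have Xeq: "X t = (U t, w t, z t)" for t unfolding U_def w_def z_def by simp
  have cX: "continuous_on {0..T} X"
    using X(3) has_vector_derivative_continuous continuous_on_eq_continuous_within by blast
  have cU: "continuous_on {0..T} U" "continuous_on {0..T} w" "continuous_on {0..T} z"
    unfolding U_def w_def z_def using cX by (auto intro!: continuous_intros)
  \<comment> \<open>The nonlocal halves are given by a choice operator, so their continuity in time
    is drawn from their Lipschitz dependence on the unknowns.\<close>
  have lip: "continuous_on {0..T} G" if "\<And>t t'. t \<in> {0..T} \<Longrightarrow> t' \<in> {0..T} \<Longrightarrow> norm (G t - G t') \<le> 4 * D * norm (X t - X t')" for G :: "real \<Rightarrow> (real \<Rightarrow>\<^sub>C real)"
    unfolding continuous_on_def
  proof
    fix t assume t: "t \<in> {0..T}"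
    have "((\<lambda>t'. 4 * D * norm (X t' - X t)) \<longlongrightarrow> 0) (at t within {0..T})"
      using cX t unfolding continuous_on_def by (auto intro!: tendsto_eq_intros)
    moreover have "\<forall>\<^sub>F t' in at t within {0..T}. norm (G t' - G t) \<le> 4 * D * norm (X t' - X t)"
      unfolding eventually_at_filter using that t by (auto intro: always_eventually)
    ultimately have "((\<lambda>t'. G t' - G t) \<longlongrightarrow> 0) (at t within {0..T})" by (rule Lim_null_comparison[rotated])
    then show "(G \<longlongrightarrow> G t) (at t within {0..T})" by (rule LIM_zero_cancel)
  qed
  have cL: "continuous_on {0..T} (\<lambda>t. Lb (U t) (w t) (z t))" "continuous_on {0..T} (\<lambda>t. Rb (U t) (w t) (z t))"
    using Lb_Rb_lipschitz[OF good good] by (intro lip; simp add: Xeq)+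
  have ap: "bounded_linear (\<lambda>Y. apply_bcontfun (fst Y) s)" "bounded_linear (\<lambda>Y. apply_bcontfun (fst (snd Y)) s)"
    "bounded_linear (\<lambda>Y. apply_bcontfun (snd (snd Y)) s)" for s :: real and Y :: "(real \<Rightarrow>\<^sub>C real) \<times> (real \<Rightarrow>\<^sub>C real) \<times> (real \<Rightarrow>\<^sub>C real)"
    by (auto intro!: bounded_linear_compose[OF bounded_linear_apply_bcontfun] bounded_linear_intros bounded_linear_fst_comp bounded_linear_snd_comp bounded_linear_ident)
  show ?thesis
  proof (rule that[of "\<lambda>t. apply_bcontfun (U t)" "\<lambda>t. apply_bcontfun (w t)" "\<lambda>t. apply_bcontfun (z t)"])
    show "good (U t) (w t) (z t)" if "t \<in> {0..T}" for t by (rule good[OF that])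
    show "continuous_on ({0..T} \<times> UNIV) (\<lambda>(t, s). U t s)" by (rule path_jointly_continuous[OF cU(1)])
    show "continuous_on ({0..T} \<times> UNIV) (\<lambda>(t, s). w t s)" by (rule path_jointly_continuous[OF cU(2)])
    show "continuous_on ({0..T} \<times> UNIV) (\<lambda>(t, s). z t s)" by (rule path_jointly_continuous[OF cU(3)])
    show "continuous_on ({0..T} \<times> UNIV) (\<lambda>(t, s). left_sol (z t) (label_flux (U t) (w t) (z t)) s)"
      by (rule continuous_on_eq[OF path_jointly_continuous[OF cL(1)]]) (auto simp: bcontfun_apply_good(1)[OF good])
    show "continuous_on ({0..T} \<times> UNIV) (\<lambda>(t, s). right_sol (z t) (label_flux (U t) (w t) (z t)) s)"
      by (rule continuous_on_eq[OF path_jointly_continuous[OF cL(2)]]) (auto simp: bcontfun_apply_good(2)[OF good])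
    fix t s assume t: "t \<in> {0..T}"
    note ev = bcontfun_apply_good[OF good[OF t], of s]
    have e: "fst (Fb (X t)) s = (left_sol (z t) (label_flux (U t) (w t) (z t)) s - right_sol (z t) (label_flux (U t) (w t) (z t)) s) / 2"
      "fst (snd (Fb (X t))) s = nonlin (U t s) - (w t s)^2 / 2 - (left_sol (z t) (label_flux (U t) (w t) (z t)) s + right_sol (z t) (label_flux (U t) (w t) (z t)) s) / 2"
      "snd (snd (Fb (X t))) s = w t s * z t s"
      unfolding Xeq Fb_def by (simp_all add: ev minus_bcontfun.rep_eq plus_bcontfun.rep_eq scaleR_bcontfun.rep_eq)
    show "((\<lambda>t. U t s) has_real_derivative
        (left_sol (z t) (label_flux (U t) (w t) (z t)) s - right_sol (z t) (label_flux (U t) (w t) (z t)) s) / 2) (at t within {0..T})"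
      using bounded_linear.has_vector_derivative[OF ap(1) X(3)[OF t], of s] unfolding e
      by (simp add: has_real_derivative_iff_has_vector_derivative U_def)
    show "((\<lambda>t. w t s) has_real_derivative nonlin (U t s) - (w t s)^2 / 2 -
        (left_sol (z t) (label_flux (U t) (w t) (z t)) s + right_sol (z t) (label_flux (U t) (w t) (z t)) s) / 2) (at t within {0..T})"
      using bounded_linear.has_vector_derivative[OF ap(2) X(3)[OF t], of s] unfolding e
      by (simp add: has_real_derivative_iff_has_vector_derivative w_def)
    show "((\<lambda>t. z t s) has_real_derivative w t s * z t s) (at t within {0..T})"
      using bounded_linear.has_vector_derivative[OF ap(3) X(3)[OF t], of s] unfolding e
      by (simp add: has_real_derivative_iff_has_vector_derivative z_def)
  next
    show "apply_bcontfun (U 0) = u0" "apply_bcontfun (w 0) = w0" "apply_bcontfun (z 0) = (\<lambda>s. 1)"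
      unfolding U_def w_def z_def X(1) by (auto simp: b)
  qed
qed

end

section \<open>Joint smoothness in the space variable\<close>

text \<open>Only space derivatives are counted, each jointly continuous in time and space: that is
  what differentiation under a time integral needs and what yields convergence uniform on compact
  sets. Asking for some derivative at each order, instead of iterating \<open>ddx\<close>, makes the
  closure rules plain inductions.\<close>

fun space_smooth :: "real \<Rightarrow> nat \<Rightarrow> (real \<Rightarrow> real \<Rightarrow> real) \<Rightarrow> bool" where
  "space_smooth T 0 g \<longleftrightarrow> continuous_on ({0..T} \<times> UNIV) (\<lambda>(t, s). g t s)"
| "space_smooth T (Suc n) g \<longleftrightarrow> continuous_on ({0..T} \<times> UNIV) (\<lambda>(t, s). g t s) \<and>
     (\<exists>g'. (\<forall>t\<in>{0..T}. \<forall>s. (g t has_real_derivative g' t s) (at s)) \<and> space_smooth T n g')"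

lemma space_smooth_continuous: "space_smooth T n g \<Longrightarrow> continuous_on ({0..T} \<times> UNIV) (\<lambda>(t, s). g t s)"
  by (cases n) auto

lemma space_smooth_SucI:
  assumes "continuous_on ({0..T} \<times> UNIV) (\<lambda>(t, s). g t s)"
    "\<And>t s. t \<in> {0..T} \<Longrightarrow> (g t has_real_derivative g' t s) (at s)" "space_smooth T n g'"
  shows "space_smooth T (Suc n) g"
  unfolding space_smooth.simps using assms by blast

lemma space_smooth_SucE:
  assumes "space_smooth T (Suc n) g"
  obtains g' where "\<And>t s. t \<in> {0..T} \<Longrightarrow> (g t has_real_derivative g' t s) (at s)" "space_smooth T n g'"
  using assms that unfolding space_smooth.simps by blast

lemma space_smooth_Suc_lower: "space_smooth T (Suc n) g \<Longrightarrow> space_smooth T n g"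
proof (induction n arbitrary: g)
  case (Suc n)
  from Suc.prems obtain g' where "\<And>t s. t \<in> {0..T} \<Longrightarrow> (g t has_real_derivative g' t s) (at s)" "space_smooth T (Suc n) g'"
    by (rule space_smooth_SucE) blast
  then show ?case using space_smooth_continuous[OF Suc.prems] Suc.IH by (intro space_smooth_SucI[of T g g']) auto
qed simp

lemma space_smooth_cong:
  assumes "space_smooth T n g" "\<And>t s. t \<in> {0..T} \<Longrightarrow> k t s = g t s"
  shows "space_smooth T n k"
proof -
  have e: "k t = g t" if "t \<in> {0..T}" for t using assms(2)[OF that] by auto
  have c: "continuous_on ({0..T} \<times> UNIV) (\<lambda>(t, s). k t s)"
    by (rule continuous_on_eq[OF space_smooth_continuous[OF assms(1)]]) (use assms(2) in auto)
  show ?thesis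
  proof (cases n)
    case (Suc m)
    from assms(1)[unfolded Suc] obtain g' where
      "\<And>t s. t \<in> {0..T} \<Longrightarrow> (g t has_real_derivative g' t s) (at s)" "space_smooth T m g'"
      by (rule space_smooth_SucE) blast
    then show ?thesis unfolding Suc using c e by (intro space_smooth_SucI[of T k g']) auto
  qed (use c in simp)
qed

lemma space_smooth_space:
  assumes "smooth f"
  shows "space_smooth T n (\<lambda>t. f)"
  using assms
proof (induction n arbitrary: f)
  case 0
  have "continuous_on ({0..T} \<times> UNIV) (\<lambda>p. f (snd p))"
    by (rule continuous_on_compose2[OF smooth_continuous_on[OF 0, of UNIV]]) (auto intro!: continuous_intros)
  then show ?case by (simp add: split_beta)
next
  case (Suc n)
  have "continuous_on ({0..T} \<times> UNIV) (\<lambda>p. f (snd p))"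
    by (rule continuous_on_compose2[OF smooth_continuous_on[OF Suc.prems, of UNIV]]) (auto intro!: continuous_intros)
  then show ?case
    by (intro space_smooth_SucI[of T _ "\<lambda>t. ddx f"]) (auto simp: split_beta intro: smooth_has_real_derivative Suc smooth_ddx)
qed

lemma space_smooth_const: "space_smooth T n (\<lambda>t s. c)"
  using space_smooth_space[OF smooth_const] .

lemma space_smooth_add: "space_smooth T n f \<Longrightarrow> space_smooth T n g \<Longrightarrow> space_smooth T n (\<lambda>t s. f t s + g t s)"
proof (induction n arbitrary: f g)
  case 0
  then show ?case by (auto simp: split_beta intro!: continuous_intros)
next
  case (Suc n)
  from Suc.prems(1) obtain f' where f': "\<And>t s. t \<in> {0..T} \<Longrightarrow> (f t has_real_derivative f' t s) (at s)" "space_smooth T n f'"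
    by (rule space_smooth_SucE) blast
  from Suc.prems(2) obtain g' where g': "\<And>t s. t \<in> {0..T} \<Longrightarrow> (g t has_real_derivative g' t s) (at s)" "space_smooth T n g'"
    by (rule space_smooth_SucE) blast
  show ?case
    by (rule space_smooth_SucI[of T _ "\<lambda>t s. f' t s + g' t s"])
      (use space_smooth_continuous[OF Suc.prems(1)] space_smooth_continuous[OF Suc.prems(2)] f' g' Suc.IH in
        \<open>auto simp: split_beta intro!: continuous_intros DERIV_add\<close>)
qed

lemma space_smooth_mult: "space_smooth T n f \<Longrightarrow> space_smooth T n g \<Longrightarrow> space_smooth T n (\<lambda>t s. f t s * g t s)"
proof (induction n arbitrary: f g)
  case 0
  then show ?case by (auto simp: split_beta intro!: continuous_intros)
next
  case (Suc n)
  from Suc.prems(1) obtain f' where f': "\<And>t s. t \<in> {0..T} \<Longrightarrow> (f t has_real_derivative f' t s) (at s)" "space_smooth T n f'"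
    by (rule space_smooth_SucE) blast
  from Suc.prems(2) obtain g' where g': "\<And>t s. t \<in> {0..T} \<Longrightarrow> (g t has_real_derivative g' t s) (at s)" "space_smooth T n g'"
    by (rule space_smooth_SucE) blast
  show ?case
  proof (rule space_smooth_SucI[of T _ "\<lambda>t s. f' t s * g t s + g' t s * f t s"])
    show "continuous_on ({0..T} \<times> UNIV) (\<lambda>(t, s). f t s * g t s)"
      using space_smooth_continuous[OF Suc.prems(1)] space_smooth_continuous[OF Suc.prems(2)] by (auto simp: split_beta intro!: continuous_intros)
    show "((\<lambda>s. f t s * g t s) has_real_derivative f' t s * g t s + g' t s * f t s) (at s)" if "t \<in> {0..T}" for t s
      by (rule DERIV_mult[OF f'(1)[OF that] g'(1)[OF that]])
    show "space_smooth T n (\<lambda>t s. f' t s * g t s + g' t s * f t s)"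
      by (intro space_smooth_add Suc.IH f' g' Suc.prems space_smooth_Suc_lower)
  qed
qed

lemma space_smooth_cmult: "space_smooth T n f \<Longrightarrow> space_smooth T n (\<lambda>t s. c * f t s)"
  by (rule space_smooth_mult[OF space_smooth_const])

lemma space_smooth_diff: "space_smooth T n f \<Longrightarrow> space_smooth T n g \<Longrightarrow> space_smooth T n (\<lambda>t s. f t s - g t s)"
  using space_smooth_add[of T n f "\<lambda>t s. (-1) * g t s"] space_smooth_cmult[of T n g "-1"] by simp

lemma space_smooth_power: "space_smooth T n f \<Longrightarrow> space_smooth T n (\<lambda>t s. f t s ^ k)"
proof (induction k)
  case 0
  show ?case using space_smooth_const by simp
next
  case (Suc k)
  then show ?case using space_smooth_mult[of T n f "\<lambda>t s. f t s ^ k"] by simp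
qed

lemma space_smooth_inverse:
  assumes "space_smooth T n f" "\<And>t s. t \<in> {0..T} \<Longrightarrow> f t s \<noteq> 0"
  shows "space_smooth T n (\<lambda>t s. inverse (f t s))"
  using assms(1)
proof (induction n)
  case 0
  then show ?case using assms(2) by (auto simp: split_beta intro!: continuous_intros)
next
  case (Suc n)
  from Suc.prems obtain f' where f': "\<And>t s. t \<in> {0..T} \<Longrightarrow> (f t has_real_derivative f' t s) (at s)" "space_smooth T n f'"
    by (rule space_smooth_SucE) blast
  show ?case
  proof (rule space_smooth_SucI[of T _ "\<lambda>t s. (-1) * (inverse (f t s) * f' t s * inverse (f t s))"])
    show "continuous_on ({0..T} \<times> UNIV) (\<lambda>(t, s). inverse (f t s))"
      using space_smooth_continuous[OF Suc.prems] assms(2) by (auto simp: split_beta intro!: continuous_intros)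
    show "((\<lambda>s. inverse (f t s)) has_real_derivative (-1) * (inverse (f t s) * f' t s * inverse (f t s))) (at s)" if "t \<in> {0..T}" for t s
      using DERIV_inverse'[OF f'(1)[OF that] assms(2)[OF that]] by simp
    show "space_smooth T n (\<lambda>t s. (-1) * (inverse (f t s) * f' t s * inverse (f t s)))"
      by (intro space_smooth_cmult space_smooth_mult Suc.IH space_smooth_Suc_lower[OF Suc.prems] f'(2))
  qed
qed

lemma slice_continuous:
  fixes g :: "real \<Rightarrow> real \<Rightarrow> real"
  assumes "continuous_on ({0..T} \<times> UNIV) (\<lambda>(t, s). g t s)"
  shows "continuous_on {0..T} (\<lambda>t. g t s)" "t \<in> {0..T} \<Longrightarrow> continuous_on A (g t)"
proof -
  have "continuous_on {0..T} (\<lambda>t. (t, s))" by (intro continuous_intros)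
  from continuous_on_compose2[OF assms this] show "continuous_on {0..T} (\<lambda>t. g t s)" by auto
  show "continuous_on A (g t)" if "t \<in> {0..T}"
  proof -
    have "continuous_on A (\<lambda>s. (t, s))" by (intro continuous_intros)
    moreover have "(\<lambda>s. (t, s)) ` A \<subseteq> {0..T} \<times> UNIV" using that by auto
    ultimately have "continuous_on A (\<lambda>x. (\<lambda>(t, s). g t s) (t, x))" by (rule continuous_on_compose2[OF assms])
    then show ?thesis by simp
  qed
qed

text \<open>The substitution \<open>\<tau> = t * \<sigma>\<close> turns the moving upper limit into
  a fixed interval, where continuity in parameters is available; it also covers
  \<open>t = 0\<close>.\<close>

lemma time_integral_continuous:
  fixes g :: "real \<Rightarrow> real \<Rightarrow> real"
  assumes g: "continuous_on ({0..T} \<times> UNIV) (\<lambda>(t, s). g t s)"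
  shows "continuous_on ({0..T} \<times> UNIV) (\<lambda>(t, s). integral {0..t} (\<lambda>\<tau>. g \<tau> s))"
proof (rule continuous_on_eq)
  show "continuous_on ({0..T} \<times> UNIV) (\<lambda>p. integral (cbox 0 1) (\<lambda>\<sigma>. g (fst p * \<sigma>) (snd p) * fst p))"
  proof (rule integral_continuous_on_param)
    have "continuous_on (({0..T} \<times> UNIV) \<times> cbox 0 1) (\<lambda>q. (fst (fst q) * snd q, snd (fst q)))"
      by (intro continuous_intros)
    moreover have "fst (fst q) * snd q \<in> {0..T}" if "q \<in> ({0..T} \<times> (UNIV :: real set)) \<times> cbox (0::real) 1" for q
    proof -
      have "fst (fst q) * snd q \<le> T * 1" using that by (intro mult_mono) (auto simp: mem_Times_iff)
      then show ?thesis using that by (auto simp: mem_Times_iff)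
    qed
    ultimately have "continuous_on (({0..T} \<times> UNIV) \<times> cbox 0 1) (\<lambda>q. (\<lambda>(t, s). g t s) (fst (fst q) * snd q, snd (fst q)))"
      by (intro continuous_on_compose2[OF g]) auto
    then show "continuous_on (({0..T} \<times> UNIV) \<times> cbox 0 1) (\<lambda>(p, \<sigma>). g (fst p * \<sigma>) (snd p) * fst p)"
      by (auto simp: split_beta intro!: continuous_intros)
  qed
  show "integral (cbox 0 1) (\<lambda>\<sigma>. g (fst p * \<sigma>) (snd p) * fst p) = (case p of (t, s) \<Rightarrow> integral {0..t} (\<lambda>\<tau>. g \<tau> s))"
    if p: "p \<in> {0..T} \<times> UNIV" for p
  proof -
    obtain t s where ps: "p = (t, s)" by force
    have t: "0 \<le> t" "t \<le> T" using p ps by auto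
    let ?F = "\<lambda>x. integral {0..x} (\<lambda>\<tau>. g \<tau> s)"
    have "((\<lambda>\<sigma>. g (t * \<sigma>) s * t) has_integral (?F (t * 1) - ?F (t * 0))) {0..1}"
    proof (rule fundamental_theorem_of_calculus)
      fix \<sigma> :: real assume s01: "\<sigma> \<in> {0..1}"
      have "t * \<sigma> \<le> t * 1" using t s01 by (intro mult_left_mono) auto
      then have m: "t * \<sigma> \<in> {0..t}" using t s01 by auto
      have c: "continuous_on {0..t} (\<lambda>\<tau>. g \<tau> s)"
        using continuous_on_subset[OF slice_continuous(1)[OF g, of s]] t by auto
      have "(?F has_real_derivative g (t * \<sigma>) s) (at (t * \<sigma>) within {0..t})"
        by (rule integral_has_real_derivative[OF c m])
      moreover have "(\<lambda>\<sigma>. t * \<sigma>) ` {0..1} \<subseteq> {0..t}"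
        using t by (auto simp: mult_left_le)
      ultimately have "(?F has_real_derivative g (t * \<sigma>) s) (at (t * \<sigma>) within (\<lambda>\<sigma>. t * \<sigma>) ` {0..1})"
        by (rule DERIV_subset)
      from DERIV_image_chain[OF this, of t]
      have "((\<lambda>\<sigma>. ?F (t * \<sigma>)) has_real_derivative g (t * \<sigma>) s * t) (at \<sigma> within {0..1})"
        by (simp add: o_def DERIV_cmult_Id)
      then show "((\<lambda>\<sigma>. ?F (t * \<sigma>)) has_vector_derivative g (t * \<sigma>) s * t) (at \<sigma> within {0..1})"
        by (simp add: has_real_derivative_iff_has_vector_derivative)
    qed simp
    moreover have "integral {0..0} (\<lambda>\<tau>. g \<tau> s) = 0" by simp
    ultimately show ?thesis
      by (simp only: integral_unique ps fst_conv snd_conv prod.case cbox_interval mult_1_right mult_zero_right diff_zero)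
  qed
qed

lemma time_integral_derivative:
  fixes g :: "real \<Rightarrow> real \<Rightarrow> real"
  assumes g: "continuous_on ({0..T} \<times> UNIV) (\<lambda>(t, s). g t s)"
    and g': "\<And>t s. t \<in> {0..T} \<Longrightarrow> (g t has_real_derivative g' t s) (at s)"
    and cg': "continuous_on ({0..T} \<times> UNIV) (\<lambda>(t, s). g' t s)" and t: "t \<in> {0..T}"
  shows "((\<lambda>s. integral {0..t} (\<lambda>\<tau>. g \<tau> s)) has_real_derivative integral {0..t} (\<lambda>\<tau>. g' \<tau> s)) (at s)"
proof -
  have "((\<lambda>s. integral (cbox 0 t) (\<lambda>\<tau>. g \<tau> s)) has_field_derivative integral (cbox 0 t) (\<lambda>\<tau>. g' \<tau> s)) (at s within UNIV)"
  proof (rule leibniz_rule_field_derivative[where f = "\<lambda>s \<tau>. g \<tau> s" and fx = "\<lambda>s \<tau>. g' \<tau> s"])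
    show "((\<lambda>x. g \<tau> x) has_field_derivative g' \<tau> x) (at x within UNIV)" if "\<tau> \<in> cbox 0 t" for x \<tau>
      using g'[of \<tau> x] that t by simp
    show "(\<lambda>\<tau>. g \<tau> x) integrable_on cbox 0 t" for x
      by (rule integrable_continuous) (rule continuous_on_subset[OF slice_continuous(1)[OF g]], use t in auto)
    have "continuous_on (UNIV \<times> cbox 0 t) (\<lambda>q. (snd q, fst q) :: real \<times> real)" by (intro continuous_intros)
    then have "continuous_on (UNIV \<times> cbox 0 t) (\<lambda>q. (\<lambda>(t, s). g' t s) (snd q, fst q))"
      by (rule continuous_on_compose2[OF cg']) (use t in auto)
    then show "continuous_on (UNIV \<times> cbox 0 t) (\<lambda>(x, \<tau>). g' \<tau> x)" by (simp add: split_beta)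
  qed auto
  then show ?thesis by simp
qed

lemma space_smooth_integral: "space_smooth T n g \<Longrightarrow> space_smooth T n (\<lambda>t s. integral {0..t} (\<lambda>\<tau>. g \<tau> s))"
proof (induction n arbitrary: g)
  case 0
  then show ?case using time_integral_continuous by simp
next
  case (Suc n)
  note c = space_smooth_continuous[OF Suc.prems]
  from Suc.prems obtain g' where g': "\<And>t s. t \<in> {0..T} \<Longrightarrow> (g t has_real_derivative g' t s) (at s)" "space_smooth T n g'"
    by (rule space_smooth_SucE) blast
  show ?case
    by (rule space_smooth_SucI[OF time_integral_continuous[OF c] time_integral_derivative[OF c g'(1) space_smooth_continuous[OF g'(2)]] Suc.IH[OF g'(2)]])
qed

lemma time_FTC:
  fixes f :: "real \<Rightarrow> real"
  assumes "\<And>\<tau>. \<tau> \<in> {0..T} \<Longrightarrow> (f has_real_derivative f' \<tau>) (at \<tau> within {0..T})" "t \<in> {0..T}"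
  shows "f t = f 0 + integral {0..t} f'"
proof -
  have "(f' has_integral (f t - f 0)) {0..t}"
  proof (rule fundamental_theorem_of_calculus)
    fix x assume "x \<in> {0..t}"
    then have "(f has_real_derivative f' x) (at x within {0..t})"
      using assms by (intro DERIV_subset[OF assms(1)]) auto
    then show "(f has_vector_derivative f' x) (at x within {0..t})"
      by (simp add: has_real_derivative_iff_has_vector_derivative)
  qed (use assms in auto)
  then show ?thesis by (simp add: integral_unique)
qed

text \<open>Hadamard's formula. The factor in front of \<open>x - s\<close> depends continuously on
  \<open>x\<close>, as Caratheodory's characterisation of the derivative requires.\<close>

lemma increment_average:
  fixes f f' :: "real \<Rightarrow> real"
  assumes "\<And>y. (f has_real_derivative f' y) (at y)" "continuous_on UNIV f'"
  shows "f x - f s = integral {0..1} (\<lambda>\<theta>. f' (s + \<theta> * (x - s))) * (x - s)"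
proof -
  have "((\<lambda>\<theta>. f' (s + \<theta> * (x - s)) * (x - s)) has_integral (f (s + 1 * (x - s)) - f (s + 0 * (x - s)))) {0..1}"
  proof (rule fundamental_theorem_of_calculus)
    fix \<theta> :: real
    have "((\<lambda>\<theta>. s + \<theta> * (x - s)) has_real_derivative (x - s)) (at \<theta> within {0..1})"
      by (auto intro!: derivative_eq_intros)
    from DERIV_chain2[OF assms(1) this]
    show "((\<lambda>\<theta>. f (s + \<theta> * (x - s))) has_vector_derivative f' (s + \<theta> * (x - s)) * (x - s)) (at \<theta> within {0..1})"
      by (simp add: has_real_derivative_iff_has_vector_derivative)
  qed simp
  from integral_unique[OF this] show ?thesis by simp
qed

text \<open>The difference \<open>w t x - w t s\<close> solves a linear equation in \<open>t\<close> with integrating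
  factor \<open>sqrt (z t s * z t x)\<close>; writing increments of the data as averages of derivatives
  gives the Caratheodory form of differentiability.\<close>

lemma riccati_space_derivative:
  fixes w z f fs :: "real \<Rightarrow> real \<Rightarrow> real"
  assumes wt: "\<And>t s. t \<in> {0..T} \<Longrightarrow> ((\<lambda>t. w t s) has_real_derivative f t s - (w t s)^2 / 2) (at t within {0..T})"
    and zt: "\<And>t s. t \<in> {0..T} \<Longrightarrow> ((\<lambda>t. z t s) has_real_derivative w t s * z t s) (at t within {0..T})"
    and z0: "\<And>s. z 0 s = 1" and zpos: "\<And>t s. t \<in> {0..T} \<Longrightarrow> z t s > 0"
    and cz: "continuous_on ({0..T} \<times> UNIV) (\<lambda>(t, s). z t s)"
    and cfs: "continuous_on ({0..T} \<times> UNIV) (\<lambda>(t, s). fs t s)"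
    and ffs: "\<And>t s. t \<in> {0..T} \<Longrightarrow> (f t has_real_derivative fs t s) (at s)"
    and w0: "\<And>s. (w 0 has_real_derivative w0' s) (at s)" "continuous_on UNIV w0'"
    and t: "t \<in> {0..T}"
  shows "(w t has_real_derivative (w0' s + integral {0..t} (\<lambda>\<tau>. z \<tau> s * fs \<tau> s)) / z t s) (at s)"
proof -
  define N where "N = (\<lambda>\<tau> x. integral (cbox 0 1) (\<lambda>\<theta>. fs \<tau> (s + \<theta> * (x - s))))"
  define N0 where "N0 = (\<lambda>x. integral (cbox 0 1) (\<lambda>\<theta>. w0' (s + \<theta> * (x - s))))"
  define r where "r = (\<lambda>\<tau> x. sqrt (z \<tau> s * z \<tau> x))"
  have cN: "continuous_on ({0..T} \<times> UNIV) (\<lambda>(\<tau>, x). N \<tau> x)"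
  proof -
    have "continuous_on ({0..T} \<times> UNIV) (\<lambda>p. integral (cbox 0 1) (\<lambda>\<theta>. fs (fst p) (s + \<theta> * (snd p - s))))"
    proof (rule integral_continuous_on_param)
      have "continuous_on (({0..T} \<times> UNIV) \<times> cbox 0 1) (\<lambda>q. (fst (fst q), s + snd q * (snd (fst q) - s)))"
        by (intro continuous_intros)
      then have "continuous_on (({0..T} \<times> UNIV) \<times> cbox 0 1) (\<lambda>q. (\<lambda>(t, s). fs t s) (fst (fst q), s + snd q * (snd (fst q) - s)))"
        by (rule continuous_on_compose2[OF cfs]) auto
      then show "continuous_on (({0..T} \<times> UNIV) \<times> cbox 0 1) (\<lambda>(p, \<theta>). fs (fst p) (s + \<theta> * (snd p - s)))"
        by (simp add: split_beta)
    qed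
    then show ?thesis unfolding N_def by (simp add: split_beta)
  qed
  have cN0: "continuous_on UNIV N0"
    unfolding N0_def
  proof (rule integral_continuous_on_param)
    show "continuous_on (UNIV \<times> cbox 0 1) (\<lambda>(x, \<theta>). w0' (s + \<theta> * (x - s)))"
      unfolding split_beta by (rule continuous_on_compose2[OF w0(2)]) (auto intro!: continuous_intros)
  qed
  have rpos: "r \<tau> x > 0" if "\<tau> \<in> {0..T}" for \<tau> x
    unfolding r_def using zpos[OF that] by simp
  have cr: "continuous_on ({0..T} \<times> UNIV) (\<lambda>(\<tau>, x). r \<tau> x)"
  proof -
    have "continuous_on ({0..T} \<times> UNIV) (\<lambda>p. (fst p, s))" by (intro continuous_intros)
    then have "continuous_on ({0..T} \<times> UNIV) (\<lambda>p. (\<lambda>(t, s). z t s) (fst p, s))"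
      by (rule continuous_on_compose2[OF cz]) auto
    then show ?thesis unfolding r_def using cz by (auto simp: split_beta intro!: continuous_intros)
  qed
  define M where "M = (\<lambda>x. (N0 x + integral {0..t} (\<lambda>\<tau>. r \<tau> x * N \<tau> x)) / r t x)"
  have incr: "w t x - w t s = M x * (x - s)" for x
  proof -
    let ?\<delta> = "\<lambda>\<tau>. w \<tau> x - w \<tau> s"
    \<comment> \<open>The quadratic terms of the two equations contribute
      \<open>-(w \<tau> s + w \<tau> x) / 2\<close> times the difference, and the logarithmic
      derivative of \<open>r\<close> is exactly the opposite coefficient.\<close>
    have rd: "((\<lambda>\<tau>. r \<tau> x) has_real_derivative r \<tau> x * ((w \<tau> s + w \<tau> x) / 2)) (at \<tau> within {0..T})" if \<tau>: "\<tau> \<in> {0..T}" for \<tau>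
    proof -
      let ?a = "z \<tau> s * z \<tau> x"
      have a: "?a > 0" using zpos[OF \<tau>] by simp
      have d: "((\<lambda>\<tau>. z \<tau> s * z \<tau> x) has_real_derivative (w \<tau> s + w \<tau> x) * ?a) (at \<tau> within {0..T})"
        by (rule DERIV_cong[OF DERIV_mult[OF zt[OF \<tau>] zt[OF \<tau>]]]) (simp add: algebra_simps)
      have "((\<lambda>\<tau>. r \<tau> x) has_real_derivative (inverse (sqrt ?a) / 2) * ((w \<tau> s + w \<tau> x) * ?a)) (at \<tau> within {0..T})"
        unfolding r_def by (rule DERIV_chain2[OF DERIV_real_sqrt[OF a] d])
      moreover have "(inverse (sqrt ?a) / 2) * ((w \<tau> s + w \<tau> x) * ?a) = r \<tau> x * ((w \<tau> s + w \<tau> x) / 2)"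
      proof -
        have "?a = r \<tau> x * r \<tau> x" unfolding r_def using a by simp
        then show ?thesis using rpos[OF \<tau>, of x] unfolding r_def[symmetric] by (simp add: field_simps r_def[symmetric])
      qed
      ultimately show ?thesis by (rule DERIV_cong)
    qed
    have "?\<delta> t * r t x = ?\<delta> 0 * r 0 x + integral {0..t} (\<lambda>\<tau>. (r \<tau> x * N \<tau> x) * (x - s))"
    proof (rule time_FTC[OF _ t, of "\<lambda>\<tau>. ?\<delta> \<tau> * r \<tau> x"])
      fix \<tau> assume \<tau>: "\<tau> \<in> {0..T}"
      have e: "f \<tau> x - f \<tau> s = N \<tau> x * (x - s)"
        unfolding N_def cbox_interval by (rule increment_average[OF ffs[OF \<tau>] slice_continuous(2)[OF cfs \<tau>]])
      have "((f \<tau> x - (w \<tau> x)^2 / 2) - (f \<tau> s - (w \<tau> s)^2 / 2)) * r \<tau> x + (r \<tau> x * ((w \<tau> s + w \<tau> x) / 2)) * ?\<delta> \<tau>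
         = (f \<tau> x - f \<tau> s) * r \<tau> x" by (simp add: power2_eq_square field_simps)
      also have "\<dots> = (r \<tau> x * N \<tau> x) * (x - s)" unfolding e by simp
      finally have "((f \<tau> x - (w \<tau> x)^2 / 2) - (f \<tau> s - (w \<tau> s)^2 / 2)) * r \<tau> x + (r \<tau> x * ((w \<tau> s + w \<tau> x) / 2)) * ?\<delta> \<tau>
         = (r \<tau> x * N \<tau> x) * (x - s)" .
      with DERIV_mult[OF DERIV_diff[OF wt[OF \<tau>] wt[OF \<tau>]] rd[OF \<tau>], of x s]
      show "((\<lambda>\<tau>. ?\<delta> \<tau> * r \<tau> x) has_real_derivative (r \<tau> x * N \<tau> x) * (x - s)) (at \<tau> within {0..T})"
        by simp
    qed
    moreover have "?\<delta> 0 = N0 x * (x - s)"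
      unfolding N0_def cbox_interval by (rule increment_average[OF w0])
    moreover have "r 0 x = 1" unfolding r_def z0 by simp
    ultimately have "?\<delta> t * r t x = (N0 x + integral {0..t} (\<lambda>\<tau>. r \<tau> x * N \<tau> x)) * (x - s)"
      by (simp only: mult_1_right integral_mult_left distrib_right)
    then show ?thesis unfolding M_def using rpos[OF t, of x] by (simp add: field_simps)
  qed
  have "continuous_on UNIV (\<lambda>x. integral {0..t} (\<lambda>\<tau>. r \<tau> x * N \<tau> x))"
  proof -
    have "continuous_on ({0..T} \<times> UNIV) (\<lambda>(\<tau>, x). r \<tau> x * N \<tau> x)"
      using cr cN by (auto simp: split_beta intro!: continuous_intros)
    from slice_continuous(2)[OF time_integral_continuous[OF this] t] show ?thesis .
  qed
  then have cM: "continuous_on UNIV M"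
    unfolding M_def using cN0 slice_continuous(2)[OF cr t, of UNIV] rpos[OF t]
    by (intro continuous_intros) (auto simp: less_imp_neq[symmetric])
  have "(w t has_real_derivative M s) (at s)"
  proof (rule CARAT_DERIV[THEN iffD2], intro exI[of _ M] conjI allI)
    show "w t x - w t s = M x * (x - s)" for x by (rule incr)
    show "isCont M s" using cM by (simp add: continuous_on_eq_continuous_at)
  qed simp
  moreover have "M s = (w0' s + integral {0..t} (\<lambda>\<tau>. z \<tau> s * fs \<tau> s)) / z t s"
  proof -
    have rs: "r \<tau> s = z \<tau> s" if "\<tau> \<in> {0..T}" for \<tau> unfolding r_def using zpos[OF that, of s] by simp
    have "integral {0..t} (\<lambda>\<tau>. r \<tau> s * N \<tau> s) = integral {0..t} (\<lambda>\<tau>. z \<tau> s * fs \<tau> s)"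
      by (rule Henstock_Kurzweil_Integration.integral_cong) (use rs t in \<open>auto simp: N_def\<close>)
    then show ?thesis unfolding M_def using rs[OF t] by (simp add: N0_def)
  qed
  ultimately show ?thesis by simp
qed

text \<open>The derivatives supplied by different orders agree by uniqueness, so a single one serves
  all orders.\<close>

lemma space_smooth_all_derivative:
  assumes "\<And>n. space_smooth T n g"
  obtains g' where "\<And>t s. t \<in> {0..T} \<Longrightarrow> (g t has_real_derivative g' t s) (at s)" "\<And>n. space_smooth T n g'"
proof -
  from assms[of "Suc 0"] obtain g' where g': "\<And>t s. t \<in> {0..T} \<Longrightarrow> (g t has_real_derivative g' t s) (at s)" "space_smooth T 0 g'"
    by (rule space_smooth_SucE) blast
  have "space_smooth T n g'" for n
  proof -
    from assms[of "Suc n"] obtain h where h: "\<And>t s. t \<in> {0..T} \<Longrightarrow> (g t has_real_derivative h t s) (at s)" "space_smooth T n h"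
      by (rule space_smooth_SucE) blast
    show ?thesis by (rule space_smooth_cong[OF h(2)]) (use DERIV_unique g'(1) h(1) in blast)
  qed
  then show ?thesis using that g'(1) by blast
qed

lemma uniform_limit_of_jointly_continuous:
  fixes F :: "real \<Rightarrow> real \<Rightarrow> real"
  assumes F: "continuous_on ({0..T} \<times> UNIV) (\<lambda>(t, x). F t x)" and K: "compact K" and t: "t \<in> {0..T}"
  shows "uniform_limit K F (F t) (at t within {0..T})"
proof (rule uniform_limitI)
  fix e :: real assume e: "e > 0"
  have "uniformly_continuous_on ({0..T} \<times> K) (\<lambda>(t, x). F t x)"
    by (rule compact_uniformly_continuous[OF continuous_on_subset[OF F]]) (use K in \<open>auto intro: compact_Times\<close>)
  then obtain d where d: "d > 0" "\<And>p q. p \<in> {0..T} \<times> K \<Longrightarrow> q \<in> {0..T} \<times> K \<Longrightarrow> dist q p < d \<Longrightarrow>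
      dist ((\<lambda>(t, x). F t x) q) ((\<lambda>(t, x). F t x) p) < e"
    unfolding uniformly_continuous_on_def using e by meson
  show "\<forall>\<^sub>F s in at t within {0..T}. \<forall>x\<in>K. dist (F s x) (F t x) < e"
    unfolding eventually_at
  proof (intro exI[of _ d] conjI ballI impI)
    fix s x assume "s \<in> {0..T}" "s \<noteq> t \<and> dist s t < d" "x \<in> K"
    then show "dist (F s x) (F t x) < e"
      using d(2)[of "(t, x)" "(s, x)"] t by (auto simp: dist_Pair_Pair)
  qed (rule d(1))
qed

text \<open>At a zero of \<open>g\<close> the product rule asks only for continuity of the other
  factor. It is applied in time, to a factor whose time derivative is unknown.\<close>

lemma DERIV_mult_vanishing:
  fixes B g :: "real \<Rightarrow> real"
  assumes g: "(g has_real_derivative g') (at t within S)" "g t = 0" and B: "(B \<longlongrightarrow> B t) (at t within S)"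
  shows "((\<lambda>x. B x * g x) has_real_derivative B t * g') (at t within S)"
proof -
  have "((\<lambda>y. B y * ((g y - g t) / (y - t))) \<longlongrightarrow> B t * g') (at t within S)"
    using g(1) B unfolding has_field_derivative_iff by (intro tendsto_mult)
  then show ?thesis unfolding has_field_derivative_iff using g(2) by simp
qed

section \<open>Smooth solutions from the Lagrangian system\<close>

text \<open>These are the properties delivered by \<open>lagrangian_solution\<close>, with the slope
  of the datum as initial \<open>w\<close>. The three unknowns are still independent: that
  \<open>w\<close> is the slope of the solution and \<open>z\<close> the Jacobian of the flow is
  assumed at time 0 only and has to be proved for later times.\<close>

locale lagrangian = rch +
  fixes T :: real and u0 :: "real \<Rightarrow> real" and U w z :: "real \<Rightarrow> real \<Rightarrow> real"
  assumes T: "T > 0" and u0: "smooth u0"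
    and good: "\<And>t. t \<in> {0..T} \<Longrightarrow> good (U t) (w t) (z t)"
    and cU: "continuous_on ({0..T} \<times> UNIV) (\<lambda>(t, s). U t s)"
    and cw: "continuous_on ({0..T} \<times> UNIV) (\<lambda>(t, s). w t s)"
    and cz: "continuous_on ({0..T} \<times> UNIV) (\<lambda>(t, s). z t s)"
    and cL: "continuous_on ({0..T} \<times> UNIV) (\<lambda>(t, s). left_sol (z t) (label_flux (U t) (w t) (z t)) s)"
    and cR: "continuous_on ({0..T} \<times> UNIV) (\<lambda>(t, s). right_sol (z t) (label_flux (U t) (w t) (z t)) s)"
    and Ut: "\<And>t s. t \<in> {0..T} \<Longrightarrow> ((\<lambda>t. U t s) has_real_derivative
        (left_sol (z t) (label_flux (U t) (w t) (z t)) s - right_sol (z t) (label_flux (U t) (w t) (z t)) s) / 2) (at t within {0..T})"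
    and wt: "\<And>t s. t \<in> {0..T} \<Longrightarrow> ((\<lambda>t. w t s) has_real_derivative nonlin (U t s) - (w t s)^2 / 2 -
        (left_sol (z t) (label_flux (U t) (w t) (z t)) s + right_sol (z t) (label_flux (U t) (w t) (z t)) s) / 2) (at t within {0..T})"
    and zt: "\<And>t s. t \<in> {0..T} \<Longrightarrow> ((\<lambda>t. z t s) has_real_derivative w t s * z t s) (at t within {0..T})"
    and init: "U 0 = u0" "w 0 = ddx u0" "z 0 = (\<lambda>s. 1)"
begin

section \<open>Regularity in the label variable\<close>

definition El :: "real \<Rightarrow> real \<Rightarrow> real" where "El t = left_sol (z t) (label_flux (U t) (w t) (z t))"
definition Er :: "real \<Rightarrow> real \<Rightarrow> real" where "Er t = right_sol (z t) (label_flux (U t) (w t) (z t))"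
definition p :: "real \<Rightarrow> real \<Rightarrow> real" where "p t s = flux (U t s) (w t s) * z t s"

lemma p_eq: "label_flux (U t) (w t) (z t) = p t"
  by (auto simp: label_flux_def p_def)

lemma bounds:
  assumes "t \<in> {0..T}"
  shows "\<bar>U t s\<bar> \<le> 2" "\<bar>w t s\<bar> \<le> 2" "1/2 \<le> z t s" "z t s \<le> 3/2" "z t s > 0" "z t s \<noteq> 0"
    "\<bar>El t s\<bar> \<le> D" "\<bar>Er t s\<bar> \<le> D"
  using goodD(4-7)[OF good[OF assms], of s] good_left(2)[OF good[OF assms], of s] good_right(2)[OF good[OF assms], of s]
  unfolding El_def Er_def by auto

lemma E_space:
  assumes "t \<in> {0..T}"
  shows "(El t has_real_derivative p t s - z t s * El t s) (at s)"
    "(Er t has_real_derivative z t s * Er t s - p t s) (at s)"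
  using good_left(1)[OF good[OF assms], of s] good_right(1)[OF good[OF assms], of s]
  unfolding El_def Er_def p_eq by auto

lemma space_smooth0: "space_smooth T 0 U" "space_smooth T 0 w" "space_smooth T 0 z" "space_smooth T 0 El" "space_smooth T 0 Er"
  using cU cw cz cL cR unfolding El_def Er_def by auto

lemma space_smooth_PP: "space_smooth T n f \<Longrightarrow> space_smooth T n g \<Longrightarrow> space_smooth T n (\<lambda>t s. flux (f t s) (g t s))"
  unfolding flux_def nonlin_def
  using space_smooth_cmult[OF space_smooth_power, of T n g "1/2" 2]
  by (intro space_smooth_add space_smooth_cmult space_smooth_power) auto

lemma space_smooth_p: "space_smooth T n U \<Longrightarrow> space_smooth T n w \<Longrightarrow> space_smooth T n z \<Longrightarrow> space_smooth T n p"
  unfolding p_def[abs_def] by (intro space_smooth_mult space_smooth_PP)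

text \<open>The compatibility of the unknowns. By the product rule \<open>w * z\<close> has time
  derivative \<open>p - z * (El + Er) / 2\<close>, which is also the label derivative of
  \<open>(El - Er) / 2\<close>, the time derivative of \<open>U\<close>. Both sides start from
  \<open>ddx u0\<close>.\<close>

lemma U_space:
  assumes t: "t \<in> {0..T}"
  shows "(U t has_real_derivative w t s * z t s) (at s)"
proof -
  let ?g = "\<lambda>t s. (1/2) * (El t s - Er t s)"
  let ?g' = "\<lambda>t s. p t s - (1/2) * (z t s * (El t s + Er t s))"
  have sg: "space_smooth T 0 ?g" "space_smooth T 0 ?g'"
    by (intro space_smooth_cmult space_smooth_diff space_smooth_mult space_smooth_add space_smooth_p space_smooth0)+
  have eq: "U t s = u0 s + integral {0..t} (\<lambda>\<tau>. ?g \<tau> s)" for s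
    using time_FTC[OF _ t, of "\<lambda>t. U t s" "\<lambda>\<tau>. ?g \<tau> s"] Ut init unfolding El_def Er_def by simp
  have wz: "w t s * z t s = ddx u0 s + integral {0..t} (\<lambda>\<tau>. ?g' \<tau> s)"
  proof -
    have "((\<lambda>\<tau>. w \<tau> s * z \<tau> s) has_real_derivative ?g' \<tau> s) (at \<tau> within {0..T})" if \<tau>: "\<tau> \<in> {0..T}" for \<tau>
      by (rule DERIV_cong[OF DERIV_mult[OF wt[OF \<tau>] zt[OF \<tau>]]])
        (simp add: El_def Er_def p_def flux_def power2_eq_square field_simps)
    from time_FTC[OF this t] show ?thesis using init by simp
  qed
  have "((\<lambda>s. u0 s + integral {0..t} (\<lambda>\<tau>. ?g \<tau> s)) has_real_derivative ddx u0 s + integral {0..t} (\<lambda>\<tau>. ?g' \<tau> s)) (at s)"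
  proof (intro DERIV_add smooth_has_real_derivative[OF u0] time_integral_derivative[OF _ _ _ t])
    show "((\<lambda>s. ?g t s) has_real_derivative ?g' t s) (at s)" if "t \<in> {0..T}" for t s
      by (rule DERIV_cong[OF DERIV_cmult[OF DERIV_diff[OF E_space[OF that]]]]) (simp add: field_simps)
  qed (use sg in auto)
  moreover have "U t = (\<lambda>s. u0 s + integral {0..t} (\<lambda>\<tau>. ?g \<tau> s))" using eq by auto
  ultimately show ?thesis unfolding wz by simp
qed

text \<open>The label derivative of \<open>nonlin U - (El + Er) / 2\<close>, the forcing in the
  Riccati equation of \<open>w\<close>; the flux terms of \<open>El\<close> and \<open>Er\<close>
  cancel.\<close>

definition fs :: "real \<Rightarrow> real \<Rightarrow> real" where
  "fs t s = nonlin' (U t s) * (w t s * z t s) - (1/2) * (z t s * (Er t s - El t s))"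

definition ws :: "real \<Rightarrow> real \<Rightarrow> real" where
  "ws t s = (ddx (ddx u0) s + integral {0..t} (\<lambda>\<tau>. z \<tau> s * fs \<tau> s)) * inverse (z t s)"

lemma space_smooth_fs: "space_smooth T n U \<Longrightarrow> space_smooth T n w \<Longrightarrow> space_smooth T n z \<Longrightarrow> space_smooth T n El \<Longrightarrow> space_smooth T n Er \<Longrightarrow> space_smooth T n fs"
proof -
  assume a: "space_smooth T n U" "space_smooth T n w" "space_smooth T n z" "space_smooth T n El" "space_smooth T n Er"
  have "space_smooth T n (\<lambda>t s. nonlin' (U t s))"
    unfolding nonlin'_def mult.assoc by (intro space_smooth_add space_smooth_cmult space_smooth_power a)
  then show ?thesis unfolding fs_def[abs_def] by (intro space_smooth_diff space_smooth_mult space_smooth_cmult a)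
qed

lemma space_smooth_ws: "space_smooth T n U \<Longrightarrow> space_smooth T n w \<Longrightarrow> space_smooth T n z \<Longrightarrow> space_smooth T n El \<Longrightarrow> space_smooth T n Er \<Longrightarrow> space_smooth T n ws"
  unfolding ws_def[abs_def]
  by (intro space_smooth_mult space_smooth_add space_smooth_inverse space_smooth_integral space_smooth_fs space_smooth_space smooth_ddx u0) (use bounds in auto)

lemma w_space:
  assumes t: "t \<in> {0..T}"
  shows "(w t has_real_derivative ws t s) (at s)"
proof -
  let ?f = "\<lambda>t s. nonlin (U t s) - (1/2) * (El t s + Er t s)"
  have "(w t has_real_derivative (ddx (ddx u0) s + integral {0..t} (\<lambda>\<tau>. z \<tau> s * fs \<tau> s)) / z t s) (at s)"
  proof (rule riccati_space_derivative[where f = ?f, OF _ zt _ _ cz _ _ _ _ t])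
    show "((\<lambda>t. w t s) has_real_derivative ?f t s - (w t s)\<^sup>2 / 2) (at t within {0..T})" if "t \<in> {0..T}" for t s
      by (rule DERIV_cong[OF wt[OF that]]) (simp add: El_def Er_def)
    show "continuous_on ({0..T} \<times> UNIV) (\<lambda>(t, s). fs t s)" using space_smooth_continuous[OF space_smooth_fs[OF space_smooth0]] .
    show "(?f t has_real_derivative fs t s) (at s)" if "t \<in> {0..T}" for t s
      by (rule DERIV_cong[OF DERIV_diff[OF DERIV_chain2[OF nonlin_deriv U_space[OF that]] DERIV_cmult[OF DERIV_add[OF E_space[OF that]]]]])
        (simp add: fs_def field_simps)
    show "(w 0 has_real_derivative ddx (ddx u0) s) (at s)" for s
      unfolding init by (intro smooth_has_real_derivative smooth_ddx u0)
    show "continuous_on UNIV (ddx (ddx u0))" by (intro smooth_continuous_on smooth_ddx u0)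
  qed (use init bounds in auto)
  then show ?thesis unfolding ws_def divide_inverse .
qed

text \<open>Solving the linear equation of \<open>z\<close> explicitly lets its label derivative
  follow from that of \<open>w\<close> under the time integral.\<close>

lemma z_exp:
  assumes t: "t \<in> {0..T}"
  shows "z t s = exp (integral {0..t} (\<lambda>\<tau>. w \<tau> s))"
proof -
  have "ln (z t s) = ln (z 0 s) + integral {0..t} (\<lambda>\<tau>. w \<tau> s)"
  proof (rule time_FTC[OF _ t, of "\<lambda>t. ln (z t s)"])
    show "((\<lambda>t. ln (z t s)) has_real_derivative w \<tau> s) (at \<tau> within {0..T})" if \<tau>: "\<tau> \<in> {0..T}" for \<tau>
      by (rule DERIV_cong[OF DERIV_chain2[OF DERIV_ln_divide[OF bounds(5)[OF \<tau>]] zt[OF \<tau>]]])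
        (use bounds(6)[OF \<tau>, of s] in simp)
  qed
  then have "ln (z t s) = integral {0..t} (\<lambda>\<tau>. w \<tau> s)" using init by simp
  then show ?thesis using bounds(5)[OF t, of s] by (metis exp_ln)
qed

lemma z_space:
  assumes t: "t \<in> {0..T}"
  shows "(z t has_real_derivative z t s * integral {0..t} (\<lambda>\<tau>. ws \<tau> s)) (at s)"
proof -
  have "((\<lambda>s. exp (integral {0..t} (\<lambda>\<tau>. w \<tau> s))) has_real_derivative
      exp (integral {0..t} (\<lambda>\<tau>. w \<tau> s)) * integral {0..t} (\<lambda>\<tau>. ws \<tau> s)) (at s)"
    by (rule DERIV_chain2[OF DERIV_exp time_integral_derivative[OF cw w_space space_smooth_continuous[OF space_smooth_ws[OF space_smooth0]] t]])
  moreover have "z t = (\<lambda>s. exp (integral {0..t} (\<lambda>\<tau>. w \<tau> s)))" using z_exp[OF t] by auto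
  ultimately show ?thesis by simp
qed

text \<open>The label derivatives of the five functions are expressed by the same five, their time
  integrals and the smooth datum. Hence order \<open>n\<close> for all of them yields order
  \<open>n + 1\<close>, which is why they are treated together.\<close>

lemma space_smooth_all: "space_smooth T n U \<and> space_smooth T n w \<and> space_smooth T n z \<and> space_smooth T n El \<and> space_smooth T n Er"
proof (induction n)
  case 0
  show ?case using space_smooth0 by blast
next
  case (Suc n)
  then have s: "space_smooth T n U" "space_smooth T n w" "space_smooth T n z" "space_smooth T n El" "space_smooth T n Er" by auto
  have "space_smooth T (Suc n) U"
    by (rule space_smooth_SucI[OF cU U_space]) (auto intro: space_smooth_mult s)
  moreover have "space_smooth T (Suc n) w"
    by (rule space_smooth_SucI[OF cw w_space]) (auto intro: space_smooth_ws s)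
  moreover have "space_smooth T (Suc n) z"
    by (rule space_smooth_SucI[OF cz z_space]) (auto intro!: space_smooth_mult space_smooth_integral space_smooth_ws s)
  moreover have "space_smooth T (Suc n) El"
    by (rule space_smooth_SucI[OF space_smooth_continuous[OF space_smooth0(4)] E_space(1)]) (auto intro!: space_smooth_diff space_smooth_mult space_smooth_p s)
  moreover have "space_smooth T (Suc n) Er"
    by (rule space_smooth_SucI[OF space_smooth_continuous[OF space_smooth0(5)] E_space(2)]) (auto intro!: space_smooth_diff space_smooth_mult space_smooth_p s)
  ultimately show ?case by blast
qed

text \<open>Uniqueness needs a bounded second derivative of one solution. The bound inherits the
  size of \<open>ddx (ddx u0)\<close> and so grows with the oscillation of the datum, which is
  harmless as it enters no other estimate.\<close>

lemma ws_bounded: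
  assumes "\<And>s. \<bar>ddx (ddx u0) s\<bar> \<le> B"
  obtains B' where "\<And>t s. t \<in> {0..T} \<Longrightarrow> \<bar>ws t s\<bar> \<le> B'"
proof
  fix t s assume t: "t \<in> {0..T}"
  let ?K = "3/2 * (Ch * 3 + 3/2 * D)"
  have D0: "D \<ge> 0" using D_ge by simp
  have fb: "\<bar>z \<tau> s * fs \<tau> s\<bar> \<le> ?K" if \<tau>: "\<tau> \<in> {0..T}" for \<tau>
  proof -
    note b = bounds[OF \<tau>, of s]
    have "\<bar>nonlin' (U \<tau> s) * (w \<tau> s * z \<tau> s)\<bar> \<le> Ch * (2 * (3/2))"
      unfolding abs_mult using b nonlin'_bound[OF b(1)] Ch_nonneg by (intro mult_mono) auto
    moreover have "\<bar>(1/2) * (z \<tau> s * (Er \<tau> s - El \<tau> s))\<bar> \<le> (1/2) * ((3/2) * (2 * D))"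
      unfolding abs_mult using b D0 by (intro mult_mono) auto
    ultimately have "\<bar>fs \<tau> s\<bar> \<le> Ch * 3 + 3/2 * D" unfolding fs_def by linarith
    then show ?thesis unfolding abs_mult using b by (intro mult_mono) auto
  qed
  have sm: "space_smooth T 0 (\<lambda>t s. z t s * fs t s)" by (intro space_smooth_mult space_smooth_fs space_smooth0)
  have "norm (integral {0..t} (\<lambda>\<tau>. z \<tau> s * fs \<tau> s)) \<le> ?K * (t - 0)"
    by (rule integral_bound) (use t fb continuous_on_subset[OF slice_continuous(1)[OF space_smooth_continuous[OF sm]], of "{0..t}"] in auto)
  also have "\<dots> \<le> ?K * T" using t Ch_nonneg D0 by (intro mult_left_mono) auto
  finally have "\<bar>ddx (ddx u0) s + integral {0..t} (\<lambda>\<tau>. z \<tau> s * fs \<tau> s)\<bar> \<le> B + ?K * T"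
    using assms[of s] by (simp only: real_norm_def)
  moreover have "\<bar>inverse (z t s)\<bar> \<le> 2"
    using bounds(3,5)[OF t, of s] by (simp add: field_simps)
  ultimately show "\<bar>ws t s\<bar> \<le> (B + ?K * T) * 2"
    unfolding ws_def abs_mult by (intro mult_mono) auto
qed

section \<open>The flow of characteristics and its inverse\<close>

definition Phi :: "real \<Rightarrow> real \<Rightarrow> real" where "Phi t s = s + integral {0..t} (\<lambda>\<tau>. U \<tau> s)"

text \<open>Since \<open>w * z\<close> is the label derivative of \<open>U\<close>, the equation of
  \<open>z\<close> is that of the Jacobian of the flow.\<close>

lemma Phi_space:
  assumes t: "t \<in> {0..T}"
  shows "(Phi t has_real_derivative z t s) (at s)"
proof -
  have "z t s = z 0 s + integral {0..t} (\<lambda>\<tau>. w \<tau> s * z \<tau> s)"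
    by (rule time_FTC[OF zt t])
  moreover have "((\<lambda>s. s + integral {0..t} (\<lambda>\<tau>. U \<tau> s)) has_real_derivative 1 + integral {0..t} (\<lambda>\<tau>. w \<tau> s * z \<tau> s)) (at s)"
    by (intro DERIV_add DERIV_ident time_integral_derivative[OF cU U_space _ t] space_smooth_continuous[OF space_smooth_mult[OF space_smooth0(2,3)]])
  ultimately show ?thesis unfolding Phi_def[abs_def] using init by simp
qed

lemma Phi_time:
  assumes t: "t \<in> {0..T}"
  shows "((\<lambda>t. Phi t s) has_real_derivative U t s) (at t within {0..T})"
  unfolding Phi_def using integral_has_real_derivative[OF slice_continuous(1)[OF cU] t]
  by (auto intro!: derivative_eq_intros)

lemma Phi_expanding: "t \<in> {0..T} \<Longrightarrow> \<bar>a - b\<bar> \<le> 2 * \<bar>Phi t a - Phi t b\<bar>"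
  using growth_half[OF Phi_space bounds(3), of t a b] growth_half[OF Phi_space bounds(3), of t b a]
  by (cases "a \<le> b") auto

lemma Phi_bound: "t \<in> {0..T} \<Longrightarrow> \<bar>Phi t s - s\<bar> \<le> 2 * T"
proof -
  assume t: "t \<in> {0..T}"
  have "norm (integral {0..t} (\<lambda>\<tau>. U \<tau> s)) \<le> 2 * (t - 0)"
    by (rule integral_bound) (use t bounds continuous_on_subset[OF slice_continuous(1)[OF cU], of "{0..t}"] in auto)
  then show ?thesis unfolding Phi_def using t by simp
qed

lemma Phi_surj:
  assumes t: "t \<in> {0..T}"
  shows "\<exists>s. Phi t s = x"
proof -
  have "\<exists>s\<ge>x - 2 * T. s \<le> x + 2 * T \<and> Phi t s = x"
  proof (rule IVT)
    show "Phi t (x - 2 * T) \<le> x" "x \<le> Phi t (x + 2 * T)"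
      using Phi_bound[OF t, of "x - 2 * T"] Phi_bound[OF t, of "x + 2 * T"] by auto
    show "\<forall>s. x - 2 * T \<le> s \<and> s \<le> x + 2 * T \<longrightarrow> isCont (Phi t) s"
      using Phi_space[OF t] DERIV_isCont by blast
  qed (use T in simp)
  then show ?thesis by blast
qed

definition Psi :: "real \<Rightarrow> real \<Rightarrow> real" where "Psi t x = (SOME s. Phi t s = x)"

lemma Phi_Psi: "t \<in> {0..T} \<Longrightarrow> Phi t (Psi t x) = x"
  unfolding Psi_def using someI_ex[OF Phi_surj] .

lemma Psi_Phi: "t \<in> {0..T} \<Longrightarrow> Psi t (Phi t s) = s"
  using Phi_expanding[of t "Psi t (Phi t s)" s] Phi_Psi[of t "Phi t s"] by simp

text \<open>By expansion, the distance of two values of \<open>Psi\<close> is at most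
  \<open>2 * \<bar>x' - Phi t' (Psi t x)\<bar>\<close>. Here \<open>Psi t x\<close> is frozen, so
  continuity of \<open>Phi\<close> in time suffices to send this to 0.\<close>

lemma Psi_continuous: "continuous_on ({0..T} \<times> UNIV) (\<lambda>(t, x). Psi t x)"
  unfolding continuous_on_def
proof
  fix q :: "real \<times> real" assume q: "q \<in> {0..T} \<times> UNIV"
  obtain t x where tx: "q = (t, x)" by force
  have t: "t \<in> {0..T}" using q tx by auto
  have "space_smooth T 0 Phi" unfolding Phi_def[abs_def]
    using space_smooth_add[OF space_smooth_space[of "\<lambda>s. s"] space_smooth_integral[OF space_smooth0(1)]] smooth_of_real[where 'a = real] by simp
  then have cP: "continuous_on {0..T} (\<lambda>t'. Phi t' (Psi t x))"
    using slice_continuous(1) by auto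
  have c: "continuous_on ({0..T} \<times> UNIV) (\<lambda>r. Phi (fst r) (Psi t x))"
    by (rule continuous_on_compose2[OF cP]) (auto intro!: continuous_intros)
  have "((\<lambda>r. 2 * \<bar>snd r - Phi (fst r) (Psi t x)\<bar>) \<longlongrightarrow> 2 * \<bar>x - Phi t (Psi t x)\<bar>) (at q within {0..T} \<times> UNIV)"
    using c q tendsto_snd[OF tendsto_ident_at, of q "{0..T} \<times> UNIV"] unfolding continuous_on_def tx
    by (auto intro!: tendsto_intros)
  then have l: "((\<lambda>r. 2 * \<bar>snd r - Phi (fst r) (Psi t x)\<bar>) \<longlongrightarrow> 0) (at q within {0..T} \<times> UNIV)"
    using Phi_Psi[OF t] by simp
  have "((\<lambda>r. Psi (fst r) (snd r) - Psi t x) \<longlongrightarrow> 0) (at q within {0..T} \<times> UNIV)"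
  proof (rule Lim_null_comparison[OF _ l])
    show "\<forall>\<^sub>F r in at q within {0..T} \<times> UNIV. norm (Psi (fst r) (snd r) - Psi t x) \<le> 2 * \<bar>snd r - Phi (fst r) (Psi t x)\<bar>"
      unfolding eventually_at_filter
    proof (rule always_eventually, intro allI impI)
      fix r :: "real \<times> real" assume "r \<in> {0..T} \<times> UNIV"
      then have r: "fst r \<in> {0..T}" by (simp add: mem_Times_iff)
      show "norm (Psi (fst r) (snd r) - Psi t x) \<le> 2 * \<bar>snd r - Phi (fst r) (Psi t x)\<bar>"
        using Phi_expanding[OF r, of "Psi (fst r) (snd r)" "Psi t x"] Phi_Psi[OF r] by simp
    qed
  qed
  then show "((\<lambda>(t, x). Psi t x) \<longlongrightarrow> (case q of (t, x) \<Rightarrow> Psi t x)) (at q within {0..T} \<times> UNIV)"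
    unfolding tx by (simp add: split_beta LIM_zero_cancel)
qed

lemma Psi_space:
  assumes t: "t \<in> {0..T}"
  shows "(Psi t has_real_derivative inverse (z t (Psi t x))) (at x)"
proof (rule DERIV_inverse_function[of "Phi t" _ _ _ "x - 1" "x + 1"])
  show "(Phi t has_real_derivative z t (Psi t x)) (at (Psi t x))" by (rule Phi_space[OF t])
  show "z t (Psi t x) \<noteq> 0" by (rule bounds(6)[OF t])
  show "isCont (Psi t) x"
    using slice_continuous(2)[OF Psi_continuous t, of UNIV] by (simp add: continuous_on_eq_continuous_at)
qed (use Phi_Psi[OF t] in auto)

lemma compose_Psi_continuous:
  assumes "continuous_on ({0..T} \<times> UNIV) (\<lambda>(t, s). g t s)"
  shows "continuous_on ({0..T} \<times> UNIV) (\<lambda>(t, x). g t (Psi t x) :: real)"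
proof -
  have "continuous_on ({0..T} \<times> UNIV) (\<lambda>r. (fst r, Psi (fst r) (snd r)))"
    using Psi_continuous by (auto simp: split_beta intro!: continuous_intros)
  then have "continuous_on ({0..T} \<times> UNIV) (\<lambda>r. (\<lambda>(t, s). g t s) (fst r, Psi (fst r) (snd r)))"
    by (rule continuous_on_compose2[OF assms]) auto
  then show ?thesis by (simp add: split_beta)
qed

lemma compose_Psi_derivative:
  assumes "t \<in> {0..T}" "\<And>s. (g has_real_derivative g' s) (at s)"
  shows "((\<lambda>x. g (Psi t x)) has_real_derivative g' (Psi t x) * inverse (z t (Psi t x))) (at x)"
  by (rule DERIV_chain2[OF assms(2) Psi_space[OF assms(1)]])

section \<open>The solution in the original coordinates\<close>

definition u :: "real \<Rightarrow> real \<Rightarrow> real" where "u t x = U t (Psi t x)"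

text \<open>In labels the space derivative is \<open>1 / z\<close> times the label derivative, and
  this operation preserves joint smoothness of all orders.\<close>

lemma u_iterated_derivative:
  "\<exists>g. (\<forall>m. space_smooth T m g) \<and> (\<forall>t\<in>{0..T}. (ddx ^^ n) (u t) = (\<lambda>x. g t (Psi t x)))"
proof (induction n)
  case 0
  show ?case using space_smooth_all by (intro exI[of _ U]) (auto simp: u_def)
next
  case (Suc n)
  then obtain g where g: "\<And>m. space_smooth T m g" "\<And>t. t \<in> {0..T} \<Longrightarrow> (ddx ^^ n) (u t) = (\<lambda>x. g t (Psi t x))" by blast
  obtain g' where g': "\<And>t s. t \<in> {0..T} \<Longrightarrow> (g t has_real_derivative g' t s) (at s)" "\<And>m. space_smooth T m g'"
    using space_smooth_all_derivative[OF g(1)] by blast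
  have "space_smooth T m (\<lambda>t s. g' t s * inverse (z t s))" for m
    using space_smooth_all by (intro space_smooth_mult g' space_smooth_inverse) (use bounds in auto)
  moreover have "(ddx ^^ Suc n) (u t) = (\<lambda>x. g' t (Psi t x) * inverse (z t (Psi t x)))" if "t \<in> {0..T}" for t
    using g(2)[OF that] ddx_real_eqI[OF compose_Psi_derivative[OF that g'(1)[OF that]]] by simp
  ultimately show ?case by (intro exI[of _ "\<lambda>t s. g' t s * inverse (z t s)"]) auto
qed

lemma u_CT_smooth: "u \<in> CT_smooth T"
  unfolding CT_smooth_def
proof (intro CollectI conjI ballI allI impI)
  fix t assume t: "t \<in> {0..T}"
  show "smooth (u t)"
    unfolding smooth_def
  proof (intro allI)
    fix n x
    obtain g where g: "\<And>m. space_smooth T m g" "(ddx ^^ n) (u t) = (\<lambda>x. g t (Psi t x))"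
      using u_iterated_derivative[of n] t by blast
    obtain g' where g': "\<And>t s. t \<in> {0..T} \<Longrightarrow> (g t has_real_derivative g' t s) (at s)" "\<And>m. space_smooth T m g'"
      using space_smooth_all_derivative[OF g(1)] by blast
    show "(ddx ^^ n) (u t) differentiable at x"
      unfolding g(2) using compose_Psi_derivative[OF t g'(1)[OF t], of x]
      unfolding has_real_derivative_iff_has_vector_derivative by (rule differentiableI_vector)
  qed
  fix n and K :: "real set" assume K: "compact K"
  obtain g where g: "\<And>m. space_smooth T m g" "\<And>t. t \<in> {0..T} \<Longrightarrow> (ddx ^^ n) (u t) = (\<lambda>x. g t (Psi t x))"
    using u_iterated_derivative[of n] by blast
  have "continuous_on ({0..T} \<times> UNIV) (\<lambda>(t, x). (ddx ^^ n) (u t) x)"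
    by (rule continuous_on_eq[OF compose_Psi_continuous[OF space_smooth_continuous[OF g(1)]]]) (use g(2) in auto)
  from uniform_limit_of_jointly_continuous[OF this K t]
  show "uniform_limit K (\<lambda>s. (ddx ^^ n) (u s)) ((ddx ^^ n) (u t)) (at t within {0..T})" .
qed

lemma u_x: "t \<in> {0..T} \<Longrightarrow> (u t has_real_derivative w t (Psi t x)) (at x)"
  unfolding u_def[abs_def]
  by (rule DERIV_cong[OF compose_Psi_derivative[OF _ U_space]]) (use bounds in auto)

lemma ddx_u: "t \<in> {0..T} \<Longrightarrow> ddx (u t) = (\<lambda>x. w t (Psi t x))"
  by (rule ddx_real_eqI[OF u_x])

lemma ddx2_u: "t \<in> {0..T} \<Longrightarrow> ddx (ddx (u t)) = (\<lambda>x. ws t (Psi t x) * inverse (z t (Psi t x)))"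
  unfolding ddx_u by (rule ddx_real_eqI[OF compose_Psi_derivative[OF _ w_space]])

lemma u_bounds: "t \<in> {0..T} \<Longrightarrow> \<bar>u t x\<bar> \<le> 2" "t \<in> {0..T} \<Longrightarrow> \<bar>ddx (u t) x\<bar> \<le> 2"
  using bounds by (auto simp: u_def ddx_u)

text \<open>Composition with \<open>Psi\<close> divides derivatives by \<open>z\<close>, which turns
  the equations of \<open>El\<close> and \<open>Er\<close> into those with coefficient 1. Uniqueness
  of the bounded solution identifies them with the halves of the convolution.\<close>

lemma u_sol_one:
  assumes t: "t \<in> {0..T}"
  defines "P \<equiv> \<lambda>x. flux (u t x) (ddx (u t) x)"
  shows "left_sol (\<lambda>s. 1) P = (\<lambda>x. El t (Psi t x))" "right_sol (\<lambda>s. 1) P = (\<lambda>x. Er t (Psi t x))"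
    and "continuous_on UNIV P" "\<And>x. \<bar>P x\<bar> \<le> 2 + 2 * Ch"
proof -
  have Peq: "P = (\<lambda>x. flux (U t (Psi t x)) (w t (Psi t x)))" unfolding P_def u_def ddx_u[OF t] ..
  show cP: "continuous_on UNIV P"
    unfolding Peq using slice_continuous(2)[OF compose_Psi_continuous[OF space_smooth_continuous[OF space_smooth_PP[OF space_smooth0(1,2)]]] t] .
  show bP: "\<bar>P x\<bar> \<le> 2 + 2 * Ch" for x unfolding Peq by (rule flux_bound) (use bounds[OF t] in auto)
  have pz: "p t s * inverse (z t s) = flux (U t s) (w t s)" for s unfolding p_def using bounds(6)[OF t] by simp
  have "(\<lambda>x. El t (Psi t x)) = left_sol (\<lambda>s. 1) P"
  proof (rule left_sol_unique[OF _ _ cP bP])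
    show "((\<lambda>x. El t (Psi t x)) has_real_derivative P x - 1 * El t (Psi t x)) (at x)" for x
      by (rule DERIV_cong[OF compose_Psi_derivative[OF t E_space(1)[OF t]]])
        (use bounds(6)[OF t, of "Psi t x"] in \<open>simp add: Peq left_diff_distrib pz\<close>)
    show "\<bar>El t (Psi t x)\<bar> \<le> D" for x by (rule bounds(7)[OF t])
  qed auto
  then show "left_sol (\<lambda>s. 1) P = (\<lambda>x. El t (Psi t x))" by (rule sym)
  have "(\<lambda>x. Er t (Psi t x)) = right_sol (\<lambda>s. 1) P"
  proof (rule right_sol_unique[OF _ _ cP bP])
    show "((\<lambda>x. Er t (Psi t x)) has_real_derivative 1 * Er t (Psi t x) - P x) (at x)" for x
      by (rule DERIV_cong[OF compose_Psi_derivative[OF t E_space(2)[OF t]]])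
        (use bounds(6)[OF t, of "Psi t x"] in \<open>simp add: Peq left_diff_distrib pz\<close>)
    show "\<bar>Er t (Psi t x)\<bar> \<le> D" for x by (rule bounds(8)[OF t])
  qed auto
  then show "right_sol (\<lambda>s. 1) P = (\<lambda>x. Er t (Psi t x))" by (rule sym)
qed

end

context rch
begin

lemma rch_rhs_eq:
  assumes "continuous_on UNIV (\<lambda>x. flux (f x) (ddx f x))" "\<And>x. \<bar>flux (f x) (ddx f x)\<bar> \<le> B"
  shows "rch_rhs c1 c2 c3 f x =
    (left_sol (\<lambda>s. 1) (\<lambda>x. flux (f x) (ddx f x)) x - right_sol (\<lambda>s. 1) (\<lambda>x. flux (f x) (ddx f x)) x) / 2"
proof -
  have "(\<lambda>y. (1/2) * (ddx f y)^2 + c1 * (f y)^2 + c2 * (f y)^3 + c3 * (f y)^4) = (\<lambda>x. flux (f x) (ddx f x))"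
    by (auto simp: flux_def nonlin_def)
  then show ?thesis unfolding rch_rhs_def using ddx_helmholtz_inv[OF assms] by (simp add: field_simps)
qed

end

context lagrangian
begin

lemma u_rhs:
  assumes t: "t \<in> {0..T}"
  shows "rch_rhs c1 c2 c3 (u t) x = (El t (Psi t x) - Er t (Psi t x)) / 2"
  using rch_rhs_eq[OF u_sol_one(3,4)[OF t]] u_sol_one(1,2)[OF t] by simp

text \<open>The position is fixed while the equation lives on characteristics, and differentiability
  of \<open>Psi\<close> in time is to be avoided. So the label \<open>s\<close> through
  \<open>(t, x)\<close> is frozen and \<open>u t' x\<close> is written as \<open>U t' s\<close> plus
  an averaged slope times \<open>x - Phi t' s\<close>. The average is merely continuous in time, but
  its cofactor vanishes at \<open>t' = t\<close>.\<close>

lemma u_time: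
  assumes t: "t \<in> {0..T}"
  shows "((\<lambda>s. u s x) has_real_derivative rch_rhs c1 c2 c3 (u t) x - u t x * ddx (u t) x) (at t within {0..T})"
proof -
  define s where "s = Psi t x"
  define A where "A = (\<lambda>t' y. integral (cbox 0 1) (\<lambda>\<theta>. w t' (Psi t' (y + \<theta> * (x - y)))))"
  have cwP: "continuous_on ({0..T} \<times> UNIV) (\<lambda>(t, x). w t (Psi t x))" by (rule compose_Psi_continuous[OF cw])
  have cA: "continuous_on ({0..T} \<times> UNIV) (\<lambda>(t, y). A t y)"
  proof -
    have "continuous_on ({0..T} \<times> UNIV) (\<lambda>r. integral (cbox 0 1) (\<lambda>\<theta>. w (fst r) (Psi (fst r) (snd r + \<theta> * (x - snd r)))))"
    proof (rule integral_continuous_on_param)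
      have "continuous_on (({0..T} \<times> UNIV) \<times> cbox 0 1) (\<lambda>q. (fst (fst q), snd (fst q) + snd q * (x - snd (fst q))))"
        by (intro continuous_intros)
      then have "continuous_on (({0..T} \<times> UNIV) \<times> cbox 0 1) (\<lambda>q. (\<lambda>(t, x). w t (Psi t x)) (fst (fst q), snd (fst q) + snd q * (x - snd (fst q))))"
        by (rule continuous_on_compose2[OF cwP]) auto
      then show "continuous_on (({0..T} \<times> UNIV) \<times> cbox 0 1) (\<lambda>(r, \<theta>). w (fst r) (Psi (fst r) (snd r + \<theta> * (x - snd r))))"
        by (simp add: split_beta)
    qed
    then show ?thesis unfolding A_def by (simp add: split_beta)
  qed
  have cPhi: "continuous_on {0..T} (\<lambda>t'. Phi t' s)"
    using DERIV_continuous[OF Phi_time] unfolding continuous_on_eq_continuous_within by blast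
  have cB: "continuous_on {0..T} (\<lambda>t'. A t' (Phi t' s))"
  proof -
    have "continuous_on {0..T} (\<lambda>t'. (t', Phi t' s))" by (intro continuous_intros cPhi)
    from continuous_on_compose2[OF cA this] show ?thesis by auto
  qed
  have eq: "u t' x = U t' s + A t' (Phi t' s) * (x - Phi t' s)" if t': "t' \<in> {0..T}" for t'
  proof -
    have c: "continuous_on UNIV (\<lambda>x. w t' (Psi t' x))" by (rule slice_continuous(2)[OF cwP t'])
    have "u t' x - u t' (Phi t' s) = A t' (Phi t' s) * (x - Phi t' s)"
      unfolding A_def cbox_interval by (rule increment_average[OF u_x[OF t'] c])
    moreover have "u t' (Phi t' s) = U t' s" unfolding u_def Psi_Phi[OF t'] ..
    ultimately show ?thesis by simp
  qed
  have xs: "Phi t s = x" unfolding s_def by (rule Phi_Psi[OF t])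
  have "((\<lambda>t'. A t' (Phi t' s) * (x - Phi t' s)) has_real_derivative A t (Phi t s) * (0 - U t s)) (at t within {0..T})"
  proof (rule DERIV_mult_vanishing)
    show "((\<lambda>t'. x - Phi t' s) has_real_derivative 0 - U t s) (at t within {0..T})"
      by (intro DERIV_diff DERIV_const Phi_time[OF t])
    show "((\<lambda>t'. A t' (Phi t' s)) \<longlongrightarrow> A t (Phi t s)) (at t within {0..T})"
      using cB t unfolding continuous_on_def by blast
  qed (simp add: xs)
  moreover have "A t (Phi t s) = ddx (u t) x" unfolding xs A_def ddx_u[OF t] by simp
  ultimately have "((\<lambda>t'. U t' s + A t' (Phi t' s) * (x - Phi t' s)) has_real_derivative
      (El t s - Er t s) / 2 + ddx (u t) x * (0 - U t s)) (at t within {0..T})"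
    using Ut[OF t, of s] unfolding El_def Er_def by (intro DERIV_add) auto
  moreover have "(El t s - Er t s) / 2 + ddx (u t) x * (0 - U t s) = rch_rhs c1 c2 c3 (u t) x - u t x * ddx (u t) x"
    unfolding u_rhs[OF t] s_def[symmetric] by (simp add: u_def s_def)
  ultimately have "((\<lambda>t'. U t' s + A t' (Phi t' s) * (x - Phi t' s)) has_real_derivative
      rch_rhs c1 c2 c3 (u t) x - u t x * ddx (u t) x) (at t within {0..T})" by simp
  then show ?thesis
    by (rule has_field_derivative_transform_within[OF _ zero_less_one t]) (simp add: eq)
qed

lemma u_Linf: "u \<in> Linf_T_lipschitz T"
  unfolding Linf_T_lipschitz_def
proof (intro CollectI exI[of _ 4] AE_I2 impI conjI)
  fix t assume t: "t \<in> {0..T}"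
  have c: "continuous_on UNIV (u t)" "continuous_on UNIV (ddx (u t))"
    using u_CT_smooth t smooth_continuous_on smooth_ddx unfolding CT_smooth_def by blast+
  have "2-lipschitz_on UNIV (u t)"
  proof (rule lipschitz_onI)
    fix x y
    have "norm (u t x - u t y) \<le> 2 * norm (x - y)"
      by (rule field_differentiable_bound[of UNIV "u t" "\<lambda>x. w t (Psi t x)"]) (use u_x[OF t] bounds[OF t] in auto)
    then show "dist (u t x) (u t y) \<le> 2 * dist x y" by (simp add: dist_norm)
  qed simp
  moreover have "bounded (range (u t))" using u_bounds(1)[OF t] by (auto simp: bounded_iff)
  ultimately show "u t \<in> bounded_lipschitz" unfolding bounded_lipschitz_def by blast
  have "Linf_norm (u t) \<le> ennreal 2" "Linf_norm (ddx (u t)) \<le> ennreal 2"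
    using Linf_norm_le[OF borel_measurable_continuous_onI[OF c(1)], of 2]
      Linf_norm_le[OF borel_measurable_continuous_onI[OF c(2)], of 2] u_bounds[OF t] by simp_all
  then have "Linf_norm (u t) + Linf_norm (ddx (u t)) \<le> ennreal 2 + ennreal 2" by (rule add_mono)
  then show "Linf_norm (u t) + Linf_norm (ddx (u t)) \<le> ennreal 4" by simp
qed

lemma u_init: "u 0 x = u0 x"
proof -
  have "Phi 0 x = x" unfolding Phi_def by simp
  then have "Psi 0 x = x" using Psi_Phi[of 0 x] T by simp
  then show ?thesis unfolding u_def init by simp
qed

lemma u_solution: "rch_solution c1 c2 c3 T u0 u"
  unfolding rch_solution_def using u_CT_smooth u_Linf u_init u_time by blast

end

section \<open>Uniqueness\<close>

text \<open>Only difference quotients from the left are used, so the maximum may occur at the final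
  time.\<close>

lemma derivative_nonneg_at_max:
  fixes g :: "real \<Rightarrow> real"
  assumes d: "(g has_real_derivative D) (at t within {0..T})" and t: "0 < t" "t \<le> T"
    and m: "\<And>s. s \<in> {0..T} \<Longrightarrow> g s \<le> g t"
  shows "D \<ge> 0"
proof -
  have "(g has_real_derivative D) (at t within {0..t})" by (rule DERIV_subset[OF d]) (use t in auto)
  then have "((\<lambda>s. (g s - g t) / (s - t)) \<longlongrightarrow> D) (at t within {0..t})"
    unfolding has_field_derivative_iff .
  moreover have "\<forall>\<^sub>F s in at t within {0..t}. 0 \<le> (g s - g t) / (s - t)"
    unfolding eventually_at_filter
    by (rule always_eventually) (use m t in \<open>auto intro!: divide_nonpos_nonpos\<close>)
  moreover have "at t within {0..t} \<noteq> bot"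
    using t by (simp add: trivial_limit_within islimpt_Icc)
  ultimately show ?thesis by (rule tendsto_lowerbound)
qed

text \<open>At a maximum of \<open>exp (- K t) * f t x - \<epsilon> * sqrt (1 + x\<^sup>2)\<close> the transport term is
  controlled by \<open>\<epsilon>\<close>; the penalisation makes the maximum exist although the line is
  not compact.\<close>

lemma transport_maximum_principle:
  fixes f v ft fx :: "real \<Rightarrow> real \<Rightarrow> real"
  assumes cf: "continuous_on ({0..T} \<times> UNIV) (\<lambda>(t, x). f t x)"
    and M: "\<And>t x. t \<in> {0..T} \<Longrightarrow> f t x \<le> M" and f0: "\<And>x. f 0 x \<le> 0"
    and ft: "\<And>t x. t \<in> {0..T} \<Longrightarrow> ((\<lambda>t. f t x) has_real_derivative ft t x) (at t within {0..T})"
    and fx: "\<And>t x. t \<in> {0..T} \<Longrightarrow> (f t has_real_derivative fx t x) (at x)"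
    and V: "\<And>t x. t \<in> {0..T} \<Longrightarrow> \<bar>v t x\<bar> \<le> V" and C: "C \<ge> 0"
    and key: "\<And>t x S. t \<in> {0..T} \<Longrightarrow> S \<ge> 0 \<Longrightarrow> (\<And>y. f t y \<le> S) \<Longrightarrow> ft t x + v t x * fx t x \<le> C * S"
    and t: "t \<in> {0..T}"
  shows "f t x \<le> 0"
proof (rule ccontr)
  assume "\<not> f t x \<le> 0"
  then have pos: "f t x > 0" by simp
  \<comment> \<open>At the maximum found below \<open>h\<close> exceeds \<open>S / 2\<close>. The
    damping \<open>K * h\<close> is then at least \<open>C * S + S\<close>, more than the growth
    \<open>C * S\<close> and the penalisation error \<open>V * \<epsilon> < S\<close>
    together.\<close>
  define K where "K = 2 * C + 2"
  define h where "h = (\<lambda>t x. exp (- K * t) * f t x)"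
  define S where "S = (SUP q\<in>{0..T} \<times> UNIV. h (fst q) (snd q))"
  have K: "K > 0" unfolding K_def using C by simp
  have T0: "T \<ge> 0" using t by auto
  have V0: "V \<ge> 0" using V[OF t, of x] by linarith
  have hM: "h t x \<le> \<bar>M\<bar>" if "t \<in> {0..T}" for t x
  proof -
    have "exp (- K * t) * f t x \<le> exp (- K * t) * \<bar>M\<bar>" using M[OF that, of x] by (intro mult_left_mono) auto
    also have "\<dots> \<le> 1 * \<bar>M\<bar>" using K that by (intro mult_right_mono) auto
    finally show ?thesis unfolding h_def by simp
  qed
  have bdd: "bdd_above ((\<lambda>q. h (fst q) (snd q)) ` ({0..T} \<times> UNIV))"
    by (rule bdd_aboveI2[of _ _ "\<bar>M\<bar>"]) (use hM in auto)
  have hS: "h t x \<le> S" if "t \<in> {0..T}" for t x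
    unfolding S_def using cSUP_upper[OF _ bdd, of "(t, x)"] that by simp
  have S: "S > 0" using hS[OF t, of x] pos unfolding h_def by (smt (verit) exp_gt_zero mult_pos_pos)
  have "\<exists>q\<in>{0..T} \<times> UNIV. 3/4 * S < h (fst q) (snd q)"
    using less_cSUP_iff[OF _ bdd, of "3/4 * S"] S t unfolding S_def[symmetric] by auto
  then obtain t1 x1 where t1: "t1 \<in> {0..T}" and h1: "3/4 * S < h t1 x1" by auto
  \<comment> \<open>The first entry keeps the penalised value at the near-maximiser
    \<open>(t1, x1)\<close> above \<open>S / 2\<close>; the second makes
    \<open>V * \<epsilon>\<close> smaller than \<open>S\<close>.\<close>
  define \<epsilon> where "\<epsilon> = min (S / (8 * (1 + x1\<^sup>2))) (S / (2 * (V + 1)))"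
  have pq: "1 + x1\<^sup>2 > 0" by (simp add: add_pos_nonneg)
  have \<epsilon>: "\<epsilon> > 0" unfolding \<epsilon>_def using S V0 pq by simp
  have \<epsilon>1: "\<epsilon> * (1 + x1\<^sup>2) \<le> S / 8"
  proof -
    have "\<epsilon> * (1 + x1\<^sup>2) \<le> S / (8 * (1 + x1\<^sup>2)) * (1 + x1\<^sup>2)" unfolding \<epsilon>_def using pq by (intro mult_right_mono) auto
    moreover have "S / (8 * y) * y = S / 8" if "y > 0" for y using that by simp
    ultimately show ?thesis using pq by metis
  qed
  have \<epsilon>2: "V * \<epsilon> < S"
  proof -
    have "(V + 1) * \<epsilon> \<le> (V + 1) * (S / (2 * (V + 1)))" unfolding \<epsilon>_def using V0 by (intro mult_left_mono) auto
    also have "\<dots> = S / 2"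
    proof -
      have "y * (S / (2 * y)) = S / 2" if "y > 0" for y using that by simp
      from this[of "V + 1"] show ?thesis using V0 by simp
    qed
    finally show ?thesis using S \<epsilon> by (simp add: algebra_simps)
  qed
  define g where "g = (\<lambda>t x. h t x - \<epsilon> * sqrt (1 + x\<^sup>2))"
  have g1: "g t1 x1 > S / 2"
  proof -
    have "sqrt (1 + x1\<^sup>2) \<le> 1 + x1\<^sup>2" by (rule real_le_lsqrt) (auto simp: power2_eq_square distrib_left distrib_right)
    then have "\<epsilon> * sqrt (1 + x1\<^sup>2) \<le> S / 8" using \<epsilon>1 \<epsilon> by (smt (verit) mult_left_mono)
    then show ?thesis unfolding g_def using h1 S by linarith
  qed
  have gx: "g t x \<le> S - \<epsilon> * \<bar>x\<bar>" if "t \<in> {0..T}" for t x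
  proof -
    have "\<bar>x\<bar> \<le> sqrt (1 + x\<^sup>2)" by (rule real_le_rsqrt) simp
    then have "\<epsilon> * \<bar>x\<bar> \<le> \<epsilon> * sqrt (1 + x\<^sup>2)" using \<epsilon> by (intro mult_left_mono) auto
    then show ?thesis unfolding g_def using hS[OF that, of x] by linarith
  qed
  \<comment> \<open>Beyond \<open>R\<close> the penalty outweighs \<open>S\<close>, so a maximum
    over the compact rectangle is a maximum over the whole strip.\<close>
  define R where "R = S / \<epsilon>"
  have out: "g t x \<le> 0" if "t \<in> {0..T}" "\<bar>x\<bar> \<ge> R" for t x
  proof -
    have "S \<le> \<epsilon> * \<bar>x\<bar>" using that(2) \<epsilon> unfolding R_def by (simp add: field_simps)
    then show ?thesis using gx[OF that(1), of x] by linarith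
  qed
  have cg: "continuous_on ({0..T} \<times> UNIV) (\<lambda>q. g (fst q) (snd q))"
    unfolding g_def h_def using cf by (auto simp: split_beta intro!: continuous_intros)
  have "\<exists>q\<in>{0..T} \<times> {-R..R}. \<forall>r\<in>{0..T} \<times> {-R..R}. g (fst r) (snd r) \<le> g (fst q) (snd q)"
  proof (rule continuous_attains_sup)
    show "compact ({0..T} \<times> {-R..R})" by (intro compact_Times compact_Icc)
    show "{0..T} \<times> {-R..R} \<noteq> {}" using T0 S \<epsilon> unfolding R_def by auto
    show "continuous_on ({0..T} \<times> {-R..R}) (\<lambda>q. g (fst q) (snd q))" by (rule continuous_on_subset[OF cg]) auto
  qed
  then obtain ts xs where ts: "ts \<in> {0..T}" and "xs \<in> {-R..R}"
      and mx: "\<And>t x. t \<in> {0..T} \<Longrightarrow> x \<in> {-R..R} \<Longrightarrow> g t x \<le> g ts xs" by auto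
  have "\<bar>x1\<bar> < R" using out[OF t1, of x1] g1 S by linarith
  then have gs: "g ts xs > S / 2" using mx[OF t1, of x1] g1 by (auto simp: abs_less_iff)
  have mxx: "g t x \<le> g ts xs" if "t \<in> {0..T}" for t x
  proof (cases "\<bar>x\<bar> \<le> R")
    case True
    then show ?thesis using mx[OF that, of x] by (auto simp: abs_le_iff)
  next
    case False
    then show ?thesis using out[OF that, of x] gs S by linarith
  qed
  have hs: "h ts xs > S / 2"
  proof -
    have "\<epsilon> * sqrt (1 + xs\<^sup>2) \<ge> 0" using \<epsilon> by simp
    then show ?thesis using gs unfolding g_def by linarith
  qed
  have "ts \<noteq> 0"
  proof
    assume "ts = 0"
    then have "h ts xs \<le> 0" unfolding h_def using f0[of xs] by (simp add: mult_nonneg_nonpos)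
    then show False using hs S by linarith
  qed
  then have ts0: "0 < ts" "ts \<le> T" using ts by auto
  let ?E = "exp (- K * ts)"
  have "?E * ft ts xs - K * h ts xs \<ge> 0"
  proof (rule derivative_nonneg_at_max[OF _ ts0, of "\<lambda>t. g t xs"])
    show "((\<lambda>t. g t xs) has_real_derivative ?E * ft ts xs - K * h ts xs) (at ts within {0..T})"
      unfolding g_def h_def by (auto intro!: derivative_eq_intros ft[OF ts] simp: algebra_simps)
  qed (use mxx in auto)
  moreover have "?E * fx ts xs - \<epsilon> * (xs / sqrt (1 + xs\<^sup>2)) = 0"
  proof (rule DERIV_local_max[of "g ts" _ xs 1])
    have sq: "1 + xs\<^sup>2 > 0" by (simp add: add_pos_nonneg)
    have d2: "((\<lambda>x. 1 + x\<^sup>2) has_real_derivative 2 * xs) (at xs)"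
      by (auto intro!: derivative_eq_intros)
    have "((\<lambda>x. sqrt (1 + x\<^sup>2)) has_real_derivative inverse (sqrt (1 + xs\<^sup>2)) / 2 * (2 * xs)) (at xs)"
      by (rule DERIV_chain2[where f = sqrt and g = "\<lambda>x. 1 + x\<^sup>2", OF DERIV_real_sqrt[OF sq] d2])
    moreover have "inverse y / 2 * (2 * xs) = xs / y" for y by (cases "y = 0") (auto simp: field_simps)
    ultimately have "((\<lambda>x. sqrt (1 + x\<^sup>2)) has_real_derivative xs / sqrt (1 + xs\<^sup>2)) (at xs)"
      by (simp only:)
    then show "(g ts has_real_derivative ?E * fx ts xs - \<epsilon> * (xs / sqrt (1 + xs\<^sup>2))) (at xs)"
      unfolding g_def h_def by (intro DERIV_diff DERIV_cmult fx[OF ts])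
  qed (use mxx[OF ts] in auto)
  moreover have "\<bar>v ts xs * (\<epsilon> * (xs / sqrt (1 + xs\<^sup>2)))\<bar> \<le> V * \<epsilon>"
  proof -
    have "\<bar>xs\<bar> \<le> sqrt (1 + xs\<^sup>2)" by (rule real_le_rsqrt) simp
    moreover have "0 < 1 + xs\<^sup>2" by (simp add: add_pos_nonneg)
    ultimately have "\<bar>xs / sqrt (1 + xs\<^sup>2)\<bar> \<le> 1" by (simp add: abs_divide divide_le_eq_1)
    then have "\<epsilon> * \<bar>xs / sqrt (1 + xs\<^sup>2)\<bar> \<le> \<epsilon> * 1" using \<epsilon> by (intro mult_left_mono) auto
    then show ?thesis unfolding abs_mult[of "v ts xs"] using V[OF ts, of xs] V0 \<epsilon> by (intro mult_mono) (auto simp: abs_mult)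
  qed
  moreover have "?E * (ft ts xs + v ts xs * fx ts xs) \<le> C * S"
  proof -
    have "f ts y \<le> exp (K * ts) * S" for y
    proof -
      have "exp (K * ts) * h ts y \<le> exp (K * ts) * S" using hS[OF ts] by (intro mult_left_mono) auto
      then show ?thesis unfolding h_def by (simp add: mult.assoc[symmetric] exp_add[symmetric])
    qed
    then have "ft ts xs + v ts xs * fx ts xs \<le> C * (exp (K * ts) * S)"
      using S by (intro key[OF ts]) auto
    then have "?E * (ft ts xs + v ts xs * fx ts xs) \<le> ?E * (C * (exp (K * ts) * S))" by (intro mult_left_mono) auto
    also have "\<dots> = C * S" by (simp add: exp_minus)
    finally show ?thesis .
  qed
  moreover have "K * h ts xs \<ge> K * (S / 2)" using hs K by (intro mult_left_mono) auto
  moreover have "?E * (ft ts xs + v ts xs * fx ts xs) = ?E * ft ts xs + v ts xs * (?E * fx ts xs)"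
    by (simp add: algebra_simps)
  moreover have "K * (S / 2) = C * S + S" unfolding K_def by (simp add: algebra_simps)
  ultimately show False using \<epsilon>2 by (smt (verit))
qed

lemma CT_smooth_jointly_continuous:
  assumes "v \<in> CT_smooth T"
  shows "continuous_on ({0..T} \<times> UNIV) (\<lambda>(t, x). (ddx ^^ n) (v t) x)"
  unfolding continuous_on_iff
proof (intro ballI allI impI)
  fix q :: "real \<times> real" and e :: real
  assume q: "q \<in> {0..T} \<times> UNIV" and e: "e > 0"
  obtain t x where tx: "q = (t, x)" by force
  have t: "t \<in> {0..T}" using q tx by auto
  let ?F = "\<lambda>t. (ddx ^^ n) (v t)"
  have "uniform_limit (cball x 1) ?F (?F t) (at t within {0..T})"
    using assms t unfolding CT_smooth_def by auto
  then have "\<forall>\<^sub>F s in at t within {0..T}. \<forall>y\<in>cball x 1. dist (?F s y) (?F t y) < e / 2"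
    using e by (intro uniform_limitD) auto
  then obtain d1 where d1: "d1 > 0" "\<And>s y. s \<in> {0..T} \<Longrightarrow> s \<noteq> t \<Longrightarrow> dist s t < d1 \<Longrightarrow> y \<in> cball x 1 \<Longrightarrow> dist (?F s y) (?F t y) < e / 2"
    unfolding eventually_at by blast
  have "smooth (v t)" using assms t unfolding CT_smooth_def by auto
  then have "smooth (?F t)" by (induction n) (auto intro: smooth_ddx)
  then have "isCont (?F t) x" using smooth_continuous_on continuous_on_eq_continuous_at by blast
  then obtain d2 where d2: "d2 > 0" "\<And>y. dist y x < d2 \<Longrightarrow> dist (?F t y) (?F t x) < e / 2"
    unfolding continuous_at_eps_delta using e by (metis half_gt_zero dist_norm real_norm_def dist_real_def)
  show "\<exists>d>0. \<forall>q'\<in>{0..T} \<times> UNIV. dist q' q < d \<longrightarrow> dist (case q' of (t, x) \<Rightarrow> ?F t x) (case q of (t, x) \<Rightarrow> ?F t x) < e"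
  proof (intro exI[of _ "min 1 (min d1 d2)"] conjI ballI impI)
    fix q' :: "real \<times> real" assume q': "q' \<in> {0..T} \<times> UNIV" "dist q' q < min 1 (min d1 d2)"
    obtain s y where sy: "q' = (s, y)" by force
    have s: "s \<in> {0..T}" using q' sy by auto
    have "dist s t \<le> dist q' q" "dist y x \<le> dist q' q"
      using dist_fst_le[of q' q] dist_snd_le[of q' q] sy tx by auto
    then have ds: "dist s t < d1" "dist y x < d2" "y \<in> cball x 1" using q'(2) by (auto simp: dist_commute)
    have "dist (?F s y) (?F t y) < e / 2" using d1(2)[OF s _ ds(1,3)] e by (cases "s = t") auto
    then have "dist (?F s y) (?F t x) < e" using d2(2)[OF ds(2)] dist_triangle_half_l[of "?F s y" "?F t y" e "?F t x"]
      by (metis dist_commute dist_triangle_half_r)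
    then show "dist (case q' of (t, x) \<Rightarrow> ?F t x) (case q of (t, x) \<Rightarrow> ?F t x) < e" using sy tx by simp
  qed (use d1 d2 in auto)
qed

text \<open>The maximum with 0 appears because \<open>ennreal\<close> sends negative numbers to
  0.\<close>

lemma Linf_norm_continuous_le:
  assumes "continuous_on UNIV f" "Linf_norm f \<le> ennreal M"
  shows "\<bar>f x\<bar> \<le> max M 0"
proof -
  have "AE x in lborel. ennreal (norm (f x)) \<le> ennreal M"
    using esssup_AE[of "\<lambda>x. ennreal (norm (f x))" lborel] assms(2) unfolding Linf_norm_def
    by (auto elim!: eventually_mono intro: order_trans)
  then have "AE x in lborel. \<bar>f x\<bar> \<le> max M 0"
    by eventually_elim (auto simp: ennreal_le_iff2)
  then show ?thesis by (rule continuous_AE_le) (intro continuous_intros assms(1))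
qed

text \<open>The solution class controls the Lipschitz norm only for almost every time. Continuity in
  time at each fixed position upgrades this to every time, endpoints included.\<close>

lemma Linf_T_lipschitz_bound:
  assumes T: "T > 0" and v: "v \<in> CT_smooth T" "v \<in> Linf_T_lipschitz T"
  obtains M where "M \<ge> 0" "\<And>t x. t \<in> {0..T} \<Longrightarrow> \<bar>v t x\<bar> \<le> M" "\<And>t x. t \<in> {0..T} \<Longrightarrow> \<bar>ddx (v t) x\<bar> \<le> M"
proof -
  obtain M where M: "AE t in lborel. t \<in> {0..T} \<longrightarrow> v t \<in> bounded_lipschitz \<and> Linf_norm (v t) + Linf_norm (ddx (v t)) \<le> ennreal M"
    using v(2) unfolding Linf_T_lipschitz_def by auto
  have sm: "smooth (v t)" if "t \<in> {0..T}" for t using v(1) that unfolding CT_smooth_def by auto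
  have c: "continuous_on ({0..T} \<times> UNIV) (\<lambda>(t, x). v t x)" "continuous_on ({0..T} \<times> UNIV) (\<lambda>(t, x). ddx (v t) x)"
    using CT_smooth_jointly_continuous[OF v(1), of 0] CT_smooth_jointly_continuous[OF v(1), of 1] by auto
  show ?thesis
  proof (rule that[of "max M 0"])
    show "\<bar>v t x\<bar> \<le> max M 0" if t: "t \<in> {0..T}" for t x
    proof (rule continuous_AE_le_interval[OF _ _ T t])
      show "AE t in lborel. t \<in> {0..T} \<longrightarrow> \<bar>v t x\<bar> \<le> max M 0"
        using M
      proof eventually_elim
        case (elim t)
        show ?case
        proof
          assume t: "t \<in> {0..T}"
          then have "Linf_norm (v t) \<le> ennreal M" using elim by (auto intro: order_trans[rotated] add_increasing2)
          then show "\<bar>v t x\<bar> \<le> max M 0" by (rule Linf_norm_continuous_le[OF smooth_continuous_on[OF sm[OF t]]])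
        qed
      qed
      show "continuous_on {0..T} (\<lambda>t. \<bar>v t x\<bar>)" by (intro continuous_intros slice_continuous(1)[OF c(1)])
    qed
    show "\<bar>ddx (v t) x\<bar> \<le> max M 0" if t: "t \<in> {0..T}" for t x
    proof (rule continuous_AE_le_interval[OF _ _ T t])
      show "AE t in lborel. t \<in> {0..T} \<longrightarrow> \<bar>ddx (v t) x\<bar> \<le> max M 0"
        using M
      proof eventually_elim
        case (elim t)
        show ?case
        proof
          assume t: "t \<in> {0..T}"
          then have "Linf_norm (ddx (v t)) \<le> ennreal M" using elim by (auto intro: order_trans[rotated] add_increasing)
          then show "\<bar>ddx (v t) x\<bar> \<le> max M 0"
            by (rule Linf_norm_continuous_le[OF smooth_continuous_on[OF smooth_ddx[OF sm[OF t]]]])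
        qed
      qed
      show "continuous_on {0..T} (\<lambda>t. \<bar>ddx (v t) x\<bar>)" by (intro continuous_intros slice_continuous(1)[OF c(2)])
    qed
  qed simp
qed

context rch
begin

section \<open>Evolution of a solution and of its slope at a fixed position\<close>

definition field_flux :: "(real \<Rightarrow> real \<Rightarrow> real) \<Rightarrow> real \<Rightarrow> real \<Rightarrow> real" where
  "field_flux v t x = flux (v t x) (ddx (v t) x)"

definition Hl :: "(real \<Rightarrow> real \<Rightarrow> real) \<Rightarrow> real \<Rightarrow> real \<Rightarrow> real" where "Hl v t = left_sol (\<lambda>s. 1) (field_flux v t)"
definition Hr :: "(real \<Rightarrow> real \<Rightarrow> real) \<Rightarrow> real \<Rightarrow> real \<Rightarrow> real" where "Hr v t = right_sol (\<lambda>s. 1) (field_flux v t)"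

text \<open>A competing solution may be of any finite size, so the constants on
  \<open>[-2, 2]\<close> are of no use in the uniqueness argument.\<close>

lemma flux_bounded_lipschitz:
  assumes M: "M \<ge> 0"
  obtains L where "L \<ge> 0" "\<And>a b. \<bar>a\<bar> \<le> M \<Longrightarrow> \<bar>b\<bar> \<le> M \<Longrightarrow> \<bar>flux a b\<bar> \<le> L"
    "\<And>a b a' b'. \<bar>a\<bar> \<le> M \<Longrightarrow> \<bar>b\<bar> \<le> M \<Longrightarrow> \<bar>a'\<bar> \<le> M \<Longrightarrow> \<bar>b'\<bar> \<le> M \<Longrightarrow> \<bar>flux a b - flux a' b'\<bar> \<le> L * (\<bar>a - a'\<bar> + \<bar>b - b'\<bar>)"
proof -
  define K where "K = 2 * \<bar>c1\<bar> * M + 3 * \<bar>c2\<bar> * M^2 + 4 * \<bar>c3\<bar> * M^3"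
  have K0: "K \<ge> 0" unfolding K_def using M by simp
  have h': "\<bar>nonlin' y\<bar> \<le> K" if y: "\<bar>y\<bar> \<le> M" for y
  proof -
    have p: "\<bar>y\<bar>^2 \<le> M^2" "\<bar>y\<bar>^3 \<le> M^3" using y by (intro power_mono; simp)+
    have "\<bar>nonlin' y\<bar> \<le> \<bar>2 * c1 * y\<bar> + \<bar>3 * c2 * y^2\<bar> + \<bar>4 * c3 * y^3\<bar>" unfolding nonlin'_def by linarith
    also have "\<dots> = 2 * \<bar>c1\<bar> * \<bar>y\<bar> + 3 * \<bar>c2\<bar> * \<bar>y\<bar>^2 + 4 * \<bar>c3\<bar> * \<bar>y\<bar>^3" by (simp add: abs_mult power_abs)
    also have "\<dots> \<le> K" unfolding K_def using y p by (intro add_mono mult_left_mono) auto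
    finally show ?thesis .
  qed
  have hl: "\<bar>nonlin a - nonlin b\<bar> \<le> K * \<bar>a - b\<bar>" if "\<bar>a\<bar> \<le> M" "\<bar>b\<bar> \<le> M" for a b
    using field_differentiable_bound[of "{-M..M}" nonlin nonlin' K a b] nonlin_deriv h' that by (auto simp: abs_le_iff)
  have lip: "\<bar>flux a b - flux a' b'\<bar> \<le> (K + M) * (\<bar>a - a'\<bar> + \<bar>b - b'\<bar>)"
    if a: "\<bar>a\<bar> \<le> M" "\<bar>b\<bar> \<le> M" "\<bar>a'\<bar> \<le> M" "\<bar>b'\<bar> \<le> M" for a b a' b'
  proof -
    have "b^2 / 2 - b'^2 / 2 = (b + b') / 2 * (b - b')" by (simp add: power2_eq_square field_simps)
    then have "\<bar>b^2 / 2 - b'^2 / 2\<bar> = \<bar>(b + b') / 2\<bar> * \<bar>b - b'\<bar>" by (simp only: abs_mult)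
    also have "\<dots> \<le> M * \<bar>b - b'\<bar>" using a by (intro mult_right_mono) auto
    finally have "\<bar>flux a b - flux a' b'\<bar> \<le> K * \<bar>a - a'\<bar> + M * \<bar>b - b'\<bar>" using hl[OF a(1,3)] unfolding flux_def by linarith
    also have "\<dots> \<le> (K + M) * \<bar>a - a'\<bar> + (K + M) * \<bar>b - b'\<bar>" using K0 M by (intro add_mono mult_right_mono) auto
    finally show ?thesis by (simp add: algebra_simps)
  qed
  have bd: "\<bar>flux a b\<bar> \<le> (K + M) * (2 * M)" if a: "\<bar>a\<bar> \<le> M" "\<bar>b\<bar> \<le> M" for a b
  proof -
    have "\<bar>flux a b - flux 0 0\<bar> \<le> (K + M) * (\<bar>a - 0\<bar> + \<bar>b - 0\<bar>)" by (rule lip) (use a M in auto)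
    also have "\<dots> \<le> (K + M) * (2 * M)" using a K0 M by (intro mult_left_mono) auto
    finally show ?thesis by (simp add: flux_def nonlin_def)
  qed
  show ?thesis
  proof (rule that[of "(K + M) * (2 * M + 1)"])
    show "(K + M) * (2 * M + 1) \<ge> 0" using K0 M by simp
    show "\<bar>flux a b\<bar> \<le> (K + M) * (2 * M + 1)" if "\<bar>a\<bar> \<le> M" "\<bar>b\<bar> \<le> M" for a b
      using bd[OF that] K0 M by (simp add: algebra_simps)
    show "\<bar>flux a b - flux a' b'\<bar> \<le> (K + M) * (2 * M + 1) * (\<bar>a - a'\<bar> + \<bar>b - b'\<bar>)"
      if "\<bar>a\<bar> \<le> M" "\<bar>b\<bar> \<le> M" "\<bar>a'\<bar> \<le> M" "\<bar>b'\<bar> \<le> M" for a b a' b'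
    proof -
      have "(K + M) * 1 * (\<bar>a - a'\<bar> + \<bar>b - b'\<bar>) \<le> (K + M) * (2 * M + 1) * (\<bar>a - a'\<bar> + \<bar>b - b'\<bar>)"
        using K0 M by (intro mult_right_mono mult_left_mono) auto
      then show ?thesis using lip[OF that] by simp
    qed
  qed
qed

text \<open>The definition of a solution gives a time derivative for \<open>v\<close> but not for
  its slope. The slope equation is obtained by writing \<open>v\<close> as a time integral,
  differentiating under the integral in space, and then applying the fundamental theorem in time. In
  it the local flux reappears from the second derivative of the nonlocal term.\<close>

lemma solution_facts:
  assumes T: "T > 0" and sol: "rch_solution c1 c2 c3 T u0 v"
    and M0: "M \<ge> 0" and Mv: "\<forall>t\<in>{0..T}. \<forall>x. \<bar>v t x\<bar> \<le> M \<and> \<bar>ddx (v t) x\<bar> \<le> M"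
    and t: "t \<in> {0..T}"
  shows "continuous_on UNIV (field_flux v t)" "\<exists>L. \<forall>x. \<bar>field_flux v t x\<bar> \<le> L"
    "((\<lambda>t. v t x) has_real_derivative (Hl v t x - Hr v t x) / 2 - v t x * ddx (v t) x) (at t within {0..T})"
    "((\<lambda>t. ddx (v t) x) has_real_derivative
       field_flux v t x - (Hl v t x + Hr v t x) / 2 - (ddx (v t) x)^2 - v t x * ddx (ddx (v t)) x) (at t within {0..T})"
proof -
  have v: "v \<in> CT_smooth T" using sol unfolding rch_solution_def by auto
  have sm: "smooth (v t)" if "t \<in> {0..T}" for t using v that unfolding CT_smooth_def by auto
  have cv: "continuous_on ({0..T} \<times> UNIV) (\<lambda>(t, x). v t x)" "continuous_on ({0..T} \<times> UNIV) (\<lambda>(t, x). ddx (v t) x)"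
    "continuous_on ({0..T} \<times> UNIV) (\<lambda>(t, x). ddx (ddx (v t)) x)"
    using CT_smooth_jointly_continuous[OF v, of 0] CT_smooth_jointly_continuous[OF v, of 1]
      CT_smooth_jointly_continuous[OF v, of 2] by (auto simp: numeral_2_eq_2)
  obtain L where L: "\<And>a b. \<bar>a\<bar> \<le> M \<Longrightarrow> \<bar>b\<bar> \<le> M \<Longrightarrow> \<bar>flux a b\<bar> \<le> L"
    using flux_bounded_lipschitz[OF M0] by metis
  have PL: "\<bar>field_flux v t x\<bar> \<le> L" if "t \<in> {0..T}" for t x unfolding field_flux_def by (rule L) (use Mv that in auto)
  then show "\<exists>L. \<forall>x. \<bar>field_flux v t x\<bar> \<le> L" using t by blast
  have cP: "continuous_on ({0..T} \<times> UNIV) (\<lambda>(t, x). field_flux v t x)"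
    unfolding field_flux_def flux_def nonlin_def using cv by (auto simp: split_beta intro!: continuous_intros)
  note cPt = slice_continuous(2)[OF cP]
  show "continuous_on UNIV (field_flux v t)" by (rule cPt[OF t])
  have cH: "continuous_on ({0..T} \<times> UNIV) (\<lambda>(t, x). Hl v t x)" "continuous_on ({0..T} \<times> UNIV) (\<lambda>(t, x). Hr v t x)"
    unfolding Hl_def Hr_def using sol_one_jointly_continuous[OF cP PL] by auto
  have one: "continuous_on UNIV (\<lambda>s::real. 1::real)" by (rule continuous_on_const)
  have dH: "(Hl v t has_real_derivative field_flux v t x - Hl v t x) (at x)" "(Hr v t has_real_derivative Hr v t x - field_flux v t x) (at x)"
    if "t \<in> {0..T}" for t x
    using left_sol(1)[OF one _ cPt[OF that] PL[OF that]] right_sol(1)[OF one _ cPt[OF that] PL[OF that]]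
    unfolding Hl_def Hr_def by auto
  let ?N = "\<lambda>t x. (Hl v t x - Hr v t x) / 2 - v t x * ddx (v t) x"
  let ?N' = "\<lambda>t x. field_flux v t x - (Hl v t x + Hr v t x) / 2 - (ddx (v t) x)^2 - v t x * ddx (ddx (v t)) x"
  have vt: "((\<lambda>t. v t x) has_real_derivative ?N t x) (at t within {0..T})" if t: "t \<in> {0..T}" for t x
  proof -
    have "rch_rhs c1 c2 c3 (v t) x = (Hl v t x - Hr v t x) / 2"
    proof -
      have e: "(\<lambda>x. flux (v t x) (ddx (v t) x)) = field_flux v t" by (auto simp: field_flux_def)
      show ?thesis unfolding Hl_def Hr_def
        by (rule rch_rhs_eq[of "v t" L x, unfolded e]) (use cPt[OF t, of UNIV] PL[OF t] in \<open>auto simp: field_flux_def\<close>)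
    qed
    then show ?thesis using sol t unfolding rch_solution_def by metis
  qed
  then show "((\<lambda>t. v t x) has_real_derivative ?N t x) (at t within {0..T})" using t .
  have cN: "continuous_on ({0..T} \<times> UNIV) (\<lambda>(t, x). ?N t x)" "continuous_on ({0..T} \<times> UNIV) (\<lambda>(t, x). ?N' t x)"
    using cv cH cP by (auto simp: split_beta intro!: continuous_intros)
  have dN: "(?N t has_real_derivative ?N' t x) (at x)" if t: "t \<in> {0..T}" for t x
  proof -
    note d1 = smooth_has_real_derivative[OF sm[OF t], of x] and d2 = smooth_has_real_derivative[OF smooth_ddx[OF sm[OF t]], of x]
    show ?thesis
      by (rule DERIV_cong[OF DERIV_diff[OF DERIV_cdivide[OF DERIV_diff[OF dH[OF t]]] DERIV_mult[OF d1 d2]]])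
        (simp add: field_simps power2_eq_square)
  qed
  have vx: "ddx (v t) x = ddx u0 x + integral {0..t} (\<lambda>\<tau>. ?N' \<tau> x)" if t: "t \<in> {0..T}" for t x
  proof -
    have veq: "v t = (\<lambda>x. u0 x + integral {0..t} (\<lambda>\<tau>. ?N \<tau> x))"
    proof
      fix x
      show "v t x = u0 x + integral {0..t} (\<lambda>\<tau>. ?N \<tau> x)"
        using time_FTC[OF vt t, of x] sol unfolding rch_solution_def by simp
    qed
    have "v 0 = u0" using sol unfolding rch_solution_def by auto
    then have "smooth u0" using sm[of 0] T by simp
    then have "((\<lambda>x. u0 x + integral {0..t} (\<lambda>\<tau>. ?N \<tau> x)) has_real_derivative ddx u0 x + integral {0..t} (\<lambda>\<tau>. ?N' \<tau> x)) (at x)"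
      by (intro DERIV_add smooth_has_real_derivative time_integral_derivative[OF cN(1) dN cN(2) t])
    then have "(v t has_real_derivative ddx u0 x + integral {0..t} (\<lambda>\<tau>. ?N' \<tau> x)) (at x)" unfolding veq[symmetric] .
    then show ?thesis using smooth_has_real_derivative[OF sm[OF t], of x] DERIV_unique by blast
  qed
  have "((\<lambda>t. ddx u0 x + integral {0..t} (\<lambda>\<tau>. ?N' \<tau> x)) has_real_derivative 0 + ?N' t x) (at t within {0..T})"
    by (intro DERIV_add DERIV_const integral_has_real_derivative[OF slice_continuous(1)[OF cN(2)] t])
  from DERIV_cong[OF this add_0]
  show "((\<lambda>t. ddx (v t) x) has_real_derivative ?N' t x) (at t within {0..T})"
    by (rule has_field_derivative_transform_within[OF _ zero_less_one t]) (rule vx[symmetric])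
qed

text \<open>Only the second derivative of one of the two solutions has to be bounded, since the
  difference is transported along the other one.\<close>

lemma rch_solution_unique:
  assumes T: "T > 0" and su: "rch_solution c1 c2 c3 T u0 u" and sv: "rch_solution c1 c2 c3 T u0 v"
    and B: "\<And>t x. t \<in> {0..T} \<Longrightarrow> \<bar>ddx (ddx (u t)) x\<bar> \<le> B" and t: "t \<in> {0..T}"
  shows "v t x = u t x"
proof -
  have uv: "u \<in> CT_smooth T" "v \<in> CT_smooth T" "u \<in> Linf_T_lipschitz T" "v \<in> Linf_T_lipschitz T"
    using su sv unfolding rch_solution_def by auto
  obtain M1 where M1: "M1 \<ge> 0" "\<And>t x. t \<in> {0..T} \<Longrightarrow> \<bar>u t x\<bar> \<le> M1" "\<And>t x. t \<in> {0..T} \<Longrightarrow> \<bar>ddx (u t) x\<bar> \<le> M1"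
    using Linf_T_lipschitz_bound[OF T uv(1,3)] by metis
  obtain M2 where M2: "M2 \<ge> 0" "\<And>t x. t \<in> {0..T} \<Longrightarrow> \<bar>v t x\<bar> \<le> M2" "\<And>t x. t \<in> {0..T} \<Longrightarrow> \<bar>ddx (v t) x\<bar> \<le> M2"
    using Linf_T_lipschitz_bound[OF T uv(2,4)] by metis
  define M where "M = max M1 M2"
  have M: "M \<ge> 0" and Mu: "\<And>t x. t \<in> {0..T} \<Longrightarrow> \<bar>u t x\<bar> \<le> M" "\<And>t x. t \<in> {0..T} \<Longrightarrow> \<bar>ddx (u t) x\<bar> \<le> M"
    and Mv: "\<And>t x. t \<in> {0..T} \<Longrightarrow> \<bar>v t x\<bar> \<le> M" "\<And>t x. t \<in> {0..T} \<Longrightarrow> \<bar>ddx (v t) x\<bar> \<le> M"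
    unfolding M_def using M1 M2 by (auto simp: le_max_iff_disj)
  have B0: "B \<ge> 0" using B[OF t, of x] by linarith
  have sm: "smooth (u t)" "smooth (v t)" if "t \<in> {0..T}" for t using uv that unfolding CT_smooth_def by auto
  have "\<forall>t\<in>{0..T}. \<forall>x. \<bar>u t x\<bar> \<le> M \<and> \<bar>ddx (u t) x\<bar> \<le> M" "\<forall>t\<in>{0..T}. \<forall>x. \<bar>v t x\<bar> \<le> M \<and> \<bar>ddx (v t) x\<bar> \<le> M"
    using Mu Mv by auto
  note fu = solution_facts[OF T su M this(1)] and fv = solution_facts[OF T sv M this(2)]
  obtain L where L: "L \<ge> 0"
    "\<And>a b a' b'. \<bar>a\<bar> \<le> M \<Longrightarrow> \<bar>b\<bar> \<le> M \<Longrightarrow> \<bar>a'\<bar> \<le> M \<Longrightarrow> \<bar>b'\<bar> \<le> M \<Longrightarrow> \<bar>flux a b - flux a' b'\<bar> \<le> L * (\<bar>a - a'\<bar> + \<bar>b - b'\<bar>)"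
    using flux_bounded_lipschitz[OF M] by metis
  define d where "d = (\<lambda>t x. v t x - u t x)"
  define e where "e = (\<lambda>t x. ddx (v t) x - ddx (u t) x)"
  define a where "a = (\<lambda>t x. ((Hl v t x - Hr v t x) / 2 - v t x * ddx (v t) x) - ((Hl u t x - Hr u t x) / 2 - u t x * ddx (u t) x))"
  define b where "b = (\<lambda>t x. (field_flux v t x - (Hl v t x + Hr v t x) / 2 - (ddx (v t) x)^2 - v t x * ddx (ddx (v t)) x)
     - (field_flux u t x - (Hl u t x + Hr u t x) / 2 - (ddx (u t) x)^2 - u t x * ddx (ddx (u t)) x))"
  define k where "k = (\<lambda>t x. ddx (ddx (v t)) x - ddx (ddx (u t)) x)"
  have dt: "((\<lambda>t. d t x) has_real_derivative a t x) (at t within {0..T})" if "t \<in> {0..T}" for t x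
    unfolding d_def a_def by (intro DERIV_diff fu(3) fv(3) that)
  have et: "((\<lambda>t. e t x) has_real_derivative b t x) (at t within {0..T})" if "t \<in> {0..T}" for t x
    unfolding e_def b_def by (intro DERIV_diff fu(4) fv(4) that)
  have dx: "(d t has_real_derivative e t x) (at x)" if "t \<in> {0..T}" for t x
    unfolding d_def e_def by (intro DERIV_diff smooth_has_real_derivative sm that)
  have ex: "(e t has_real_derivative k t x) (at x)" if "t \<in> {0..T}" for t x
    unfolding e_def k_def by (intro DERIV_diff smooth_has_real_derivative smooth_ddx sm that)
  \<comment> \<open>Each summand is twice the factor of \<open>\<sigma>\<close> in the bounds for
    \<open>p\<close> and \<open>q\<close> below.\<close>
  define C where "C = 2 * (4 * L + M) + 2 * (6 * L + 2 * M + B)"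
  have "(d t x)^2 + (e t x)^2 \<le> 0"
  proof (rule transport_maximum_principle[where f = "\<lambda>t x. (d t x)^2 + (e t x)^2" and v = v and V = M and C = C
        and ft = "\<lambda>t x. 2 * d t x * a t x + 2 * e t x * b t x" and fx = "\<lambda>t x. 2 * d t x * e t x + 2 * e t x * k t x"
        and M = "(2 * M)^2 + (2 * M)^2", OF _ _ _ _ _ _ _ _ t])
    show "\<bar>v t x\<bar> \<le> M" if "t \<in> {0..T}" for t x by (rule Mv(1)[OF that])
    show "C \<ge> 0" unfolding C_def using L M B0 by simp
    have "continuous_on ({0..T} \<times> UNIV) (\<lambda>(t, x). d t x)" "continuous_on ({0..T} \<times> UNIV) (\<lambda>(t, x). e t x)"
      unfolding d_def e_def
      using CT_smooth_jointly_continuous[OF uv(1), of 0] CT_smooth_jointly_continuous[OF uv(1), of 1]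
        CT_smooth_jointly_continuous[OF uv(2), of 0] CT_smooth_jointly_continuous[OF uv(2), of 1]
      by (auto simp: split_beta intro!: continuous_intros)
    then show "continuous_on ({0..T} \<times> UNIV) (\<lambda>(t, x). (d t x)^2 + (e t x)^2)"
      by (auto simp: split_beta intro!: continuous_intros)
    show "(d t x)^2 + (e t x)^2 \<le> (2 * M)^2 + (2 * M)^2" if "t \<in> {0..T}" for t x
    proof -
      have "\<bar>d t x\<bar> \<le> \<bar>2 * M\<bar>" "\<bar>e t x\<bar> \<le> \<bar>2 * M\<bar>"
        using Mu[OF that, of x] Mv[OF that, of x] unfolding d_def e_def by linarith+
      then show ?thesis unfolding abs_le_square_iff by (rule add_mono)
    qed
    have "u 0 = u0" "v 0 = u0" using su sv unfolding rch_solution_def by auto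
    then show "(d 0 x)^2 + (e 0 x)^2 \<le> 0" for x unfolding d_def e_def by simp
    show "((\<lambda>t. (d t x)^2 + (e t x)^2) has_real_derivative 2 * d t x * a t x + 2 * e t x * b t x) (at t within {0..T})"
      if "t \<in> {0..T}" for t x
      using dt[OF that, of x] et[OF that, of x] by (auto intro!: derivative_eq_intros)
    show "((\<lambda>x. (d t x)^2 + (e t x)^2) has_real_derivative 2 * d t x * e t x + 2 * e t x * k t x) (at x)"
      if "t \<in> {0..T}" for t x
      using dx[OF that, of x] ex[OF that, of x] by (auto intro!: derivative_eq_intros)
    fix t x S assume t: "t \<in> {0..T}" and S: "S \<ge> 0" and le: "\<And>y. (d t y)^2 + (e t y)^2 \<le> S"
    define \<sigma> where "\<sigma> = sqrt S"
    have \<sigma>: "\<sigma> \<ge> 0" "\<sigma> * \<sigma> = S" unfolding \<sigma>_def using S by auto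
    have de: "\<bar>d t y\<bar> \<le> \<sigma>" "\<bar>e t y\<bar> \<le> \<sigma>" for y
    proof -
      have "(d t y)^2 \<le> S" "(e t y)^2 \<le> S" using le[of y] zero_le_power2[of "d t y"] zero_le_power2[of "e t y"] by linarith+
      then show "\<bar>d t y\<bar> \<le> \<sigma>" "\<bar>e t y\<bar> \<le> \<sigma>" unfolding \<sigma>_def by (simp_all add: real_le_rsqrt)
    qed
    have dP: "\<bar>field_flux v t y - field_flux u t y\<bar> \<le> 2 * L * \<sigma>" for y
    proof -
      have "\<bar>field_flux v t y - field_flux u t y\<bar> \<le> L * (\<bar>v t y - u t y\<bar> + \<bar>ddx (v t) y - ddx (u t) y\<bar>)"
        unfolding field_flux_def by (intro L Mu Mv t)
      also have "\<dots> \<le> L * (\<sigma> + \<sigma>)" using de[of y] L(1) unfolding d_def e_def by (intro mult_left_mono add_mono) auto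
      finally show ?thesis by simp
    qed
    obtain Q1 Q2 where "\<And>y. \<bar>field_flux v t y\<bar> \<le> Q1" "\<And>y. \<bar>field_flux u t y\<bar> \<le> Q2" using fu(2)[OF t] fv(2)[OF t] by blast
    then have Q: "\<And>y. \<bar>field_flux v t y\<bar> \<le> max Q1 Q2" "\<And>y. \<bar>field_flux u t y\<bar> \<le> max Q1 Q2" by (auto simp: le_max_iff_disj)
    have one: "continuous_on UNIV (\<lambda>s::real. 1::real)" "\<And>s::real. (1::real) \<ge> 1/2" by (auto intro: continuous_on_const)
    have dH: "\<bar>Hl v t x - Hl u t x\<bar> \<le> 4 * L * \<sigma>" "\<bar>Hr v t x - Hr u t x\<bar> \<le> 4 * L * \<sigma>"
      using left_sol_lipschitz[OF one fv(1)[OF t] Q(1) one fu(1)[OF t] Q(2), of 0 "2 * L * \<sigma>" x]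
        right_sol_lipschitz[OF one fv(1)[OF t] Q(1) one fu(1)[OF t] Q(2), of 0 "2 * L * \<sigma>" x] dP
      unfolding Hl_def Hr_def by auto
    \<comment> \<open>\<open>p\<close> and \<open>q\<close> are the derivatives of \<open>d\<close>
      and \<open>e\<close> along the field \<open>v\<close>. In \<open>q\<close> the second
      derivative of \<open>v\<close> cancels and only that of \<open>u\<close> remains, multiplied
      by \<open>d\<close>.\<close>
    define p where "p = a t x + v t x * e t x"
    define q where "q = b t x + v t x * k t x"
    have "p = ((Hl v t x - Hl u t x) - (Hr v t x - Hr u t x)) / 2 - d t x * ddx (u t) x"
      unfolding p_def a_def d_def e_def by (simp add: field_simps)
    moreover have "\<bar>d t x * ddx (u t) x\<bar> \<le> \<sigma> * M" unfolding abs_mult using de Mu[OF t] \<sigma> by (intro mult_mono) auto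
    moreover have "\<bar>(A - A') / 2 - X\<bar> \<le> r + s" if "\<bar>A\<bar> \<le> r" "\<bar>A'\<bar> \<le> r" "\<bar>X\<bar> \<le> s" for A A' X r s :: real
      using that by (auto simp: abs_le_iff add_divide_distrib diff_divide_distrib)
    ultimately have p: "\<bar>p\<bar> \<le> (4 * L + M) * \<sigma>" using dH unfolding distrib_right mult.commute[of \<sigma>] by blast
    have "q = (field_flux v t x - field_flux u t x) - ((Hl v t x - Hl u t x) + (Hr v t x - Hr u t x)) / 2
        - (ddx (v t) x + ddx (u t) x) * e t x - d t x * ddx (ddx (u t)) x"
      unfolding q_def b_def d_def e_def k_def by (simp add: field_simps power2_eq_square)
    moreover have "\<bar>(ddx (v t) x + ddx (u t) x) * e t x\<bar> \<le> (2 * M) * \<sigma>"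
      unfolding abs_mult using de Mu(2)[OF t, of x] Mv(2)[OF t, of x] M by (intro mult_mono) auto
    moreover have "\<bar>d t x * ddx (ddx (u t)) x\<bar> \<le> \<sigma> * B" unfolding abs_mult using de B[OF t] \<sigma> by (intro mult_mono) auto
    moreover have "\<bar>Y - (A + A') / 2 - X - X'\<bar> \<le> s + r + s' + s''"
      if "\<bar>Y\<bar> \<le> s" "\<bar>A\<bar> \<le> r" "\<bar>A'\<bar> \<le> r" "\<bar>X\<bar> \<le> s'" "\<bar>X'\<bar> \<le> s''" for Y A A' X X' r s s' s'' :: real
      using that by (auto simp: abs_le_iff add_divide_distrib diff_divide_distrib)
    ultimately have "\<bar>q\<bar> \<le> 2 * L * \<sigma> + 4 * L * \<sigma> + (2 * M) * \<sigma> + \<sigma> * B"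
      using dH dP[of x] by blast
    then have q: "\<bar>q\<bar> \<le> (6 * L + 2 * M + B) * \<sigma>" by (simp add: algebra_simps)
    have "2 * d t x * p \<le> 2 * ((4 * L + M) * S)"
    proof -
      have "\<bar>d t x * p\<bar> \<le> \<sigma> * ((4 * L + M) * \<sigma>)" unfolding abs_mult using de p \<sigma> by (intro mult_mono) auto
      also have "\<dots> = (4 * L + M) * S" unfolding \<sigma>(2)[symmetric] by simp
      finally show ?thesis by (simp add: abs_le_iff)
    qed
    moreover have "2 * e t x * q \<le> 2 * ((6 * L + 2 * M + B) * S)"
    proof -
      have "\<bar>e t x * q\<bar> \<le> \<sigma> * ((6 * L + 2 * M + B) * \<sigma>)" unfolding abs_mult using de q \<sigma> by (intro mult_mono) auto
      also have "\<dots> = (6 * L + 2 * M + B) * S" unfolding \<sigma>(2)[symmetric] by simp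
      finally show ?thesis by (simp add: abs_le_iff)
    qed
    moreover have "2 * d t x * a t x + 2 * e t x * b t x + v t x * (2 * d t x * e t x + 2 * e t x * k t x)
        = 2 * d t x * p + 2 * e t x * q" unfolding p_def q_def by (simp add: algebra_simps)
    ultimately show "2 * d t x * a t x + 2 * e t x * b t x + v t x * (2 * d t x * e t x + 2 * e t x * k t x) \<le> C * S"
      unfolding C_def by (simp add: algebra_simps)
  qed
  then have "(d t x)^2 = 0" using zero_le_power2[of "d t x"] zero_le_power2[of "e t x"] by linarith
  then show ?thesis unfolding d_def by simp
qed

end

section \<open>The initial profile\<close>

definition logistic :: "real \<Rightarrow> real" where "logistic y = exp y / (1 + exp y)"
definition softplus :: "real \<Rightarrow> real" where "softplus y = ln (1 + exp y)"
text \<open>Since \<open>softplus\<close> is a smooth substitute for \<open>max y 0\<close>, this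
  function approaches \<open>sin y\<close> on the right and decays exponentially on the left: it
  switches the oscillation on without a cut-off. In closed form, its derivatives are polynomials in
  \<open>logistic\<close> and the sine and cosine of \<open>softplus\<close>.\<close>

definition profile :: "real \<Rightarrow> real" where "profile y = sin (softplus y)"
definition profile' :: "real \<Rightarrow> real" where "profile' y = logistic y * cos (softplus y)"
definition profile'' :: "real \<Rightarrow> real" where
  "profile'' y = (logistic y - (logistic y)\<^sup>2) * cos (softplus y) - (logistic y)\<^sup>2 * sin (softplus y)"

lemma logistic_bounds: "0 < logistic y" "logistic y < 1"
  unfolding logistic_def using exp_gt_zero[of y] by (auto simp: add_pos_pos)

lemma one_plus_exp_pos: "0 < 1 + exp (y::real)"
  by (simp add: add_pos_pos)

lemma softplus_deriv: "(softplus has_real_derivative logistic y) (at y)"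
proof -
  have "((\<lambda>y. 1 + exp y) has_real_derivative exp y) (at y)" by (auto intro!: derivative_eq_intros)
  from DERIV_chain2[where f = ln, OF DERIV_ln_divide[OF one_plus_exp_pos] this]
  show ?thesis unfolding softplus_def[abs_def] logistic_def by simp
qed

lemma logistic_deriv: "(logistic has_real_derivative logistic y - (logistic y)\<^sup>2) (at y)"
proof -
  have nz: "1 + exp y \<noteq> 0" using one_plus_exp_pos[of y] by simp
  have d: "((\<lambda>y. 1 + exp y) has_real_derivative exp y) (at y)" by (auto intro!: derivative_eq_intros)
  have e: "(a * b - a * a) / (b * b) = a / b - (a / b)\<^sup>2" if "b \<noteq> 0" for a b :: real
    using that by (simp add: field_simps power2_eq_square)
  have "(logistic has_real_derivative (exp y * (1 + exp y) - exp y * exp y) / ((1 + exp y) * (1 + exp y))) (at y)"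
    unfolding logistic_def[abs_def] by (rule DERIV_divide[OF DERIV_exp d nz])
  then show ?thesis unfolding e[OF nz] logistic_def .
qed

lemma profile_deriv: "(profile has_real_derivative profile' y) (at y)"
  unfolding profile_def[abs_def] profile'_def
  by (rule DERIV_cong[OF DERIV_chain2[OF DERIV_sin softplus_deriv]]) simp

lemma cos_softplus_deriv: "((\<lambda>y. cos (softplus y)) has_real_derivative - (logistic y * sin (softplus y))) (at y)"
  by (rule DERIV_cong[OF DERIV_chain2[OF DERIV_cos softplus_deriv]]) simp

lemma profile'_deriv: "(profile' has_real_derivative profile'' y) (at y)"
  unfolding profile'_def[abs_def] profile''_def
  by (rule DERIV_cong[OF DERIV_mult[OF logistic_deriv cos_softplus_deriv]]) (simp add: power2_eq_square algebra_simps)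

lemma profile_bounds: "\<bar>profile y\<bar> \<le> 1" "\<bar>profile' y\<bar> \<le> 1" "\<bar>profile'' y\<bar> \<le> 2"
proof -
  note l = logistic_bounds[of y]
  have sq: "0 \<le> (logistic y)\<^sup>2" "(logistic y)\<^sup>2 \<le> logistic y"
    using l mult_left_mono[of "logistic y" 1 "logistic y"] by (auto simp: power2_eq_square)
  show "\<bar>profile y\<bar> \<le> 1" unfolding profile_def by simp
  have "\<bar>logistic y * cos (softplus y)\<bar> \<le> 1 * 1" unfolding abs_mult using l by (intro mult_mono) auto
  then show "\<bar>profile' y\<bar> \<le> 1" unfolding profile'_def by simp
  have "\<bar>logistic y - (logistic y)\<^sup>2\<bar> \<le> 1" using l sq by linarith
  then have "\<bar>(logistic y - (logistic y)\<^sup>2) * cos (softplus y)\<bar> \<le> 1 * 1" unfolding abs_mult by (intro mult_mono) auto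
  moreover have "\<bar>(logistic y)\<^sup>2 * sin (softplus y)\<bar> \<le> 1 * 1" unfolding abs_mult using l sq by (intro mult_mono) auto
  ultimately show "\<bar>profile'' y\<bar> \<le> 2" unfolding profile''_def by linarith
qed

lemma smooth_profile: "smooth profile"
proof -
  let ?s = "\<lambda>y. sin (softplus y)" and ?c = "\<lambda>y. cos (softplus y)"
  let ?G = "{logistic, ?s, ?c}"
  have g: "logistic \<in> generated_algebra ?G" "?s \<in> generated_algebra ?G" "?c \<in> generated_algebra ?G" by (auto intro: generated_algebra.base)
  have m: "(\<lambda>y. - f y) \<in> generated_algebra ?G" if "f \<in> generated_algebra ?G" for f
    using generated_algebra.mult[OF generated_algebra.const[of "-1"] that] by simp
  have 1: "(\<lambda>y. logistic y - (logistic y)\<^sup>2) \<in> generated_algebra ?G"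
    using generated_algebra.add[OF g(1) m[OF generated_algebra.mult[OF g(1) g(1)]]] by (simp add: power2_eq_square)
  have 2: "(\<lambda>y. logistic y * ?c y) \<in> generated_algebra ?G" by (rule generated_algebra.mult[OF g(1) g(3)])
  have 3: "(\<lambda>y. - (logistic y * ?s y)) \<in> generated_algebra ?G" by (rule m[OF generated_algebra.mult[OF g(1) g(2)]])
  have "smooth ?s"
  proof (rule smooth_generated_algebra[OF g(2)])
    fix f assume "f \<in> ?G"
    then consider "f = logistic" | "f = ?s" | "f = ?c" by blast
    then show "\<exists>g'\<in>generated_algebra ?G. \<forall>x. (f has_vector_derivative g' x) (at x)"
    proof cases
      case 1
      then show ?thesis using \<open>(\<lambda>y. logistic y - (logistic y)\<^sup>2) \<in> generated_algebra ?G\<close> logistic_deriv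
        by (intro bexI[of _ "\<lambda>y. logistic y - (logistic y)\<^sup>2"]) (auto simp: has_real_derivative_iff_has_vector_derivative)
    next
      case 2
      then show ?thesis using \<open>(\<lambda>y. logistic y * ?c y) \<in> generated_algebra ?G\<close> profile_deriv
        by (intro bexI[of _ "\<lambda>y. logistic y * ?c y"])
          (auto simp: has_real_derivative_iff_has_vector_derivative profile_def[abs_def] profile'_def)
    next
      case 3
      then show ?thesis using \<open>(\<lambda>y. - (logistic y * ?s y)) \<in> generated_algebra ?G\<close> cos_softplus_deriv
        by (intro bexI[of _ "\<lambda>y. - (logistic y * ?s y)"]) (auto simp: has_real_derivative_iff_has_vector_derivative)
    qed
  qed
  then show ?thesis unfolding profile_def[abs_def] .
qed

lemma softplus_bound: "\<bar>softplus y - max y 0\<bar> \<le> 1"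
proof -
  have l2: "ln 2 \<le> (1::real)" using ln_le_minus_one[of "2::real"] by simp
  show ?thesis
  proof (cases "y \<ge> 0")
    case True
    have "exp y * 1 \<le> 1 + exp y" by simp
    then have "ln (exp y * 1) \<le> softplus y" unfolding softplus_def by (intro ln_mono) auto
    moreover have "1 + exp y \<le> exp y * 2" using True by simp
    then have "softplus y \<le> ln (exp y * 2)" unfolding softplus_def by (intro ln_mono one_plus_exp_pos) auto
    moreover have "ln (exp y * 2) = y + ln 2" by (simp add: ln_mult)
    ultimately show ?thesis using True l2 by simp
  next
    case False
    have "ln 1 \<le> softplus y" unfolding softplus_def by (intro ln_mono) auto
    moreover have "softplus y \<le> ln 2" unfolding softplus_def using False by (intro ln_mono one_plus_exp_pos) auto
    ultimately show ?thesis using False l2 by simp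
  qed
qed

text \<open>With \<open>\<sigma> = logistic\<close> and \<open>r = softplus\<close> one has \<open>r' = \<sigma>\<close> and \<open>\<sigma>' = \<sigma> - \<sigma>\<^sup>2\<close>, so
  \<open>(\<sigma> cos r)\<^sup>2\<close> differs from the derivative of \<open>(r - \<sigma>)/2 + sin (2 r)/4\<close> by at most \<open>\<sigma>'/2\<close>.\<close>

lemma profile_energy:
  assumes H: "\<And>y. (H has_real_derivative (profile' y)\<^sup>2) (at y)" "H 0 = 0"
  shows "\<bar>H y - max y 0 / 2\<bar> \<le> 4"
proof -
  define W where "W = (\<lambda>y. (softplus y - logistic y) / 2 + sin (2 * softplus y) / 4)"
  have W: "(W has_real_derivative (profile' y)\<^sup>2 + (logistic y - (logistic y)\<^sup>2) * cos (2 * softplus y) / 2) (at y)" for y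
  proof -
    have d2: "((\<lambda>y. sin (2 * softplus y)) has_real_derivative cos (2 * softplus y) * (2 * logistic y)) (at y)"
      by (rule DERIV_chain2[OF DERIV_sin DERIV_cmult[OF softplus_deriv]])
    have c2: "(cos x)\<^sup>2 = (1 + cos (2 * x)) / 2" for x :: real by (simp add: cos_double_cos)
    have "(W has_real_derivative (logistic y - (logistic y - (logistic y)\<^sup>2)) / 2 + cos (2 * softplus y) * (2 * logistic y) / 4) (at y)"
      unfolding W_def by (intro DERIV_add DERIV_cdivide DERIV_diff softplus_deriv logistic_deriv d2)
    moreover have "(logistic y - (logistic y - (logistic y)\<^sup>2)) / 2 + cos (2 * softplus y) * (2 * logistic y) / 4
        = (profile' y)\<^sup>2 + (logistic y - (logistic y)\<^sup>2) * cos (2 * softplus y) / 2"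
      unfolding profile'_def power_mult_distrib c2 by (simp add: field_simps)
    ultimately show ?thesis by simp
  qed
  have lb: "0 \<le> logistic y - (logistic y)\<^sup>2" for y
    using logistic_bounds[of y] mult_left_mono[of "logistic y" 1 "logistic y"] by (simp add: power2_eq_square)
  have cb: "\<bar>(logistic y - (logistic y)\<^sup>2) * cos (2 * softplus y) / 2\<bar> \<le> (logistic y - (logistic y)\<^sup>2) / 2" for y
    using lb[of y] mult_left_mono[of "\<bar>cos (2 * softplus y)\<bar>" 1 "logistic y - (logistic y)\<^sup>2"]
    by (simp add: abs_mult)
  have key1: "0 \<le> a + x + y - a" and key2: "0 \<le> a - (a + x - y)" if "\<bar>x\<bar> \<le> y" for a x y :: real
    using that by linarith+
  \<comment> \<open>The derivatives of \<open>W\<close> and \<open>H\<close> differ by at most half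
    the derivative of \<open>logistic\<close>. Adding or subtracting \<open>logistic / 2\<close>
    therefore gives monotone comparisons, and the correction stays bounded because
    \<open>logistic\<close> lies between 0 and 1.\<close>
  have up: "W a + logistic a / 2 - H a \<le> W b + logistic b / 2 - H b" if "a \<le> b" for a b
  proof (rule DERIV_nonneg_imp_nondecreasing[OF that, of "\<lambda>y. W y + logistic y / 2 - H y"])
    fix y
    have "((\<lambda>y. W y + logistic y / 2 - H y) has_real_derivative
       ((profile' y)\<^sup>2 + (logistic y - (logistic y)\<^sup>2) * cos (2 * softplus y) / 2) + (logistic y - (logistic y)\<^sup>2) / 2 - (profile' y)\<^sup>2) (at y)"
      by (intro DERIV_diff DERIV_add DERIV_cdivide W H logistic_deriv)
    then show "\<exists>d. ((\<lambda>y. W y + logistic y / 2 - H y) has_real_derivative d) (at y) \<and> 0 \<le> d"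
      using key1[OF cb[of y]] by blast
  qed
  have dn: "H a - (W a - logistic a / 2) \<le> H b - (W b - logistic b / 2)" if "a \<le> b" for a b
  proof (rule DERIV_nonneg_imp_nondecreasing[OF that, of "\<lambda>y. H y - (W y - logistic y / 2)"])
    fix y
    have "((\<lambda>y. H y - (W y - logistic y / 2)) has_real_derivative
       (profile' y)\<^sup>2 - (((profile' y)\<^sup>2 + (logistic y - (logistic y)\<^sup>2) * cos (2 * softplus y) / 2) - (logistic y - (logistic y)\<^sup>2) / 2)) (at y)"
      by (intro DERIV_diff DERIV_cdivide W H logistic_deriv)
    then show "\<exists>d. ((\<lambda>y. H y - (W y - logistic y / 2)) has_real_derivative d) (at y) \<and> 0 \<le> d"
      using key2[OF cb[of y]] by blast
  qed
  have Wb: "\<bar>W x - max x 0 / 2\<bar> \<le> 5/4" for x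
  proof -
    have "sin (2 * softplus x) / 4 \<le> 1/4" "- (sin (2 * softplus x) / 4) \<le> 1/4"
      using sin_le_one[of "2 * softplus x"] sin_ge_minus_one[of "2 * softplus x"] by linarith+
    moreover have "\<bar>(a - l) / 2 + c - m / 2\<bar> \<le> 5/4" if "\<bar>a - m\<bar> \<le> 1" "0 < l" "l < 1" "c \<le> 1/4" "- c \<le> 1/4" for a l c m :: real
    proof -
      have "a - m \<le> 1" "m - a \<le> 1" using that(1) by linarith+
      then show ?thesis using that(2-) unfolding diff_divide_distrib by (intro abs_leI) linarith+
    qed
    ultimately show ?thesis using softplus_bound[of x] logistic_bounds[of x] unfolding W_def by blast
  qed
  have W0: "W 0 \<le> 5/4" "- W 0 \<le> 5/4" using Wb[of 0] by auto
  have Wy: "W y - max y 0 / 2 \<le> 5/4" "- (W y - max y 0 / 2) \<le> 5/4" using Wb[of y] unfolding abs_le_iff by blast+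
  note lg = logistic_bounds[of y] logistic_bounds[of 0]
  show ?thesis
  proof (cases "0 \<le> y")
    case True
    show ?thesis using up[OF True] dn[OF True] Wy W0 lg H(2) by (intro abs_leI) linarith+
  next
    case False
    then have "y \<le> 0" by simp
    then show ?thesis using up[of y 0] dn[of y 0] Wy W0 lg H(2) by (intro abs_leI) linarith+
  qed
qed

section \<open>Growth of the low-frequency part\<close>

lemma derivative_bound_within:
  fixes f :: "real \<Rightarrow> real"
  assumes "\<And>x. x \<in> {a..b} \<Longrightarrow> (f has_real_derivative f' x) (at x within {a..b})" "\<And>x. x \<in> {a..b} \<Longrightarrow> \<bar>f' x\<bar> \<le> B"
    and "x \<in> {a..b}" "y \<in> {a..b}"
  shows "\<bar>f x - f y\<bar> \<le> B * \<bar>x - y\<bar>"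
  using field_differentiable_bound[of "{a..b}" f f' B x y] assms by simp

lemma derivative_bound_zero:
  fixes f :: "real \<Rightarrow> real"
  assumes "\<And>x. (f has_real_derivative f' x) (at x)" "\<And>x. \<bar>x\<bar> \<le> \<bar>s\<bar> \<Longrightarrow> \<bar>f' x\<bar> \<le> B"
  shows "\<bar>f s - f 0\<bar> \<le> B * \<bar>s\<bar>"
proof -
  have "\<bar>f s - f 0\<bar> \<le> B * \<bar>s - 0\<bar>"
    by (rule derivative_bound_within[of "-\<bar>s\<bar>" "\<bar>s\<bar>" f f']) (use assms in \<open>auto intro: has_field_derivative_at_within\<close>)
  then show ?thesis by simp
qed

lemma average_bound:
  fixes a b :: real
  assumes "\<bar>a\<bar> \<le> B" "\<bar>b\<bar> \<le> B"
  shows "\<bar>(a + b) / 2\<bar> \<le> B" "\<bar>(a - b) / 2\<bar> \<le> B"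
  using assms by (auto simp: abs_le_iff add_divide_distrib diff_divide_distrib)

context lagrangian
begin

section \<open>Formation of the kink on the characteristic from 0\<close>

lemma time_increment:
  assumes "\<And>t. t \<in> {0..T} \<Longrightarrow> (f has_real_derivative f' t) (at t within {0..T})" "\<And>t. t \<in> {0..T} \<Longrightarrow> \<bar>f' t\<bar> \<le> B"
    and "t \<in> {0..T}"
  shows "\<bar>f t - f 0\<bar> \<le> B * t"
  using derivative_bound_within[of 0 T f f' B t 0] assms by simp

lemma growth_bounds:
  assumes t: "t \<in> {0..T}"
  shows "\<bar>U t s - u0 s\<bar> \<le> D * t" "\<bar>w t s - ddx u0 s\<bar> \<le> 2 * D * t" "\<bar>z t s - 1\<bar> \<le> 3 * t"
proof -
  have "\<bar>U t s - U 0 s\<bar> \<le> D * t"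
  proof (rule time_increment[OF Ut _ t])
    fix \<tau> assume "\<tau> \<in> {0..T}"
    then show "\<bar>(left_sol (z \<tau>) (label_flux (U \<tau>) (w \<tau>) (z \<tau>)) s - right_sol (z \<tau>) (label_flux (U \<tau>) (w \<tau>) (z \<tau>)) s) / 2\<bar> \<le> D"
      using average_bound(2)[OF bounds(7,8)[of \<tau> s]] unfolding El_def Er_def by blast
  qed
  then show "\<bar>U t s - u0 s\<bar> \<le> D * t" unfolding init .
  have "\<bar>w t s - w 0 s\<bar> \<le> 2 * D * t"
  proof (rule time_increment[OF wt _ t])
    fix \<tau> assume \<tau>: "\<tau> \<in> {0..T}"
    note b = bounds[OF \<tau>, of s]
    have "(w \<tau> s)\<^sup>2 \<le> 4" using b(2) abs_le_square_iff[of "w \<tau> s" 2] by simp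
    moreover have "0 \<le> (w \<tau> s)\<^sup>2" by simp
    moreover have "nonlin (U \<tau> s) \<le> 2 * Ch" "- nonlin (U \<tau> s) \<le> 2 * Ch" using nonlin_bound2[OF b(1)] by auto
    moreover have "(El \<tau> s + Er \<tau> s) / 2 \<le> D" "- ((El \<tau> s + Er \<tau> s) / 2) \<le> D"
      using average_bound(1)[OF b(7,8)] unfolding abs_le_iff by blast+
    moreover have "2 * Ch + 2 \<le> D" unfolding D_def using Ch_nonneg by simp
    ultimately show "\<bar>nonlin (U \<tau> s) - (w \<tau> s)\<^sup>2 / 2 - (left_sol (z \<tau>) (label_flux (U \<tau>) (w \<tau>) (z \<tau>)) s + right_sol (z \<tau>) (label_flux (U \<tau>) (w \<tau>) (z \<tau>)) s) / 2\<bar> \<le> 2 * D"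
      unfolding El_def[symmetric] Er_def[symmetric] by (intro abs_leI) linarith+
  qed
  then show "\<bar>w t s - ddx u0 s\<bar> \<le> 2 * D * t" unfolding init .
  have "\<bar>z t s - z 0 s\<bar> \<le> 3 * t"
  proof (rule time_increment[OF zt _ t])
    fix \<tau> assume "\<tau> \<in> {0..T}"
    note b = bounds[OF this, of s]
    have "\<bar>w \<tau> s * z \<tau> s\<bar> \<le> 2 * (3/2)" unfolding abs_mult using b by (intro mult_mono) auto
    then show "\<bar>w \<tau> s * z \<tau> s\<bar> \<le> 3" by simp
  qed
  then show "\<bar>z t s - 1\<bar> \<le> 3 * t" unfolding init .
qed

text \<open>\<open>Q\<close> is minus the acceleration of the characteristics, and its label
  derivative is \<open>z * (El + Er) / 2 - p\<close>. The first part is nearly constant close to the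
  label 0. The second is, for short times, half the squared initial slope, whose primitive is
  \<open>A\<^sup>2 / 4 * max s 0\<close> up to an error of order \<open>1 / lam\<close>; this
  difference of means is the origin of the kink.\<close>

lemma Q_increment:
  assumes \<tau>: "\<tau> \<in> {0..T}" and T1: "T \<le> 1" and A: "0 < A" "A \<le> 1" and lam: "lam \<ge> 1"
    and u0_eq: "u0 = (\<lambda>s. A / lam * profile (lam * s))"
  defines "Q \<equiv> \<lambda>s. (Er \<tau> s - El \<tau> s) / 2"
  shows "\<bar>(Q s - Q 0) - (El \<tau> 0 + Er \<tau> 0) / 2 * s + A\<^sup>2 / 4 * max s 0\<bar>
    \<le> 20 * D\<^sup>2 * (\<tau> + 1 / lam + \<bar>s\<bar>) * \<bar>s\<bar> + 2 / lam"
proof -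
  have cp: "continuous_on UNIV (\<lambda>y. (profile' y)\<^sup>2)"
    using profile'_deriv DERIV_isCont by (intro continuous_intros continuous_at_imp_continuous_on) blast
  obtain H where H: "\<And>y. (H has_real_derivative (profile' y)\<^sup>2) (at y)" "H 0 = 0"
    using antiderivative_exists[OF cp] by blast
  have \<tau>01: "0 \<le> \<tau>" "\<tau> \<le> 1" using \<tau> T1 by auto
  let ?w0 = "\<lambda>s. A * profile' (lam * s)"
  have chl: "((\<lambda>s. F (lam * s)) has_real_derivative F' (lam * s) * lam) (at s)" if "\<And>y. (F has_real_derivative F' y) (at y)" for F F' s
    by (rule DERIV_chain2[OF that]) (auto intro!: derivative_eq_intros)
  have w0: "ddx u0 = ?w0"
  proof (rule ddx_real_eqI)
    show "(u0 has_real_derivative ?w0 s) (at s)" for s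
      unfolding u0_eq by (rule DERIV_cong[OF DERIV_cmult[OF chl[OF profile_deriv]]]) (use lam in simp)
  qed
  \<comment> \<open>The last term is the primitive of half the squared initial slope. Together with
    the linear term it cancels the main parts of the derivative of \<open>Q\<close>, so that
    \<open>G\<close> varies little.\<close>
  define G where "G = (\<lambda>s. Q s - (El \<tau> 0 + Er \<tau> 0) / 2 * s + A\<^sup>2 / (2 * lam) * H (lam * s))"
  let ?G' = "\<lambda>s. (z \<tau> s * ((El \<tau> s + Er \<tau> s) / 2) - p \<tau> s) - (El \<tau> 0 + Er \<tau> 0) / 2 + (?w0 s)\<^sup>2 / 2"
  have dG: "(G has_real_derivative ?G' s) (at s)" for s
  proof -
    have "(Q has_real_derivative ((z \<tau> s * Er \<tau> s - p \<tau> s) - (p \<tau> s - z \<tau> s * El \<tau> s)) / 2) (at s)"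
      unfolding Q_def by (intro DERIV_cdivide DERIV_diff E_space[OF \<tau>])
    from DERIV_add[OF DERIV_diff[OF this DERIV_cmult_Id] DERIV_cmult[OF chl[OF H(1)]]]
    show ?thesis unfolding G_def
      by (rule DERIV_cong) (use lam in \<open>simp add: field_simps power_mult_distrib power2_eq_square\<close>)
  qed
  have D8: "D \<ge> 8" by (rule D_ge)
  have Ch: "Ch \<ge> 0" "2 + 2 * Ch \<le> D" "Ch \<le> D" using Ch_nonneg unfolding D_def by auto
  have Gb: "\<bar>?G' r\<bar> \<le> 20 * D\<^sup>2 * (\<tau> + 1 / lam + \<bar>s\<bar>)" if r: "\<bar>r\<bar> \<le> \<bar>s\<bar>" for r
  proof -
    note b = bounds[OF \<tau>, of r] and gb = growth_bounds[OF \<tau>, of r]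
    let ?Q0 = "\<lambda>s. (El \<tau> s + Er \<tau> s) / 2"
    have t1: "\<bar>(z \<tau> r - 1) * ?Q0 r\<bar> \<le> (3 * \<tau>) * D"
      unfolding abs_mult using gb(3) average_bound(1)[OF b(7,8)] \<tau>01 by (intro mult_mono) auto
    have t2: "\<bar>?Q0 r - ?Q0 0\<bar> \<le> (3/2 * D) * \<bar>r\<bar>"
    proof (rule derivative_bound_zero)
      show "(?Q0 has_real_derivative ((p \<tau> x - z \<tau> x * El \<tau> x) + (z \<tau> x * Er \<tau> x - p \<tau> x)) / 2) (at x)" for x
        by (intro DERIV_cdivide DERIV_add E_space[OF \<tau>])
      show "\<bar>((p \<tau> x - z \<tau> x * El \<tau> x) + (z \<tau> x * Er \<tau> x - p \<tau> x)) / 2\<bar> \<le> 3/2 * D" for x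
      proof -
        note bx = bounds[OF \<tau>, of x]
        have "((p \<tau> x - z \<tau> x * El \<tau> x) + (z \<tau> x * Er \<tau> x - p \<tau> x)) / 2 = z \<tau> x * ((Er \<tau> x - El \<tau> x) / 2)"
          by (simp add: field_simps)
        also have "\<bar>\<dots>\<bar> \<le> (3/2) * D" unfolding abs_mult using bx(3,4) average_bound(2)[OF bx(8,7)] by (intro mult_mono) auto
        finally show ?thesis .
      qed
    qed
    have t3: "\<bar>flux (U \<tau> r) (w \<tau> r) * (z \<tau> r - 1)\<bar> \<le> D * (3 * \<tau>)"
      unfolding abs_mult using flux_bound[OF b(1,2)] Ch gb(3) D8 by (intro mult_mono) auto
    have u0b: "\<bar>u0 r\<bar> \<le> 1 / lam"
    proof -
      have "\<bar>A / lam * profile (lam * r)\<bar> \<le> (1 / lam) * 1"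
        unfolding abs_mult using A lam profile_bounds(1) by (intro mult_mono) (auto simp: divide_right_mono)
      then show ?thesis unfolding u0_eq by simp
    qed
    \<comment> \<open>\<open>nonlin\<close> vanishes at 0, and \<open>U\<close> is as small as the
      amplitude of the datum up to growth in time. The slope does not become small, which is why
      only the quadratic slope term survives.\<close>
    have t4: "\<bar>nonlin (U \<tau> r)\<bar> \<le> D * (1 / lam + D * \<tau>)"
    proof -
      have "\<bar>nonlin (U \<tau> r)\<bar> \<le> Ch * \<bar>U \<tau> r\<bar>" by (rule nonlin_bound[OF b(1)])
      also have "\<dots> \<le> D * (1 / lam + D * \<tau>)" using Ch u0b gb(1) D8 by (intro mult_mono) auto
      finally show ?thesis .
    qed
    have w0b: "\<bar>?w0 r\<bar> \<le> 1"
      using mult_mono[of A 1 "\<bar>profile' (lam * r)\<bar>" 1] A profile_bounds(2) by (simp add: abs_mult)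
    have t5: "\<bar>(w \<tau> r)\<^sup>2 / 2 - (?w0 r)\<^sup>2 / 2\<bar> \<le> 2 * (2 * D * \<tau>)"
    proof -
      have "(w \<tau> r)\<^sup>2 / 2 - (?w0 r)\<^sup>2 / 2 = (w \<tau> r + ?w0 r) / 2 * (w \<tau> r - ?w0 r)"
        by (simp add: power2_eq_square field_simps)
      also have "\<bar>\<dots>\<bar> \<le> 2 * (2 * D * \<tau>)"
        unfolding abs_mult using gb(2) b(2) w0b unfolding w0 by (intro mult_mono) auto
      finally show ?thesis .
    qed
    have dec: "?G' r = (z \<tau> r - 1) * ?Q0 r + (?Q0 r - ?Q0 0) - flux (U \<tau> r) (w \<tau> r) * (z \<tau> r - 1) - nonlin (U \<tau> r)
        - ((w \<tau> r)\<^sup>2 / 2 - (?w0 r)\<^sup>2 / 2)"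
      unfolding p_def flux_def by (simp add: algebra_simps add_divide_distrib diff_divide_distrib)
    have tri: "\<bar>a + b' - c - d - e\<bar> \<le> \<bar>a\<bar> + \<bar>b'\<bar> + \<bar>c\<bar> + \<bar>d\<bar> + \<bar>e\<bar>" for a b' c d e :: real by linarith
    have "\<bar>?G' r\<bar> \<le> (3 * \<tau>) * D + (3/2 * D) * \<bar>r\<bar> + D * (3 * \<tau>) + D * (1 / lam + D * \<tau>) + 2 * (2 * D * \<tau>)"
      unfolding dec by (rule order_trans[OF tri]) (intro add_mono t1 t2 t3 t4 t5)
    also have "\<dots> = (10 * D + D * D) * \<tau> + D * (1 / lam) + (3/2 * D) * \<bar>r\<bar>" by (simp add: algebra_simps)
    also have "\<dots> \<le> (20 * D\<^sup>2) * \<tau> + (20 * D\<^sup>2) * (1 / lam) + (20 * D\<^sup>2) * \<bar>s\<bar>"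
    proof -
      have "D * 1 \<le> D * D" using D8 by (intro mult_left_mono) auto
      then have DD: "D \<le> D\<^sup>2" "0 \<le> D\<^sup>2" by (auto simp: power2_eq_square)
      have "10 * D + D * D \<le> 20 * D\<^sup>2" using DD unfolding power2_eq_square[symmetric] by linarith
      then show ?thesis using DD D8 \<tau>01 lam r by (intro add_mono mult_mono) auto
    qed
    finally show ?thesis by (simp add: distrib_left)
  qed
  have "\<bar>G s - G 0\<bar> \<le> 20 * D\<^sup>2 * (\<tau> + 1 / lam + \<bar>s\<bar>) * \<bar>s\<bar>"
    by (rule derivative_bound_zero[OF dG Gb])
  moreover have "\<bar>A\<^sup>2 / (2 * lam) * H (lam * s) - A\<^sup>2 / 4 * max s 0\<bar> \<le> 2 / lam"
  proof -
    have "max (lam * s) 0 = lam * max s 0" using lam by (simp add: max_mult_distrib_left)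
    then have "A\<^sup>2 / (2 * lam) * H (lam * s) - A\<^sup>2 / 4 * max s 0 = A\<^sup>2 / (2 * lam) * (H (lam * s) - max (lam * s) 0 / 2)"
      using lam by (simp add: field_simps)
    also have "\<bar>\<dots>\<bar> = \<bar>A\<^sup>2 / (2 * lam)\<bar> * \<bar>H (lam * s) - max (lam * s) 0 / 2\<bar>" by (rule abs_mult)
    also have "\<dots> \<le> (1 / (2 * lam)) * 4"
    proof (intro mult_mono profile_energy[OF H])
      have "A\<^sup>2 \<le> 1" using A by (simp add: power_le_one)
      then show "\<bar>A\<^sup>2 / (2 * lam)\<bar> \<le> 1 / (2 * lam)" using lam by (simp add: divide_right_mono)
    qed (use lam in auto)
    finally show ?thesis by simp
  qed
  moreover have "(Q s - Q 0) - (El \<tau> 0 + Er \<tau> 0) / 2 * s + A\<^sup>2 / 4 * max s 0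
      = (G s - G 0) - (A\<^sup>2 / (2 * lam) * H (lam * s) - A\<^sup>2 / 4 * max s 0)"
    unfolding G_def using H(2) by simp
  ultimately show ?thesis by linarith
qed

text \<open>Integrating \<open>Q_increment\<close> in time produces the kink in the label variable,
  centred at the position \<open>q = Phi t 0\<close>. Going from the label \<open>s\<close> to the
  displacement \<open>y\<close> costs \<open>\<bar>y - s\<bar> \<le> 6 * t * \<bar>y\<bar>\<close>
  times slopes of order \<open>t\<close>, again quadratic in time. The slope \<open>b\<close> is
  left undetermined, as affine parts are invisible to the test kernels.\<close>

lemma u_expansion:
  assumes t: "t \<in> {0..T}" and T1: "T \<le> 1" and A: "0 < A" "A \<le> 1" and lam: "lam \<ge> 1"
    and u0_eq: "u0 = (\<lambda>s. A / lam * profile (lam * s))"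
  obtains q b where "\<And>y. \<bar>u t (q + y) - u t q + b * y - t * A\<^sup>2 / 4 * max y 0\<bar>
    \<le> 100 * D\<^sup>2 * (1 / lam + t * (t + 1 / lam) * \<bar>y\<bar> + t * y\<^sup>2)"
proof -
  define b where "b = integral {0..t} (\<lambda>\<tau>. (El \<tau> 0 + Er \<tau> 0) / 2)"
  have t01: "0 \<le> t" "t \<le> 1" using t T1 by auto
  have cE: "continuous_on {0..T} (\<lambda>\<tau>. (El \<tau> 0 + Er \<tau> 0) / 2)"
    by (intro continuous_intros slice_continuous(1) space_smooth_continuous[OF space_smooth0(4)] space_smooth_continuous[OF space_smooth0(5)]) auto
  have D8: "D \<ge> 8" by (rule D_ge)
  have DD: "D \<le> D\<^sup>2" "0 \<le> D\<^sup>2" "1 \<le> D\<^sup>2"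
    using mult_mono[of 1 D D D] mult_mono[of 1 D 1 D] D8 by (auto simp: power2_eq_square)
  have bb: "\<bar>b\<bar> \<le> D * t"
  proof -
    have "norm (integral {0..t} (\<lambda>\<tau>. (El \<tau> 0 + Er \<tau> 0) / 2)) \<le> D * (t - 0)"
    proof (rule integral_bound)
      show "norm ((El \<tau> 0 + Er \<tau> 0) / 2) \<le> D" if "\<tau> \<in> {0..t}" for \<tau>
        using average_bound(1)[OF bounds(7,8)[of \<tau> 0]] that t by auto
    qed (use t continuous_on_subset[OF cE] in auto)
    then show ?thesis unfolding b_def by simp
  qed
  define \<beta> where "\<beta> = A\<^sup>2 / 4"
  have A2: "0 \<le> \<beta>" "\<beta> \<le> 1" unfolding \<beta>_def using A power_le_one[of A 2] by auto
  let ?K = "20 * D\<^sup>2"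
  have lag: "\<bar>U t s - U t 0 + b * s - t * \<beta> * max s 0\<bar> \<le> 4 / lam + ?K * t * (t + 1 / lam + \<bar>s\<bar>) * \<bar>s\<bar>" for s
  proof -
    let ?B = "?K * (t + 1 / lam + \<bar>s\<bar>) * \<bar>s\<bar> + 2 / lam"
    define F where "F = (\<lambda>\<tau>. U \<tau> s - U \<tau> 0 + integral {0..\<tau>} (\<lambda>\<tau>. (El \<tau> 0 + Er \<tau> 0) / 2) * s - \<tau> * (\<beta> * max s 0))"
    define F' where "F' = (\<lambda>\<tau>. (El \<tau> s - Er \<tau> s) / 2 - (El \<tau> 0 - Er \<tau> 0) / 2 + (El \<tau> 0 + Er \<tau> 0) / 2 * s - \<beta> * max s 0)"
    have "\<bar>F t - F 0\<bar> \<le> ?B * \<bar>t - 0\<bar>"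
    proof (rule derivative_bound_within[of 0 t F F'])
      fix \<tau> assume "\<tau> \<in> {0..t}"
      then have \<tau>: "\<tau> \<in> {0..T}" "\<tau> \<le> t" using t by auto
      have "(F has_real_derivative F' \<tau>) (at \<tau> within {0..T})"
        unfolding F_def F'_def using Ut[OF \<tau>(1), of s] Ut[OF \<tau>(1), of 0] integral_has_real_derivative[OF cE \<tau>(1)]
        unfolding El_def[symmetric] Er_def[symmetric]
        by (intro DERIV_diff DERIV_add DERIV_cmult_right) (auto intro!: derivative_eq_intros)
      then show "(F has_real_derivative F' \<tau>) (at \<tau> within {0..t})" by (rule DERIV_subset) (use t in auto)
      have "\<bar>F' \<tau>\<bar> = \<bar>((Er \<tau> s - El \<tau> s) / 2 - (Er \<tau> 0 - El \<tau> 0) / 2) - (El \<tau> 0 + Er \<tau> 0) / 2 * s + \<beta> * max s 0\<bar>"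
        unfolding F'_def by (subst abs_minus_cancel[symmetric]) (rule arg_cong[of _ _ abs], simp add: diff_divide_distrib)
      also have "\<dots> \<le> ?K * (\<tau> + 1 / lam + \<bar>s\<bar>) * \<bar>s\<bar> + 2 / lam"
        unfolding \<beta>_def by (rule Q_increment[OF \<tau>(1) T1 A lam u0_eq])
      also have "\<dots> \<le> ?B" using \<tau>(2) DD by (intro add_right_mono mult_right_mono mult_left_mono) auto
      finally show "\<bar>F' \<tau>\<bar> \<le> ?B" .
    qed (use t01 in auto)
    moreover have "\<bar>F 0\<bar> \<le> 2 / lam"
    proof -
      have ub: "\<bar>u0 r\<bar> \<le> 1 / lam" for r
      proof -
        have "\<bar>A / lam * profile (lam * r)\<bar> \<le> (1 / lam) * 1"
          unfolding abs_mult using A lam profile_bounds(1) by (intro mult_mono) (auto simp: divide_right_mono)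
        then show ?thesis unfolding u0_eq by simp
      qed
      have "F 0 = u0 s - u0 0" unfolding F_def init by simp
      moreover have "2 / lam = 1 / lam + 1 / lam" by simp
      ultimately show ?thesis using ub[of s] ub[of 0] by linarith
    qed
    moreover have "F t = U t s - U t 0 + b * s - t * \<beta> * max s 0" unfolding F_def b_def by simp
    moreover have "?B * \<bar>t - 0\<bar> \<le> ?K * t * (t + 1 / lam + \<bar>s\<bar>) * \<bar>s\<bar> + 2 / lam"
    proof -
      have "2 / lam * t \<le> 2 / lam * 1" using t01 lam by (intro mult_left_mono) auto
      then show ?thesis using t01 by (simp add: algebra_simps)
    qed
    ultimately show ?thesis by linarith
  qed
  have main: "\<bar>u t (Phi t 0 + y) - u t (Phi t 0) + b * y - t * A\<^sup>2 / 4 * max y 0\<bar>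
    \<le> 100 * D\<^sup>2 * (1 / lam + t * (t + 1 / lam) * \<bar>y\<bar> + t * y\<^sup>2)" for y
  proof -
    define s where "s = Psi t (Phi t 0 + y)"
    have Ps: "Phi t s = Phi t 0 + y" unfolding s_def by (rule Phi_Psi[OF t])
    have uU: "u t (Phi t 0 + y) = U t s" "u t (Phi t 0) = U t 0"
      unfolding u_def s_def using Psi_Phi[OF t] by auto
    have sy: "\<bar>s\<bar> \<le> 2 * \<bar>y\<bar>" using Phi_expanding[OF t, of s 0] Ps by simp
    have ys: "\<bar>y - s\<bar> \<le> 6 * t * \<bar>y\<bar>"
    proof -
      have "\<bar>(Phi t s - s) - (Phi t 0 - 0)\<bar> \<le> (3 * t) * \<bar>s\<bar>"
        by (rule derivative_bound_zero[of "\<lambda>s. Phi t s - s" "\<lambda>s. z t s - 1"])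
          (auto intro!: DERIV_diff DERIV_ident Phi_space[OF t] growth_bounds(3)[OF t])
      also have "\<dots> \<le> (3 * t) * (2 * \<bar>y\<bar>)" using sy t01 by (intro mult_left_mono) auto
      finally show ?thesis using Ps by simp
    qed
    have e1: "\<bar>b * (y - s)\<bar> \<le> D * t * (6 * t * \<bar>y\<bar>)" unfolding abs_mult using bb ys D8 t01 by (intro mult_mono) auto
    have e2: "\<bar>t * \<beta> * (max y 0 - max s 0)\<bar> \<le> t * 1 * (6 * t * \<bar>y\<bar>)"
    proof -
      have "\<bar>max y 0 - max s 0\<bar> \<le> \<bar>y - s\<bar>" by (simp add: max_def abs_if)
      then have "\<bar>max y 0 - max s 0\<bar> \<le> 6 * t * \<bar>y\<bar>" using ys by linarith
      moreover have "\<bar>t * \<beta>\<bar> \<le> t * 1" unfolding abs_mult using t01 A2 by (intro mult_mono) auto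
      ultimately show ?thesis unfolding abs_mult[of "t * \<beta>"] using t01 by (intro mult_mono) auto
    qed
    have e3: "?K * t * (t + 1 / lam + \<bar>s\<bar>) * \<bar>s\<bar> \<le> ?K * t * (t + 1 / lam + 2 * \<bar>y\<bar>) * (2 * \<bar>y\<bar>)"
      using sy t01 lam DD by (intro mult_mono mult_nonneg_nonneg) auto
    have "u t (Phi t 0 + y) - u t (Phi t 0) + b * y - t * A\<^sup>2 / 4 * max y 0
        = (U t s - U t 0 + b * s - t * \<beta> * max s 0) + b * (y - s) - t * \<beta> * (max y 0 - max s 0)"
      unfolding uU \<beta>_def[symmetric] times_divide_eq_right[symmetric] by (simp add: algebra_simps)
    moreover have tri: "\<bar>a + c - d\<bar> \<le> \<bar>a\<bar> + \<bar>c\<bar> + \<bar>d\<bar>" for a c d :: real by linarith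
    ultimately have "\<bar>u t (Phi t 0 + y) - u t (Phi t 0) + b * y - t * A\<^sup>2 / 4 * max y 0\<bar>
        \<le> 4 / lam + ?K * t * (t + 1 / lam + 2 * \<bar>y\<bar>) * (2 * \<bar>y\<bar>) + D * t * (6 * t * \<bar>y\<bar>) + t * 1 * (6 * t * \<bar>y\<bar>)"
      using order_trans[OF tri add_mono[OF add_mono[OF order_trans[OF lag[of s] add_left_mono[OF e3]] e1] e2]] by (simp only:)
    also have "\<dots> = 4 * (1 / lam) + (40 * D\<^sup>2) * (t * (t + 1 / lam) * \<bar>y\<bar>) + (80 * D\<^sup>2) * (t * y\<^sup>2) + (6 * D + 6) * (t * t * \<bar>y\<bar>)"
      by (simp add: algebra_simps power2_eq_square)
    also have "\<dots> \<le> (100 * D\<^sup>2) * (1 / lam) + (40 * D\<^sup>2) * (t * (t + 1 / lam) * \<bar>y\<bar>) + (100 * D\<^sup>2) * (t * y\<^sup>2) + (60 * D\<^sup>2) * (t * (t + 1 / lam) * \<bar>y\<bar>)"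
    proof -
      have h1: "4 * (1 / lam) \<le> (100 * D\<^sup>2) * (1 / lam)" using DD lam by (intro mult_right_mono) auto
      have h2: "(80 * D\<^sup>2) * (t * y\<^sup>2) \<le> (100 * D\<^sup>2) * (t * y\<^sup>2)" using DD t01 by (intro mult_right_mono) auto
      have f: "t * t * \<bar>y\<bar> \<le> t * (t + 1 / lam) * \<bar>y\<bar>" using t01 lam by (intro mult_right_mono mult_left_mono) auto
      have h3: "(6 * D + 6) * (t * t * \<bar>y\<bar>) \<le> (60 * D\<^sup>2) * (t * (t + 1 / lam) * \<bar>y\<bar>)"
        by (rule mult_mono[OF _ f]) (use DD t01 in auto)
      show ?thesis by (intro add_mono h1 h2 h3 order_refl)
    qed
    also have "\<dots> = 100 * D\<^sup>2 * (1 / lam + t * (t + 1 / lam) * \<bar>y\<bar> + t * y\<^sup>2)" by (simp add: algebra_simps)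
    finally show ?thesis .
  qed
  show ?thesis by (rule that[of "Phi t 0" b]) (rule main)
qed

end

section \<open>Norm inflation\<close>

text \<open>After dilation by \<open>2^j\<close> and weighting with \<open>2^j\<close>, the kink and
  the linear error are the same on every scale, the constant error grows like \<open>2^j\<close> and
  the quadratic one decays like \<open>2^-j\<close>. Summing over \<open>M\<close> scales gives the
  factors \<open>M\<close>, \<open>2 ^ M\<close> and 2.\<close>

lemma besov_norm_expansion_lower_bound:
  assumes LP: "littlewood_paley chi phi"
    and u: "continuous_on UNIV u" "\<And>x. \<bar>u x\<bar> \<le> B"
    and ex: "\<And>y. \<bar>u (q + y) - u q + b * y - \<beta> * max y 0\<bar> \<le> e0 + e1 * \<bar>y\<bar> + e2 * y\<^sup>2"
    and nn: "\<beta> \<ge> 0" "e0 \<ge> 0" "e2 \<ge> 0"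
  defines "\<theta> \<equiv> fourier (gauss_phi phi)"
  defines "a \<equiv> \<lambda>k. \<integral>y. \<bar>y\<bar> ^ k * norm (\<theta> y) \<partial>lborel"
  defines "m \<equiv> norm (\<integral>y. of_real (max y 0) * \<theta> y \<partial>lborel)"
  shows "ennreal ((real M * (\<beta> * m - e1 * a 1) - 2 ^ M * (e0 * a 0) - 2 * (e2 * a 2)) / sqrt (2 * pi))
    \<le> besov_norm chi phi (distr_of_fun (complexify u))"
proof -
  note bt = bump_gauss_phi[OF LP]
  have i\<theta>: "integrable lborel \<theta>" unfolding \<theta>_def by (rule fourier_bump_integrable[OF bt])
  have [measurable]: "\<theta> \<in> borel_measurable borel" "u \<in> borel_measurable borel"
    using fourier_bump_continuous[OF bt] u(1) borel_measurable_continuous_onI unfolding \<theta>_def by blast+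
  have ia: "integrable lborel (\<lambda>y. \<bar>y\<bar> ^ k * norm (\<theta> y))" if "k \<le> 2" for k
    unfolding \<theta>_def by (rule fourier_bump_moment_integrable[OF bt that])
  have a0: "a k \<ge> 0" for k unfolding a_def by (rule integral_nonneg_AE) simp
  have i1: "integrable lborel (\<lambda>y. of_real y * \<theta> y)" "integrable lborel (\<lambda>y. of_real (max y 0) * \<theta> y)"
  proof -
    show "integrable lborel (\<lambda>y. of_real y * \<theta> y)"
      by (rule Bochner_Integration.integrable_bound[OF ia[of 1]]) (auto simp: norm_mult)
    show "integrable lborel (\<lambda>y. of_real (max y 0) * \<theta> y)"
      by (rule Bochner_Integration.integrable_bound[OF ia[of 1]]) (auto simp: norm_mult intro!: mult_right_mono)
  qed
  note mom = gauss_phi_moments[OF LP, folded \<theta>_def]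
  have blk: "2 ^ j * norm (\<integral>y. complexify u (q + y / 2 ^ j) * \<theta> y \<partial>lborel)
      \<ge> \<beta> * m - e1 * a 1 - 2 ^ j * (e0 * a 0) - (1/2) ^ j * (e2 * a 2)" for j
  proof -
    let ?b = "2 ^ j :: real"
    have b0: "?b > 0" by simp
    let ?c = "\<integral>y. of_real (max y 0) * \<theta> y \<partial>lborel"
    define E where "E = (\<lambda>y. u (q + y / ?b) - u q + b * (y / ?b) - \<beta> * max (y / ?b) 0)"
    have E: "\<bar>E y\<bar> \<le> e0 + e1 * \<bar>y / ?b\<bar> + e2 * (y / ?b)\<^sup>2" for y unfolding E_def by (rule ex)
    have [measurable]: "E \<in> borel_measurable borel" unfolding E_def by measurable
    have bnd: "integrable lborel (\<lambda>y. e0 * (\<bar>y\<bar> ^ 0 * norm (\<theta> y)) + (e1 / ?b) * (\<bar>y\<bar> ^ 1 * norm (\<theta> y)) + (e2 / ?b\<^sup>2) * (\<bar>y\<bar> ^ 2 * norm (\<theta> y)))"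
      by (intro Bochner_Integration.integrable_add integrable_mult_right ia) auto
    have le: "norm (of_real (E y) * \<theta> y) \<le> e0 * (\<bar>y\<bar> ^ 0 * norm (\<theta> y)) + (e1 / ?b) * (\<bar>y\<bar> ^ 1 * norm (\<theta> y)) + (e2 / ?b\<^sup>2) * (\<bar>y\<bar> ^ 2 * norm (\<theta> y))" for y
    proof -
      have "norm (of_real (E y) * \<theta> y) \<le> (e0 + e1 * \<bar>y / ?b\<bar> + e2 * (y / ?b)\<^sup>2) * norm (\<theta> y)"
        unfolding norm_mult norm_of_real by (intro mult_right_mono E) auto
      then show ?thesis by (simp add: abs_divide power_divide algebra_simps)
    qed
    have iE: "integrable lborel (\<lambda>y. of_real (E y) * \<theta> y)"
      by (rule Bochner_Integration.integrable_bound[OF bnd]) (use le in \<open>auto intro: order_trans[OF _ abs_ge_self]\<close>)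
    have nE: "norm (\<integral>y. of_real (E y) * \<theta> y \<partial>lborel) \<le> e0 * a 0 + (e1 / ?b) * a 1 + (e2 / ?b\<^sup>2) * a 2"
    proof -
      have "norm (\<integral>y. of_real (E y) * \<theta> y \<partial>lborel) \<le> (\<integral>y. norm (of_real (E y) * \<theta> y) \<partial>lborel)"
        by (rule integral_norm_bound)
      also have "\<dots> \<le> (\<integral>y. e0 * (\<bar>y\<bar> ^ 0 * norm (\<theta> y)) + (e1 / ?b) * (\<bar>y\<bar> ^ 1 * norm (\<theta> y)) + (e2 / ?b\<^sup>2) * (\<bar>y\<bar> ^ 2 * norm (\<theta> y)) \<partial>lborel)"
        by (rule integral_mono[OF _ bnd le]) (use iE in simp)
      also have "\<dots> = e0 * a 0 + (e1 / ?b) * a 1 + (e2 / ?b\<^sup>2) * a 2"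
        unfolding a_def using ia[of 0] ia[of 1] ia[of 2]
        by (subst Bochner_Integration.integral_add, (auto)[2])+ simp
      finally show ?thesis .
    qed
    \<comment> \<open>The terms with \<open>u q\<close> and \<open>b\<close> integrate to 0 against
      \<open>\<theta>\<close>, because its first two moments vanish.\<close>
    have split: "complexify u (q + y / ?b) * \<theta> y = ((of_real (u q) * \<theta> y - of_real (b / ?b) * (of_real y * \<theta> y))
        + of_real (\<beta> / ?b) * (of_real (max y 0) * \<theta> y)) + of_real (E y) * \<theta> y" for y
    proof -
      have "max (y / ?b) 0 = max y 0 / ?b" by (auto simp: max_def divide_le_0_iff not_le)
      then have "u (q + y / ?b) = u q - (b / ?b) * y + (\<beta> / ?b) * max y 0 + E y" unfolding E_def by simp
      then show ?thesis unfolding complexify_def by (simp only: of_real_add of_real_diff of_real_mult ring_distribs mult.assoc)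
    qed
    have "(\<integral>y. complexify u (q + y / ?b) * \<theta> y \<partial>lborel) = of_real (\<beta> / ?b) * ?c + (\<integral>y. of_real (E y) * \<theta> y \<partial>lborel)"
    proof -
      have "(\<integral>y. complexify u (q + y / ?b) * \<theta> y \<partial>lborel)
         = (((\<integral>y. of_real (u q) * \<theta> y \<partial>lborel) - (\<integral>y. of_real (b / ?b) * (of_real y * \<theta> y) \<partial>lborel))
          + (\<integral>y. of_real (\<beta> / ?b) * (of_real (max y 0) * \<theta> y) \<partial>lborel)) + (\<integral>y. of_real (E y) * \<theta> y \<partial>lborel)"
        unfolding split using i\<theta> i1 iE
        by (intro trans[OF Bochner_Integration.integral_add] arg_cong2[where f = "(+)"] Bochner_Integration.integral_diff refl
            Bochner_Integration.integrable_add Bochner_Integration.integrable_diff integrable_mult_right)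
      then show ?thesis using mom by simp
    qed
    then have "norm (\<integral>y. complexify u (q + y / ?b) * \<theta> y \<partial>lborel) \<ge> norm (of_real (\<beta> / ?b) * ?c) - norm (\<integral>y. of_real (E y) * \<theta> y \<partial>lborel)"
      by (simp only: norm_diff_ineq)
    moreover have "norm (of_real (\<beta> / ?b) * ?c) = \<beta> / ?b * m" unfolding m_def norm_mult norm_of_real using nn by simp
    ultimately have "norm (\<integral>y. complexify u (q + y / ?b) * \<theta> y \<partial>lborel) \<ge> \<beta> / ?b * m - (e0 * a 0 + (e1 / ?b) * a 1 + (e2 / ?b\<^sup>2) * a 2)"
      using nE by linarith
    then have "?b * norm (\<integral>y. complexify u (q + y / ?b) * \<theta> y \<partial>lborel) \<ge> ?b * (\<beta> / ?b * m - (e0 * a 0 + (e1 / ?b) * a 1 + (e2 / ?b\<^sup>2) * a 2))"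
      by (intro mult_left_mono) auto
    moreover have "?b * (\<beta> / ?b * m - (e0 * a 0 + (e1 / ?b) * a 1 + (e2 / ?b\<^sup>2) * a 2))
        = \<beta> * m - e1 * a 1 - 2 ^ j * (e0 * a 0) - (1/2) ^ j * (e2 * a 2)"
    proof -
      have "x * (\<beta> / x * m - (e0 * a 0 + (e1 / x) * a 1 + (e2 / x\<^sup>2) * a 2))
        = \<beta> * m - e1 * a 1 - x * (e0 * a 0) - (1 / x) * (e2 * a 2)" if "x > 0" for x
        using that by (simp add: field_simps power2_eq_square)
      from this[OF b0] show ?thesis by (simp add: power_divide)
    qed
    ultimately show ?thesis by (simp only:)
  qed
  have g2: "(\<Sum>j<M. (2::real) ^ j) \<le> 2 ^ M" by (induction M) auto
  have gh: "(\<Sum>j<M. (1/2::real) ^ j) \<le> 2"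
  proof -
    have "(\<Sum>j<M. (1/2::real) ^ j) = 2 - 2 * (1/2) ^ M" by (induction M) auto
    then show ?thesis by simp
  qed
  have "real M * (\<beta> * m - e1 * a 1) - 2 ^ M * (e0 * a 0) - 2 * (e2 * a 2)
      \<le> real M * (\<beta> * m - e1 * a 1) - (\<Sum>j<M. 2 ^ j) * (e0 * a 0) - (\<Sum>j<M. (1/2) ^ j) * (e2 * a 2)"
    using mult_right_mono[OF g2, of "e0 * a 0"] mult_right_mono[OF gh, of "e2 * a 2"] nn a0 by simp
  also have "\<dots> = (\<Sum>j<M. \<beta> * m - e1 * a 1 - 2 ^ j * (e0 * a 0) - (1/2) ^ j * (e2 * a 2))"
    by (simp add: sum_subtractf sum_distrib_right)
  also have "\<dots> \<le> (\<Sum>j<M. 2 ^ j * norm (\<integral>y. complexify u (q + y / 2 ^ j) * \<theta> y \<partial>lborel))"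
    by (rule sum_mono[OF blk])
  finally have "(real M * (\<beta> * m - e1 * a 1) - 2 ^ M * (e0 * a 0) - 2 * (e2 * a 2)) / sqrt (2 * pi)
     \<le> (\<Sum>j<M. 2 ^ j * norm (\<integral>y. complexify u (q + y / 2 ^ j) * \<theta> y \<partial>lborel)) / sqrt (2 * pi)"
    by (intro divide_right_mono) auto
  also have "\<dots> = (\<Sum>j<M. 2 ^ j / sqrt (2 * pi) * norm (\<integral>y. complexify u (q + y / 2 ^ j) * \<theta> y \<partial>lborel))"
    by (simp add: sum_divide_distrib)
  finally have "ennreal ((real M * (\<beta> * m - e1 * a 1) - 2 ^ M * (e0 * a 0) - 2 * (e2 * a 2)) / sqrt (2 * pi))
     \<le> ennreal (\<Sum>j<M. 2 ^ j / sqrt (2 * pi) * norm (\<integral>y. complexify u (q + y / 2 ^ j) * \<theta> y \<partial>lborel))"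
    by (rule ennreal_leI)
  also have "\<dots> \<le> besov_norm chi phi (distr_of_fun (complexify u))"
    unfolding \<theta>_def by (rule besov_norm_lower_bound)
  finally show ?thesis .
qed

lemma scaled_profile:
  fixes A lam :: real
  assumes lam: "lam > 0"
  defines "u0 \<equiv> \<lambda>s. A / lam * profile (lam * s)"
  shows "smooth u0" "(u0 has_real_derivative A * profile' (lam * s)) (at s)"
    "((\<lambda>s. A * profile' (lam * s)) has_real_derivative A * lam * profile'' (lam * s)) (at s)"
    "ddx u0 = (\<lambda>s. A * profile' (lam * s))" "ddx (ddx u0) = (\<lambda>s. A * lam * profile'' (lam * s))"
proof -
  have chl: "((\<lambda>s. F (lam * s)) has_real_derivative F' (lam * s) * lam) (at s)" if "\<And>y. (F has_real_derivative F' y) (at y)" for F F' s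
    by (rule DERIV_chain2[OF that]) (auto intro!: derivative_eq_intros)
  show "smooth u0" unfolding u0_def using smooth_affine[OF smooth_profile, of "A / lam" lam 0] by simp
  show d1: "(u0 has_real_derivative A * profile' (lam * s)) (at s)" for s
    unfolding u0_def by (rule DERIV_cong[OF DERIV_cmult[OF chl[OF profile_deriv]]]) (use lam in simp)
  show d2: "((\<lambda>s. A * profile' (lam * s)) has_real_derivative A * lam * profile'' (lam * s)) (at s)" for s
    by (rule DERIV_cong[OF DERIV_cmult[OF chl[OF profile'_deriv]]]) simp
  show e: "ddx u0 = (\<lambda>s. A * profile' (lam * s))" by (rule ddx_real_eqI[OF d1])
  show "ddx (ddx u0) = (\<lambda>s. A * lam * profile'' (lam * s))" unfolding e by (rule ddx_real_eqI[OF d2])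
qed

theorem theorem1p2:
  fixes \<Omega> \<gamma> :: real and chi phi :: "real \<Rightarrow> real"
  assumes "rch_beta \<Omega> \<noteq> 0"
    and "rch_gamma_root \<Omega> \<gamma>"
    and "littlewood_paley chi phi"
  shows "\<exists>(C::real) > 0. \<exists>(N0::nat) > 0. \<forall>N \<ge> N0. \<exists>(u0 :: real \<Rightarrow> real) (T::real).
     smooth u0 \<and> 0 < T \<and> T \<le> 2 / real N powr (1/2) \<and>
     tempered_fun (complexify u0) \<and>
     besov_norm chi phi (distr_of_fun (complexify u0)) \<le> ennreal (C * real N powr (- (1/10))) \<and>
     (\<exists>u. rch_solution (rch_c1 \<Omega> \<gamma>) (rch_c2 \<Omega> \<gamma>) (rch_c3 \<Omega>) T u0 u \<and>
        (\<forall>v. rch_solution (rch_c1 \<Omega> \<gamma>) (rch_c2 \<Omega> \<gamma>) (rch_c3 \<Omega>) T u0 v \<longrightarrow>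
           (\<forall>t\<in>{0..T}. \<forall>x. v t x = u t x)) \<and>
        (\<exists>t0\<in>{0..T}. tempered_fun (complexify (u t0)) \<and>
           besov_norm chi phi (distr_of_fun (complexify (u t0))) \<ge> ennreal (ln (real N))))"
proof -
  note LP = assms(3)
  obtain C where C: "C > 0"
    "\<And>u u' u'' A L B1. (\<And>x. (u has_real_derivative u' x) (at x)) \<Longrightarrow> (\<And>x. (u' has_real_derivative u'' x) (at x)) \<Longrightarrow>
       continuous_on UNIV u'' \<Longrightarrow> (\<And>x. \<bar>u x\<bar> \<le> A / 2 ^ L) \<Longrightarrow> (\<And>x. \<bar>u' x\<bar> \<le> B1) \<Longrightarrow> (\<And>x. \<bar>u'' x\<bar> \<le> A * 2 ^ L) \<Longrightarrow>
       besov_norm chi phi (distr_of_fun (complexify u)) \<le> ennreal (C * A)"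
    using besov_norm_interpolation[OF LP] by metis
  interpret rch "rch_c1 \<Omega> \<gamma>" "rch_c2 \<Omega> \<gamma>" "rch_c3 \<Omega>" .
  define \<theta> where "\<theta> = fourier (gauss_phi phi)"
  define a where "a = (\<lambda>k. \<integral>y. \<bar>y\<bar> ^ k * norm (\<theta> y) \<partial>lborel)"
  define m where "m = norm (\<integral>y. of_real (max y 0) * \<theta> y \<partial>lborel)"
  have a0: "a k \<ge> 0" for k unfolding a_def by (rule integral_nonneg_AE) simp
  have m0: "m > 0" unfolding m_def \<theta>_def using gauss_phi_moments(3)[OF LP] by simp
  define K where "K = 100 * D\<^sup>2"
  have D8: "D \<ge> 8" by (rule D_ge)
  have K0: "K > 0" unfolding K_def using D8 by simp
  \<comment> \<open>The second derivative of \<open>profile\<close> is bounded by 2 rather than 1,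
    so the interpolation estimate is used with amplitude \<open>2 * A\<close>; hence
    \<open>2 * C\<close>. Every \<open>N \<ge> 1\<close> is admissible, since the parameters chosen
    below adapt to it.\<close>
  show ?thesis
  proof (intro exI[of _ "2 * C"] exI[of _ 1] conjI allI impI)
    show "2 * C > 0" using C by simp
    fix N :: nat assume N: "N \<ge> 1"
    define A where "A = real N powr (- (1/10))"
    have A: "0 < A" "A \<le> 1"
      unfolding A_def using N powr_mono[of "- (1/10)" 0 "real N"] by auto
    \<comment> \<open>The entries are the prescribed bound, the lifespan of the Lagrangian system,
      and a time so short that the linear error takes at most half of the kink term
      \<open>T * A\<^sup>2 * m / 4\<close>. The other half is \<open>g\<close>, the net gain per
      scale. Adding 1 to \<open>a 1\<close> keeps the denominator positive.\<close>
    define T where "T = min (min (2 / real N powr (1/2)) (1 / (20 * D))) (A\<^sup>2 * m / (16 * K * (a 1 + 1)))"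
    have T: "T > 0" "T \<le> 2 / real N powr (1/2)" "T \<le> 1 / (20 * D)" "T \<le> A\<^sup>2 * m / (16 * K * (a 1 + 1))"
      unfolding T_def using N D8 A m0 K0 a0[of 1] by (auto simp: add_nonneg_pos)
    have "1 / (20 * D) \<le> 1" using D8 by (simp add: divide_le_eq)
    then have T1: "T \<le> 1" using T(3) by linarith
    define g where "g = T * A\<^sup>2 * m / 8"
    have g: "g > 0" unfolding g_def using T A m0 by simp
    have Ka: "2 * K * T\<^sup>2 * a 1 \<le> g"
    proof -
      have p: "16 * K * (a 1 + 1) > 0" using K0 a0[of 1] by (simp add: add_nonneg_pos)
      have "T * (16 * K * (a 1 + 1)) \<le> A\<^sup>2 * m" using T(4) p by (simp add: pos_le_divide_eq)
      then have "T * (T * (16 * K * (a 1 + 1))) \<le> T * (A\<^sup>2 * m)" using T(1) by (intro mult_left_mono) auto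
      moreover have "T * (T * (16 * K * a 1)) \<le> T * (T * (16 * K * (a 1 + 1)))"
        using T(1) K0 a0[of 1] by (intro mult_left_mono) auto
      ultimately show ?thesis unfolding g_def by (simp add: power2_eq_square mult_ac)
    qed
    \<comment> \<open>The terms with \<open>a 0\<close> and \<open>a 2\<close> pay for the total
      rounding error and the total quadratic error; what is left of \<open>M * g\<close> reaches the
      logarithm.\<close>
    obtain M :: nat where "(sqrt (2 * pi) * ln (real N) + K * a 0 + 2 * K * a 2) / g \<le> real M"
      using real_arch_simple by blast
    then have M: "sqrt (2 * pi) * ln (real N) + K * a 0 + 2 * K * a 2 \<le> real M * g"
      using g by (simp add: pos_divide_le_eq)
    \<comment> \<open>Besides resolving \<open>M\<close> scales, the oscillation has to be fast
      enough for \<open>1 / lam \<le> T\<close>, so that the linear error coefficient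
      \<open>T * (T + 1 / lam)\<close> is at most \<open>2 * T\<^sup>2\<close>.\<close>
    obtain L0 :: nat where L0: "1 / T < 2 ^ L0" using real_arch_pow[of 2 "1 / T"] by auto
    define L where "L = max M L0"
    define lam :: real where "lam = 2 ^ L"
    have lam: "lam \<ge> 1" "lam > 0" unfolding lam_def by simp_all
    have lamM: "2 ^ M \<le> lam" unfolding lam_def L_def by (intro power_increasing) auto
    have "(2::real) ^ L0 \<le> lam" unfolding lam_def L_def by (intro power_increasing) auto
    then have "1 / T \<le> lam" using L0 by linarith
    then have lamT: "1 / lam \<le> T" using T(1) lam by (simp add: field_simps)
    define u0 where "u0 = (\<lambda>s. A / lam * profile (lam * s))"
    note sp = scaled_profile[OF lam(2), of A, folded u0_def]
    have ub: "\<bar>u0 s\<bar> \<le> A / lam" "\<bar>A * profile' (lam * s)\<bar> \<le> 1" "\<bar>A * lam * profile'' (lam * s)\<bar> \<le> 2 * A * lam" for s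
    proof -
      have "\<bar>A / lam * profile (lam * s)\<bar> \<le> A / lam * 1"
        unfolding abs_mult using A lam profile_bounds(1) by (intro mult_mono) auto
      then show "\<bar>u0 s\<bar> \<le> A / lam" unfolding u0_def by simp
      have "\<bar>A * profile' (lam * s)\<bar> \<le> 1 * 1" unfolding abs_mult using A profile_bounds(2) by (intro mult_mono) auto
      then show "\<bar>A * profile' (lam * s)\<bar> \<le> 1" by simp
      have "\<bar>(A * lam) * profile'' (lam * s)\<bar> \<le> (A * lam) * 2"
        unfolding abs_mult[of "A * lam"] using A lam profile_bounds(3) by (intro mult_mono) auto
      then show "\<bar>A * lam * profile'' (lam * s)\<bar> \<le> 2 * A * lam" by (simp add: mult_ac)
    qed
    have Al: "A / lam \<le> 1" using A lam by (simp add: divide_le_eq)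
    have c0: "continuous_on UNIV u0" by (rule smooth_continuous_on[OF sp(1)])
    have temp0: "tempered_fun (complexify u0)" by (rule tempered_fun_bounded[OF c0 ub(1)])
    have bes0: "besov_norm chi phi (distr_of_fun (complexify u0)) \<le> ennreal (2 * C * real N powr (- (1/10)))"
    proof -
      have "besov_norm chi phi (distr_of_fun (complexify u0)) \<le> ennreal (C * (2 * A))"
      proof (rule C(2)[of u0 "\<lambda>s. A * profile' (lam * s)" "\<lambda>s. A * lam * profile'' (lam * s)" "2 * A" L 1])
        show "continuous_on UNIV (\<lambda>s. A * lam * profile'' (lam * s))"
          unfolding sp(5)[symmetric] by (intro smooth_continuous_on smooth_ddx sp(1))
        show "\<bar>u0 s\<bar> \<le> 2 * A / 2 ^ L" for s
        proof -
          have "A / lam \<le> 2 * A / lam" using A lam by (intro divide_right_mono) auto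
          then show ?thesis using ub(1)[of s] unfolding lam_def by linarith
        qed
        show "\<bar>A * lam * profile'' (lam * s)\<bar> \<le> 2 * A * 2 ^ L" for s using ub(3)[of s] unfolding lam_def .
      qed (use sp(2,3) ub(2) in auto)
      then show ?thesis unfolding A_def by (simp add: mult_ac)
    qed
    have cw0: "continuous_on UNIV (ddx u0)" by (intro smooth_continuous_on smooth_ddx sp(1))
    have b0: "\<bar>u0 s\<bar> \<le> 1" "\<bar>ddx u0 s\<bar> \<le> 1" for s
      using ub(1)[of s] Al ub(2)[of s] unfolding sp(4) by auto
    obtain U w z where lag:
      "\<And>t. t \<in> {0..T} \<Longrightarrow> good (U t) (w t) (z t)"
      "continuous_on ({0..T} \<times> UNIV) (\<lambda>(t, s). U t s)"
      "continuous_on ({0..T} \<times> UNIV) (\<lambda>(t, s). w t s)"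
      "continuous_on ({0..T} \<times> UNIV) (\<lambda>(t, s). z t s)"
      "continuous_on ({0..T} \<times> UNIV) (\<lambda>(t, s). left_sol (z t) (label_flux (U t) (w t) (z t)) s)"
      "continuous_on ({0..T} \<times> UNIV) (\<lambda>(t, s). right_sol (z t) (label_flux (U t) (w t) (z t)) s)"
      "\<And>t s. t \<in> {0..T} \<Longrightarrow> ((\<lambda>t. U t s) has_real_derivative
          (left_sol (z t) (label_flux (U t) (w t) (z t)) s - right_sol (z t) (label_flux (U t) (w t) (z t)) s) / 2) (at t within {0..T})"
      "\<And>t s. t \<in> {0..T} \<Longrightarrow> ((\<lambda>t. w t s) has_real_derivative nonlin (U t s) - (w t s)^2 / 2 -
          (left_sol (z t) (label_flux (U t) (w t) (z t)) s + right_sol (z t) (label_flux (U t) (w t) (z t)) s) / 2) (at t within {0..T})"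
      "\<And>t s. t \<in> {0..T} \<Longrightarrow> ((\<lambda>t. z t s) has_real_derivative w t s * z t s) (at t within {0..T})"
      "U 0 = u0" "w 0 = ddx u0" "z 0 = (\<lambda>s. 1)"
      by (rule lagrangian_solution[OF c0 b0(1) cw0 b0(2) T(1,3)]) blast
    interpret L: lagrangian "rch_c1 \<Omega> \<gamma>" "rch_c2 \<Omega> \<gamma>" "rch_c3 \<Omega>" T u0 U w z
      by (rule lagrangian.intro, rule T(1), rule sp(1), erule lag(1), rule lag(2), rule lag(3), rule lag(4),
          rule lag(5), rule lag(6), erule lag(7), erule lag(8), erule lag(9), rule lag(10), rule lag(11), rule lag(12))
    have b2: "\<bar>ddx (ddx u0) s\<bar> \<le> 2 * A * lam" for s unfolding sp(5) by (rule ub(3))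
    obtain B' where B': "\<And>t s. t \<in> {0..T} \<Longrightarrow> \<bar>L.ws t s\<bar> \<le> B'" using L.ws_bounded[OF b2] by blast
    have uxx: "\<bar>ddx (ddx (L.u t)) x\<bar> \<le> B' * 2" if t: "t \<in> {0..T}" for t x
    proof -
      have "\<bar>inverse (z t s)\<bar> \<le> 2" for s using L.bounds(3,5)[OF t, of s] by (simp add: field_simps)
      then show ?thesis unfolding L.ddx2_u[OF t] abs_mult using B'[OF t]
        by (intro mult_mono) (auto intro: order_trans[OF abs_ge_zero])
    qed
    have TT: "T \<in> {0..T}" using T(1) by simp
    have cT: "continuous_on UNIV (L.u T)"
      using L.u_CT_smooth TT smooth_continuous_on unfolding CT_smooth_def by blast
    have tempT: "tempered_fun (complexify (L.u T))"
      by (rule tempered_fun_bounded[OF cT L.u_bounds(1)[OF TT]])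
    obtain q b where qb: "\<And>y. \<bar>L.u T (q + y) - L.u T q + b * y - T * A\<^sup>2 / 4 * max y 0\<bar>
        \<le> 100 * D\<^sup>2 * (1 / lam + T * (T + 1 / lam) * \<bar>y\<bar> + T * y\<^sup>2)"
      using L.u_expansion[OF TT T1 A lam(1) u0_def] by metis
    let ?e0 = "K * (1 / lam)" and ?e1 = "K * (T * (T + 1 / lam))" and ?e2 = "K * T"
    have low: "ennreal ((real M * (T * A\<^sup>2 / 4 * m - ?e1 * a 1) - 2 ^ M * (?e0 * a 0) - 2 * (?e2 * a 2)) / sqrt (2 * pi))
        \<le> besov_norm chi phi (distr_of_fun (complexify (L.u T)))"
      unfolding a_def m_def \<theta>_def
    proof (rule besov_norm_expansion_lower_bound[OF LP cT L.u_bounds(1)[OF TT]])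
      show "\<bar>L.u T (q + y) - L.u T q + b * y - T * A\<^sup>2 / 4 * max y 0\<bar> \<le> ?e0 + ?e1 * \<bar>y\<bar> + ?e2 * y\<^sup>2" for y
        using qb[of y] unfolding K_def[symmetric] by (simp only: distrib_left[of K] mult.assoc)
    qed (use T K0 lam A in auto)
    have "sqrt (2 * pi) * ln (real N) \<le> real M * (T * A\<^sup>2 / 4 * m - ?e1 * a 1) - 2 ^ M * (?e0 * a 0) - 2 * (?e2 * a 2)"
    proof -
      have "?e1 * a 1 \<le> K * (T * (T + T)) * a 1"
        using lamT T(1) K0 a0[of 1] by (intro mult_right_mono mult_left_mono) auto
      also have "\<dots> = 2 * K * T\<^sup>2 * a 1" by (simp add: power2_eq_square)
      finally have "?e1 * a 1 \<le> g" using Ka by linarith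
      moreover have "T * A\<^sup>2 / 4 * m = g + g" unfolding g_def by simp
      ultimately have "real M * g \<le> real M * (T * A\<^sup>2 / 4 * m - ?e1 * a 1)" by (intro mult_left_mono) auto
      moreover have "2 ^ M * (?e0 * a 0) \<le> K * a 0"
      proof -
        have "2 ^ M * (1 / lam) \<le> 1" using lamM lam by (simp add: divide_le_eq)
        then have "(2 ^ M * (1 / lam)) * (K * a 0) \<le> 1 * (K * a 0)" using K0 a0[of 0] by (intro mult_right_mono) auto
        then show ?thesis by (simp add: mult_ac)
      qed
      moreover have "2 * (?e2 * a 2) \<le> 2 * K * a 2"
      proof -
        have "T * (2 * K * a 2) \<le> 1 * (2 * K * a 2)" using T1 K0 a0[of 2] by (intro mult_right_mono) auto
        then show ?thesis by (simp add: mult_ac)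
      qed
      ultimately show ?thesis using M by linarith
    qed
    then have "ln (real N) \<le> (real M * (T * A\<^sup>2 / 4 * m - ?e1 * a 1) - 2 ^ M * (?e0 * a 0) - 2 * (?e2 * a 2)) / sqrt (2 * pi)"
      by (simp add: pos_le_divide_eq mult.commute)
    from order_trans[OF ennreal_leI[OF this] low]
    have besT: "besov_norm chi phi (distr_of_fun (complexify (L.u T))) \<ge> ennreal (ln (real N))" .
    have uniq: "\<forall>t\<in>{0..T}. \<forall>x. v t x = L.u t x" if v: "rch_solution (rch_c1 \<Omega> \<gamma>) (rch_c2 \<Omega> \<gamma>) (rch_c3 \<Omega>) T u0 v" for v
    proof (intro ballI allI)
      show "v t x = L.u t x" if "t \<in> {0..T}" for t x
        by (rule rch_solution_unique[OF T(1) L.u_solution v _ that]) (rule uxx)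
    qed
    show "\<exists>u0 T. smooth u0 \<and> 0 < T \<and> T \<le> 2 / real N powr (1/2) \<and>
     tempered_fun (complexify u0) \<and>
     besov_norm chi phi (distr_of_fun (complexify u0)) \<le> ennreal (2 * C * real N powr (- (1/10))) \<and>
     (\<exists>u. rch_solution (rch_c1 \<Omega> \<gamma>) (rch_c2 \<Omega> \<gamma>) (rch_c3 \<Omega>) T u0 u \<and>
        (\<forall>v. rch_solution (rch_c1 \<Omega> \<gamma>) (rch_c2 \<Omega> \<gamma>) (rch_c3 \<Omega>) T u0 v \<longrightarrow>
           (\<forall>t\<in>{0..T}. \<forall>x. v t x = u t x)) \<and>
        (\<exists>t0\<in>{0..T}. tempered_fun (complexify (u t0)) \<and>
           besov_norm chi phi (distr_of_fun (complexify (u t0))) \<ge> ennreal (ln (real N))))"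
      by (rule exI[of _ u0], rule exI[of _ T], intro conjI exI[of _ L.u] bexI[of _ T] allI impI sp(1) T(1,2)
          temp0 bes0 L.u_solution tempT besT TT) (erule uniq)
  qed simp
qed

end
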